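(* The moduli space $\mathfrak{Z}_{23\mathcal{B}}=\mathcal{Z}_{23\mathcal{B}}/\mathfrak{I}$ is a 4-dimensional real analytic manifold, the natural projection from $\mathcal{Z}_{23\mathcal{B}}$ to $\mathfrak{Z}_{23\mathcal{B}}$ is real analytic, $\mathfrak{Z}_{23\mathcal{B}}$ is simply connected, and the second Betti number of $\mathfrak{Z}_{23\mathcal{B}}$ is $1$.
   Context: For $C=(C_{11}{}^1,C_{11}{}^2,C_{12}{}^1=C_{21}{}^1,C_{12}{}^2=C_{21}{}^2,C_{22}{}^1,C_{22}{}^2)\in\mathbb{R}^6$, let $\mathcal{M}_C$ be the affine surface $\mathbb{R}^+\times\mathbb{R}$ (coordinates $(x^1,x^2)$, $x^1>0$) with the torsion-free connection whose Christoffel symbols are $\Gamma_{ij}{}^k=(x^1)^{-1}C_{ij}{}^k$, i.e. $\nabla_{\partial_{x^i}}\partial_{x^j}=\Gamma_{ij}{}^k\partial_{x^k}$ (a Type $\mathcal{B}$ surface). Let $\kappa(\mathcal{M}_C)$ be the dimension of the space of affine Killing vector fields on $\mathcal{M}_C$, and let $$\mathcal{Z}_{23\mathcal{B}}:=\{C\in\mathbb{R}^6:2\le\kappa(\mathcal{M}_C)\le3\}\subset\mathbb{R}^6 .$$ Let $\mathfrak{I}:=\{T_{b,c}:T_{b,c}(x^1,x^2)=(x^1,bx^1+cx^2),\ b\in\mathbb{R},\ c\ne0\}$. It acts on $\mathbb{R}^6$ by pull-back, where $(T_{b,c})_*\partial_{x^1}=\partial_{x^1}+b\,\partial_{x^2}$,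 $(T_{b,c})_*\partial_{x^2}=c\,\partial_{x^2}$ and $T_{b,c}^*C$ denotes the symbols of the connection in this new frame: $(T_{b,c}^*C)_{11}{}^1=C_{11}{}^1+2bC_{12}{}^1+b^2C_{22}{}^1$, $(T_{b,c}^*C)_{11}{}^2=c^{-1}\{C_{11}{}^2+b(2C_{12}{}^2-C_{11}{}^1)+b^2(C_{22}{}^2-2C_{12}{}^1)-b^3C_{22}{}^1\}$, $(T_{b,c}^*C)_{12}{}^1=cC_{12}{}^1+bcC_{22}{}^1$, $(T_{b,c}^*C)_{12}{}^2=C_{12}{}^2+bC_{22}{}^2-b(C_{12}{}^1+bC_{22}{}^1)$, $(T_{b,c}^*C)_{22}{}^1=c^2C_{22}{}^1$, $(T_{b,c}^*C)_{22}{}^2=cC_{22}{}^2-bcC_{22}{}^1$. The moduli space $\mathfrak{Z}_{23\mathcal{B}}$ of isomorphism classes of (unoriented) surfaces $\mathcal{M}_C$ with $2\le\kappa(\mathcal{M}_C)\le3$ is identified with the quotient $\mathcal{Z}_{23\mathcal{B}}/\mathfrak{I}$. *)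

theory Defs
  imports
    "HOL-Analysis.Analysis"
    "HOL-Homology.Homology"
    "HOL-Library.Function_Algebras"
begin

subsection \<open>Type B connections on the right half-plane\<close>

definition half_plane :: "(real^2) set" where
  "half_plane = {p. p $ 1 > 0}"

text \<open>
  A point \<open>C :: real^6\<close> lists, in this order, the coefficients
  \<open>C\<^sub>1\<^sub>1\<^sup>1, C\<^sub>1\<^sub>1\<^sup>2, C\<^sub>1\<^sub>2\<^sup>1, C\<^sub>1\<^sub>2\<^sup>2, C\<^sub>2\<^sub>2\<^sup>1, C\<^sub>2\<^sub>2\<^sup>2\<close>.
\<close>

definition coeff :: "real^6 \<Rightarrow> 2 \<Rightarrow> 2 \<Rightarrow> 2 \<Rightarrow> real" where
  "coeff C i j k =
     (if i = 1 \<and> j = 1 then (if k = 1 then C $ 1 else C $ 2)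
      else if i = 2 \<and> j = 2 then (if k = 1 then C $ 5 else C $ 6)
      else (if k = 1 then C $ 3 else C $ 4))"

definition christoffel :: "real^6 \<Rightarrow> real^2 \<Rightarrow> 2 \<Rightarrow> 2 \<Rightarrow> 2 \<Rightarrow> real" where
  "christoffel C p i j k = coeff C i j k / p $ 1"

subsection \<open>Affine Killing vector fields\<close>

text \<open>
  A vector field is a function \<open>real^2 \<Rightarrow> real^2\<close>, of which only the values on the
  half-plane matter.
\<close>

definition partial :: "'n \<Rightarrow> (real^'n \<Rightarrow> 'b::real_normed_vector) \<Rightarrow> real^'n \<Rightarrow> 'b" where
  "partial i f p = frechet_derivative f (at p) (axis i 1)"

text \<open>For open \<open>U\<close> this is \<open>f\<close> being of class \<open>C\<^sup>\<infinity>\<close> on \<open>U\<close>: differentiability of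
  every iterated partial derivative entails its continuity.\<close>

definition smooth_on :: "(real^'n) set \<Rightarrow> (real^'n \<Rightarrow> 'b::real_normed_vector) \<Rightarrow> bool" where
  "smooth_on U f \<longleftrightarrow> (\<forall>is. \<forall>p\<in>U. foldr partial is f differentiable (at p))"

definition lie_bracket :: "(real^2 \<Rightarrow> real^2) \<Rightarrow> (real^2 \<Rightarrow> real^2) \<Rightarrow> real^2 \<Rightarrow> real^2" where
  "lie_bracket X Y p =
     frechet_derivative Y (at p) (X p) - frechet_derivative X (at p) (Y p)"

text \<open>\<open>covariant C Y Z\<close> is \<open>\<nabla>\<^sub>Y Z\<close>.\<close>

definition covariant ::
    "real^6 \<Rightarrow> (real^2 \<Rightarrow> real^2) \<Rightarrow> (real^2 \<Rightarrow> real^2) \<Rightarrow> real^2 \<Rightarrow> real^2" where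
  "covariant C Y Z p =
     frechet_derivative Z (at p) (Y p)
     + (\<chi> k. \<Sum>i\<in>UNIV. \<Sum>j\<in>UNIV. christoffel C p i j k * Y p $ i * Z p $ j)"

text \<open>
  The condition says that the Lie derivative of the connection along \<open>X\<close> vanishes.  Fields are
  required to be \<open>0\<close> off the half-plane so that distinct elements are distinct fields on it;
  without this the space would be infinite-dimensional for trivial reasons.
\<close>

definition affine_killing :: "real^6 \<Rightarrow> (real^2 \<Rightarrow> real^2) set" where
  "affine_killing C =
     {X. (\<forall>p. p \<notin> half_plane \<longrightarrow> X p = 0) \<and> smooth_on half_plane X \<and>
         (\<forall>Y Z. smooth_on half_plane Y \<longrightarrow> smooth_on half_plane Z \<longrightarrow>
            (\<forall>p\<in>half_plane.
               lie_bracket X (covariant C Y Z) p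
                 = covariant C Y (lie_bracket X Z) p + covariant C (lie_bracket X Y) Z p))}"

definition vf_scale :: "real \<Rightarrow> (real^2 \<Rightarrow> real^2) \<Rightarrow> real^2 \<Rightarrow> real^2" where
  "vf_scale a X = (\<lambda>p. a *\<^sub>R X p)"

lemma vector_space_vf_scale: "vector_space vf_scale"
  by unfold_locales (auto simp: vf_scale_def fun_eq_iff algebra_simps)

text \<open>Note that \<open>dim\<close> is \<open>0\<close> for an infinite-dimensional space; the space of affine Killing
  fields is always finite-dimensional.\<close>

definition kappa :: "real^6 \<Rightarrow> nat" where
  "kappa C = vector_space.dim vf_scale (affine_killing C)"

subsection \<open>The moduli space\<close>

definition Z23B :: "(real^6) set" where
  "Z23B = {C. 2 \<le> kappa C \<and> kappa C \<le> 3}"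

definition pull :: "real \<Rightarrow> real \<Rightarrow> real^6 \<Rightarrow> real^6" where
  "pull b c C = vector
     [C$1 + 2 * b * C$3 + b^2 * C$5,
      (C$2 + b * (2 * C$4 - C$1) + b^2 * (C$6 - 2 * C$3) - b^3 * C$5) / c,
      c * C$3 + b * c * C$5,
      C$4 + b * C$6 - b * (C$3 + b * C$5),
      c^2 * C$5,
      c * C$6 - b * c * C$5]"

text \<open>The library has such evaluation rules for \<open>vector\<close> only up to length 3.\<close>

lemma vector_6:
  fixes u v w x y z :: "'a::zero"
  shows "(vector [u, v, w, x, y, z] :: 'a^6) $ 1 = u"
    and "(vector [u, v, w, x, y, z] :: 'a^6) $ 2 = v"
    and "(vector [u, v, w, x, y, z] :: 'a^6) $ 3 = w"
    and "(vector [u, v, w, x, y, z] :: 'a^6) $ 4 = x"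
    and "(vector [u, v, w, x, y, z] :: 'a^6) $ 5 = y"
    and "(vector [u, v, w, x, y, z] :: 'a^6) $ 6 = z"
  by (simp_all add: vector_def)

definition moduli_rel :: "(real^6) rel" where
  "moduli_rel = {(C, D). C \<in> Z23B \<and> D \<in> Z23B \<and> (\<exists>b c. c \<noteq> 0 \<and> D = pull b c C)}"

definition moduli_proj :: "real^6 \<Rightarrow> (real^6) set" where
  "moduli_proj C = moduli_rel `` {C}"

definition quotient_topology :: "'a topology \<Rightarrow> ('a \<Rightarrow> 'b) \<Rightarrow> 'b topology" where
  "quotient_topology X f =
     topology (\<lambda>U. U \<subseteq> f ` topspace X \<and> openin X {x \<in> topspace X. f x \<in> U})"

lemma openin_quotient_topology:
  "openin (quotient_topology X f) U \<longleftrightarrow>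
     U \<subseteq> f ` topspace X \<and> openin X {x \<in> topspace X. f x \<in> U}"
proof -
  have "istopology (\<lambda>U. U \<subseteq> f ` topspace X \<and> openin X {x \<in> topspace X. f x \<in> U})"
    unfolding istopology_def
  proof (intro conjI allI impI)
    fix S T
    assume S: "S \<subseteq> f ` topspace X \<and> openin X {x \<in> topspace X. f x \<in> S}"
      and T: "T \<subseteq> f ` topspace X \<and> openin X {x \<in> topspace X. f x \<in> T}"
    show "S \<inter> T \<subseteq> f ` topspace X" using S by blast
    have "{x \<in> topspace X. f x \<in> S \<inter> T}
            = {x \<in> topspace X. f x \<in> S} \<inter> {x \<in> topspace X. f x \<in> T}" by blast
    then show "openin X {x \<in> topspace X. f x \<in> S \<inter> T}" 
      using openin_Int[OF conjunct2[OF S] conjunct2[OF T]] by (rule ssubst)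
  next
    fix K
    assume K: "\<forall>S\<in>K. S \<subseteq> f ` topspace X \<and> openin X {x \<in> topspace X. f x \<in> S}"
    show "\<Union>K \<subseteq> f ` topspace X" using K by blast
    have "{x \<in> topspace X. f x \<in> \<Union>K} = \<Union>((\<lambda>S. {x \<in> topspace X. f x \<in> S}) ` K)" by blast
    then show "openin X {x \<in> topspace X. f x \<in> \<Union>K}" using K by (metis (no_types, lifting) openin_Union imageE)
  qed
  then show ?thesis
    unfolding quotient_topology_def by (simp add: topology_inverse')
qed

lemma topspace_quotient_topology: "topspace (quotient_topology X f) = f ` topspace X"
proof
  show "topspace (quotient_topology X f) \<subseteq> f ` topspace X"
    using openin_quotient_topology[of X f] openin_topspace by blast
  have "{x \<in> topspace X. f x \<in> f ` topspace X} = topspace X" by blast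
  then have "openin (quotient_topology X f) (f ` topspace X)"
    by (simp add: openin_quotient_topology)
  then show "f ` topspace X \<subseteq> topspace (quotient_topology X f)"
    by (rule openin_subset)
qed

lemma quotient_map_quotient_topology: "quotient_map X (quotient_topology X f) f"
  by (simp add: quotient_map_def topspace_quotient_topology openin_quotient_topology)

definition moduli_space :: "(real^6) set topology" where
  "moduli_space = quotient_topology (top_of_set Z23B) moduli_proj"

lemma topspace_moduli_space: "topspace moduli_space = Z23B // moduli_rel"
  by (auto simp: moduli_space_def topspace_quotient_topology moduli_proj_def quotient_def)

subsection \<open>Real analytic maps and manifolds\<close>

text \<open>
  Around each point of \<open>S\<close> the map is the sum of a multivariate power series, with multi-indices
  \<open>\<alpha> :: 'n \<Rightarrow> nat\<close>.  The domain \<open>S\<close> is forced to be open.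
\<close>

definition real_analytic_on :: "(real^'n) set \<Rightarrow> (real^'n \<Rightarrow> real^'m) \<Rightarrow> bool" where
  "real_analytic_on S f \<longleftrightarrow>
     (\<forall>x\<in>S. \<exists>r>0. ball x r \<subseteq> S \<and>
        (\<exists>a :: ('n \<Rightarrow> nat) \<Rightarrow> real^'m. \<forall>y\<in>ball x r.
           ((\<lambda>\<alpha>. (\<Prod>i\<in>UNIV. (y $ i - x $ i) ^ \<alpha> i) *\<^sub>R a \<alpha>) has_sum f y) UNIV))"

definition is_chart :: "'a topology \<Rightarrow> 'a set \<times> ('a \<Rightarrow> real^'m) \<Rightarrow> bool" where
  "is_chart X = (\<lambda>(U, \<phi>). openin X U \<and> open (\<phi> ` U) \<and>
     homeomorphic_map (subtopology X U) (top_of_set (\<phi> ` U)) \<phi>)"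

text \<open>The dimension of the manifold is \<open>CARD('m)\<close>.\<close>

definition analytic_atlas :: "'a topology \<Rightarrow> ('a set \<times> ('a \<Rightarrow> real^'m)) set \<Rightarrow> bool" where
  "analytic_atlas X A \<longleftrightarrow>
     (\<forall>\<kappa>\<in>A. is_chart X \<kappa>) \<and> (\<Union>\<kappa>\<in>A. fst \<kappa>) = topspace X \<and>
     (\<forall>(U, \<phi>)\<in>A. \<forall>(V, \<psi>)\<in>A. real_analytic_on (\<phi> ` (U \<inter> V)) (\<psi> \<circ> inv_into U \<phi>))"

definition real_analytic_manifold ::
    "'a topology \<Rightarrow> ('a set \<times> ('a \<Rightarrow> real^'m)) set \<Rightarrow> bool" where
  "real_analytic_manifold X A \<longleftrightarrow>
     Hausdorff_space X \<and> second_countable X \<and> analytic_atlas X A"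

text \<open>Analyticity of a map from an open subset of \<open>real^'n\<close>, with its standard
  analytic structure, into the manifold with atlas \<open>A\<close>.\<close>

definition analytic_into ::
    "(real^'n) set \<Rightarrow> 'a topology \<Rightarrow> ('a set \<times> ('a \<Rightarrow> real^'m)) set \<Rightarrow> (real^'n \<Rightarrow> 'a) \<Rightarrow> bool" where
  "analytic_into S X A f \<longleftrightarrow>
     open S \<and> continuous_map (top_of_set S) X f \<and>
     (\<forall>(U, \<phi>)\<in>A. real_analytic_on {x \<in> S. f x \<in> U} (\<phi> \<circ> f))"

subsection \<open>Simple connectivity and Betti numbers\<close>

text \<open>Versions of \<open>homotopic_loops\<close> and \<open>simply_connected\<close> for abstract topologies.  As there, a
  simply connected space is path connected: the loops \<open>p\<close> and \<open>q\<close> may be constant.\<close>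

definition loop_in :: "'a topology \<Rightarrow> (real \<Rightarrow> 'a) \<Rightarrow> bool" where
  "loop_in X p \<longleftrightarrow> pathin X p \<and> p 1 = p 0"

definition simply_connected_space :: "'a topology \<Rightarrow> bool" where
  "simply_connected_space X \<longleftrightarrow>
     (\<forall>p q. loop_in X p \<and> loop_in X q \<longrightarrow>
        homotopic_with (\<lambda>r. r 1 = r 0) (top_of_set {0..1}) X p q)"

definition int_independent :: "('a, 'b) monoid_scheme \<Rightarrow> 'a set \<Rightarrow> bool" where
  "int_independent G S \<longleftrightarrow> S \<subseteq> carrier G \<and> finite S \<and>
     (\<forall>n :: 'a \<Rightarrow> int. finprod G (\<lambda>x. x [^]\<^bsub>G\<^esub> n x) S = \<one>\<^bsub>G\<^esub> \<longrightarrow> (\<forall>x\<in>S. n x = 0))"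

text \<open>Rank of an abelian group: the maximal number of elements independent over the integers.\<close>

definition abelian_rank :: "('a, 'b) monoid_scheme \<Rightarrow> enat" where
  "abelian_rank G = (SUP S\<in>{S. int_independent G S}. enat (card S))"

definition betti_number :: "nat \<Rightarrow> 'a topology \<Rightarrow> enat" where
  "betti_number k X = abelian_rank (homology_group (int k) X)"

end

(*
  A Killing field is determined by its 1-jet at a point, and translation in x^2 and the homothety
  give two Killing fields on every M_C.  Preservation of the curvature leaves room for at most one
  more unless the connection is flat or C_12^1 = C_22^1 = C_22^2 = 0, where explicit further fields
  show that kappa > 3; hence Z23B is the complement of these two cases.

  The quotient is covered by four charts.  For C_22^1 > 0 and for C_22^1 < 0 one normalises
  C_12^1 = 0 and C_22^1 = 1 or -1; the residual reflection acts by -1 on two coordinates, which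
  squaring a complex coordinate divides out, and each chart becomes R^4 minus a point.  Where
  the trace C_12^1 + C_22^2 is nonzero, normalising it to 1 gives a chart onto R^4.  The remaining
  points have C_22^1 = 0 and trace 0; near them one normalises C_11^1 = 0 by choosing analytically
  one of the two real roots of the indefinite form C_ij^1, which gives a chart onto a contractible
  set.

  The first two charts are disjoint and meet the third in contractible sets, so by van Kampen and
  excision the union Y of these three is simply connected with trivial homology in degrees 1 and 2.
  The last chart is contractible and meets Y in a set homotopy equivalent to a circle, whose first
  homology becomes the second homology of the whole.
*)
theory Submission
  imports Defs "HOL-Complex_Analysis.Conformal_Mappings"
begin

subsection \<open>Convergent power series\<close>

text \<open>The action on \<open>Z23B\<close> is not free: reflections \<open>c = -1\<close> have
  fixed points, and dividing by them produces a cone. The cone is still a topological plane, and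
  squaring a complex coordinate makes it an analytic one; but the projection is not a submersion
  there, so analytic functions on the quotient do not always lift. What saves the atlas is that all
  such points lie only in the two charts with \<open>C$5 \<noteq> 0\<close>. On an overlap of two
  different charts there are local analytic lifts to \<open>Z23B\<close>, and a transition map is
  the invariant map of the second chart evaluated on a lift of the first. Analyticity thus has to be
  closed only under arithmetic, inverses and square roots of positive functions.

  The last chart is forced because the trace can vanish together with \<open>C$5\<close>. One root
  of the quadratic form then runs off to infinity as \<open>C$5\<close> tends to 0, and since a
  reflection flips the sign of the square root of its discriminant, an invariant of odd weight in
  \<open>c\<close> has to say which root persists.\<close>

definition total_degree :: "('n::finite \<Rightarrow> nat) \<Rightarrow> nat" where
  "total_degree \<alpha> = (\<Sum>i\<in>UNIV. \<alpha> i)"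

definition monomial :: "real^'n \<Rightarrow> ('n \<Rightarrow> nat) \<Rightarrow> real" where
  "monomial h \<alpha> = (\<Prod>i\<in>UNIV. h $ i ^ \<alpha> i)"

text \<open>\<open>M\<close> bounds the weighted \<open>l\<^sup>1\<close>-norm of the coefficients; these norms make convergent power
  series on a polydisc a Banach algebra.\<close>

definition power_series_rep :: "real \<Rightarrow> real \<Rightarrow> (('n::finite \<Rightarrow> nat) \<Rightarrow> real) \<Rightarrow> (real^'n \<Rightarrow> real) \<Rightarrow> bool" where
  "power_series_rep r M a F \<longleftrightarrow>
     (\<exists>N\<le>M. ((\<lambda>\<alpha>. \<bar>a \<alpha>\<bar> * r ^ total_degree \<alpha>) has_sum N) UNIV) \<and>
     (\<forall>h. (\<forall>i. \<bar>h $ i\<bar> \<le> r) \<longrightarrow> ((\<lambda>\<alpha>. a \<alpha> * monomial h \<alpha>) has_sum F h) UNIV)"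

lemma monomial_add: "monomial h (\<lambda>i. \<alpha> i + \<beta> i) = monomial h \<alpha> * monomial h \<beta>"
  by (simp add: monomial_def power_add prod.distrib)

lemma total_degree_add: "total_degree (\<lambda>i. \<alpha> i + \<beta> i) = total_degree \<alpha> + total_degree \<beta>"
  by (simp add: total_degree_def sum.distrib)

lemma abs_monomial_le:
  assumes "\<And>i. \<bar>h $ i\<bar> \<le> r"
  shows "\<bar>monomial h \<alpha>\<bar> \<le> r ^ total_degree \<alpha>"
proof -
  have "\<bar>monomial h \<alpha>\<bar> = (\<Prod>i\<in>UNIV. \<bar>h $ i\<bar> ^ \<alpha> i)" by (simp add: monomial_def abs_prod power_abs)
  also have "\<dots> \<le> (\<Prod>i\<in>UNIV. r ^ \<alpha> i)" using assms by (intro prod_mono) (auto intro: power_mono)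
  also have "\<dots> = r ^ total_degree \<alpha>" by (simp add: total_degree_def power_sum)
  finally show ?thesis .
qed

lemma summable_on_abs_le:
  fixes f g :: "'a \<Rightarrow> real"
  assumes "g summable_on A" "\<And>x. x \<in> A \<Longrightarrow> \<bar>f x\<bar> \<le> g x"
  shows "f summable_on A"
  by (rule summable_on_iff_abs_summable_on_real[THEN iffD2], rule summable_on_comparison_test[OF assms(1)])
    (use assms(2) in auto)

text \<open>A series of monomials listed with repetitions may be summed exponent by exponent because
  it converges absolutely on the polydisc. Products and compositions produce such lists. Collecting
  terms can only decrease the sum of absolute values, so the bound \<open>M\<close>
  survives.\<close>

lemma power_series_rep_regroup:
  fixes m :: "'k \<Rightarrow> ('n::finite \<Rightarrow> nat)"
  assumes r: "r > 0" and M: "((\<lambda>k. \<bar>c k\<bar> * r ^ total_degree (m k)) has_sum M) UNIV"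
    and F: "\<And>h. (\<And>i. \<bar>h $ i\<bar> \<le> r) \<Longrightarrow> ((\<lambda>k. c k * monomial h (m k)) has_sum F h) UNIV"
  shows "\<exists>a. power_series_rep r M a F"
proof -
  define S where "S \<alpha> = {k. m k = \<alpha>}" for \<alpha>
  have bij: "bij_betw (\<lambda>k. (m k, k)) UNIV (Sigma UNIV S)"
    by (rule bij_betwI[of _ _ _ snd]) (auto simp: S_def)
  have sc: "(\<lambda>k. \<bar>c k\<bar>) summable_on S \<alpha>" for \<alpha>
  proof -
    have "(\<lambda>k. \<bar>c k\<bar> * r ^ total_degree (m k)) summable_on S \<alpha>"
      by (rule summable_on_subset_banach[OF has_sum_imp_summable[OF M]]) simp
    then have "(\<lambda>k. \<bar>c k\<bar> * r ^ total_degree \<alpha>) summable_on S \<alpha>"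
      by (rule summable_on_cong[THEN iffD1, rotated]) (simp add: S_def)
    then show ?thesis using r by (simp add: summable_on_cmult_left')
  qed
  have cs: "c summable_on S \<alpha>" for \<alpha>
    by (rule summable_on_abs_le[OF sc]) simp
  define a where "a \<alpha> = infsum c (S \<alpha>)" for \<alpha>
  define A where "A \<alpha> = infsum (\<lambda>k. \<bar>c k\<bar>) (S \<alpha>)" for \<alpha>
  have ac: "(c has_sum a \<alpha>) (S \<alpha>)" and Ac: "((\<lambda>k. \<bar>c k\<bar>) has_sum A \<alpha>) (S \<alpha>)" for \<alpha>
    using cs sc by (auto simp: a_def A_def)
  have aA: "\<bar>a \<alpha>\<bar> \<le> A \<alpha>" for \<alpha>
    using norm_infsum_bound[of c "S \<alpha>"] sc by (simp add: a_def A_def)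
  have "((\<lambda>(\<alpha>, k). \<bar>c k\<bar> * r ^ total_degree \<alpha>) has_sum M) (Sigma UNIV S)"
    using M has_sum_reindex_bij_betw[OF bij, of "\<lambda>(\<alpha>, k). \<bar>c k\<bar> * r ^ total_degree \<alpha>"] by simp
  then have hA: "((\<lambda>\<alpha>. A \<alpha> * r ^ total_degree \<alpha>) has_sum M) UNIV"
    by (rule has_sum_SigmaD) (auto intro: has_sum_cmult_left Ac)
  have sa: "(\<lambda>\<alpha>. \<bar>a \<alpha>\<bar> * r ^ total_degree \<alpha>) summable_on UNIV"
    by (rule summable_on_comparison_test[of "\<lambda>\<alpha>. A \<alpha> * r ^ total_degree \<alpha>"])
      (use has_sum_imp_summable[OF hA] r aA in \<open>auto intro!: mult_right_mono\<close>)
  then obtain N where N: "((\<lambda>\<alpha>. \<bar>a \<alpha>\<bar> * r ^ total_degree \<alpha>) has_sum N) UNIV" unfolding summable_on_def by blast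
  moreover have "N \<le> M"
    by (rule has_sum_mono[OF N hA]) (use r aA in \<open>auto intro!: mult_right_mono\<close>)
  moreover have "((\<lambda>\<alpha>. a \<alpha> * monomial h \<alpha>) has_sum F h) UNIV" if "\<And>i. \<bar>h $ i\<bar> \<le> r" for h
  proof -
    have "((\<lambda>(\<alpha>, k). c k * monomial h \<alpha>) has_sum F h) (Sigma UNIV S)"
      using F[OF that] has_sum_reindex_bij_betw[OF bij, of "\<lambda>(\<alpha>, k). c k * monomial h \<alpha>"] by simp
    then show ?thesis by (rule has_sum_SigmaD) (auto intro: has_sum_cmult_left ac)
  qed
  ultimately show ?thesis unfolding power_series_rep_def by blast
qed

lemma power_series_rep_single:
  assumes "\<And>h. F h = c * monomial h \<alpha>"
  shows "power_series_rep r (\<bar>c\<bar> * r ^ total_degree \<alpha>) (\<lambda>\<beta>. if \<beta> = \<alpha> then c else 0) F"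
  unfolding power_series_rep_def
  by (auto intro!: exI[of _ "\<bar>c\<bar> * r ^ total_degree \<alpha>"] has_sum_finite_neutralI[of "{\<alpha>}"] simp: assms split: if_splits)

lemma power_series_rep_add:
  assumes r: "r > 0" and F: "power_series_rep r M a F" and G: "power_series_rep r N b G"
  shows "power_series_rep r (M + N) (\<lambda>\<alpha>. a \<alpha> + b \<alpha>) (\<lambda>h. F h + G h)"
proof -
  obtain M' where M': "M' \<le> M" "((\<lambda>\<alpha>. \<bar>a \<alpha>\<bar> * r ^ total_degree \<alpha>) has_sum M') UNIV"
    using F unfolding power_series_rep_def by blast
  obtain N' where N': "N' \<le> N" "((\<lambda>\<alpha>. \<bar>b \<alpha>\<bar> * r ^ total_degree \<alpha>) has_sum N') UNIV"
    using G unfolding power_series_rep_def by blast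
  have s: "((\<lambda>\<alpha>. (\<bar>a \<alpha>\<bar> + \<bar>b \<alpha>\<bar>) * r ^ total_degree \<alpha>) has_sum (M' + N')) UNIV"
    using has_sum_add[OF M'(2) N'(2)] by (simp add: distrib_right)
  have le: "\<bar>a \<alpha> + b \<alpha>\<bar> * r ^ total_degree \<alpha> \<le> (\<bar>a \<alpha>\<bar> + \<bar>b \<alpha>\<bar>) * r ^ total_degree \<alpha>" for \<alpha>
    using r by (intro mult_right_mono) auto
  have "(\<lambda>\<alpha>. \<bar>a \<alpha> + b \<alpha>\<bar> * r ^ total_degree \<alpha>) summable_on UNIV"
    by (rule summable_on_comparison_test[of "\<lambda>\<alpha>. (\<bar>a \<alpha>\<bar> + \<bar>b \<alpha>\<bar>) * r ^ total_degree \<alpha>"])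
      (use has_sum_imp_summable[OF s] r le in auto)
  then obtain K where K: "((\<lambda>\<alpha>. \<bar>a \<alpha> + b \<alpha>\<bar> * r ^ total_degree \<alpha>) has_sum K) UNIV" unfolding summable_on_def by blast
  have "K \<le> M' + N'" by (rule has_sum_mono[OF K s]) (rule le)
  then show ?thesis
    using K M'(1) N'(1) F G unfolding power_series_rep_def
    by (auto intro!: exI[of _ K] has_sum_add simp: distrib_right)
qed

text \<open>The Cauchy product, as a series over pairs of multi-indices. The series of absolute
  values factors and has sum \<open>M' * N'\<close>, which makes the norm submultiplicative.\<close>

lemma power_series_rep_mult:
  assumes r: "r > 0" and F: "power_series_rep r M a F" and G: "power_series_rep r N b G"
  shows "\<exists>c. power_series_rep r (M * N) c (\<lambda>h. F h * G h)"
proof -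
  obtain M' where M': "M' \<le> M" "((\<lambda>\<alpha>. \<bar>a \<alpha>\<bar> * r ^ total_degree \<alpha>) has_sum M') UNIV"
    using F unfolding power_series_rep_def by blast
  obtain N' where N': "N' \<le> N" "((\<lambda>\<alpha>. \<bar>b \<alpha>\<bar> * r ^ total_degree \<alpha>) has_sum N') UNIV"
    using G unfolding power_series_rep_def by blast
  define c where "c = (\<lambda>(\<alpha>, \<beta>). a \<alpha> * b \<beta>)"
  define m where "m = (\<lambda>(\<alpha>::'a\<Rightarrow>nat, \<beta>). \<lambda>i. \<alpha> i + \<beta> i)"
  have pos: "0 \<le> M'" "0 \<le> N'" using M'(2) N'(2) r by (auto intro: has_sum_nonneg)
  define P where "P = (\<lambda>(\<alpha>, \<beta>). (\<bar>a \<alpha>\<bar> * r ^ total_degree \<alpha>) * (\<bar>b \<beta>\<bar> * r ^ total_degree \<beta>))"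
  have row: "((\<lambda>\<beta>. P (\<alpha>, \<beta>)) has_sum (\<bar>a \<alpha>\<bar> * r ^ total_degree \<alpha>) * N') UNIV" for \<alpha>
    unfolding P_def by (simp add: has_sum_cmult_right N'(2))
  have tot: "((\<lambda>\<alpha>. (\<bar>a \<alpha>\<bar> * r ^ total_degree \<alpha>) * N') has_sum M' * N') UNIV"
    by (rule has_sum_cmult_left[OF M'(2)])
  have sum: "P summable_on (UNIV \<times> UNIV)"
    by (rule summable_on_SigmaI[OF row]) (use has_sum_imp_summable[OF tot] r in \<open>auto simp: P_def\<close>)
  have P: "(P has_sum M' * N') UNIV"
    using has_sum_SigmaI[OF row tot sum] by simp
  have cP: "\<bar>c k\<bar> * r ^ total_degree (m k) = P k" for k
    by (cases k) (simp add: c_def m_def P_def total_degree_add power_add abs_mult)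
  have "\<exists>d. power_series_rep r (M' * N') d (\<lambda>h. F h * G h)"
  proof (rule power_series_rep_regroup[OF r, of c m])
    show "((\<lambda>k. \<bar>c k\<bar> * r ^ total_degree (m k)) has_sum M' * N') UNIV" unfolding cP by (rule P)
    fix h :: "real^'a" assume h: "\<And>i. \<bar>h $ i\<bar> \<le> r"
    have ch: "c (\<alpha>, \<beta>) * monomial h (m (\<alpha>, \<beta>)) = (a \<alpha> * monomial h \<alpha>) * (b \<beta> * monomial h \<beta>)" for \<alpha> \<beta>
      by (simp add: c_def m_def monomial_add)
    have Fh: "((\<lambda>\<alpha>. a \<alpha> * monomial h \<alpha>) has_sum F h) UNIV" "((\<lambda>\<alpha>. b \<alpha> * monomial h \<alpha>) has_sum G h) UNIV"
      using F G h unfolding power_series_rep_def by blast+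
    have sm: "(\<lambda>k. c k * monomial h (m k)) summable_on (UNIV \<times> UNIV)"
    proof (rule summable_on_abs_le[OF sum])
      fix k
      have "\<bar>c k * monomial h (m k)\<bar> \<le> \<bar>c k\<bar> * r ^ total_degree (m k)"
        unfolding abs_mult by (intro mult_left_mono abs_monomial_le h) auto
      then show "\<bar>c k * monomial h (m k)\<bar> \<le> P k" unfolding cP .
    qed
    have "((\<lambda>k. c k * monomial h (m k)) has_sum F h * G h) (UNIV \<times> UNIV)"
    proof (rule has_sum_SigmaI[OF _ _ sm])
      show "((\<lambda>\<beta>. c (\<alpha>, \<beta>) * monomial h (m (\<alpha>, \<beta>))) has_sum (a \<alpha> * monomial h \<alpha>) * G h) UNIV" for \<alpha>
        unfolding ch by (rule has_sum_cmult_right[OF Fh(2)])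
      show "((\<lambda>\<alpha>. (a \<alpha> * monomial h \<alpha>) * G h) has_sum F h * G h) UNIV"
        by (rule has_sum_cmult_left[OF Fh(1)])
    qed
    then show "((\<lambda>k. c k * monomial h (m k)) has_sum F h * G h) UNIV" by simp
  qed
  moreover have "M' * N' \<le> M * N" using pos M'(1) N'(1) by (intro mult_mono) auto
  ultimately show ?thesis unfolding power_series_rep_def by (meson order_trans)
qed

lemma power_series_rep_const: "power_series_rep r \<bar>c\<bar> (\<lambda>\<beta>. if \<beta> = (\<lambda>_. 0) then c else 0) (\<lambda>_. c)"
  using power_series_rep_single[of "\<lambda>_. c" c "\<lambda>_. 0" r] by (simp add: monomial_def total_degree_def)

lemma power_series_rep_power:
  assumes r: "r > 0" and F: "power_series_rep r M a F"
  shows "\<exists>c. power_series_rep r (M ^ k) c (\<lambda>h. F h ^ k)"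
proof (induction k)
  case 0
  show ?case using power_series_rep_const[of r 1] by auto
next
  case (Suc k)
  then obtain c where "power_series_rep r (M ^ k) c (\<lambda>h. F h ^ k)" by blast
  then show ?case using power_series_rep_mult[OF r F] by simp
qed

lemma power_series_rep_at_0:
  assumes r: "r > 0" and F: "power_series_rep r M a F"
  shows "a (\<lambda>_. 0) = F 0"
proof -
  have "((\<lambda>\<alpha>. a \<alpha> * monomial 0 \<alpha>) has_sum F 0) UNIV"
    using F r unfolding power_series_rep_def by simp
  moreover have "((\<lambda>\<alpha>. a \<alpha> * monomial 0 \<alpha>) has_sum a (\<lambda>_. 0)) UNIV"
  proof (rule has_sum_finite_neutralI[of "{\<lambda>_. 0}"])
    fix \<alpha> :: "'a \<Rightarrow> nat" assume "\<alpha> \<in> UNIV - {\<lambda>_. 0}"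
    then obtain i where "\<alpha> i \<noteq> 0" by auto
    then have "monomial 0 \<alpha> = 0" unfolding monomial_def by (intro prod_zero) (auto intro!: bexI[of _ i])
    then show "a \<alpha> * monomial 0 \<alpha> = 0" by simp
  qed (auto simp: monomial_def)
  ultimately show ?thesis using has_sum_unique by blast
qed

text \<open>Without constant term every monomial has degree at least 1, so passing from radius
  \<open>r\<close> to \<open>r'\<close> gains a factor \<open>r' / r\<close> in the norm. In this
  way a germ vanishing at the centre becomes small enough to be substituted into a power series of
  finite radius.\<close>

lemma power_series_rep_shrink:
  assumes r: "0 < r'" "r' \<le> r" and F: "power_series_rep r M a F" and 0: "F 0 = 0"
  shows "power_series_rep r' (r' / r * M) a F"
proof -
  obtain M' where M': "M' \<le> M" "((\<lambda>\<alpha>. \<bar>a \<alpha>\<bar> * r ^ total_degree \<alpha>) has_sum M') UNIV"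
    using F unfolding power_series_rep_def by blast
  have a0: "a (\<lambda>_. 0) = 0" using power_series_rep_at_0[OF _ F] r 0 by simp
  have s: "((\<lambda>\<alpha>. r' / r * (\<bar>a \<alpha>\<bar> * r ^ total_degree \<alpha>)) has_sum r' / r * M') UNIV"
    by (rule has_sum_cmult_right[OF M'(2)])
  have le: "\<bar>a \<alpha>\<bar> * r' ^ total_degree \<alpha> \<le> r' / r * (\<bar>a \<alpha>\<bar> * r ^ total_degree \<alpha>)" for \<alpha>
  proof (cases "\<alpha> = (\<lambda>_. 0)")
    case True
    then show ?thesis using a0 by simp
  next
    case False
    then have "total_degree \<alpha> \<noteq> 0" by (auto simp: total_degree_def)
    then obtain d where d: "total_degree \<alpha> = Suc d" using not0_implies_Suc by blast
    have "r' ^ d \<le> r ^ d" using r by (intro power_mono) auto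
    then have "\<bar>a \<alpha>\<bar> * (r' * r' ^ d) \<le> \<bar>a \<alpha>\<bar> * (r' * r ^ d)" using r by (intro mult_left_mono) auto
    also have "\<dots> = r' / r * (\<bar>a \<alpha>\<bar> * r ^ total_degree \<alpha>)" using r d by simp
    finally show ?thesis by (simp add: d)
  qed
  have "(\<lambda>\<alpha>. \<bar>a \<alpha>\<bar> * r' ^ total_degree \<alpha>) summable_on UNIV"
    by (rule summable_on_comparison_test[OF has_sum_imp_summable[OF s] le]) (use r in auto)
  then obtain K where K: "((\<lambda>\<alpha>. \<bar>a \<alpha>\<bar> * r' ^ total_degree \<alpha>) has_sum K) UNIV" unfolding summable_on_def by blast
  have "K \<le> r' / r * M'" by (rule has_sum_mono[OF K s le])
  also have "\<dots> \<le> r' / r * M" using M'(1) r by (intro mult_left_mono) auto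
  finally show ?thesis
    using K F r unfolding power_series_rep_def by (meson order_trans)
qed

text \<open>The constant term is split off and added back, because
  \<open>power_series_rep_shrink\<close> applies to functions vanishing at 0.\<close>

lemma power_series_rep_smaller:
  assumes r: "0 < r'" "r' \<le> r" and F: "power_series_rep r M a F"
  shows "\<exists>M' a'. power_series_rep r' M' a' F"
proof -
  have r0: "r > 0" using r by simp
  note G = power_series_rep_add[OF r0 F power_series_rep_const[of r "- F 0"]]
  have "power_series_rep r' (r' / r * (M + \<bar>- F 0\<bar>)) (\<lambda>\<alpha>. a \<alpha> + (if \<alpha> = (\<lambda>_. 0) then - F 0 else 0)) (\<lambda>h. F h + - F 0)"
    by (rule power_series_rep_shrink[OF r G]) simp
  from power_series_rep_add[OF r(1) this power_series_rep_const[of r' "F 0"]] show ?thesis by auto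
qed

lemma power_series_rep_bound:
  assumes F: "power_series_rep r \<rho> a F" and h: "\<And>i. \<bar>h $ i\<bar> \<le> r"
  shows "\<bar>F h\<bar> \<le> \<rho>"
proof -
  obtain K where K: "K \<le> \<rho>" "((\<lambda>\<alpha>. \<bar>a \<alpha>\<bar> * r ^ total_degree \<alpha>) has_sum K) UNIV"
    using F unfolding power_series_rep_def by blast
  have Fh: "((\<lambda>\<alpha>. a \<alpha> * monomial h \<alpha>) has_sum F h) UNIV" using F h unfolding power_series_rep_def by blast
  have le: "\<bar>a \<alpha> * monomial h \<alpha>\<bar> \<le> \<bar>a \<alpha>\<bar> * r ^ total_degree \<alpha>" for \<alpha>
    unfolding abs_mult by (intro mult_left_mono abs_monomial_le h) auto
  have "F h \<le> K" by (rule has_sum_mono[OF Fh K(2)]) (use le in \<open>simp add: abs_le_iff\<close>)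
  moreover have "- F h \<le> K"
    by (rule has_sum_mono[OF has_sum_uminus[THEN iffD2, OF _] K(2)]) (use Fh le in \<open>auto simp: abs_le_iff\<close>)
  ultimately show ?thesis using K(1) by simp
qed

text \<open>By submultiplicativity the \<open>k\<close>-th power of \<open>F\<close> has norm at
  most \<rho>^k, so the double series over \<open>k\<close> and the exponents is dominated by the
  series of \<open>c\<close> at \<rho>.\<close>

lemma power_series_rep_compose:
  assumes r: "r > 0" and F: "power_series_rep r \<rho> a F"
    and c: "summable (\<lambda>k. \<bar>c k\<bar> * \<rho> ^ k)" and g: "\<And>z. \<bar>z\<bar> \<le> \<rho> \<Longrightarrow> (\<lambda>k. c k * z ^ k) sums g z"
  shows "\<exists>M b. power_series_rep r M b (\<lambda>h. g (F h))"
proof -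
  obtain b where b: "\<And>k. power_series_rep r (\<rho> ^ k) (b k) (\<lambda>h. F h ^ k)"
    using power_series_rep_power[OF r F] by metis
  obtain N where N: "\<And>k. N k \<le> \<rho> ^ k" "\<And>k. ((\<lambda>\<alpha>. \<bar>b k \<alpha>\<bar> * r ^ total_degree \<alpha>) has_sum N k) UNIV"
    using b unfolding power_series_rep_def by metis
  have N0: "0 \<le> N k" for k by (rule has_sum_nonneg[OF N(2)]) (use r in auto)
  have Fle: "\<bar>F h\<bar> \<le> \<rho>" if "\<And>i. \<bar>h $ i\<bar> \<le> r" for h
    by (rule power_series_rep_bound[OF F that])
  define C where "C = (\<lambda>(k, \<alpha>). c k * b k \<alpha>)"
  define P where "P = (\<lambda>(k, \<alpha>). \<bar>c k\<bar> * (\<bar>b k \<alpha>\<bar> * r ^ total_degree \<alpha>))"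
  have row: "((\<lambda>\<alpha>. P (k, \<alpha>)) has_sum \<bar>c k\<bar> * N k) UNIV" for k
    unfolding P_def by (simp add: has_sum_cmult_right N(2))
  have tot: "(\<lambda>k. \<bar>c k\<bar> * N k) summable_on UNIV"
  proof (rule summable_on_comparison_test)
    have r0: "0 \<le> \<rho>" using Fle[of 0] r by (smt (verit) abs_ge_zero zero_index)
    show "(\<lambda>k. \<bar>c k\<bar> * \<rho> ^ k) summable_on UNIV"
      using c r0 by (subst summable_on_UNIV_nonneg_real_iff) auto
  qed (use N(1) N0 in \<open>auto intro!: mult_left_mono\<close>)
  have sum: "P summable_on (UNIV \<times> UNIV)"
    by (rule summable_on_SigmaI[OF row tot]) (use r in \<open>auto simp: P_def\<close>)
  then obtain M where M: "(P has_sum M) UNIV" unfolding summable_on_def UNIV_Times_UNIV by blast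
  have CP: "\<bar>C k\<bar> * r ^ total_degree (snd k) = P k" for k
    by (cases k) (simp add: C_def P_def abs_mult)
  have "\<exists>d. power_series_rep r M d (\<lambda>h. g (F h))"
  proof (rule power_series_rep_regroup[OF r, of C snd])
    show "((\<lambda>k. \<bar>C k\<bar> * r ^ total_degree (snd k)) has_sum M) UNIV" unfolding CP by (rule M)
    fix h :: "real^'a" assume h: "\<And>i. \<bar>h $ i\<bar> \<le> r"
    have sm: "(\<lambda>k. C k * monomial h (snd k)) summable_on (UNIV \<times> UNIV)"
    proof (rule summable_on_abs_le[OF sum])
      fix k
      have "\<bar>C k * monomial h (snd k)\<bar> \<le> \<bar>C k\<bar> * r ^ total_degree (snd k)"
        unfolding abs_mult by (intro mult_left_mono abs_monomial_le h) auto
      then show "\<bar>C k * monomial h (snd k)\<bar> \<le> P k" unfolding CP .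
    qed
    have r0: "0 \<le> \<rho>" using Fle[OF h] by linarith
    have "((\<lambda>k. C k * monomial h (snd k)) has_sum g (F h)) (UNIV \<times> UNIV)"
    proof (rule has_sum_SigmaI[OF _ _ sm])
      show "((\<lambda>\<alpha>. C (k, \<alpha>) * monomial h (snd (k, \<alpha>))) has_sum c k * F h ^ k) UNIV" for k
        using b[of k] h unfolding C_def power_series_rep_def by (auto simp: mult.assoc intro!: has_sum_cmult_right)
      have "summable (\<lambda>k. norm (c k * F h ^ k))"
      proof (rule summable_comparison_test'[OF c])
        show "norm (norm (c k * F h ^ k)) \<le> \<bar>c k\<bar> * \<rho> ^ k" for k
          using Fle[OF h] by (auto simp: abs_mult power_abs intro!: mult_left_mono power_mono)
      qed
      then show "((\<lambda>k. c k * F h ^ k) has_sum g (F h)) UNIV"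
        by (rule norm_summable_imp_has_sum[OF _ g[OF Fle[OF h]]])
    qed
    then show "((\<lambda>k. C k * monomial h (snd k)) has_sum g (F h)) UNIV" by simp
  qed
  then show ?thesis by blast
qed


section \<open>Germs of analytic functions and their closure properties\<close>

definition analytic_at :: "(real^'n \<Rightarrow> real) \<Rightarrow> real^'n \<Rightarrow> bool" where
  "analytic_at f x \<longleftrightarrow> (\<exists>r>0. \<exists>M a. power_series_rep r M a (\<lambda>h. f (x + h)))"

lemma analytic_at_common_radius:
  assumes "analytic_at f x" "analytic_at g x"
  obtains r M a N b where "r > 0" "power_series_rep r M a (\<lambda>h. f (x + h))" "power_series_rep r N b (\<lambda>h. g (x + h))"
proof -
  obtain r M a r' N b where 1: "r > 0" "power_series_rep r M a (\<lambda>h. f (x + h))" "r' > 0" "power_series_rep r' N b (\<lambda>h. g (x + h))"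
    using assms unfolding analytic_at_def by blast
  then have m: "0 < min r r'" "min r r' \<le> r" "min r r' \<le> r'" by simp_all
  obtain M' a' where f': "power_series_rep (min r r') M' a' (\<lambda>h. f (x + h))"
    using power_series_rep_smaller[OF m(1,2) 1(2)] by blast
  obtain N' b' where g': "power_series_rep (min r r') N' b' (\<lambda>h. g (x + h))"
    using power_series_rep_smaller[OF m(1,3) 1(4)] by blast
  show thesis by (rule that[OF m(1) f' g'])
qed

lemma analytic_at_const: "analytic_at (\<lambda>_. c) x"
  unfolding analytic_at_def using power_series_rep_const zero_less_one by blast

lemma analytic_at_add: "analytic_at f x \<Longrightarrow> analytic_at g x \<Longrightarrow> analytic_at (\<lambda>y. f y + g y) x"
  by (rule analytic_at_common_radius[of f x g]) (use power_series_rep_add in \<open>unfold analytic_at_def, blast+\<close>)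

lemma analytic_at_mult: "analytic_at f x \<Longrightarrow> analytic_at g x \<Longrightarrow> analytic_at (\<lambda>y. f y * g y) x"
  by (rule analytic_at_common_radius[of f x g]) (use power_series_rep_mult in \<open>unfold analytic_at_def, blast+\<close>)

lemma analytic_at_coord: "analytic_at (\<lambda>y. y $ i) x"
proof -
  have "monomial h (\<lambda>j. if j = i then 1 else 0) = h $ i" for h :: "real^'a"
    by (simp add: monomial_def if_distrib[of "\<lambda>k. _ ^ k"] prod.delta cong: if_cong)
  then have "\<exists>M a. power_series_rep 1 M a (\<lambda>h::real^'a. h $ i)"
    using power_series_rep_single[of "\<lambda>h. h $ i" 1 "\<lambda>j. if j = i then 1 else 0" 1] by auto
  then obtain M a where "power_series_rep 1 M a (\<lambda>h::real^'a. h $ i)" by blast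
  from power_series_rep_add[OF zero_less_one power_series_rep_const this, of "x $ i"]
  have "\<exists>M a. power_series_rep 1 M a (\<lambda>h. (x + h) $ i)" by (auto simp: vector_add_component)
  then show ?thesis unfolding analytic_at_def using zero_less_one by blast
qed

text \<open>The difference \<open>f - f x\<close> vanishes at the centre, so its norm tends to 0
  with the radius and drops below the radius \<rho> of the outer series.\<close>

lemma analytic_at_compose:
  assumes f: "analytic_at f x" and \<rho>: "\<rho> > 0"
    and c: "summable (\<lambda>k. \<bar>c k\<bar> * \<rho> ^ k)" and g: "\<And>z. \<bar>z\<bar> \<le> \<rho> \<Longrightarrow> (\<lambda>k. c k * z ^ k) sums g (f x + z)"
  shows "analytic_at (\<lambda>y. g (f y)) x"
proof -
  obtain r M a where r: "r > 0" "power_series_rep r M a (\<lambda>h. f (x + h))"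
    using f unfolding analytic_at_def by blast
  define F where "F h = f (x + h) + - f x" for h
  define a' where "a' \<alpha> = a \<alpha> + (if \<alpha> = (\<lambda>_. 0) then - f x else 0)" for \<alpha>
  define K where "K = M + \<bar>- f x\<bar>"
  have F: "power_series_rep r K a' F"
    using power_series_rep_add[OF r power_series_rep_const[of r "- f x"]] unfolding F_def a'_def K_def .
  \<comment> \<open>Chosen so that \<open>r' / r * K\<close> is at most \<rho>; the summand 1 keeps
    the denominator away from 0.\<close>
  define r' where "r' = min r (\<rho> * r / (\<bar>K\<bar> + 1))"
  have r': "0 < r'" "r' \<le> r" using r \<rho> by (auto simp: r'_def)
  have "r' / r * K \<le> r' / r * \<bar>K\<bar>" using r r' by (intro mult_left_mono) auto
  also have "\<dots> \<le> (\<rho> * r / (\<bar>K\<bar> + 1)) / r * \<bar>K\<bar>"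
    using r \<rho> by (intro mult_right_mono divide_right_mono) (auto simp: r'_def)
  also have "\<dots> = \<rho> * (\<bar>K\<bar> / (\<bar>K\<bar> + 1))" using r by simp
  also have "\<dots> \<le> \<rho> * 1" using \<rho> by (intro mult_left_mono) auto
  finally have le: "r' / r * K \<le> \<rho>" by simp
  have "power_series_rep r' (r' / r * K) a' F"
    by (rule power_series_rep_shrink[OF r' F]) (simp add: F_def)
  then have "power_series_rep r' \<rho> a' F"
    using le unfolding power_series_rep_def by (meson order_trans)
  from power_series_rep_compose[OF r'(1) this c, of "\<lambda>z. g (f x + z)"] g
  have "\<exists>M b. power_series_rep r' M b (\<lambda>h. g (f (x + h)))" by (simp add: F_def)
  then show ?thesis unfolding analytic_at_def using r'(1) by blast
qed

lemma analytic_at_inverse: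
  assumes f: "analytic_at f x" and 0: "f x \<noteq> 0"
  shows "analytic_at (\<lambda>y. inverse (f y)) x"
proof (rule analytic_at_compose[OF f])
  define u where "u = f x"
  have u: "u \<noteq> 0" using 0 by (simp add: u_def)
  \<comment> \<open>Half the distance from \<open>f x\<close> to the pole at 0, so that the
    geometric series has ratio at most 1/2.\<close>
  show "\<bar>f x\<bar> / 2 > 0" using 0 by simp
  have "summable (\<lambda>k. inverse \<bar>u\<bar> * (1/2) ^ k)" by (intro summable_mult summable_geometric) simp
  moreover have "(\<lambda>k. inverse \<bar>u\<bar> * (1/2) ^ k) = (\<lambda>k. \<bar>(-1) ^ k * inverse u ^ Suc k\<bar> * (\<bar>f x\<bar> / 2) ^ k)"
    using u by (simp add: u_def[symmetric] fun_eq_iff abs_mult power_abs power_divide field_simps)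
  ultimately show "summable (\<lambda>k. \<bar>(-1) ^ k * inverse (f x) ^ Suc k\<bar> * (\<bar>f x\<bar> / 2) ^ k)"
    unfolding u_def by simp
  fix z assume z: "\<bar>z\<bar> \<le> \<bar>f x\<bar> / 2"
  then have uz: "u + z \<noteq> 0" using u by (auto simp: u_def)
  have "\<bar>- (z / u)\<bar> < 1" using z u by (simp add: u_def abs_divide pos_divide_less_eq)
  then have "(\<lambda>k. (- (z / u)) ^ k) sums (1 / (1 - - (z / u)))" by (intro geometric_sums) simp
  then have "(\<lambda>k. inverse u * (- (z / u)) ^ k) sums (inverse u * (1 / (1 - - (z / u))))" by (rule sums_mult)
  moreover have "inverse u * (1 / (1 - - (z / u))) = inverse (u + z)" using u uz by (simp add: field_simps)
  moreover have "inverse u * (- (z / u)) ^ k = (-1) ^ k * inverse u ^ Suc k * z ^ k" for k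
    using power_minus[of "z / u" k] by (simp add: power_divide field_simps power_inverse)
  ultimately show "(\<lambda>k. (-1) ^ k * inverse (f x) ^ Suc k * z ^ k) sums inverse (f x + z)"
    unfolding u_def by simp
qed

lemma analytic_at_sqrt:
  assumes f: "analytic_at f x" and 0: "f x > 0"
  shows "analytic_at (\<lambda>y. sqrt (f y)) x"
proof (rule analytic_at_compose[OF f])
  define u where "u = f x"
  have u: "u > 0" using 0 by (simp add: u_def)
  show "f x / 2 > 0" using 0 by simp
  let ?c = "\<lambda>k. sqrt (f x) * ((1/2) gchoose k) / f x ^ k"
  \<comment> \<open>Convergence of the binomial series at 3/4 gives absolute convergence at the
    smaller value 1/2, which corresponds to the radius \<open>f x / 2\<close>.\<close>
  have "summable (\<lambda>k. norm (((1/2::real) gchoose k) * (1/2) ^ k))"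
    by (rule powser_insidea[of _ "3/4"]) (use gen_binomial_real[of "3/4" "1/2"] in \<open>auto simp: sums_iff\<close>)
  then have "summable (\<lambda>k. sqrt u * norm (((1/2::real) gchoose k) * (1/2) ^ k))" by (rule summable_mult)
  moreover have "sqrt u * norm (((1/2::real) gchoose k) * (1/2) ^ k) = \<bar>?c k\<bar> * (f x / 2) ^ k" for k
    using u by (simp add: u_def[symmetric] abs_mult power_divide)
  ultimately have "summable (\<lambda>k. \<bar>?c k\<bar> * (f x / 2) ^ k)" by (simp only:)
  then show "summable (\<lambda>k. \<bar>?c k\<bar> * (f x / 2) ^ k)" .
  fix z assume z: "\<bar>z\<bar> \<le> f x / 2"
  then have uz: "u + z > 0" using u by (auto simp: u_def)
  have "\<bar>z / u\<bar> < 1" using z u by (simp add: u_def abs_divide pos_divide_less_eq)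
  from sums_mult[OF gen_binomial_real[OF this, of "1/2"], of "sqrt u"]
  have "(\<lambda>k. sqrt u * (((1/2) gchoose k) * (z / u) ^ k)) sums (sqrt u * (1 + z / u) powr (1/2))" .
  moreover have "sqrt u * (1 + z / u) powr (1/2) = sqrt (u + z)"
  proof -
    have "1 + z / u = (u + z) / u" using u by (simp add: field_simps)
    then show ?thesis using u uz by (simp add: powr_half_sqrt real_sqrt_divide)
  qed
  moreover have "sqrt u * (((1/2) gchoose k) * (z / u) ^ k) = ?c k * z ^ k" for k
    by (simp add: u_def power_divide)
  ultimately show "(\<lambda>k. ?c k * z ^ k) sums sqrt (f x + z)" unfolding u_def by simp
qed

lemma analytic_at_minus: "analytic_at f x \<Longrightarrow> analytic_at (\<lambda>y. - f y) x"
  using analytic_at_mult[OF analytic_at_const[of "-1"]] by fastforce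

lemma analytic_at_diff: "analytic_at f x \<Longrightarrow> analytic_at g x \<Longrightarrow> analytic_at (\<lambda>y. f y - g y) x"
  using analytic_at_add[OF _ analytic_at_minus] by fastforce

lemma analytic_at_divide: "analytic_at f x \<Longrightarrow> analytic_at g x \<Longrightarrow> g x \<noteq> 0 \<Longrightarrow> analytic_at (\<lambda>y. f y / g y) x"
  unfolding divide_inverse by (intro analytic_at_mult analytic_at_inverse)

lemma analytic_at_power: "analytic_at f x \<Longrightarrow> analytic_at (\<lambda>y. f y ^ k) x"
  by (induction k) (auto intro: analytic_at_const analytic_at_mult)

lemmas analytic_intros = analytic_at_const analytic_at_coord analytic_at_add analytic_at_diff analytic_at_minus
  analytic_at_mult analytic_at_power analytic_at_divide analytic_at_inverse analytic_at_sqrt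

text \<open>After subtracting the value at the centre, the shrinking estimate bounds the function on
  a ball by a constant times the radius.\<close>

lemma analytic_at_imp_isCont:
  assumes "analytic_at f x"
  shows "isCont f x"
proof -
  obtain r M a where r: "r > 0" "power_series_rep r M a (\<lambda>h. f (x + h))"
    using assms unfolding analytic_at_def by blast
  define F where "F h = f (x + h) + - f x" for h
  obtain b K where F: "power_series_rep r K b F"
    using power_series_rep_add[OF r power_series_rep_const[of r "- f x"]] unfolding F_def by blast
  have F0: "F 0 = 0" by (simp add: F_def)
  have bound: "\<bar>F h\<bar> \<le> \<bar>K\<bar> / r * e" if e: "0 < e" "e \<le> r" and h: "norm h < e" for e h
  proof -
    have hi: "\<bar>h $ i\<bar> \<le> e" for i using component_le_norm_cart[of h i] h by linarith
    have R: "power_series_rep e (e / r * K) b F" by (rule power_series_rep_shrink[OF e F F0])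
    have "\<bar>F h\<bar> \<le> e / r * K" by (rule power_series_rep_bound[OF R hi])
    also have "\<dots> \<le> e / r * \<bar>K\<bar>" using e r by (intro mult_left_mono) auto
    finally show ?thesis by (simp add: field_simps)
  qed
  show ?thesis
    unfolding continuous_at_eps_delta
  proof (intro allI impI)
    fix \<epsilon> :: real assume \<epsilon>: "\<epsilon> > 0"
    define e where "e = min r (\<epsilon> * r / (\<bar>K\<bar> + 1))"
    have e: "0 < e" "e \<le> r" using r \<epsilon> by (auto simp: e_def)
    have "\<bar>K\<bar> / r * e \<le> \<bar>K\<bar> / r * (\<epsilon> * r / (\<bar>K\<bar> + 1))" using r by (intro mult_left_mono) (auto simp: e_def)
    also have "\<dots> = \<epsilon> * (\<bar>K\<bar> / (\<bar>K\<bar> + 1))" using r by simp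
    also have "\<dots> < \<epsilon> * 1" using \<epsilon> by (intro mult_strict_left_mono) auto
    finally have lt: "\<bar>K\<bar> / r * e < \<epsilon>" by simp
    show "\<exists>d>0. \<forall>y. dist y x < d \<longrightarrow> dist (f y) (f x) < \<epsilon>"
    proof (intro exI[of _ e] conjI allI impI e)
      fix y assume "dist y x < e"
      then have "\<bar>F (y - x)\<bar> \<le> \<bar>K\<bar> / r * e" using bound[OF e] by (simp add: dist_norm)
      then show "dist (f y) (f x) < \<epsilon>" using lt by (simp add: F_def dist_real_def)
    qed
  qed
qed

text \<open>Each component only has to agree near the point with an analytic germ. This leaves room
  for maps defined through a choice of representative, a sign or a case distinction, which become
  analytic expressions after such a local replacement. The least of the finitely many radii serves
  all components.\<close>

lemma real_analytic_onI:
  fixes F :: "real^'n \<Rightarrow> real^'m"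
  assumes S: "open S"
    and F: "\<And>x j. x \<in> S \<Longrightarrow> \<exists>g. analytic_at g x \<and> (\<forall>\<^sub>F y in nhds x. F y $ j = g y)"
  shows "real_analytic_on S F"
  unfolding real_analytic_on_def
proof
  fix x assume x: "x \<in> S"
  have "\<exists>g r M a. r > 0 \<and> power_series_rep r M a (\<lambda>h. g (x + h)) \<and> (\<forall>y\<in>ball x r. F y $ j = g y)" for j
  proof -
    obtain g where g: "analytic_at g x" "\<forall>\<^sub>F y in nhds x. F y $ j = g y" using F[OF x] by blast
    obtain r M a where r: "r > 0" "power_series_rep r M a (\<lambda>h. g (x + h))" using g(1) unfolding analytic_at_def by blast
    obtain d where d: "d > 0" "\<And>y. dist y x < d \<Longrightarrow> F y $ j = g y" using g(2) unfolding eventually_nhds_metric by blast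
    obtain M' a' where "power_series_rep (min r d) M' a' (\<lambda>h. g (x + h))"
      using power_series_rep_smaller[OF _ _ r(2), of "min r d"] r(1) d(1) by auto
    moreover have "\<forall>y\<in>ball x (min r d). F y $ j = g y" using d by (auto simp: dist_commute)
    moreover have "min r d > 0" using r(1) d(1) by simp
    ultimately show ?thesis by blast
  qed
  then obtain g r M a where g: "\<And>j. r j > 0" "\<And>j. power_series_rep (r j) (M j) (a j) (\<lambda>h. g j (x + h))"
    "\<And>j. \<forall>y\<in>ball x (r j). F y $ j = g j y" by metis
  obtain d where d: "d > 0" "ball x d \<subseteq> S" using S x open_contains_ball by blast
  define e where "e = min d (Min (range r))"
  have e: "e > 0" using d g(1) by (auto simp: e_def)
  have er: "e \<le> r j" for j by (auto simp: e_def intro: min.coboundedI2)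
  have "((\<lambda>\<alpha>. (\<Prod>i\<in>UNIV. (y $ i - x $ i) ^ \<alpha> i) *\<^sub>R (\<chi> j. a j \<alpha>)) has_sum F y) UNIV" if y: "y \<in> ball x e" for y
  proof -
    have yr: "y \<in> ball x (r j)" for j using y er[of j] by (auto simp: dist_norm)
    have small: "\<bar>(y - x) $ i\<bar> \<le> r j" for i j
      using component_le_norm_cart[of "y - x" i] yr[of j] by (auto simp: dist_norm norm_minus_commute)
    have comp: "((\<lambda>\<alpha>. a j \<alpha> * monomial (y - x) \<alpha>) has_sum F y $ j) UNIV" for j
    proof -
      have "F y $ j = g j (x + (y - x))" using g(3)[of j] yr[of j] by auto
      then show ?thesis using g(2)[of j] small unfolding power_series_rep_def by metis
    qed
    have "((\<lambda>\<alpha>. \<Sum>j\<in>J. (a j \<alpha> * monomial (y - x) \<alpha>) *\<^sub>R (axis j 1 :: real^'m)) has_sum (\<Sum>j\<in>J. (F y $ j) *\<^sub>R axis j 1)) UNIV"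
      if "finite J" for J
      using that
    proof (induction J)
      case (insert j J)
      have "((\<lambda>\<alpha>. (a j \<alpha> * monomial (y - x) \<alpha>) *\<^sub>R (axis j 1 :: real^'m)) has_sum (F y $ j) *\<^sub>R axis j 1) UNIV"
        by (rule has_sum_bounded_linear[OF bounded_linear_scaleR_left comp])
      from has_sum_add[OF this insert.IH] show ?case using insert.hyps by simp
    qed simp
    from this[of UNIV] have "((\<lambda>\<alpha>. \<Sum>j\<in>UNIV. (a j \<alpha> * monomial (y - x) \<alpha>) *\<^sub>R (axis j 1 :: real^'m)) has_sum F y) UNIV"
      using basis_expansion[of "F y"] by (simp add: scalar_mult_eq_scaleR)
    moreover have "(\<Sum>j\<in>UNIV. (a j \<alpha> * monomial (y - x) \<alpha>) *\<^sub>R (axis j 1 :: real^'m)) = (\<Prod>i\<in>UNIV. (y $ i - x $ i) ^ \<alpha> i) *\<^sub>R (\<chi> j. a j \<alpha>)" for \<alpha>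
      using basis_expansion[of "\<chi> j. a j \<alpha> * monomial (y - x) \<alpha>"]
      by (simp add: scalar_mult_eq_scaleR vec_eq_iff monomial_def mult.commute)
    ultimately show ?thesis by simp
  qed
  moreover have "ball x e \<subseteq> S" using d by (auto simp: e_def)
  ultimately show "\<exists>r>0. ball x r \<subseteq> S \<and> (\<exists>a :: ('n \<Rightarrow> nat) \<Rightarrow> real^'m. \<forall>y\<in>ball x r.
           ((\<lambda>\<alpha>. (\<Prod>i\<in>UNIV. (y $ i - x $ i) ^ \<alpha> i) *\<^sub>R a \<alpha>) has_sum F y) UNIV)"
    using e by (intro exI[of _ e] conjI exI[of _ "\<lambda>\<alpha>. \<chi> j. a j \<alpha>"]) auto
qed

subsection \<open>Simple connectivity of unions\<close>

abbreviation "I01 \<equiv> top_of_set {0..1::real}"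

definition path_homotopic :: "'a topology \<Rightarrow> (real \<Rightarrow> 'a) \<Rightarrow> (real \<Rightarrow> 'a) \<Rightarrow> bool" where
  "path_homotopic X p q \<longleftrightarrow> homotopic_with (\<lambda>r. r 0 = p 0 \<and> r 1 = p 1) I01 X p q"

text \<open>Simple connectivity in terms of paths with fixed end points, which is what gluing needs.\<close>

definition paths_homotopic_space :: "'a topology \<Rightarrow> bool" where
  "paths_homotopic_space X \<longleftrightarrow> path_connected_space X \<and>
     (\<forall>p q. pathin X p \<and> pathin X q \<and> p 0 = q 0 \<and> p 1 = q 1 \<longrightarrow> path_homotopic X p q)"

lemma path_homotopic_iff:
  "path_homotopic X p q \<longleftrightarrow> (\<exists>h. continuous_map (prod_topology I01 I01) X h \<and>
     (\<forall>x\<in>{0..1}. h (0, x) = p x) \<and> (\<forall>x\<in>{0..1}. h (1, x) = q x) \<and>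
     (\<forall>t\<in>{0..1}. h (t, 0) = p 0 \<and> h (t, 1) = p 1))"
  unfolding path_homotopic_def by (subst homotopic_with) auto

lemma path_homotopic_ends: "path_homotopic X p q \<Longrightarrow> q 0 = p 0 \<and> q 1 = p 1"
  unfolding path_homotopic_def by (drule homotopic_with_imp_property) auto

lemma path_homotopic_pathin: "path_homotopic X p q \<Longrightarrow> pathin X p \<and> pathin X q"
  unfolding path_homotopic_def pathin_def by (rule homotopic_with_imp_continuous_maps)

lemma path_homotopic_refl: "pathin X p \<Longrightarrow> path_homotopic X p p"
  unfolding path_homotopic_def pathin_def by simp

lemma path_homotopic_trans: "path_homotopic X p q \<Longrightarrow> path_homotopic X q r \<Longrightarrow> path_homotopic X p r"
proof -
  assume 1: "path_homotopic X p q" and 2: "path_homotopic X q r"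
  have "homotopic_with (\<lambda>r. r 0 = p 0 \<and> r 1 = p 1) I01 X q r"
    using 2 path_homotopic_ends[OF 1] unfolding path_homotopic_def by simp
  then show ?thesis using 1 homotopic_with_trans unfolding path_homotopic_def by blast
qed

lemma path_homotopic_mono:
  assumes "path_homotopic (subtopology X S) p q" shows "path_homotopic X p q"
  using assms unfolding path_homotopic_iff continuous_map_in_subtopology by blast

lemma pathin_subtopology_iff: "pathin (subtopology X S) p \<longleftrightarrow> pathin X p \<and> p ` {0..1} \<subseteq> S"
  unfolding pathin_def continuous_map_in_subtopology by (auto simp: image_subset_iff)

text \<open>The given segment and a path joining its ends inside \<open>S \<inter> T\<close> both
  run in \<open>T\<close>, where paths with equal ends are homotopic. This homotopy is glued with
  the constant one outside the segment.\<close>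

lemma replace_segment:
  assumes T: "paths_homotopic_space (subtopology X T)" and ST: "path_connected_space (subtopology X (S \<inter> T))"
    and p: "pathin X p" and ab: "0 \<le> a" "a \<le> b" "b \<le> 1"
    and pT: "p ` {a..b} \<subseteq> T" and ends: "p a \<in> S \<inter> T" "p b \<in> S \<inter> T"
  shows "\<exists>p'. path_homotopic X p p' \<and> (\<forall>x. x \<le> a \<or> b \<le> x \<longrightarrow> p' x = p x) \<and> p' ` {a..b} \<subseteq> S \<inter> T"
proof (cases "a = b")
  case True
  then show ?thesis using ends p path_homotopic_refl by (intro exI[of _ p]) auto
next
  case False
  then have lt: "a < b" using ab by simp
  have pc: "continuous_map I01 X p" using p by (simp add: pathin_def)
  have pts: "p x \<in> topspace X" if "x \<in> {0..1}" for x
    using continuous_map_image_subset_topspace[OF pc] that by auto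
  \<comment> \<open>Rescales the segment to the unit interval; clamping ensures that
    \<open>h\<close> is evaluated only inside the unit square.\<close>
  define c where "c x = max 0 (min 1 ((x - a) / (b - a)))" for x :: real
  have c: "c ` {0..1} \<subseteq> {0..1}" "c a = 0" "c b = 1" using lt by (auto simp: c_def)
  have c1: "continuous_on UNIV c" unfolding c_def using lt by (intro continuous_intros) auto
  define pab where "pab t = p (a + t * (b - a))" for t
  have seg: "a + t * (b - a) \<in> {a..b}" if "t \<in> {0..1}" for t
  proof -
    define m where "m = t * (b - a)"
    have "m \<le> 1 * (b - a)" unfolding m_def using that lt by (intro mult_right_mono) auto
    moreover have "0 \<le> m" using that lt by (simp add: m_def)
    ultimately show ?thesis unfolding m_def[symmetric] by simp
  qed
  have pab: "pathin (subtopology X T) pab"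
    unfolding pathin_subtopology_iff
  proof
    have "continuous_map I01 I01 (\<lambda>t. a + t * (b - a))"
      using seg ab by (force simp: continuous_map_in_subtopology intro!: continuous_intros)
    from continuous_map_compose[OF this pc] show "pathin X pab" by (simp add: pathin_def pab_def[abs_def] o_def)
    show "pab ` {0..1} \<subseteq> T" using pT seg by (auto simp: pab_def)
  qed
  have "p a \<in> topspace (subtopology X (S \<inter> T))" "p b \<in> topspace (subtopology X (S \<inter> T))"
    using ends pts ab by auto
  then obtain r where r: "pathin (subtopology X (S \<inter> T)) r" "r 0 = p a" "r 1 = p b"
    using ST unfolding path_connected_space_def by blast
  then have "pathin (subtopology X T) r" by (auto simp: pathin_subtopology_iff)
  then have "path_homotopic (subtopology X T) pab r"
    using T pab r unfolding paths_homotopic_space_def by (simp add: pab_def)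
  then have "path_homotopic X pab r" by (rule path_homotopic_mono)
  then obtain h where h: "continuous_map (prod_topology I01 I01) X h"
    "\<And>x. x \<in> {0..1} \<Longrightarrow> h (0, x) = pab x" "\<And>x. x \<in> {0..1} \<Longrightarrow> h (1, x) = r x"
    "\<And>t. t \<in> {0..1} \<Longrightarrow> h (t, 0) = pab 0 \<and> h (t, 1) = pab 1"
    unfolding path_homotopic_iff by blast
  define H where "H = (\<lambda>(s::real, x). if x \<le> a then p x else if x \<le> b then h (s, c x) else p x)"
  have csnd: "continuous_map (prod_topology I01 I01) euclideanreal snd"
    by (rule continuous_map_into_fulltopology[OF continuous_map_snd])
  have pf: "continuous_map (prod_topology I01 I01) X (\<lambda>z. p (snd z))"
    using continuous_map_compose[OF continuous_map_snd pc] unfolding o_def .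
  have cc: "continuous_map I01 I01 c"
    using c(1) continuous_on_subset[OF c1] by (auto simp: continuous_map_in_subtopology)
  have "continuous_map (prod_topology I01 I01) (prod_topology I01 I01) (\<lambda>z. (fst z, c (snd z)))"
    by (intro continuous_map_pairedI continuous_map_fst continuous_map_compose[OF continuous_map_snd cc, unfolded o_def])
  from continuous_map_compose[OF this h(1)]
  have hf: "continuous_map (prod_topology I01 I01) X (\<lambda>z. h (fst z, c (snd z)))" unfolding o_def .
  have inner: "continuous_map (prod_topology I01 I01) X (\<lambda>z. if snd z \<le> b then h (fst z, c (snd z)) else p (snd z))"
  proof (rule continuous_map_cases_le[OF csnd continuous_map_const[THEN iffD2]])
    fix z assume "z \<in> topspace (prod_topology I01 I01)" "snd z = b"
    then show "h (fst z, c (snd z)) = p (snd z)" using h(4)[of "fst z"] c by (auto simp: pab_def)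
  qed ((rule continuous_map_from_subtopology, rule hf pf) | simp)+
  have "continuous_map (prod_topology I01 I01) X (\<lambda>z. if snd z \<le> a then p (snd z) else (if snd z \<le> b then h (fst z, c (snd z)) else p (snd z)))"
  proof (rule continuous_map_cases_le[OF csnd continuous_map_const[THEN iffD2]])
    fix z assume "z \<in> topspace (prod_topology I01 I01)" "snd z = a"
    then show "p (snd z) = (if snd z \<le> b then h (fst z, c (snd z)) else p (snd z))"
      using h(4)[of "fst z"] c lt by (auto simp: pab_def)
  qed ((rule continuous_map_from_subtopology, rule inner pf) | simp)+
  then have Hc: "continuous_map (prod_topology I01 I01) X H" unfolding H_def case_prod_unfold .
  define p' where "p' x = H (1, x)" for x
  have cx: "c x \<in> {0..1}" for x by (auto simp: c_def)
  have ca: "c x = (x - a) / (b - a)" if "a \<le> x" "x \<le> b" for x using that lt by (auto simp: c_def)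
  have H0: "H (0, x) = p x" for x
  proof (cases "a \<le> x \<and> x \<le> b")
    case True
    then have "h (0, c x) = p x" using h(2)[OF cx, of x] ca[of x] lt by (simp add: pab_def)
    then show ?thesis by (simp add: H_def)
  qed (auto simp: H_def)
  have Hb: "H (t, x) = p x" if "t \<in> {0..1}" "x \<le> a \<or> b \<le> x" for t x
  proof (cases "x = b")
    case True
    then show ?thesis using h(4)[OF that(1)] c lt by (simp add: H_def pab_def)
  qed (use that in \<open>auto simp: H_def\<close>)
  have "path_homotopic X p p'"
    unfolding path_homotopic_iff
    by (intro exI[of _ H] conjI ballI Hc) (use H0 Hb ab p'_def in auto)
  moreover have "p' ` {a..b} \<subseteq> S \<inter> T"
  proof
    fix y assume "y \<in> p' ` {a..b}"
    then obtain x where x: "a \<le> x" "x \<le> b" "y = p' x" by auto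
    show "y \<in> S \<inter> T"
    proof (cases "x = a")
      case True
      then show ?thesis using x ends by (simp add: p'_def H_def)
    next
      case False
      then have "y = r (c x)" using x h(3)[OF cx, of x] by (simp add: p'_def H_def)
      then show ?thesis using r(1) cx[of x] unfolding pathin_subtopology_iff by blast
    qed
  qed
  ultimately show ?thesis using Hb[of 1] by (intro exI[of _ p']) (auto simp: p'_def)
qed

text \<open>The preimages of \<open>S\<close> and \<open>T\<close> cover the compact unit interval,
  and a Lebesgue number of this cover bounds the mesh of a suitable equidistant partition.\<close>

lemma path_subdivision:
  assumes p: "pathin X p" and S: "openin X S" and T: "openin X T" and ST: "S \<union> T = topspace X"
  shows "\<exists>n::nat. 0 < n \<and> (\<forall>k<n. p ` {k / n..Suc k / n} \<subseteq> S \<or> p ` {k / n..Suc k / n} \<subseteq> T)"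
proof -
  have pc: "continuous_map I01 X p" using p by (simp add: pathin_def)
  have "openin I01 {x \<in> {0..1}. p x \<in> S}" "openin I01 {x \<in> {0..1}. p x \<in> T}"
    using openin_continuous_map_preimage[OF pc] S T by fastforce+
  then obtain A B where A: "open A" "{x \<in> {0..1}. p x \<in> S} = {0..1} \<inter> A" and B: "open B" "{x \<in> {0..1}. p x \<in> T} = {0..1} \<inter> B"
    unfolding openin_open by auto
  have cov: "{0..1} \<subseteq> \<Union>{A, B}"
  proof
    fix x :: real assume x: "x \<in> {0..1}"
    then have "p x \<in> S \<union> T" using continuous_map_image_subset_topspace[OF pc] ST by auto
    then show "x \<in> \<Union>{A, B}" using x A(2) B(2) by blast
  qed
  obtain \<delta> where \<delta>: "\<delta> > 0" "\<And>V. V \<subseteq> {0..1} \<Longrightarrow> diameter V < \<delta> \<Longrightarrow> \<exists>W\<in>{A, B}. V \<subseteq> W"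
    using Lebesgue_number_lemma[OF compact_Icc _ cov] A(1) B(1) by (metis emptyE insert_iff insert_not_empty)
  obtain n :: nat where n: "n > 0" "inverse n < \<delta>" using real_arch_inverse \<delta>(1) by auto
  have "p ` {k / n..Suc k / n} \<subseteq> S \<or> p ` {k / n..Suc k / n} \<subseteq> T" if k: "k < n" for k
  proof -
    let ?V = "{k / n..Suc k / n} :: real set"
    have V: "?V \<subseteq> {0..1}" using k n by (auto simp: field_simps)
    have "diameter ?V = inverse n" using n by (simp add: diameter_closed_interval field_simps)
    then have "\<exists>W\<in>{A, B}. ?V \<subseteq> W" using \<delta>(2)[OF V] n(2) by simp
    then show ?thesis using V A(2) B(2) by blast
  qed
  then show ?thesis using n(1) by blast
qed

text \<open>A stretch in \<open>T\<close> can be moved into \<open>S \<inter> T\<close> only when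
  both of its ends lie there. The induction along the partition therefore carries, after an initial
  part already in \<open>S\<close>, one pending stretch in \<open>T\<close>. It is replaced as soon
  as a piece in \<open>S\<close> follows, or at the very end, where
  \<open>p 1 \<in> S\<close>.\<close>

lemma path_homotopic_into_open:
  assumes S: "openin X S" and T: "openin X T" and ST: "S \<union> T = topspace X"
    and Tsc: "paths_homotopic_space (subtopology X T)" and conn: "path_connected_space (subtopology X (S \<inter> T))"
    and p: "pathin X p" "p 0 \<in> S" "p 1 \<in> S"
  shows "\<exists>p'. path_homotopic X p p' \<and> p' ` {0..1} \<subseteq> S"
proof -
  obtain n :: nat where n: "0 < n" "\<And>k. k < n \<Longrightarrow> p ` {k / n..Suc k / n} \<subseteq> S \<or> p ` {k / n..Suc k / n} \<subseteq> T"
    using path_subdivision[OF p(1) S T ST] by blast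
  have step: "\<exists>p'. path_homotopic X p p' \<and> (\<forall>x. real k / n \<le> x \<longrightarrow> p' x = p x) \<and>
     (p' ` {0..k / n} \<subseteq> S \<or> (\<exists>t. 0 \<le> t \<and> t \<le> k / n \<and> p' ` {0..t} \<subseteq> S \<and> p' ` {t..k / n} \<subseteq> T))" if "k \<le> n" for k
    using that
  proof (induction k)
    case 0
    then show ?case using p path_homotopic_refl by (intro exI[of _ p]) auto
  next
    case (Suc k)
    then obtain p' where p': "path_homotopic X p p'" "\<And>x. real k / n \<le> x \<Longrightarrow> p' x = p x"
      "p' ` {0..k / n} \<subseteq> S \<or> (\<exists>t. 0 \<le> t \<and> t \<le> k / n \<and> p' ` {0..t} \<subseteq> S \<and> p' ` {t..k / n} \<subseteq> T)" by auto
    have kn: "0 \<le> k / real n" "k / real n \<le> Suc k / real n" "k / real n \<le> 1" "Suc k / real n \<le> 1"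
      using n(1) Suc.prems by (auto simp: divide_simps)
    have agree: "\<forall>x. real (Suc k) / n \<le> x \<longrightarrow> p' x = p x" using p'(2) kn(2) by auto
    have seg: "p' ` {k / n..Suc k / n} = p ` {k / n..Suc k / n}" using p'(2) by (intro image_cong) auto
    have split: "{0..Suc k / real n} = {0..k / n} \<union> {k / n..Suc k / n}"
      "\<And>t. 0 \<le> t \<Longrightarrow> t \<le> k / real n \<Longrightarrow> {t..Suc k / real n} = {t..k / n} \<union> {k / n..Suc k / n}"
      "\<And>t. 0 \<le> t \<Longrightarrow> t \<le> k / real n \<Longrightarrow> {0..k / real n} = {0..t} \<union> {t..k / n}"
      using kn ivl_disj_un_two_touch(4) by metis+
    have "k < n" using Suc.prems by simp
    then have "p ` {k / n..Suc k / n} \<subseteq> S \<or> p ` {k / n..Suc k / n} \<subseteq> T" by (rule n(2))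
    then show ?case
    proof (elim disjE)
      assume S: "p ` {k / n..Suc k / n} \<subseteq> S"
      show ?thesis
      proof (cases "p' ` {0..k / n} \<subseteq> S")
        case True
        then have "p' ` {0..Suc k / n} \<subseteq> S" unfolding split(1) image_Un seg by (intro Un_least S)
        then show ?thesis using p'(1) agree by blast
      next
        case False
        then obtain t where t: "0 \<le> t" "t \<le> k / n" "p' ` {0..t} \<subseteq> S" "p' ` {t..k / n} \<subseteq> T" using p'(3) by blast
        \<comment> \<open>The new piece puts the point at \<open>k / n\<close> into
          \<open>S\<close>, so the pending stretch now has both ends in
          \<open>S \<inter> T\<close>.\<close>
        have "p' (k / n) \<in> p' ` {k / n..Suc k / n}" "p' (k / n) \<in> p' ` {t..k / n}" "p' t \<in> p' ` {0..t}" "p' t \<in> p' ` {t..k / n}"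
          using kn(2) t(1,2) by (auto intro!: imageI)
        then have "p' t \<in> S \<inter> T" "p' (k / n) \<in> S \<inter> T" using t(3,4) S seg by blast+
        from replace_segment[OF Tsc conn _ t(1,2) kn(3) t(4) this]
        obtain p'' where p'': "path_homotopic X p' p''" "\<And>x. x \<le> t \<or> k / n \<le> x \<Longrightarrow> p'' x = p' x" "p'' ` {t..k / n} \<subseteq> S \<inter> T"
          using path_homotopic_pathin[OF p'(1)] by blast
        have e1: "p'' ` {0..t} = p' ` {0..t}" by (rule image_cong[OF refl], rule p''(2)) simp
        have e2: "p'' ` {k / n..Suc k / n} = p' ` {k / n..Suc k / n}" by (rule image_cong[OF refl], rule p''(2)) simp
        have "p'' ` {0..Suc k / n} = (p'' ` {0..t} \<union> p'' ` {t..k / n}) \<union> p'' ` {k / n..Suc k / n}"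
          by (simp only: split(1) split(3)[OF t(1,2)] image_Un)
        also have "\<dots> \<subseteq> S"
          unfolding e1 e2 seg by (intro Un_least t(3) S order_trans[OF p''(3) Int_lower1])
        finally have "p'' ` {0..Suc k / n} \<subseteq> S" .
        moreover have "\<forall>x. real (Suc k) / n \<le> x \<longrightarrow> p'' x = p x" using agree p''(2) kn(2) by auto
        ultimately show ?thesis using path_homotopic_trans[OF p'(1) p''(1)] by blast
      qed
    next
      assume T: "p ` {k / n..Suc k / n} \<subseteq> T"
      have "\<exists>t. 0 \<le> t \<and> t \<le> Suc k / n \<and> p' ` {0..t} \<subseteq> S \<and> p' ` {t..Suc k / n} \<subseteq> T"
      proof (cases "p' ` {0..k / n} \<subseteq> S")
        case True
        then show ?thesis using kn T seg by (intro exI[of _ "k / n"]) simp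
      next
        case False
        then obtain t where t: "0 \<le> t" "t \<le> k / n" "p' ` {0..t} \<subseteq> S" "p' ` {t..k / n} \<subseteq> T" using p'(3) by blast
        have "p' ` {t..Suc k / n} \<subseteq> T" unfolding split(2)[OF t(1,2)] image_Un seg by (intro Un_least T t(4))
        then show ?thesis using t kn(2) by (intro exI[of _ t]) simp
      qed
      then show ?thesis using p'(1) agree by blast
    qed
  qed
  obtain p' where p': "path_homotopic X p p'"
     "p' ` {0..1} \<subseteq> S \<or> (\<exists>t. 0 \<le> t \<and> t \<le> 1 \<and> p' ` {0..t} \<subseteq> S \<and> p' ` {t..1} \<subseteq> T)"
    using step[of n] n(1) by auto
  show ?thesis
  proof (cases "p' ` {0..1} \<subseteq> S")
    case False
    then obtain t where t: "0 \<le> t" "t \<le> 1" "p' ` {0..t} \<subseteq> S" "p' ` {t..1} \<subseteq> T" using p'(2) by blast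
    have "p' t \<in> p' ` {0..t}" "p' t \<in> p' ` {t..1}" "p' 1 \<in> p' ` {t..1}" using t(1,2) by (auto intro!: imageI)
    moreover have "p' 1 \<in> S" using path_homotopic_ends[OF p'(1)] p(3) by simp
    ultimately have "p' t \<in> S \<inter> T" "p' 1 \<in> S \<inter> T" using t(3,4) by blast+
    from replace_segment[OF Tsc conn _ t(1,2) order_refl t(4) this]
    obtain p'' where p'': "path_homotopic X p' p''" "\<And>x. x \<le> t \<or> 1 \<le> x \<Longrightarrow> p'' x = p' x" "p'' ` {t..1} \<subseteq> S \<inter> T"
      using path_homotopic_pathin[OF p'(1)] by blast
    have "p'' ` {0..t} = p' ` {0..t}" using p''(2) by (intro image_cong) auto
    moreover have "{0..1} = {0..t} \<union> {t..1}" using t by auto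
    ultimately have "p'' ` {0..1} \<subseteq> S" using t(3) p''(3) by (simp only: image_Un) blast
    then show ?thesis using path_homotopic_trans[OF p'(1) p''(1)] by blast
  qed (use p' in blast)
qed

text \<open>The homotopy between \<open>p\<close> and \<open>q\<close> is read off a null-homotopy of the loop \<open>p\<close> followed by
  the reverse of \<open>q\<close>: sweep the square by segments to the mid point of its left side, starting
  from the other three sides.\<close>

lemma paths_homotopic_spaceI:
  assumes conn: "path_connected_space X"
    and null: "\<And>p. pathin X p \<Longrightarrow> p 1 = p 0 \<Longrightarrow> path_homotopic X p (\<lambda>_. p 0)"
  shows "paths_homotopic_space X"
  unfolding paths_homotopic_space_def
proof (intro conjI conn allI impI)
  fix p q assume "pathin X p \<and> pathin X q \<and> p 0 = q 0 \<and> p 1 = q 1"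
  then have pq: "continuous_map I01 X p" "continuous_map I01 X q" "p 0 = q 0" "p 1 = q 1" by (auto simp: pathin_def)
  define l where "l x = (if x \<le> 1/2 then p (min 1 (2 * x)) else q (max 0 (min 1 (2 - 2 * x))))" for x
  have "pathin X l"
    unfolding pathin_def l_def
  proof (rule continuous_map_cases_le)
    have "continuous_map I01 I01 (\<lambda>x. min 1 (2 * x))" "continuous_map I01 I01 (\<lambda>x. max 0 (min 1 (2 - 2 * x)))"
      by (auto simp: continuous_map_in_subtopology intro!: continuous_intros)
    from continuous_map_compose[OF this(1) pq(1)] continuous_map_compose[OF this(2) pq(2)]
    show "continuous_map (subtopology I01 {x \<in> topspace I01. x \<le> 1 / 2}) X (\<lambda>x. p (min 1 (2 * x)))"
      "continuous_map (subtopology I01 {x \<in> topspace I01. 1 / 2 \<le> x}) X (\<lambda>x. q (max 0 (min 1 (2 - 2 * x))))"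
      by (auto simp: o_def intro: continuous_map_from_subtopology)
  qed (use pq(4) in auto)
  moreover have l01: "l 0 = p 0" "l 1 = p 0" using pq(3) by (auto simp: l_def)
  ultimately have "path_homotopic X l (\<lambda>_. l 0)" using null[of l] by simp
  then obtain h where h: "continuous_map (prod_topology I01 I01) X h"
    "\<And>x. x \<in> {0..1} \<Longrightarrow> h (0, x) = l x" "\<And>x. x \<in> {0..1} \<Longrightarrow> h (1, x) = p 0"
    "\<And>t. t \<in> {0..1} \<Longrightarrow> h (t, 0) = p 0 \<and> h (t, 1) = p 0"
    unfolding path_homotopic_iff l01 by blast
  \<comment> \<open>The point \<open>(g1 s, g2 s)\<close> walks in thirds along the three sides of
    the square on which \<open>h\<close> is constant, from \<open>(0, 0)\<close> over
    \<open>(1, 0)\<close> and \<open>(1, 1)\<close> to \<open>(0, 1)\<close>. \<open>K\<close> joins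
    it by a segment to \<open>(0, 1/2)\<close>, the place where \<open>l\<close> passes from
    \<open>p\<close> to the reverse of \<open>q\<close>.\<close>
  define g1 where "g1 s = max 0 (min 1 (min (3 * s) (3 - 3 * s)))" for s :: real
  define g2 where "g2 s = max 0 (min 1 (3 * s - 1))" for s :: real
  have g: "g1 s \<in> {0..1}" "g2 s \<in> {0..1}" for s by (auto simp: g1_def g2_def)
  define K where "K z = ((1 - snd z) * g1 (fst z), (1 - snd z) * g2 (fst z) + snd z * (1/2))" for z :: "real \<times> real"
  have K01: "fst (K z) \<in> {0..1} \<and> snd (K z) \<in> {0..1}" if "snd z \<in> {0..1}" for z
  proof -
    have "(1 - snd z) * g1 (fst z) \<le> 1 * 1" "(1 - snd z) * g2 (fst z) \<le> (1 - snd z) * 1"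
      using that g by (intro mult_mono mult_left_mono; auto)+
    moreover have "0 \<le> (1 - snd z) * g1 (fst z)" "0 \<le> (1 - snd z) * g2 (fst z)" using that g by auto
    ultimately show ?thesis using that by (auto simp: K_def)
  qed
  have gc: "continuous_on A g1" "continuous_on A g2" for A unfolding g1_def g2_def by (intro continuous_intros)+
  have Kc: "continuous_map (prod_topology I01 I01) (prod_topology I01 I01) K"
  proof -
    have "continuous_on ({0..1} \<times> {0..1}) K"
      unfolding K_def by (intro continuous_intros continuous_on_compose2[OF gc(1)] continuous_on_compose2[OF gc(2)]) auto
    then show ?thesis
      using K01 by (auto simp: prod_topology_subtopology_eu continuous_map_in_subtopology mem_Times_iff)
  qed
  show "path_homotopic X p q"
    unfolding path_homotopic_iff
  proof (intro exI[of _ "h \<circ> K"] conjI ballI)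
    show "continuous_map (prod_topology I01 I01) X (h \<circ> K)" by (rule continuous_map_compose[OF Kc h(1)])
    fix x :: real assume x: "x \<in> {0..1}"
    show "(h \<circ> K) (0, x) = p x" using x h(2)[of "x/2"] by (auto simp: K_def g1_def g2_def l_def)
    have "(h \<circ> K) (1, x) = h (0, 1 - x / 2)" by (simp add: K_def g1_def g2_def)
    also have "\<dots> = l (1 - x / 2)" using x by (intro h(2)) auto
    also have "\<dots> = q x" using x pq(4) by (auto simp: l_def)
    finally show "(h \<circ> K) (1, x) = q x" .
    have "(h \<circ> K) (x, 0) = h (g1 x, g2 x)" by (simp add: K_def)
    also have "\<dots> = p 0"
    proof -
      consider "x \<le> 1/3" | "1/3 \<le> x" "x \<le> 2/3" | "2/3 \<le> x" by linarith
      then show ?thesis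
      proof cases
        case 1
        then have "g2 x = 0" by (simp add: g2_def)
        then show ?thesis using h(4)[OF g(1)] by simp
      next
        case 2
        then have "g1 x = 1" by (simp add: g1_def)
        then show ?thesis using h(3)[OF g(2)] by simp
      next
        case 3
        then have "g2 x = 1" by (simp add: g2_def)
        then show ?thesis using h(4)[OF g(1)] by simp
      qed
    qed
    finally show "(h \<circ> K) (x, 0) = p 0" .
    show "(h \<circ> K) (x, 1) = p 1" using h(2)[of "1/2"] by (simp add: K_def l_def)
  qed
qed

text \<open>A loop is pushed into whichever of the two sets contains its base point and is
  contracted there.\<close>

theorem paths_homotopic_space_Un:
  assumes S: "openin X S" and T: "openin X T" and ST: "S \<union> T = topspace X"
    and Ssc: "paths_homotopic_space (subtopology X S)" and Tsc: "paths_homotopic_space (subtopology X T)"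
    and conn: "path_connected_space (subtopology X (S \<inter> T))" and ne: "S \<inter> T \<noteq> {}"
  shows "paths_homotopic_space X"
proof (rule paths_homotopic_spaceI)
  have sub: "S \<subseteq> topspace X" "T \<subseteq> topspace X" using ST by auto
  have "path_connectedin X S" "path_connectedin X T"
    using Ssc Tsc sub by (auto simp: path_connectedin_def paths_homotopic_space_def)
  from path_connectedin_Un[OF this ne] have "path_connectedin X (topspace X)" using ST by simp
  then show "path_connected_space X" by (simp add: path_connectedin_topspace)
  fix p assume p: "pathin X p" "p 1 = p 0"
  have null: "path_homotopic X p (\<lambda>_. p 0)" if p': "path_homotopic X p p'" "p' ` {0..1} \<subseteq> V" and V: "paths_homotopic_space (subtopology X V)" for p' V
  proof -
    have 1: "pathin (subtopology X V) p'" using path_homotopic_pathin[OF p'(1)] p'(2) by (simp add: pathin_subtopology_iff)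
    have e: "p' 0 = p 0" "p' 1 = p 0" using path_homotopic_ends[OF p'(1)] p(2) by auto
    have "p 0 \<in> topspace (subtopology X V)"
      using continuous_map_image_subset_topspace[OF 1[unfolded pathin_def]] e by fastforce
    then have "pathin (subtopology X V) (\<lambda>_. p 0)" by (simp add: pathin_const)
    then have "path_homotopic (subtopology X V) p' (\<lambda>_. p 0)"
      using V 1 e unfolding paths_homotopic_space_def by simp
    then show ?thesis using path_homotopic_trans[OF p'(1)] path_homotopic_mono by blast
  qed
  have "p 0 \<in> topspace X" using continuous_map_image_subset_topspace[OF p(1)[unfolded pathin_def]] by fastforce
  then consider "p 0 \<in> S" | "p 0 \<in> T" using ST by blast
  then show "path_homotopic X p (\<lambda>_. p 0)"
  proof cases
    case 1
    then obtain p' where "path_homotopic X p p'" "p' ` {0..1} \<subseteq> S"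
      using path_homotopic_into_open[OF S T ST Tsc conn p(1)] p(2) by auto
    then show ?thesis using null Ssc by blast
  next
    case 2
    then obtain p' where "path_homotopic X p p'" "p' ` {0..1} \<subseteq> T"
      using path_homotopic_into_open[OF T S _ Ssc _ p(1)] p(2) ST conn by (auto simp: Un_commute Int_commute)
    then show ?thesis using null Tsc by blast
  qed
qed

text \<open>Each loop contracts to its base point, and the two constant loops are moved into each
  other along a path. The homotopy is free: only the equality of the end points is
  preserved.\<close>

lemma paths_homotopic_space_imp_simply_connected:
  assumes "paths_homotopic_space X" shows "simply_connected_space X"
  unfolding simply_connected_space_def
proof (intro allI impI)
  fix p q assume "loop_in X p \<and> loop_in X q"
  then have p: "pathin X p" "p 1 = p 0" and q: "pathin X q" "q 1 = q 0" by (auto simp: loop_in_def)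
  have null: "homotopic_with (\<lambda>r. r 1 = r 0) I01 X p (\<lambda>_. p 0)" if p: "pathin X p" "p 1 = p 0" for p
  proof -
    have "p 0 \<in> topspace X" using continuous_map_image_subset_topspace[OF p(1)[unfolded pathin_def]] by fastforce
    then have "path_homotopic X p (\<lambda>_. p 0)"
      using assms p by (simp add: paths_homotopic_space_def pathin_const)
    then show ?thesis unfolding path_homotopic_def
      by (rule homotopic_with_mono) (use p(2) in auto)
  qed
  have "p 0 \<in> topspace X" "q 0 \<in> topspace X"
    using continuous_map_image_subset_topspace[OF p(1)[unfolded pathin_def]] continuous_map_image_subset_topspace[OF q(1)[unfolded pathin_def]] by fastforce+
  then obtain r where r: "pathin X r" "r 0 = p 0" "r 1 = q 0"
    using assms unfolding paths_homotopic_space_def path_connected_space_def by fast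
  have "homotopic_with (\<lambda>r. r 1 = r 0) I01 X (\<lambda>_. p 0) (\<lambda>_. q 0)"
  proof (subst homotopic_with)
    have "continuous_map (prod_topology I01 I01) X (r \<circ> fst)"
      using continuous_map_compose[OF continuous_map_fst r(1)[unfolded pathin_def]] .
    then show "\<exists>h. continuous_map (prod_topology I01 I01) X h \<and> (\<forall>x\<in>topspace I01. h (0, x) = p 0) \<and>
         (\<forall>x\<in>topspace I01. h (1, x) = q 0) \<and> (\<forall>t\<in>{0..1}. h (t, 1) = h (t, 0))"
      using r by (intro exI[of _ "r \<circ> fst"]) auto
  qed auto
  then show "homotopic_with (\<lambda>r. r 1 = r 0) I01 X p q"
    by (rule homotopic_with_trans[OF homotopic_with_trans[OF null[OF p]] homotopic_with_symD[OF null[OF q]]])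
qed

lemma paths_homotopic_space_euclidean:
  fixes S :: "'a::real_normed_vector set"
  assumes S: "simply_connected S" shows "paths_homotopic_space (top_of_set S)"
proof -
  have "path_connected_space (top_of_set S)"
    using S simply_connected_imp_path_connected[of S] path_connectedin_euclidean[of S]
    by (simp add: path_connectedin_def del: path_connectedin_euclidean)
  moreover have "path_homotopic (top_of_set S) p q"
    if "pathin (top_of_set S) p" "pathin (top_of_set S) q" "p 0 = q 0" "p 1 = q 1" for p q
  proof -
    have "path p" "path q" "path_image p \<subseteq> S" "path_image q \<subseteq> S" "pathstart q = pathstart p" "pathfinish q = pathfinish p"
      using that by (auto simp: pathin_def path_def path_image_def pathstart_def pathfinish_def continuous_map_in_subtopology)
    then have "homotopic_paths S p q" using S unfolding simply_connected_eq_homotopic_paths by blast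
    then show ?thesis unfolding homotopic_paths_def path_homotopic_def pathstart_def pathfinish_def .
  qed
  ultimately show ?thesis unfolding paths_homotopic_space_def by blast
qed

lemma paths_homotopic_space_homeomorphic:
  assumes h: "homeomorphic_map X Y f" and Y: "paths_homotopic_space Y"
  shows "paths_homotopic_space X"
proof -
  obtain g where g: "homeomorphic_maps X Y f g" using h homeomorphic_map_maps by blast
  then have fg: "continuous_map X Y f" "continuous_map Y X g" "\<And>x. x \<in> topspace X \<Longrightarrow> g (f x) = x"
    by (auto simp: homeomorphic_maps_def)
  have "path_connected_space X"
    using homeomorphic_path_connected_space[of X Y] Y h homeomorphic_map_imp_homeomorphic_space
    unfolding paths_homotopic_space_def by blast
  moreover have "path_homotopic X p q" if pq: "pathin X p" "pathin X q" "p 0 = q 0" "p 1 = q 1" for p q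
  proof -
    have "pathin Y (f \<circ> p)" "pathin Y (f \<circ> q)" using pq fg(1) unfolding pathin_def by (blast intro: continuous_map_compose)+
    then have "path_homotopic Y (f \<circ> p) (f \<circ> q)" using Y pq(3,4) unfolding paths_homotopic_space_def by simp
    then obtain k where k: "continuous_map (prod_topology I01 I01) Y k"
     "\<forall>x\<in>{0..1}. k (0, x) = (f \<circ> p) x" "\<forall>x\<in>{0..1}. k (1, x) = (f \<circ> q) x"
     "\<forall>t\<in>{0..1}. k (t, 0) = (f \<circ> p) 0 \<and> k (t, 1) = (f \<circ> p) 1" unfolding path_homotopic_iff by blast
    have in_X: "p x \<in> topspace X" "q x \<in> topspace X" if "x \<in> {0..1}" for x
      using continuous_map_image_subset_topspace[OF pq(1)[unfolded pathin_def]] continuous_map_image_subset_topspace[OF pq(2)[unfolded pathin_def]] that by fastforce+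
    show ?thesis
      unfolding path_homotopic_iff
      by (rule exI[of _ "g \<circ> k"]) (use k in_X fg(3) continuous_map_compose[OF k(1) fg(2)] in auto)
  qed
  ultimately show ?thesis unfolding paths_homotopic_space_def by blast
qed

subsection \<open>Homology of unions\<close>

text \<open>By exactness the middle group is squeezed: it is the kernel of a map to a trivial group
  and also the image of a trivial group.\<close>

lemma trivial_group_exact_middle:
  assumes "exact_seq ([C, B, A], [g, f])" "trivial_group A" "trivial_group C"
  shows "trivial_group B"
proof -
  have h: "group A" "group B" "group C" "f \<in> hom A B" "g \<in> hom B C" "f ` carrier A = kernel B C g"
    using assms(1) by (auto simp: group_hom_def group_hom_axioms_def)
  interpret f: group_hom A B f by (rule group_hom.intro) (use h in \<open>simp_all add: group_hom_axioms_def\<close>)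
  interpret g: group_hom B C g by (rule group_hom.intro) (use h in \<open>simp_all add: group_hom_axioms_def\<close>)
  have "carrier B = {\<one>\<^bsub>B\<^esub>}"
    using g.kernel_to_trivial_group[OF assms(3)] f.image_from_trivial_group[OF assms(2)] h(6) by simp
  then show ?thesis using h(2) by (simp add: trivial_group_def)
qed

text \<open>What is excised is the complement of \<open>T\<close>. It is closed and, as the two sets
  cover the space, contained in the open set \<open>S\<close>.\<close>

lemma excision_open_cover:
  assumes S: "openin X S" and T: "openin X T" and ST: "S \<union> T = topspace X"
  shows "relative_homology_group p (subtopology X T) (S \<inter> T) \<cong> relative_homology_group p X S"
proof -
  have c: "Abstract_Topology.closure_of X (topspace X - T) = topspace X - T"
    using T by (simp add: closure_of_closedin openin_closedin_eq)
  have "Abstract_Topology.closure_of X (topspace X - T) \<subseteq> X interior_of S"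
    unfolding c interior_of_openin[OF S] using ST by blast
  moreover have "S \<subseteq> topspace X" using S by (rule openin_subset)
  ultimately have "hom_induced p (subtopology X (topspace X - (topspace X - T))) (S - (topspace X - T)) (subtopology X (topspace X)) S id
    \<in> iso (relative_homology_group p (subtopology X (topspace X - (topspace X - T))) (S - (topspace X - T)))
          (relative_homology_group p (subtopology X (topspace X)) S)"
    by (rule homology_excision_axiom)
  moreover have "topspace X - (topspace X - T) = T" "S - (topspace X - T) = S \<inter> T" using ST by auto
  ultimately show ?thesis using is_isoI by (simp add: subtopology_topspace) blast
qed

text \<open>A contractible intersection makes the homology of the pair
  \<open>(T, S \<inter> T)\<close> the reduced homology of \<open>T\<close>. Excision turns it into
  that of \<open>(X, S)\<close>, and \<open>X\<close> sits between this and \<open>S\<close> in the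
  exact sequence.\<close>

lemma trivial_reduced_homology_Un:
  assumes S: "openin X S" and T: "openin X T" and ST: "S \<union> T = topspace X" and ne: "S \<inter> T \<noteq> {}"
    and c: "contractible_space (subtopology X (S \<inter> T))"
    and tS: "trivial_group (reduced_homology_group p (subtopology X S))"
    and tT: "trivial_group (reduced_homology_group p (subtopology X T))"
  shows "trivial_group (reduced_homology_group p X)"
proof -
  have TX: "T \<inter> (S \<inter> T) = S \<inter> T" by blast
  have "relative_homology_group p (subtopology X T) (S \<inter> T) \<cong> reduced_homology_group p (subtopology X T)"
    using c ne ST by (intro isomorphic_relative_homology_by_contractible) (auto simp: subtopology_subtopology TX)
  from isomorphic_group_triviality[OF this group_relative_homology_group group_reduced_homology_group] tT
  have "trivial_group (relative_homology_group p (subtopology X T) (S \<inter> T))" by blast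
  then have "trivial_group (relative_homology_group p X S)"
    by (rule isomorphic_group_triviality1[OF excision_open_cover[OF S T ST] group_relative_homology_group])
  then show ?thesis by (rule trivial_group_exact_middle[OF homology_exactness_reduced_3 tS])
qed

text \<open>A connecting map of Mayer-Vietoris type. Since \<open>Y\<close> has no homology in the
  two adjacent degrees, \<open>X\<close> has the homology of the pair \<open>(X, Y)\<close>, by
  excision that of \<open>(N, Y \<inter> N)\<close>, and contractibility of \<open>N\<close> shifts
  the degree down by one.\<close>

lemma reduced_homology_Un_contractible:
  assumes Y: "openin X Y" and N: "openin X N" and YN: "Y \<union> N = topspace X" and ne: "Y \<inter> N \<noteq> {}"
    and c: "contractible_space (subtopology X N)"
    and t: "trivial_group (reduced_homology_group p (subtopology X Y))"
      "trivial_group (reduced_homology_group (p - 1) (subtopology X Y))"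
  shows "reduced_homology_group p X \<cong> reduced_homology_group (p - 1) (subtopology X (Y \<inter> N))"
proof -
  have NX: "N \<inter> (Y \<inter> N) = Y \<inter> N" by blast
  have "topspace X \<inter> Y \<noteq> {}" using ne YN by blast
  then have "exact_seq ([reduced_homology_group (p - 1) (subtopology X Y), relative_homology_group p X Y,
      reduced_homology_group p X, reduced_homology_group p (subtopology X Y)],
     [hom_boundary p X Y, hom_induced p X {} X Y id, hom_induced p (subtopology X Y) {} X {} id])"
    by (meson exact_seq_cons_iff homology_exactness_reduced_1 homology_exactness_reduced_3)
  then have "reduced_homology_group p X \<cong> relative_homology_group p X Y"
    by (intro is_isoI) (rule very_short_exact_sequence[OF _ t])
  also have "\<dots> \<cong> relative_homology_group p (subtopology X N) (Y \<inter> N)"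
    by (rule group.iso_sym[OF group_relative_homology_group excision_open_cover[OF Y N YN]])
  also have "\<dots> \<cong> reduced_homology_group (p - 1) (subtopology (subtopology X N) (Y \<inter> N))"
    using ne YN by (intro isomorphic_group_relative_homology_of_contractible[OF c]) auto
  finally show ?thesis by (simp add: subtopology_subtopology NX)
qed

lemma homeomorphic_sphere_nsphere:
  "top_of_set (sphere (0::'a::euclidean_space) 1) homeomorphic_space nsphere (DIM('a) - 1)"
proof -
  obtain f g where "homeomorphic_maps (nsphere (DIM('a) - 1)) (top_of_set (sphere 0 1 \<inter> span (Basis :: 'a set))) f g"
    by (rule homeomorphic_maps_nsphere_euclidean_sphere[OF independent_Basis orthogonal_Basis refl]) (auto simp: DIM_positive)
  then have "nsphere (DIM('a) - 1) homeomorphic_space top_of_set (sphere (0::'a) 1)"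
    unfolding homeomorphic_space_def by auto
  then show ?thesis by (rule homeomorphic_space_sym[THEN iffD1])
qed

text \<open>The complement of the point is homotopy equivalent to a sphere around it, which appears
  here as the relative frontier of a ball.\<close>

lemma reduced_homology_punctured:
  fixes a :: "'a::euclidean_space"
  shows "reduced_homology_group p (top_of_set (- {a})) \<cong> reduced_homology_group p (nsphere (DIM('a) - 1))"
proof -
  have "a \<in> rel_interior (cball a 1)" by (simp add: rel_interior_nonempty_interior)
  with homotopy_eqv_rel_frontier_punctured_affine_hull[of "cball a 1" a]
  have "rel_frontier (cball a 1) homotopy_eqv (affine hull cball a 1 - {a})" by simp
  moreover have "affine hull cball a 1 - {a} = - {a}"
    by (subst affine_hull_nonempty_interior) auto
  moreover have "rel_frontier (cball a 1) = sphere a 1" by simp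
  ultimately have "top_of_set (sphere a 1) homotopy_equivalent_space top_of_set (- {a})" by (simp only:)
  then have 1: "top_of_set (- {a}) homotopy_equivalent_space top_of_set (sphere a 1)"
    by (rule homotopy_equivalent_space_sym[THEN iffD1])
  have "top_of_set (sphere a 1) homeomorphic_space top_of_set (sphere (0::'a) 1)"
    by (simp add: homeomorphic_spheres)
  then have 2: "top_of_set (sphere a 1) homotopy_equivalent_space nsphere (DIM('a) - 1)"
    by (intro homeomorphic_imp_homotopy_equivalent_space homeomorphic_space_trans[OF _ homeomorphic_sphere_nsphere])
  show ?thesis
    by (rule iso_trans[OF homotopy_equivalent_space_imp_isomorphic_reduced_homology_groups[OF 1]
        homotopy_equivalent_space_imp_isomorphic_reduced_homology_groups[OF 2]])
qed

text \<open>Allows independence over the integers to be tested by arithmetic with the values of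
  \<open>h\<close>.\<close>

lemma hom_finprod_integer_group:
  fixes n :: "'a \<Rightarrow> int"
  assumes "comm_group G" and h: "h \<in> hom G integer_group" and S: "finite S" "S \<subseteq> carrier G"
  shows "h (finprod G (\<lambda>x. x [^]\<^bsub>G\<^esub> n x) S) = (\<Sum>x\<in>S. n x * h x)"
  using S
proof (induction S rule: finite_induct)
  interpret comm_group G by fact
  interpret group_hom G integer_group h by (rule group_hom.intro) (use h in \<open>simp_all add: group_hom_axioms_def\<close>)
  case empty
  then show ?case using hom_one by simp
next
  interpret comm_group G by fact
  interpret group_hom G integer_group h by (rule group_hom.intro) (use h in \<open>simp_all add: group_hom_axioms_def\<close>)
  case (insert x F)
  then have x: "x \<in> carrier G" and F: "(\<lambda>x. x [^]\<^bsub>G\<^esub> n x) \<in> F \<rightarrow> carrier G" by auto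
  have "h (x [^]\<^bsub>G\<^esub> n x) = n x * h x" using hom_int_pow[OF x] by simp
  moreover have "finprod G (\<lambda>x. x [^]\<^bsub>G\<^esub> n x) (insert x F) = x [^]\<^bsub>G\<^esub> n x \<otimes>\<^bsub>G\<^esub> finprod G (\<lambda>x. x [^]\<^bsub>G\<^esub> n x) F"
    by (rule finprod_insert) (use insert.hyps F x in auto)
  ultimately show ?case using insert x F by (simp add: finprod_closed)
qed

lemma abelian_rank_integer:
  assumes G: "comm_group G" and iso: "G \<cong> integer_group"
  shows "abelian_rank G = 1"
proof -
  obtain h where h: "h \<in> hom G integer_group" and b: "bij_betw h (carrier G) UNIV"
    using iso by (auto simp: is_iso_def iso_def)
  interpret comm_group G by fact
  interpret group_hom G integer_group h by (rule group_hom.intro) (use h in \<open>simp_all add: group_hom_axioms_def\<close>)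
  note hf = hom_finprod_integer_group[OF G h]
  have inj: "x = y" if "x \<in> carrier G" "y \<in> carrier G" "h x = h y" for x y
    using b that unfolding bij_betw_def by (blast dest: inj_onD)
  have upper: "card S \<le> 1" if S: "int_independent G S" for S
  proof -
    have fS: "finite S" and sS: "S \<subseteq> carrier G" using S by (auto simp: int_independent_def)
    have "x = y" if xy: "x \<in> S" "y \<in> S" for x y
    proof (rule ccontr)
      assume ne: "x \<noteq> y"
      \<comment> \<open>The trivial relation \<open>h y * h x - h x * h y = 0\<close>. Independence
        would make both coefficients 0, which contradicts injectivity of \<open>h\<close> on
        distinct elements.\<close>
      define n where "n z = (if z = x then h y else if z = y then - h x else 0)" for z
      have "(\<Sum>z\<in>S. n z * h z) = (\<Sum>z\<in>{x, y}. n z * h z)"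
        using fS xy by (intro sum.mono_neutral_right) (auto simp: n_def)
      also have "\<dots> = 0" using ne by (simp add: n_def)
      finally have "h (finprod G (\<lambda>x. x [^]\<^bsub>G\<^esub> n x) S) = h \<one>\<^bsub>G\<^esub>" using hf[OF fS sS] hom_one by simp
      moreover have "finprod G (\<lambda>x. x [^]\<^bsub>G\<^esub> n x) S \<in> carrier G" using sS by (intro finprod_closed) auto
      ultimately have "finprod G (\<lambda>x. x [^]\<^bsub>G\<^esub> n x) S = \<one>\<^bsub>G\<^esub>" by (intro inj) auto
      then have "n x = 0" "n y = 0" using S xy unfolding int_independent_def by blast+
      then have "h x = h y" using ne by (simp add: n_def)
      then show False using inj ne xy sS by blast
    qed
    then show ?thesis using card_le_Suc0_iff_eq[OF fS] by auto
  qed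
  have "1 \<in> h ` carrier G" using b by (simp add: bij_betw_def)
  then obtain g where g: "g \<in> carrier G" "h g = 1" by auto
  have "int_independent G {g}"
    unfolding int_independent_def
  proof (intro conjI allI impI ballI)
    fix n :: "'a \<Rightarrow> int" and x assume *: "finprod G (\<lambda>x. x [^]\<^bsub>G\<^esub> n x) {g} = \<one>\<^bsub>G\<^esub>" and x: "x \<in> {g}"
    have "h (finprod G (\<lambda>x. x [^]\<^bsub>G\<^esub> n x) {g}) = n g" using hf[of "{g}"] g by simp
    then show "n x = 0" unfolding * using hom_one x by simp
  qed (use g in auto)
  then have "enat (card {g}) \<le> abelian_rank G" unfolding abelian_rank_def by (intro SUP_upper) simp
  moreover have "abelian_rank G \<le> enat 1" unfolding abelian_rank_def using upper by (intro SUP_least) simp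
  ultimately show ?thesis by (simp add: one_enat_def)
qed

subsection \<open>Affine Killing fields\<close>

lemma second_difference_limit:
  fixes f :: "real^'n \<Rightarrow> real"
  assumes U: "open U" "p \<in> U" and f: "\<And>q. q \<in> U \<Longrightarrow> f differentiable (at q)"
    and d: "partial i f differentiable (at p)"
  shows "tendsto (\<lambda>h. (f (p + h *\<^sub>R axis i 1 + h *\<^sub>R axis j 1) - f (p + h *\<^sub>R axis i 1)
             - f (p + h *\<^sub>R axis j 1) + f p) / h\<^sup>2) (partial j (partial i f) p) (at_right 0)"
proof -
  let ?ei = "axis i 1 :: real^'n" and ?ej = "axis j 1 :: real^'n"
  define L where "L = frechet_derivative (partial i f) (at p)"
  have L: "(partial i f has_derivative L) (at p)"
    using d by (simp add: L_def frechet_derivative_works)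
  have lin: "linear L" using L by (rule has_derivative_linear)
  obtain r where r: "r > 0" "ball p r \<subseteq> U" using U open_contains_ball by blast
  show ?thesis
    unfolding tendsto_iff
  proof (intro allI impI)
    fix e :: real assume e: "e > 0"
    obtain d where d: "d > 0"
      "\<And>y. norm (y - p) < d \<Longrightarrow> norm (partial i f y - partial i f p - L (y - p)) \<le> (e/4) * norm (y - p)"
      using L e unfolding has_derivative_at_alt by (meson divide_pos_pos zero_less_numeral)
    \<comment> \<open>For \<open>h < m\<close> the corners of the square stay within
      \<open>2 * h\<close> of \<open>p\<close>, hence in the ball inside \<open>U\<close> and in the
      range of the derivative estimate.\<close>
    define m where "m = min d r / 3"
    have m: "m > 0" using d(1) r(1) by (simp add: m_def)
    have main: "dist ((f (p + h *\<^sub>R ?ei + h *\<^sub>R ?ej) - f (p + h *\<^sub>R ?ei) - f (p + h *\<^sub>R ?ej) + f p) / h\<^sup>2)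
            (partial j (partial i f) p) < e" if h: "0 < h" "h < m" for h
    proof -
      \<comment> \<open>The second difference is a first difference of \<phi>, to which the mean
        value theorem applies; the values of \<open>partial i f\<close> that appear are then
        expanded by its derivative at the single point \<open>p\<close>.\<close>
      define \<phi> where "\<phi> = (\<lambda>t. f (p + t *\<^sub>R ?ei + h *\<^sub>R ?ej) - f (p + t *\<^sub>R ?ei))"
      have n1: "norm (t *\<^sub>R ?ei + h *\<^sub>R ?ej) \<le> 2 * h" if "0 \<le> t" "t \<le> h" for t
      proof -
        have "norm (t *\<^sub>R ?ei + h *\<^sub>R ?ej) \<le> norm (t *\<^sub>R ?ei) + norm (h *\<^sub>R ?ej)" by (rule norm_triangle_ineq)
        also have "\<dots> \<le> 2 * h" using that h by (simp add: norm_axis_1)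
        finally show ?thesis .
      qed
      have n2: "norm (t *\<^sub>R ?ei) \<le> h" if "0 \<le> t" "t \<le> h" for t
        using that h by (simp add: norm_axis_1)
      have hm: "3 * h < d" "3 * h < r" using h by (auto simp: m_def)
      have inU: "p + t *\<^sub>R ?ei + h *\<^sub>R ?ej \<in> U" "p + t *\<^sub>R ?ei \<in> U" if "0 \<le> t" "t \<le> h" for t
      proof -
        have "dist p (p + (t *\<^sub>R ?ei + h *\<^sub>R ?ej)) = norm (t *\<^sub>R ?ei + h *\<^sub>R ?ej)"
          unfolding dist_commute[of p] by (simp add: dist_norm)
        then have "p + t *\<^sub>R ?ei + h *\<^sub>R ?ej \<in> ball p r"
          using n1[OF that] hm h unfolding mem_ball add.assoc by linarith
        then show "p + t *\<^sub>R ?ei + h *\<^sub>R ?ej \<in> U" using r by blast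
        have "p + t *\<^sub>R ?ei \<in> ball p r" 
          using n2[OF that] hm h by (simp add: dist_norm)
        then show "p + t *\<^sub>R ?ei \<in> U" using r by blast
      qed
      have D: "((\<lambda>t. f (c + t *\<^sub>R ?ei)) has_real_derivative partial i f (c + t *\<^sub>R ?ei)) (at t)"
        if "c + t *\<^sub>R ?ei \<in> U" for c t
      proof -
        have "(f has_derivative frechet_derivative f (at (c + t *\<^sub>R ?ei))) (at (c + t *\<^sub>R ?ei))"
          using f[OF that] by (simp add: frechet_derivative_works)
        then have "((\<lambda>t. f (c + t *\<^sub>R ?ei)) has_derivative (\<lambda>s. frechet_derivative f (at (c + t *\<^sub>R ?ei)) (s *\<^sub>R ?ei))) (at t)"
          by (rule has_derivative_compose[rotated]) (auto intro!: derivative_eq_intros)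
        moreover have lin: "linear (frechet_derivative f (at (c + t *\<^sub>R ?ei)))"
          using f[OF that] by (simp add: linear_frechet_derivative)
        have "(\<lambda>s. frechet_derivative f (at (c + t *\<^sub>R ?ei)) (s *\<^sub>R ?ei)) = (*) (partial i f (c + t *\<^sub>R ?ei))"
          unfolding partial_def by (rule ext) (simp only: linear_cmul[OF lin] real_scaleR_def mult.commute)
        ultimately show ?thesis unfolding has_field_derivative_def by simp
      qed
      have "\<exists>z. 0 < z \<and> z < h \<and> \<phi> h - \<phi> 0 = (h - 0) * (partial i f (p + z *\<^sub>R ?ei + h *\<^sub>R ?ej) - partial i f (p + z *\<^sub>R ?ei))"
      proof (rule MVT2)
        fix t assume t: "0 \<le> t" "t \<le> h"
        have "((\<lambda>t. f ((p + h *\<^sub>R ?ej) + t *\<^sub>R ?ei)) has_real_derivative partial i f ((p + h *\<^sub>R ?ej) + t *\<^sub>R ?ei)) (at t)"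
          using inU(1)[OF t] by (intro D) (simp add: algebra_simps)
        moreover have "((\<lambda>t. f (p + t *\<^sub>R ?ei)) has_real_derivative partial i f (p + t *\<^sub>R ?ei)) (at t)"
          using inU(2)[OF t] by (intro D)
        ultimately show "DERIV \<phi> t :> partial i f (p + t *\<^sub>R ?ei + h *\<^sub>R ?ej) - partial i f (p + t *\<^sub>R ?ei)"
          unfolding \<phi>_def by (auto intro!: derivative_eq_intros simp: algebra_simps)
      qed (use h in simp)
      then obtain z where z: "0 < z" "z < h"
        "\<phi> h - \<phi> 0 = h * (partial i f (p + z *\<^sub>R ?ei + h *\<^sub>R ?ej) - partial i f (p + z *\<^sub>R ?ei))" by auto
      define a where "a = partial i f (p + z *\<^sub>R ?ei + h *\<^sub>R ?ej) - partial i f p - L (z *\<^sub>R ?ei + h *\<^sub>R ?ej)"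
      define b where "b = partial i f (p + z *\<^sub>R ?ei) - partial i f p - L (z *\<^sub>R ?ei)"
      have na: "norm (z *\<^sub>R ?ei + h *\<^sub>R ?ej) < d" and nb: "norm (z *\<^sub>R ?ei) < d"
        using n1[of z] n2[of z] z hm h by linarith+
      have a1: "\<bar>a\<bar> \<le> (e/4) * norm (z *\<^sub>R ?ei + h *\<^sub>R ?ej)" 
        using d(2)[of "p + (z *\<^sub>R ?ei + h *\<^sub>R ?ej)"] na by (simp add: a_def add.assoc)
      also have "\<dots> \<le> (e/4) * (2*h)" using n1[of z] z e by (intro mult_left_mono) auto
      finally have a: "\<bar>a\<bar> \<le> (e/4) * (2*h)" .
      have "\<bar>b\<bar> \<le> (e/4) * norm (z *\<^sub>R ?ei)" 
        using d(2)[of "p + z *\<^sub>R ?ei"] nb by (simp add: b_def)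
      also have "\<dots> \<le> (e/4) * h" using n2[of z] z e by (intro mult_left_mono) auto
      finally have b: "\<bar>b\<bar> \<le> (e/4) * h" .
      have Lj: "L (z *\<^sub>R ?ei + h *\<^sub>R ?ej) - L (z *\<^sub>R ?ei) = h * L ?ej"
        using lin by (simp add: linear_add linear_cmul)
      have \<phi>_diff: "\<phi> h - \<phi> 0 = h * (h * L ?ej + a - b)"
        unfolding z(3) Lj[symmetric] a_def b_def by simp
      have num: "f (p + h *\<^sub>R ?ei + h *\<^sub>R ?ej) - f (p + h *\<^sub>R ?ei) - f (p + h *\<^sub>R ?ej) + f p = h * (h * L ?ej + a - b)"
        unfolding \<phi>_diff[symmetric] by (simp add: \<phi>_def)
      have eq: "(f (p + h *\<^sub>R ?ei + h *\<^sub>R ?ej) - f (p + h *\<^sub>R ?ei) - f (p + h *\<^sub>R ?ej) + f p) / h\<^sup>2 - L ?ej = (a - b) / h"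
        unfolding num using h by (simp add: field_simps power2_eq_square)
      have "(e/4) * (2*h) + (e/4) * h = 3/4 * (e * h)" by simp
      then have "\<bar>a - b\<bar> < e * h"
        using a b mult_pos_pos[OF e h(1)] abs_triangle_ineq4[of a b] by linarith
      then have "\<bar>(a - b) / h\<bar> < e"
        using h by (simp add: abs_divide pos_divide_less_eq)
      then show ?thesis
        unfolding dist_real_def partial_def[of j "partial i f"] L_def[symmetric] eq .
    qed
    show "\<forall>\<^sub>F h in at_right 0. dist ((f (p + h *\<^sub>R ?ei + h *\<^sub>R ?ej) - f (p + h *\<^sub>R ?ei) - f (p + h *\<^sub>R ?ej) + f p) / h\<^sup>2)
            (partial j (partial i f) p) < e"
      using eventually_at_right_real[OF m] by eventually_elim (use main in auto)
  qed
qed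

text \<open>The second difference quotient is symmetric in the two directions, hence so is its
  limit.\<close>

lemma partial_commute_real:
  fixes f :: "real^'n \<Rightarrow> real"
  assumes "open U" "p \<in> U" "\<And>q. q \<in> U \<Longrightarrow> f differentiable (at q)"
    and "partial i f differentiable (at p)" "partial j f differentiable (at p)"
  shows "partial j (partial i f) p = partial i (partial j f) p"
proof (rule tendsto_unique[OF trivial_limit_at_right_real])
  show "tendsto (\<lambda>h. (f (p + h *\<^sub>R axis i 1 + h *\<^sub>R axis j 1) - f (p + h *\<^sub>R axis i 1)
             - f (p + h *\<^sub>R axis j 1) + f p) / h\<^sup>2) (partial j (partial i f) p) (at_right 0)"
    using assms by (intro second_difference_limit)
  have eq: "(f (p + h *\<^sub>R axis i 1 + h *\<^sub>R axis j 1) - f (p + h *\<^sub>R axis i 1)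
             - f (p + h *\<^sub>R axis j 1) + f p) = (f (p + h *\<^sub>R axis j 1 + h *\<^sub>R axis i 1) - f (p + h *\<^sub>R axis j 1)
             - f (p + h *\<^sub>R axis i 1) + f p)" for h
    by (simp add: algebra_simps)
  show "tendsto (\<lambda>h. (f (p + h *\<^sub>R axis i 1 + h *\<^sub>R axis j 1) - f (p + h *\<^sub>R axis i 1)
             - f (p + h *\<^sub>R axis j 1) + f p) / h\<^sup>2) (partial i (partial j f) p) (at_right 0)"
    unfolding eq using assms by (intro second_difference_limit)
qed

lemma partial_nth:
  assumes "f differentiable (at p)"
  shows "partial i (\<lambda>q. f q $ k) p = partial i f p $ k"
proof -
  have "((\<lambda>q. f q $ k) has_derivative (\<lambda>v. frechet_derivative f (at p) v $ k)) (at p)"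
    using assms by (intro bounded_linear.has_derivative[OF bounded_linear_vec_nth]) (simp add: frechet_derivative_works)
  then show ?thesis unfolding partial_def by (simp add: frechet_derivative_at[symmetric])
qed

lemma differentiable_nth:
  fixes f :: "'a::real_normed_vector \<Rightarrow> real^'m"
  shows "f differentiable F \<Longrightarrow> (\<lambda>q. f q $ k) differentiable F"
  unfolding differentiable_def using bounded_linear.has_derivative[OF bounded_linear_vec_nth] by blast

lemma partial_cong:
  assumes "open U" "p \<in> U" "\<And>q. q \<in> U \<Longrightarrow> f q = g q"
  shows "partial i f p = partial i g p"
proof -
  have "(f has_derivative D) (at p) \<longleftrightarrow> (g has_derivative D) (at p)" for D
    using has_derivative_transform_within_open[OF _ assms(1,2), of f D UNIV g]
      has_derivative_transform_within_open[OF _ assms(1,2), of g D UNIV f] assms(3) by auto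
  then show ?thesis unfolding partial_def frechet_derivative_def by simp
qed

lemma partial_commute:
  fixes f :: "real^'n \<Rightarrow> real^'m"
  assumes "open U" "p \<in> U" "\<And>q. q \<in> U \<Longrightarrow> f differentiable (at q)"
    and "partial i f differentiable (at p)" "partial j f differentiable (at p)"
  shows "partial j (partial i f) p = partial i (partial j f) p"
proof (rule vec_eq_iff[THEN iffD2], rule allI)
  fix k
  have *: "partial l (partial m f) p $ k = partial l (partial m (\<lambda>q. f q $ k)) p"
    if "partial m f differentiable (at p)" for l m
  proof -
    have "partial l (partial m f) p $ k = partial l (\<lambda>q. partial m f q $ k) p"
      using that by (simp add: partial_nth)
    also have "\<dots> = partial l (partial m (\<lambda>q. f q $ k)) p"
      using assms(1,2) by (rule partial_cong) (simp add: partial_nth assms(3))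
    finally show ?thesis .
  qed
  have **: "partial m (\<lambda>q. f q $ k) differentiable (at p)" if dm: "partial m f differentiable (at p)" for m
  proof -
    obtain D where "((\<lambda>q. partial m f q $ k) has_derivative D) (at p)"
      using differentiable_nth[OF dm] unfolding differentiable_def by blast
    then have "(partial m (\<lambda>q. f q $ k) has_derivative D) (at p)"
      by (rule has_derivative_transform_within_open[OF _ assms(1,2)]) (simp add: partial_nth assms(3))
    then show ?thesis unfolding differentiable_def by blast
  qed
  show "partial j (partial i f) p $ k = partial i (partial j f) p $ k"
    unfolding *[OF assms(4)] *[OF assms(5)]
    using assms(1,2) by (rule partial_commute_real) (auto intro: differentiable_nth assms(3) ** assms(4,5))
qed

section \<open>The Killing equations as a linear system of second order\<close>

definition gam :: "real^6 \<Rightarrow> real^2 \<Rightarrow> real^2 \<Rightarrow> real^2" where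
  "gam C v w = (\<chi> k. \<Sum>i\<in>UNIV. \<Sum>j\<in>UNIV. coeff C i j k * v $ i * w $ j)"

definition D2 :: "(real^2 \<Rightarrow> real^2) \<Rightarrow> real^2 \<Rightarrow> real^2 \<Rightarrow> real^2 \<Rightarrow> real^2" where
  "D2 X p v w = (\<Sum>i\<in>UNIV. \<Sum>j\<in>UNIV. (v $ i * w $ j) *\<^sub>R partial i (partial j X) p)"

text \<open>The Lie derivative of the connection along \<open>X\<close>, a tensor in
  \<open>v\<close> and \<open>w\<close>. Its terms are the second derivative of \<open>X\<close>,
  the change of the factor \<open>1 / x^1\<close> along \<open>X\<close>, and the action of the
  Jacobian of \<open>X\<close> on the coefficients.\<close>

definition lie_conn :: "real^6 \<Rightarrow> (real^2 \<Rightarrow> real^2) \<Rightarrow> real^2 \<Rightarrow> real^2 \<Rightarrow> real^2 \<Rightarrow> real^2" where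
  "lie_conn C X p v w = D2 X p v w - (X p $ 1 / (p $ 1)^2) *\<^sub>R gam C v w
     + (1 / p $ 1) *\<^sub>R (gam C v (frechet_derivative X (at p) w) + gam C (frechet_derivative X (at p) v) w
         - frechet_derivative X (at p) (gam C v w))"

lemma open_half_plane: "open half_plane"
  unfolding half_plane_def by (rule open_halfspace_component_gt_cart)

lemma smooth_onD: "smooth_on U f \<Longrightarrow> p \<in> U \<Longrightarrow> f differentiable (at p)"
  unfolding smooth_on_def by (metis foldr.simps(1) id_apply)

lemma smooth_on_partial: "smooth_on U f \<Longrightarrow> smooth_on U (partial i f)"
  unfolding smooth_on_def
proof (intro allI ballI)
  fix "is" p assume "\<forall>is. \<forall>p\<in>U. foldr partial is f differentiable at p" "p \<in> U"
  then have "foldr partial (is @ [i]) f differentiable at p" by blast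
  then show "foldr partial is (partial i f) differentiable at p" by simp
qed

lemma frechet_eq:
  fixes X :: "real^'n \<Rightarrow> 'b::real_normed_vector"
  assumes "X differentiable (at p)"
  shows "frechet_derivative X (at p) v = (\<Sum>i\<in>UNIV. v $ i *\<^sub>R partial i X p)"
proof -
  have lin: "linear (frechet_derivative X (at p))" using assms by (rule linear_frechet_derivative)
  have "frechet_derivative X (at p) v = frechet_derivative X (at p) (\<Sum>i\<in>UNIV. v $ i *\<^sub>R axis i 1)"
    using basis_expansion[of v] by (simp add: scalar_mult_eq_scaleR)
  also have "\<dots> = (\<Sum>i\<in>UNIV. v $ i *\<^sub>R partial i X p)"
    unfolding partial_def by (simp add: linear_sum[OF lin] linear_cmul[OF lin])
  finally show ?thesis .
qed

lemma differentiable_has_derivative: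
  "X differentiable (at p) \<Longrightarrow> (X has_derivative frechet_derivative X (at p)) (at p)"
  by (simp add: frechet_derivative_works)

lemma gam_2: "gam C v w = vector
   [C$1 * v$1 * w$1 + C$3 * (v$1 * w$2 + v$2 * w$1) + C$5 * v$2 * w$2,
    C$2 * v$1 * w$1 + C$4 * (v$1 * w$2 + v$2 * w$1) + C$6 * v$2 * w$2]"
  by (simp add: gam_def vec_eq_iff forall_2 sum_2 coeff_def algebra_simps)

lemma bounded_bilinear_gam: "bounded_bilinear (gam C)"
  unfolding bilinear_conv_bounded_bilinear[symmetric] bilinear_def
  by (auto intro!: linearI simp: gam_2 vec_eq_iff forall_2 algebra_simps)

lemma covariant_eq:
  "Z differentiable (at p) \<Longrightarrow> covariant C Y Z p = (\<Sum>j\<in>UNIV. Y p $ j *\<^sub>R partial j Z p) + (1 / p $ 1) *\<^sub>R gam C (Y p) (Z p)"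
  unfolding covariant_def
  by (simp add: frechet_eq gam_def christoffel_def vec_eq_iff forall_2 sum_2 algebra_simps add_divide_distrib)

lemma has_derivative_directional:
  assumes Z: "smooth_on half_plane Z" and Y: "(Y has_derivative Y') (at p)" and p: "p \<in> half_plane"
  shows "((\<lambda>q. \<Sum>j\<in>UNIV. Y q $ j *\<^sub>R partial j Z q) has_derivative
           (\<lambda>v. frechet_derivative Z (at p) (Y' v) + D2 Z p v (Y p))) (at p)"
proof -
  have Yj: "((\<lambda>q. Y q $ j) has_derivative (\<lambda>v. Y' v $ j)) (at p)" for j
    using bounded_linear.has_derivative[OF bounded_linear_vec_nth Y] .
  have Zj: "(partial j Z has_derivative (\<lambda>v. \<Sum>i\<in>UNIV. v $ i *\<^sub>R partial i (partial j Z) p)) (at p)" for j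
    using differentiable_has_derivative[OF smooth_onD[OF smooth_on_partial[OF Z] p]]
    by (simp add: frechet_eq[OF smooth_onD[OF smooth_on_partial[OF Z] p], abs_def])
  show ?thesis
    by (rule has_derivative_eq_rhs[OF has_derivative_sum[OF has_derivative_scaleR[OF Yj Zj]]])
      (simp add: frechet_eq[OF smooth_onD[OF Z p]] D2_def sum_2 fun_eq_iff algebra_simps)
qed

lemma has_derivative_gam_over:
  assumes Y: "(Y has_derivative Y') (at p)" and Z: "(Z has_derivative Z') (at p)" and p: "p \<in> half_plane"
  shows "((\<lambda>q. (1 / q $ 1) *\<^sub>R gam C (Y q) (Z q)) has_derivative
     (\<lambda>v. (1 / p $ 1) *\<^sub>R (gam C (Y' v) (Z p) + gam C (Y p) (Z' v)) - (v $ 1 / (p $ 1)^2) *\<^sub>R gam C (Y p) (Z p))) (at p)"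
proof -
  have p1: "p $ 1 \<noteq> 0" using p by (simp add: half_plane_def)
  have 1: "((\<lambda>q. 1 / q $ 1) has_derivative (\<lambda>v. - (v $ 1 / (p $ 1)^2))) (at p)"
  proof -
    have "((\<lambda>q::real^2. q $ 1) has_derivative (\<lambda>v. v $ 1)) (at p)"
      using bounded_linear_imp_has_derivative[OF bounded_linear_vec_nth] .
    from has_derivative_divide'[OF has_derivative_const[of 1] this p1]
    show ?thesis by (simp add: power2_eq_square)
  qed
  show ?thesis
    by (rule has_derivative_eq_rhs[OF has_derivative_scaleR[OF 1 bounded_bilinear.FDERIV[OF bounded_bilinear_gam Y Z]]])
      (simp add: fun_eq_iff algebra_simps)
qed

lemma D2_commute:
  assumes "smooth_on half_plane Z" "p \<in> half_plane"
  shows "D2 Z p v w = D2 Z p w v"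
proof -
  have "partial i (partial j Z) p = partial j (partial i Z) p" for i j
    using assms by (intro partial_commute[OF open_half_plane] smooth_onD smooth_on_partial)
  then show ?thesis unfolding D2_def sum_2 by (simp add: algebra_simps)
qed

text \<open>All derivatives of \<open>Y\<close> and \<open>Z\<close> cancel, the second derivatives
  of \<open>Z\<close> by their symmetry, so that only the values at \<open>p\<close> remain.\<close>

lemma lie_conn_eq:
  assumes X: "smooth_on half_plane X" and Y: "smooth_on half_plane Y" and Z: "smooth_on half_plane Z"
    and p: "p \<in> half_plane"
  shows "lie_bracket X (covariant C Y Z) p
           - (covariant C Y (lie_bracket X Z) p + covariant C (lie_bracket X Y) Z p)
         = lie_conn C X p (Y p) (Z p)"
proof -
  let ?DX = "frechet_derivative X (at p)" and ?DY = "frechet_derivative Y (at p)" and ?DZ = "frechet_derivative Z (at p)"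
  note d = smooth_onD[OF X p] smooth_onD[OF Y p] smooth_onD[OF Z p]
  note hd = d[THEN differentiable_has_derivative]
  note lin = d[THEN linear_frechet_derivative]
  note open_half_plane p
  have 1: "((covariant C Y Z) has_derivative (\<lambda>v. (?DZ (?DY v) + D2 Z p v (Y p)) + 
       ((1 / p $ 1) *\<^sub>R (gam C (?DY v) (Z p) + gam C (Y p) (?DZ v)) - (v $ 1 / (p $ 1)^2) *\<^sub>R gam C (Y p) (Z p)))) (at p)"
    by (rule has_derivative_transform_within_open[OF has_derivative_add[OF has_derivative_directional[OF Z hd(2) p]
          has_derivative_gam_over[OF hd(2,3) p]] open_half_plane p])
      (simp add: covariant_eq smooth_onD[OF Z])
  have lb: "lie_bracket V W q = (\<Sum>j\<in>UNIV. V q $ j *\<^sub>R partial j W q) - (\<Sum>j\<in>UNIV. W q $ j *\<^sub>R partial j V q)"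
    if "smooth_on half_plane V" "smooth_on half_plane W" "q \<in> half_plane" for V W q
    unfolding lie_bracket_def using that by (simp add: frechet_eq smooth_onD)
  have 2: "((lie_bracket X Z) has_derivative (\<lambda>v. (?DZ (?DX v) + D2 Z p v (X p)) - (?DX (?DZ v) + D2 X p v (Z p)))) (at p)"
    by (rule has_derivative_transform_within_open[OF has_derivative_diff[OF has_derivative_directional[OF Z hd(1) p]
          has_derivative_directional[OF X hd(3) p]] open_half_plane p])
      (simp add: lb X Z)
  have cov: "covariant C V W p = frechet_derivative W (at p) (V p) + (1 / p $ 1) *\<^sub>R gam C (V p) (W p)" for V W
    unfolding covariant_def
    by (simp add: gam_def christoffel_def vec_eq_iff forall_2 sum_2 algebra_simps add_divide_distrib)
  interpret g: bounded_bilinear "gam C" by (rule bounded_bilinear_gam)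
  note f1 = frechet_derivative_at[OF 1, symmetric] and f2 = frechet_derivative_at[OF 2, symmetric]
  show ?thesis
    unfolding lie_bracket_def[of X "covariant C Y Z"] lie_bracket_def[of X Y] cov f1 f2 lie_conn_def
    unfolding cov lie_bracket_def[of X Z]
    by (simp add: linear_add[OF lin(1)] linear_add[OF lin(2)] linear_add[OF lin(3)]
      linear_diff[OF lin(1)] linear_diff[OF lin(2)] linear_diff[OF lin(3)]
      linear_cmul[OF lin(1)] linear_cmul[OF lin(2)] linear_cmul[OF lin(3)] 
      g.add_left g.add_right g.diff_left g.diff_right algebra_simps D2_commute[OF Z p, of "X p" "Y p"])
qed

lemma partial_const: "partial i (\<lambda>_. c) = (\<lambda>_. 0)"
  by (rule ext) (simp add: partial_def)

lemma smooth_on_const: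
  fixes U :: "(real^'n) set"
  shows "smooth_on U (\<lambda>_. c)"
  unfolding smooth_on_def
proof (intro allI ballI)
  fix "is" :: "'n list" and p :: "real^'n"
  have "\<exists>d. foldr partial is (\<lambda>_::real^'n. c) = (\<lambda>_. d)"
    by (induction "is") (auto simp: partial_const)
  then show "foldr partial is (\<lambda>_::real^'n. c) differentiable (at p)"
    by (metis differentiable_const)
qed

text \<open>Because the Lie derivative of the connection is a tensor, constant fields
  \<open>Y\<close> and \<open>Z\<close> already detect it.\<close>

lemma affine_killing_iff:
  "X \<in> affine_killing C \<longleftrightarrow> (\<forall>p. p \<notin> half_plane \<longrightarrow> X p = 0) \<and> smooth_on half_plane X \<and>
     (\<forall>p\<in>half_plane. \<forall>v w. lie_conn C X p v w = 0)"
proof safe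
  fix p v w
  assume X: "X \<in> affine_killing C" "p \<in> half_plane"
  then have "smooth_on half_plane X"
     "lie_bracket X (covariant C (\<lambda>_. v) (\<lambda>_. w)) p
                 = covariant C (\<lambda>_. v) (lie_bracket X (\<lambda>_. w)) p + covariant C (lie_bracket X (\<lambda>_. v)) (\<lambda>_. w) p"
    unfolding affine_killing_def using smooth_on_const by blast+
  then show "lie_conn C X p v w = 0"
    using lie_conn_eq[of X "\<lambda>_. v" "\<lambda>_. w" p C] X(2) smooth_on_const by auto
next
  assume *: "\<forall>p. p \<notin> half_plane \<longrightarrow> X p = 0" "smooth_on half_plane X"
    "\<forall>p\<in>half_plane. \<forall>v w. lie_conn C X p v w = 0"
  show "X \<in> affine_killing C"
    unfolding affine_killing_def
  proof (intro CollectI conjI allI impI ballI)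
    fix Y Z :: "real^2 \<Rightarrow> real^2" and p assume "smooth_on half_plane Y" "smooth_on half_plane Z" "p \<in> half_plane"
    then show "lie_bracket X (covariant C Y Z) p
                 = covariant C Y (lie_bracket X Z) p + covariant C (lie_bracket X Y) Z p"
      using lie_conn_eq[OF *(2), of Y Z p C] *(3) by simp
  qed (use * in auto)
qed (auto simp: affine_killing_def)

text \<open>Here \<open>f\<close> and \<open>g\<close> are the components of \<open>X\<close> and
  digits denote partial derivatives. All second derivatives are expressed by the 1-jet; the value of
  \<open>g\<close> does not occur because the Christoffel symbols do not depend on
  \<open>x^2\<close>.\<close>

definition killing_pde :: "real^6 \<Rightarrow> real \<Rightarrow> real \<Rightarrow> real \<Rightarrow> real \<Rightarrow> real \<Rightarrow> real \<Rightarrow> 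
    real \<Rightarrow> real \<Rightarrow> real \<Rightarrow> real \<Rightarrow> real \<Rightarrow> real \<Rightarrow> bool" where
  "killing_pde C x f f1 f2 g1 g2 f11 f12 f22 g11 g12 g22 \<longleftrightarrow>
     f11 = f * C$1 / x\<^sup>2 + (f1 * C$1 + f2 * C$2 - 2 * (C$1 * f1 + C$3 * g1)) / x \<and>
     g11 = f * C$2 / x\<^sup>2 + (g1 * C$1 + g2 * C$2 - 2 * (C$2 * f1 + C$4 * g1)) / x \<and>
     f12 = f * C$3 / x\<^sup>2 + (f1 * C$3 + f2 * C$4 - (C$1 * f2 + C$3 * g2) - (C$3 * f1 + C$5 * g1)) / x \<and>
     g12 = f * C$4 / x\<^sup>2 + (g1 * C$3 + g2 * C$4 - (C$2 * f2 + C$4 * g2) - (C$4 * f1 + C$6 * g1)) / x \<and>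
     f22 = f * C$5 / x\<^sup>2 + (f1 * C$5 + f2 * C$6 - 2 * (C$3 * f2 + C$5 * g2)) / x \<and>
     g22 = f * C$6 / x\<^sup>2 + (g1 * C$5 + g2 * C$6 - 2 * (C$4 * f2 + C$6 * g2)) / x"

lemma lie_conn_2:
  assumes "smooth_on half_plane X" "p \<in> half_plane"
  shows "lie_conn C X p v w = 
     (v$1 * w$1) *\<^sub>R partial 1 (partial 1 X) p + (v$1 * w$2 + v$2 * w$1) *\<^sub>R partial 1 (partial 2 X) p
     + (v$2 * w$2) *\<^sub>R partial 2 (partial 2 X) p - (X p $ 1 / (p $ 1)^2) *\<^sub>R gam C v w
     + (1 / p $ 1) *\<^sub>R (gam C v (w$1 *\<^sub>R partial 1 X p + w$2 *\<^sub>R partial 2 X p)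
        + gam C (v$1 *\<^sub>R partial 1 X p + v$2 *\<^sub>R partial 2 X p) w
         - (gam C v w $ 1 *\<^sub>R partial 1 X p + gam C v w $ 2 *\<^sub>R partial 2 X p))"
proof -
  have "partial 2 (partial 1 X) p = partial 1 (partial 2 X) p"
    using assms by (intro partial_commute[OF open_half_plane] smooth_onD smooth_on_partial)
  then have D2: "D2 X p v w = (v$1 * w$1) *\<^sub>R partial 1 (partial 1 X) p + (v$1 * w$2 + v$2 * w$1) *\<^sub>R partial 1 (partial 2 X) p
     + (v$2 * w$2) *\<^sub>R partial 2 (partial 2 X) p"
    by (simp add: D2_def sum_2 algebra_simps)
  show ?thesis
    unfolding lie_conn_def frechet_eq[OF smooth_onD[OF assms]] sum_2 D2 ..
qed

lemma lie_conn_nth: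
  assumes X: "smooth_on half_plane X" and p: "p \<in> half_plane"
  defines "x \<equiv> p $ 1" and "f \<equiv> X p $ 1" and "f1 \<equiv> partial 1 X p $ 1" and "f2 \<equiv> partial 2 X p $ 1"
    and "g1 \<equiv> partial 1 X p $ 2" and "g2 \<equiv> partial 2 X p $ 2"
  shows "lie_conn C X p v w $ 1 =
      v$1 * w$1 * (partial 1 (partial 1 X) p $ 1 - (f * C$1 / x\<^sup>2 + (f1 * C$1 + f2 * C$2 - 2 * (C$1 * f1 + C$3 * g1)) / x))
      + (v$1 * w$2 + v$2 * w$1) * (partial 1 (partial 2 X) p $ 1 - (f * C$3 / x\<^sup>2 + (f1 * C$3 + f2 * C$4 - (C$1 * f2 + C$3 * g2) - (C$3 * f1 + C$5 * g1)) / x))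
      + v$2 * w$2 * (partial 2 (partial 2 X) p $ 1 - (f * C$5 / x\<^sup>2 + (f1 * C$5 + f2 * C$6 - 2 * (C$3 * f2 + C$5 * g2)) / x))"
    and "lie_conn C X p v w $ 2 =
      v$1 * w$1 * (partial 1 (partial 1 X) p $ 2 - (f * C$2 / x\<^sup>2 + (g1 * C$1 + g2 * C$2 - 2 * (C$2 * f1 + C$4 * g1)) / x))
      + (v$1 * w$2 + v$2 * w$1) * (partial 1 (partial 2 X) p $ 2 - (f * C$4 / x\<^sup>2 + (g1 * C$3 + g2 * C$4 - (C$2 * f2 + C$4 * g2) - (C$4 * f1 + C$6 * g1)) / x))
      + v$2 * w$2 * (partial 2 (partial 2 X) p $ 2 - (f * C$6 / x\<^sup>2 + (g1 * C$5 + g2 * C$6 - 2 * (C$4 * f2 + C$6 * g2)) / x))"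
  unfolding lie_conn_2[OF X p] gam_2 x_def f_def f1_def f2_def g1_def g2_def
  unfolding vector_add_component vector_minus_component vector_scaleR_component vector_2 real_scaleR_def divide_inverse mult_1
  by (simp_all only: algebra_simps)

lemma lie_conn_zero_iff:
  assumes X: "smooth_on half_plane X" and p: "p \<in> half_plane"
  shows "(\<forall>v w. lie_conn C X p v w = 0) \<longleftrightarrow>
    killing_pde C (p$1) (X p$1) (partial 1 X p$1) (partial 2 X p$1) (partial 1 X p$2) (partial 2 X p$2)
      (partial 1 (partial 1 X) p$1) (partial 1 (partial 2 X) p$1) (partial 2 (partial 2 X) p$1)
      (partial 1 (partial 1 X) p$2) (partial 1 (partial 2 X) p$2) (partial 2 (partial 2 X) p$2)" (is "?l \<longleftrightarrow> ?r")
proof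
  assume ?l
  then have e: "lie_conn C X p (axis 1 1) (axis 1 1) $ k = 0" "lie_conn C X p (axis 1 1) (axis 2 1) $ k = 0"
    "lie_conn C X p (axis 2 1) (axis 2 1) $ k = 0" for k by simp_all
  have ax: "axis 1 1 $ 1 = (1::real)" "axis 1 1 $ (2::2) = (0::real)" "axis 2 1 $ (1::2) = (0::real)" "axis 2 1 $ 2 = (1::real)"
    by (simp_all add: axis_def)
  show ?r
    unfolding killing_pde_def
    using e(1)[of 1] e(1)[of 2] e(2)[of 1] e(2)[of 2] e(3)[of 1] e(3)[of 2]
    unfolding lie_conn_nth[OF X p] ax by simp
next
  assume ?r
  then show ?l
    unfolding killing_pde_def vec_eq_iff forall_2 lie_conn_nth[OF X p] by simp
qed

lemma affine_killing_pde:
  "X \<in> affine_killing C \<longleftrightarrow> (\<forall>p. p \<notin> half_plane \<longrightarrow> X p = 0) \<and> smooth_on half_plane X \<and>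
     (\<forall>p\<in>half_plane. killing_pde C (p$1) (X p$1) (partial 1 X p$1) (partial 2 X p$1) (partial 1 X p$2) (partial 2 X p$2)
      (partial 1 (partial 1 X) p$1) (partial 1 (partial 2 X) p$1) (partial 2 (partial 2 X) p$1)
      (partial 1 (partial 1 X) p$2) (partial 1 (partial 2 X) p$2) (partial 2 (partial 2 X) p$2))"
  unfolding affine_killing_iff using lie_conn_zero_iff by blast

section \<open>Explicit vector fields and their derivatives\<close>

inductive_set elementary :: "(real^2 \<Rightarrow> real) set" where
  const: "(\<lambda>_. c) \<in> elementary"
| coord: "(\<lambda>p. p $ i) \<in> elementary"
| powr: "(\<lambda>p. p $ 1 powr s) \<in> elementary"
| ln: "(\<lambda>p. ln (p $ 1)) \<in> elementary"
| add: "f \<in> elementary \<Longrightarrow> g \<in> elementary \<Longrightarrow> (\<lambda>p. f p + g p) \<in> elementary"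
| mult: "f \<in> elementary \<Longrightarrow> g \<in> elementary \<Longrightarrow> (\<lambda>p. f p * g p) \<in> elementary"

text \<open>Records the partial derivatives as explicit functions, so that they can be computed by
  rules and compared on the half-plane.\<close>

definition has_partials :: "(real^2 \<Rightarrow> real) \<Rightarrow> (real^2 \<Rightarrow> real) \<Rightarrow> (real^2 \<Rightarrow> real) \<Rightarrow> bool" where
  "has_partials f a b \<longleftrightarrow> (\<forall>p\<in>half_plane. (f has_derivative (\<lambda>v. v$1 * a p + v$2 * b p)) (at p))"

lemma nth_has_derivative: "((\<lambda>p. p $ i) has_derivative (\<lambda>v. v $ i)) F"
  by (rule bounded_linear_imp_has_derivative[OF bounded_linear_vec_nth])

lemma has_partials_const: "has_partials (\<lambda>_. c) (\<lambda>_. 0) (\<lambda>_. 0)"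
  by (simp add: has_partials_def)

lemma has_partials_coord: "has_partials (\<lambda>p. p $ 1) (\<lambda>_. 1) (\<lambda>_. 0)" "has_partials (\<lambda>p. p $ 2) (\<lambda>_. 0) (\<lambda>_. 1)"
  by (simp_all add: has_partials_def nth_has_derivative)

lemma has_partials_powr: "has_partials (\<lambda>p. p $ 1 powr s) (\<lambda>p. s * p $ 1 powr (s - 1)) (\<lambda>_. 0)"
  unfolding has_partials_def
proof
  fix p :: "real^2" assume "p \<in> half_plane"
  then have p: "0 < p $ 1" by (simp add: half_plane_def)
  show "((\<lambda>p. p $ 1 powr s) has_derivative (\<lambda>v. v$1 * (s * p $ 1 powr (s - 1)) + v$2 * 0)) (at p)"
    by (rule has_derivative_eq_rhs[OF has_derivative_powr[OF nth_has_derivative has_derivative_const p]])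
      (use p in \<open>auto simp: fun_eq_iff powr_diff\<close>)
qed

lemma has_partials_ln: "has_partials (\<lambda>p. ln (p $ 1)) (\<lambda>p. p $ 1 powr (-1)) (\<lambda>_. 0)"
  unfolding has_partials_def
proof
  fix p :: "real^2" assume "p \<in> half_plane"
  then have p: "0 < p $ 1" by (simp add: half_plane_def)
  show "((\<lambda>p. ln (p $ 1)) has_derivative (\<lambda>v. v$1 * p $ 1 powr (-1) + v$2 * 0)) (at p)"
    by (rule has_derivative_eq_rhs[OF has_derivative_ln[OF p nth_has_derivative]])
      (use p in \<open>auto simp: fun_eq_iff powr_minus\<close>)
qed

lemma has_partials_add:
  "has_partials f f1 f2 \<Longrightarrow> has_partials g g1 g2 \<Longrightarrow>
   has_partials (\<lambda>p. f p + g p) (\<lambda>p. f1 p + g1 p) (\<lambda>p. f2 p + g2 p)"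
  unfolding has_partials_def
  by (auto intro!: has_derivative_eq_rhs[OF has_derivative_add] simp: fun_eq_iff algebra_simps)

lemma has_partials_mult:
  "has_partials f f1 f2 \<Longrightarrow> has_partials g g1 g2 \<Longrightarrow>
   has_partials (\<lambda>p. f p * g p) (\<lambda>p. f p * g1 p + f1 p * g p) (\<lambda>p. f p * g2 p + f2 p * g p)"
  unfolding has_partials_def
  by (auto intro!: has_derivative_eq_rhs[OF has_derivative_mult] simp: fun_eq_iff algebra_simps)

lemmas has_partials_intros = has_partials_const has_partials_coord has_partials_powr has_partials_ln
  has_partials_add has_partials_mult

lemma elementary_has_partialsI:
  "has_partials f a b \<Longrightarrow> a \<in> elementary \<Longrightarrow> b \<in> elementary \<Longrightarrow> \<exists>a\<in>elementary. \<exists>b\<in>elementary. has_partials f a b"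
  by blast

lemma elementary_has_partials:
  "f \<in> elementary \<Longrightarrow> \<exists>a\<in>elementary. \<exists>b\<in>elementary. has_partials f a b"
proof (induction rule: elementary.induct)
  case (const c)
  show ?case using has_partials_const elementary.const by blast
next
  case (coord i)
  then show ?case using has_partials_coord elementary.const exhaust_2[of i] by metis
next
  case (powr s)
  show ?case
    by (rule elementary_has_partialsI[OF has_partials_powr]; intro elementary.intros)
next
  case ln
  show ?case by (rule elementary_has_partialsI[OF has_partials_ln]; intro elementary.intros)
next
  case (add f g)
  then obtain f1 f2 g1 g2 where d: "f1 \<in> elementary" "f2 \<in> elementary" "has_partials f f1 f2"
      "g1 \<in> elementary" "g2 \<in> elementary" "has_partials g g1 g2" by blast
  show ?case by (rule elementary_has_partialsI[OF has_partials_add[OF d(3,6)]]; intro elementary.intros d)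
next
  case (mult f g)
  then obtain f1 f2 g1 g2 where d: "f1 \<in> elementary" "f2 \<in> elementary" "has_partials f f1 f2"
      "g1 \<in> elementary" "g2 \<in> elementary" "has_partials g g1 g2" by blast
  show ?case by (rule elementary_has_partialsI[OF has_partials_mult[OF d(3,6)]]; intro elementary.intros d mult.hyps)
qed

lemma has_partials_vec:
  fixes X :: "real^2 \<Rightarrow> real^2"
  assumes X: "\<And>p. p \<in> half_plane \<Longrightarrow> X p = vector [f p, g p]"
    and f: "has_partials f f1 f2" and g: "has_partials g g1 g2" and p: "p \<in> half_plane"
  shows "X differentiable (at p)" "partial 1 X p = vector [f1 p, g1 p]" "partial 2 X p = vector [f2 p, g2 p]"
proof -
  have fg: "(f has_derivative (\<lambda>v. v$1 * f1 p + v$2 * f2 p)) (at p)" "(g has_derivative (\<lambda>v. v$1 * g1 p + v$2 * g2 p)) (at p)"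
    using f g p by (auto simp: has_partials_def)
  have ax: "vector [a, b] = a *\<^sub>R axis 1 1 + b *\<^sub>R (axis 2 1 :: real^2)" for a b
    by (simp add: vec_eq_iff forall_2 axis_def)
  have "((\<lambda>p. vector [f p, g p] :: real^2) has_derivative (\<lambda>v. vector [v$1 * f1 p + v$2 * f2 p, v$1 * g1 p + v$2 * g2 p])) (at p)"
    unfolding ax by (intro has_derivative_add has_derivative_scaleR_left fg)
  then have X': "(X has_derivative (\<lambda>v. vector [v$1 * f1 p + v$2 * f2 p, v$1 * g1 p + v$2 * g2 p])) (at p)"
    by (rule has_derivative_transform_within_open[OF _ open_half_plane p]) (simp add: X)
  show "X differentiable (at p)" using X' unfolding differentiable_def by blast
  show "partial 1 X p = vector [f1 p, g1 p]" "partial 2 X p = vector [f2 p, g2 p]"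
    unfolding partial_def frechet_derivative_at[OF X', symmetric] by (simp_all add: axis_def)
qed

text \<open>The class \<open>elementary\<close> is closed under partial derivatives on the
  half-plane, so every iterated derivative of \<open>X\<close> again has components in it.\<close>

lemma smooth_on_elementary:
  fixes X :: "real^2 \<Rightarrow> real^2"
  assumes "f \<in> elementary" "g \<in> elementary" "\<And>p. p \<in> half_plane \<Longrightarrow> X p = vector [f p, g p]"
  shows "smooth_on half_plane X"
proof -
  have *: "\<exists>f\<in>elementary. \<exists>g\<in>elementary. \<forall>p\<in>half_plane. foldr partial is X p = vector [f p, g p]" for "is"
  proof (induction "is")
    case Nil
    then show ?case using assms by auto
  next
    case (Cons i "is")
    then obtain f g where fg: "f \<in> elementary" "g \<in> elementary" "\<And>p. p \<in> half_plane \<Longrightarrow> foldr partial is X p = vector [f p, g p]"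
      by blast
    obtain f1 f2 g1 g2 where d: "f1 \<in> elementary" "f2 \<in> elementary" "has_partials f f1 f2"
      "g1 \<in> elementary" "g2 \<in> elementary" "has_partials g g1 g2"
      using elementary_has_partials[OF fg(1)] elementary_has_partials[OF fg(2)] by blast
    note v = has_partials_vec[OF fg(3) d(3,6)]
    show ?case
    proof (cases "i = 1")
      case True
      then show ?thesis using v(2) d(1,4) by auto
    next
      case False
      then have "i = 2" using exhaust_2[of i] by simp
      then show ?thesis using v(3) d(2,5) by auto
    qed
  qed
  show ?thesis
    unfolding smooth_on_def
  proof (intro allI ballI)
    fix "is" and p :: "real^2" assume p: "p \<in> half_plane"
    obtain f g where fg: "f \<in> elementary" "g \<in> elementary" "\<And>p. p \<in> half_plane \<Longrightarrow> foldr partial is X p = vector [f p, g p]"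
      using *[of "is"] by blast
    obtain f1 f2 g1 g2 where d: "has_partials f f1 f2" "has_partials g g1 g2"
      using elementary_has_partials[OF fg(1)] elementary_has_partials[OF fg(2)] by blast
    show "foldr partial is X differentiable at p"
      by (rule has_partials_vec(1)[OF fg(3) d p])
  qed
qed

lemma affine_killingI:
  assumes nice: "f \<in> elementary" "g \<in> elementary"
    and d1: "has_partials f f1 f2" "has_partials g g1 g2"
    and d2: "has_partials f1 f11 f21" "has_partials f2 f12 f22" "has_partials g1 g11 g21" "has_partials g2 g12 g22"
    and pde: "\<And>p. 0 < p$1 \<Longrightarrow> killing_pde C (p$1) (f p) (f1 p) (f2 p) (g1 p) (g2 p) (f11 p) (f12 p) (f22 p) (g11 p) (g12 p) (g22 p)"
  shows "(\<lambda>p. if p \<in> half_plane then vector [f p, g p] else 0) \<in> affine_killing C" (is "?X \<in> _")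
proof -
  have X: "?X p = vector [f p, g p]" if "p \<in> half_plane" for p using that by simp
  have 1: "partial 1 ?X p = vector [f1 p, g1 p]" "partial 2 ?X p = vector [f2 p, g2 p]" if "p \<in> half_plane" for p
    by (rule has_partials_vec(2,3)[OF _ d1 that]; simp)+
  have 2: "partial 1 (partial 1 ?X) p = vector [f11 p, g11 p]" "partial 1 (partial 2 ?X) p = vector [f12 p, g12 p]"
    "partial 2 (partial 2 ?X) p = vector [f22 p, g22 p]" if "p \<in> half_plane" for p
    by (rule has_partials_vec(2)[OF 1(1) d2(1,3) that] has_partials_vec(2)[OF 1(2) d2(2,4) that]
        has_partials_vec(3)[OF 1(2) d2(2,4) that]; simp)+
  show ?thesis
    unfolding affine_killing_pde
  proof (intro conjI ballI)
    show "smooth_on half_plane ?X" by (rule smooth_on_elementary[OF nice X])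
    fix p :: "real^2" assume p: "p \<in> half_plane"
    then show "killing_pde C (p$1) (?X p$1) (partial 1 ?X p$1) (partial 2 ?X p$1) (partial 1 ?X p$2) (partial 2 ?X p$2)
      (partial 1 (partial 1 ?X) p$1) (partial 1 (partial 2 ?X) p$1) (partial 2 (partial 2 ?X) p$1)
      (partial 1 (partial 1 ?X) p$2) (partial 1 (partial 2 ?X) p$2) (partial 2 (partial 2 ?X) p$2)"
      unfolding X[OF p] 1[OF p] 2[OF p] vector_2
      using pde[of p] by (simp add: half_plane_def)
  qed simp
qed

lemma smooth_has_partials:
  assumes "smooth_on half_plane X"
  shows "has_partials (\<lambda>p. X p $ k) (\<lambda>p. partial 1 X p $ k) (\<lambda>p. partial 2 X p $ k)"
  unfolding has_partials_def
proof
  fix p :: "real^2" assume p: "p \<in> half_plane"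
  have "((\<lambda>p. X p $ k) has_derivative (\<lambda>v. frechet_derivative X (at p) v $ k)) (at p)"
    by (rule bounded_linear.has_derivative[OF bounded_linear_vec_nth
      differentiable_has_derivative[OF smooth_onD[OF assms p]]])
  then show "((\<lambda>p. X p $ k) has_derivative (\<lambda>v. v$1 * partial 1 X p $ k + v$2 * partial 2 X p $ k)) (at p)"
    by (simp add: frechet_eq[OF smooth_onD[OF assms p]] sum_2)
qed

lemma has_partials_DERIV:
  assumes "has_partials f f1 f2" "p + t *\<^sub>R d \<in> half_plane"
  shows "((\<lambda>t. f (p + t *\<^sub>R d)) has_real_derivative (d$1 * f1 (p + t *\<^sub>R d) + d$2 * f2 (p + t *\<^sub>R d))) (at t)"
proof -
  let ?q = "p + t *\<^sub>R d"
  have "(f has_derivative (\<lambda>v. v$1 * f1 ?q + v$2 * f2 ?q)) (at ?q)"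
    using assms by (simp add: has_partials_def)
  then have "((\<lambda>t. f (p + t *\<^sub>R d)) has_derivative (\<lambda>s. (s *\<^sub>R d)$1 * f1 ?q + (s *\<^sub>R d)$2 * f2 ?q)) (at t)"
    by (rule has_derivative_compose[rotated]) (auto intro!: derivative_eq_intros)
  then show ?thesis
    unfolding has_field_derivative_def by (rule has_derivative_eq_rhs) (simp add: fun_eq_iff algebra_simps)
qed

lemma has_partials_cong:
  assumes "has_partials f a b" "\<And>p. 0 < p $ 1 \<Longrightarrow> f p = f' p" "\<And>p. 0 < p $ 1 \<Longrightarrow> a p = a' p" "\<And>p. 0 < p $ 1 \<Longrightarrow> b p = b' p"
  shows "has_partials f' a' b'"
  unfolding has_partials_def
proof
  fix p :: "real^2" assume p: "p \<in> half_plane"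
  have "(f has_derivative (\<lambda>v. v$1 * a' p + v$2 * b' p)) (at p)"
    using assms(1,3,4) p by (simp add: has_partials_def half_plane_def)
  then show "(f' has_derivative (\<lambda>v. v$1 * a' p + v$2 * b' p)) (at p)"
    by (rule has_derivative_transform_within_open[OF _ open_half_plane p]) (simp add: assms(2) half_plane_def)
qed

lemma has_partials_unique:
  assumes "has_partials f a b" "has_partials f' a' b'" "\<And>p. 0 < p $ 1 \<Longrightarrow> f p = f' p" "p \<in> half_plane"
  shows "a p = a' p" "b p = b' p"
proof -
  have "has_partials f' a b" by (rule has_partials_cong[OF assms(1,3)]) auto
  then have "(f' has_derivative (\<lambda>v. v$1 * a p + v$2 * b p)) (at p)"
     "(f' has_derivative (\<lambda>v. v$1 * a' p + v$2 * b' p)) (at p)"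
    using assms(2,4) by (auto simp: has_partials_def)
  then have eq: "(\<lambda>v::real^2. v$1 * a p + v$2 * b p) = (\<lambda>v. v$1 * a' p + v$2 * b' p)"
    by (rule has_derivative_unique)
  show "a p = a' p" using fun_cong[OF eq, of "axis 1 1"] by (simp add: axis_def)
  show "b p = b' p" using fun_cong[OF eq, of "axis 2 1"] by (simp add: axis_def)
qed

lemma has_partials_inverse: "has_partials (\<lambda>p. inverse (p $ 1)) (\<lambda>p. - (inverse (p $ 1))\<^sup>2) (\<lambda>_. 0)"
  unfolding has_partials_def
proof
  fix p :: "real^2" assume "p \<in> half_plane"
  then have p: "p $ 1 \<noteq> 0" by (simp add: half_plane_def)
  show "((\<lambda>p. inverse (p $ 1)) has_derivative (\<lambda>v. v$1 * - (inverse (p $ 1))\<^sup>2 + v$2 * 0)) (at p)"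
    by (rule has_derivative_eq_rhs[OF Deriv.has_derivative_inverse[OF p nth_has_derivative]])
      (simp add: fun_eq_iff power2_eq_square)
qed

lemma has_partials_cmult: "has_partials f a b \<Longrightarrow> has_partials (\<lambda>p. c * f p) (\<lambda>p. c * a p) (\<lambda>p. c * b p)"
  by (rule has_partials_cong[OF has_partials_mult[OF has_partials_const]]) auto

section \<open>Integrability conditions and the curvature\<close>

lemma has_partials_first_order:
  assumes f: "has_partials f f1 f2" "has_partials f1 f11 f12" "has_partials f2 f12 f22"
    and g: "has_partials g1 g11 g12" "has_partials g2 g12 g22"
  shows "has_partials (\<lambda>p. f p * a * (inverse (p$1))\<^sup>2 + (f1 p * b1 + f2 p * b2 + g1 p * b3 + g2 p * b4) * inverse (p$1))
   (\<lambda>p. f1 p * a * (inverse (p$1))\<^sup>2 - 2 * f p * a * (inverse (p$1))^3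
      + (f11 p * b1 + f12 p * b2 + g11 p * b3 + g12 p * b4) * inverse (p$1)
      - (f1 p * b1 + f2 p * b2 + g1 p * b3 + g2 p * b4) * (inverse (p$1))\<^sup>2)
   (\<lambda>p. f2 p * a * (inverse (p$1))\<^sup>2
      + (f12 p * b1 + f22 p * b2 + g12 p * b3 + g22 p * b4) * inverse (p$1))"
proof -
  note i = has_partials_inverse
  note m = has_partials_add[OF has_partials_mult[OF has_partials_cmult[OF f(1), of a] has_partials_mult[OF i i]] has_partials_mult[OF
     has_partials_add[OF has_partials_add[OF has_partials_add[OF has_partials_cmult[OF f(2), of b1]
     has_partials_cmult[OF f(3), of b2]] has_partials_cmult[OF g(1), of b3]] has_partials_cmult[OF g(2), of b4]] i]]
  show ?thesis
    by (rule has_partials_cong[OF m]) (simp_all add: power2_eq_square power3_eq_cube algebra_simps)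
qed

text \<open>Every entry of the 1-jet gets a fixed position, with explicit zeros, so that one
  differentiation rule and one estimate cover all six equations.\<close>

lemma killing_pde_linear:
  "killing_pde C x f f1 f2 g1 g2 f11 f12 f22 g11 g12 g22 \<longleftrightarrow>
     f11 = f * C$1 * (inverse x)\<^sup>2 + (f1 * (- C$1) + f2 * C$2 + g1 * (- 2 * C$3) + g2 * 0) * inverse x \<and>
     g11 = f * C$2 * (inverse x)\<^sup>2 + (f1 * (- 2 * C$2) + f2 * 0 + g1 * (C$1 - 2 * C$4) + g2 * C$2) * inverse x \<and>
     f12 = f * C$3 * (inverse x)\<^sup>2 + (f1 * 0 + f2 * (C$4 - C$1) + g1 * (- C$5) + g2 * (- C$3)) * inverse x \<and>
     g12 = f * C$4 * (inverse x)\<^sup>2 + (f1 * (- C$4) + f2 * (- C$2) + g1 * (C$3 - C$6) + g2 * 0) * inverse x \<and>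
     f22 = f * C$5 * (inverse x)\<^sup>2 + (f1 * C$5 + f2 * (C$6 - 2 * C$3) + g1 * 0 + g2 * (- 2 * C$5)) * inverse x \<and>
     g22 = f * C$6 * (inverse x)\<^sup>2 + (f1 * 0 + f2 * (- 2 * C$4) + g1 * C$5 + g2 * (- C$6)) * inverse x"
  unfolding killing_pde_def by (simp add: divide_inverse power_inverse algebra_simps)

text \<open>The right-hand sides are the differences of the two expressions for a mixed third
  derivative, with \<open>z\<close> standing for \<open>1 / x^1\<close>. Inserting the Killing
  equations for the second derivatives collects the result around the four entries of the
  curvature.\<close>

lemma curv_integrability:
  fixes z :: real
  assumes "f11 = f * c1 * z\<^sup>2 + (f1 * (- c1) + f2 * c2 + g1 * (- 2 * c3) + g2 * 0) * z"
    and "g11 = f * c2 * z\<^sup>2 + (f1 * (- 2 * c2) + f2 * 0 + g1 * (c1 - 2 * c4) + g2 * c2) * z"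
    and "f12 = f * c3 * z\<^sup>2 + (f1 * 0 + f2 * (c4 - c1) + g1 * (- c5) + g2 * (- c3)) * z"
    and "g12 = f * c4 * z\<^sup>2 + (f1 * (- c4) + f2 * (- c2) + g1 * (c3 - c6) + g2 * 0) * z"
    and "f22 = f * c5 * z\<^sup>2 + (f1 * c5 + f2 * (c6 - 2 * c3) + g1 * 0 + g2 * (- 2 * c5)) * z"
    and "g22 = f * c6 * z\<^sup>2 + (f1 * 0 + f2 * (- 2 * c4) + g1 * c5 + g2 * (- c6)) * z"
  shows "z\<^sup>2 * ((c1 * c5 + c3 * c6 - c3\<^sup>2 - c4 * c5 - c5) * g1 - f2 * (c2 * c3 + c4\<^sup>2 - c1 * c4 - c2 * c6 - c4) + (f1 + g2) * (c3 * c4 - c2 * c5 - c3) - 2 * f * (c3 * c4 - c2 * c5 - c3) * z) =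
      f2 * c1 * z\<^sup>2 + (f12 * (- c1) + f22 * c2 + g12 * (- 2 * c3) + g22 * 0) * z
      - (f1 * c3 * z\<^sup>2 - 2 * f * c3 * z^3 + (f11 * 0 + f12 * (c4 - c1) + g11 * (- c5) + g12 * (- c3)) * z - (f1 * 0 + f2 * (c4 - c1) + g1 * (- c5) + g2 * (- c3)) * z\<^sup>2)"
    and "z\<^sup>2 * ((c2 * c3 + c4\<^sup>2 - c1 * c4 - c2 * c6 - c4) * f1 + (c2 * c5 - c3 * c4 - c6) * g1 - g1 * (c3 * c4 - c2 * c5 - c3) - g2 * (c2 * c3 + c4\<^sup>2 - c1 * c4 - c2 * c6 - c4) + (f1 + g2) * (c2 * c3 + c4\<^sup>2 - c1 * c4 - c2 * c6 - c4) - 2 * f * (c2 * c3 + c4\<^sup>2 - c1 * c4 - c2 * c6 - c4) * z) =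
      f2 * c2 * z\<^sup>2 + (f12 * (- 2 * c2) + f22 * 0 + g12 * (c1 - 2 * c4) + g22 * c2) * z
      - (f1 * c4 * z\<^sup>2 - 2 * f * c4 * z^3 + (f11 * (- c4) + f12 * (- c2) + g11 * (c3 - c6) + g12 * 0) * z - (f1 * (- c4) + f2 * (- c2) + g1 * (c3 - c6) + g2 * 0) * z\<^sup>2)"
    and "z\<^sup>2 * ((c3 * c4 - c2 * c5 - c3) * f2 + (c1 * c5 + c3 * c6 - c3\<^sup>2 - c4 * c5 - c5) * g2 - f1 * (c1 * c5 + c3 * c6 - c3\<^sup>2 - c4 * c5 - c5) - f2 * (c2 * c5 - c3 * c4 - c6) + (f1 + g2) * (c1 * c5 + c3 * c6 - c3\<^sup>2 - c4 * c5 - c5) - 2 * f * (c1 * c5 + c3 * c6 - c3\<^sup>2 - c4 * c5 - c5) * z) =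
      f2 * c3 * z\<^sup>2 + (f12 * 0 + f22 * (c4 - c1) + g12 * (- c5) + g22 * (- c3)) * z
      - (f1 * c5 * z\<^sup>2 - 2 * f * c5 * z^3 + (f11 * c5 + f12 * (c6 - 2 * c3) + g11 * 0 + g12 * (- 2 * c5)) * z - (f1 * c5 + f2 * (c6 - 2 * c3) + g1 * 0 + g2 * (- 2 * c5)) * z\<^sup>2)"
    and "z\<^sup>2 * ((c2 * c3 + c4\<^sup>2 - c1 * c4 - c2 * c6 - c4) * f2 - g1 * (c1 * c5 + c3 * c6 - c3\<^sup>2 - c4 * c5 - c5) + (f1 + g2) * (c2 * c5 - c3 * c4 - c6) - 2 * f * (c2 * c5 - c3 * c4 - c6) * z) =
      f2 * c4 * z\<^sup>2 + (f12 * (- c4) + f22 * (- c2) + g12 * (c3 - c6) + g22 * 0) * z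
      - (f1 * c6 * z\<^sup>2 - 2 * f * c6 * z^3 + (f11 * 0 + f12 * (- 2 * c4) + g11 * c5 + g12 * (- c6)) * z - (f1 * 0 + f2 * (- 2 * c4) + g1 * c5 + g2 * (- c6)) * z\<^sup>2)"
  unfolding assms by (simp_all add: algebra_simps power2_eq_square power3_eq_cube)

text \<open>Row by row the matrix of the curvature operator of the two coordinate fields, multiplied
  by the square of \<open>x^1\<close>. Its trace is \<open>- (C$3 + C$6)\<close>.\<close>

definition curv :: "real^6 \<Rightarrow> real \<times> real \<times> real \<times> real" where
  "curv C = (C$3 * C$4 - C$2 * C$5 - C$3, C$1 * C$5 + C$3 * C$6 - (C$3)\<^sup>2 - C$4 * C$5 - C$5,
     C$2 * C$3 + (C$4)\<^sup>2 - C$1 * C$4 - C$2 * C$6 - C$4, C$2 * C$5 - C$3 * C$4 - C$6)"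

text \<open>With R the curvature matrix and A the Jacobian matrix of \<open>X\<close>, the four
  equations say that R A - A R + tr(A) R is \<open>2 * f * z\<close> times R. This is the vanishing
  of the Lie derivative of the curvature; it is obtained by equating mixed third derivatives of
  \<open>X\<close>.\<close>

lemma affine_killing_curv:
  assumes X: "X \<in> affine_killing C" and p: "p \<in> half_plane" and M: "curv C = (m1, m2, m3, m4)"
  defines "f \<equiv> X p $ 1" and "f1 \<equiv> partial 1 X p $ 1" and "f2 \<equiv> partial 2 X p $ 1"
    and "g1 \<equiv> partial 1 X p $ 2" and "g2 \<equiv> partial 2 X p $ 2" and "z \<equiv> inverse (p $ 1)"
  shows "m2 * g1 - f2 * m3 + (f1 + g2) * m1 = 2 * f * m1 * z"
    and "m1 * f2 + m2 * g2 - f1 * m2 - f2 * m4 + (f1 + g2) * m2 = 2 * f * m2 * z"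
    and "m3 * f1 + m4 * g1 - g1 * m1 - g2 * m3 + (f1 + g2) * m3 = 2 * f * m3 * z"
    and "m3 * f2 - g1 * m2 + (f1 + g2) * m4 = 2 * f * m4 * z"
proof -
  have sm: "smooth_on half_plane X" using X by (simp add: affine_killing_iff)
  note h1 = smooth_has_partials[OF sm] smooth_has_partials[OF smooth_on_partial[OF sm]]
  note h3 = smooth_has_partials[OF smooth_on_partial[OF smooth_on_partial[OF sm]]]
  have com: "partial 2 (partial 1 X) q = partial 1 (partial 2 X) q" if "q \<in> half_plane" for q
    using that sm by (intro partial_commute[OF open_half_plane] smooth_onD smooth_on_partial)
  have h2: "has_partials (\<lambda>p. partial 1 X p $ k) (\<lambda>p. partial 1 (partial 1 X) p $ k) (\<lambda>p. partial 1 (partial 2 X) p $ k)" for k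
    by (rule has_partials_cong[OF h1(2)]) (auto simp: com half_plane_def)
  have com3: "partial 2 (partial 1 (partial 1 X)) p = partial 1 (partial 1 (partial 2 X)) p"
     "partial 2 (partial 1 (partial 2 X)) p = partial 1 (partial 2 (partial 2 X)) p"
  proof -
    have "partial 2 (partial 1 (partial i X)) p = partial 1 (partial 2 (partial i X)) p" for i
      using p sm by (intro partial_commute[OF open_half_plane] smooth_onD smooth_on_partial)
    moreover have "partial 1 (partial 2 (partial 1 X)) p = partial 1 (partial 1 (partial 2 X)) p"
      using open_half_plane p by (rule partial_cong) (rule com)
    ultimately show "partial 2 (partial 1 (partial 1 X)) p = partial 1 (partial 1 (partial 2 X)) p"
     "partial 2 (partial 1 (partial 2 X)) p = partial 1 (partial 2 (partial 2 X)) p" by simp_all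
  qed
  have pde: "killing_pde C (p$1) (X p$1) (partial 1 X p$1) (partial 2 X p$1) (partial 1 X p$2) (partial 2 X p$2)
      (partial 1 (partial 1 X) p$1) (partial 1 (partial 2 X) p$1) (partial 2 (partial 2 X) p$1)
      (partial 1 (partial 1 X) p$2) (partial 1 (partial 2 X) p$2) (partial 2 (partial 2 X) p$2)" if "p \<in> half_plane" for p
    using X that by (simp add: affine_killing_pde)
  note P = pde[unfolded killing_pde_linear]
  note fo = has_partials_first_order[OF h1(1)[of 1] h2[of 1] h1(2)[of 2 1] h2[of 2] h1(2)[of 2 2]]
  have u11: "partial 2 (partial 1 (partial 1 X)) p $ 1 = f2 * C$1 * z\<^sup>2 
      + (partial 1 (partial 2 X) p $ 1 * (- C$1) + partial 2 (partial 2 X) p $ 1 * C$2 + partial 1 (partial 2 X) p $ 2 * (- 2 * C$3) + partial 2 (partial 2 X) p $ 2 * 0) * z"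
    unfolding f2_def z_def
    by (rule has_partials_unique(2)[OF h3 fo _ p]) (use P in \<open>simp add: half_plane_def\<close>)
  have u12: "partial 2 (partial 1 (partial 1 X)) p $ 2 = f2 * C$2 * z\<^sup>2 
      + (partial 1 (partial 2 X) p $ 1 * (- 2 * C$2) + partial 2 (partial 2 X) p $ 1 * 0 + partial 1 (partial 2 X) p $ 2 * (C$1 - 2 * C$4) + partial 2 (partial 2 X) p $ 2 * C$2) * z"
    unfolding f2_def z_def
    by (rule has_partials_unique(2)[OF h3 fo _ p]) (use P in \<open>simp add: half_plane_def\<close>)
  have v1: "partial 1 (partial 1 (partial 2 X)) p $ 1 = f1 * C$3 * z\<^sup>2 - 2 * f * C$3 * z^3
      + (partial 1 (partial 1 X) p $ 1 * 0 + partial 1 (partial 2 X) p $ 1 * (C$4 - C$1) + partial 1 (partial 1 X) p $ 2 * (- C$5) + partial 1 (partial 2 X) p $ 2 * (- C$3)) * z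
      - (f1 * 0 + f2 * (C$4 - C$1) + g1 * (- C$5) + g2 * (- C$3)) * z\<^sup>2"
    unfolding f_def f1_def f2_def g1_def g2_def z_def
    by (rule has_partials_unique(1)[OF h3 fo _ p]) (use P in \<open>simp add: half_plane_def\<close>)
  have v2: "partial 1 (partial 1 (partial 2 X)) p $ 2 = f1 * C$4 * z\<^sup>2 - 2 * f * C$4 * z^3
      + (partial 1 (partial 1 X) p $ 1 * (- C$4) + partial 1 (partial 2 X) p $ 1 * (- C$2) + partial 1 (partial 1 X) p $ 2 * (C$3 - C$6) + partial 1 (partial 2 X) p $ 2 * 0) * z
      - (f1 * (- C$4) + f2 * (- C$2) + g1 * (C$3 - C$6) + g2 * 0) * z\<^sup>2"
    unfolding f_def f1_def f2_def g1_def g2_def z_def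
    by (rule has_partials_unique(1)[OF h3 fo _ p]) (use P in \<open>simp add: half_plane_def\<close>)
  have v3: "partial 2 (partial 1 (partial 2 X)) p $ 1 = f2 * C$3 * z\<^sup>2
      + (partial 1 (partial 2 X) p $ 1 * 0 + partial 2 (partial 2 X) p $ 1 * (C$4 - C$1) + partial 1 (partial 2 X) p $ 2 * (- C$5) + partial 2 (partial 2 X) p $ 2 * (- C$3)) * z"
    unfolding f2_def z_def
    by (rule has_partials_unique(2)[OF h3 fo _ p]) (use P in \<open>simp add: half_plane_def\<close>)
  have v4: "partial 2 (partial 1 (partial 2 X)) p $ 2 = f2 * C$4 * z\<^sup>2
      + (partial 1 (partial 2 X) p $ 1 * (- C$4) + partial 2 (partial 2 X) p $ 1 * (- C$2) + partial 1 (partial 2 X) p $ 2 * (C$3 - C$6) + partial 2 (partial 2 X) p $ 2 * 0) * z"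
    unfolding f2_def z_def
    by (rule has_partials_unique(2)[OF h3 fo _ p]) (use P in \<open>simp add: half_plane_def\<close>)
  have w1: "partial 1 (partial 2 (partial 2 X)) p $ 1 = f1 * C$5 * z\<^sup>2 - 2 * f * C$5 * z^3
      + (partial 1 (partial 1 X) p $ 1 * C$5 + partial 1 (partial 2 X) p $ 1 * (C$6 - 2 * C$3) + partial 1 (partial 1 X) p $ 2 * 0 + partial 1 (partial 2 X) p $ 2 * (- 2 * C$5)) * z
      - (f1 * C$5 + f2 * (C$6 - 2 * C$3) + g1 * 0 + g2 * (- 2 * C$5)) * z\<^sup>2"
    unfolding f_def f1_def f2_def g1_def g2_def z_def
    by (rule has_partials_unique(1)[OF h3 fo _ p]) (use P in \<open>simp add: half_plane_def\<close>)
  have w2: "partial 1 (partial 2 (partial 2 X)) p $ 2 = f1 * C$6 * z\<^sup>2 - 2 * f * C$6 * z^3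
      + (partial 1 (partial 1 X) p $ 1 * 0 + partial 1 (partial 2 X) p $ 1 * (- 2 * C$4) + partial 1 (partial 1 X) p $ 2 * C$5 + partial 1 (partial 2 X) p $ 2 * (- C$6)) * z
      - (f1 * 0 + f2 * (- 2 * C$4) + g1 * C$5 + g2 * (- C$6)) * z\<^sup>2"
    unfolding f_def f1_def f2_def g1_def g2_def z_def
    by (rule has_partials_unique(1)[OF h3 fo _ p]) (use P in \<open>simp add: half_plane_def\<close>)
  have m: "m1 = C$3 * C$4 - C$2 * C$5 - C$3" "m2 = C$1 * C$5 + C$3 * C$6 - (C$3)\<^sup>2 - C$4 * C$5 - C$5"
     "m3 = C$2 * C$3 + (C$4)\<^sup>2 - C$1 * C$4 - C$2 * C$6 - C$4" "m4 = C$2 * C$5 - C$3 * C$4 - C$6"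
    using M by (auto simp: curv_def)
  note S = P[OF p, folded f_def f1_def f2_def g1_def g2_def z_def]
  note R = curv_integrability[OF S[THEN conjunct1] S[THEN conjunct2, THEN conjunct1] S[THEN conjunct2, THEN conjunct2, THEN conjunct1]
    S[THEN conjunct2, THEN conjunct2, THEN conjunct2, THEN conjunct1]
    S[THEN conjunct2, THEN conjunct2, THEN conjunct2, THEN conjunct2, THEN conjunct1]
    S[THEN conjunct2, THEN conjunct2, THEN conjunct2, THEN conjunct2, THEN conjunct2]]
  have z: "z \<noteq> 0" using p by (simp add: z_def half_plane_def)
  have cancel: "a = b" if "z\<^sup>2 * (a - b) = 0" for a b using that z by simp
  have "z\<^sup>2 * (m2 * g1 - f2 * m3 + (f1 + g2) * m1 - 2 * f * m1 * z) =
     partial 2 (partial 1 (partial 1 X)) p $ 1 - partial 1 (partial 1 (partial 2 X)) p $ 1"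
    unfolding u11 v1 m by (rule R(1))
  then show "m2 * g1 - f2 * m3 + (f1 + g2) * m1 = 2 * f * m1 * z"
    unfolding com3 diff_self by (rule cancel)
  have "z\<^sup>2 * (m3 * f1 + m4 * g1 - g1 * m1 - g2 * m3 + (f1 + g2) * m3 - 2 * f * m3 * z) =
     partial 2 (partial 1 (partial 1 X)) p $ 2 - partial 1 (partial 1 (partial 2 X)) p $ 2"
    unfolding u12 v2 m by (rule R(2))
  then show "m3 * f1 + m4 * g1 - g1 * m1 - g2 * m3 + (f1 + g2) * m3 = 2 * f * m3 * z"
    unfolding com3 diff_self by (rule cancel)
  have "z\<^sup>2 * (m1 * f2 + m2 * g2 - f1 * m2 - f2 * m4 + (f1 + g2) * m2 - 2 * f * m2 * z) =
     partial 2 (partial 1 (partial 2 X)) p $ 1 - partial 1 (partial 2 (partial 2 X)) p $ 1"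
    unfolding v3 w1 m by (rule R(3))
  then show "m1 * f2 + m2 * g2 - f1 * m2 - f2 * m4 + (f1 + g2) * m2 = 2 * f * m2 * z"
    unfolding com3 diff_self by (rule cancel)
  have "z\<^sup>2 * (m3 * f2 - g1 * m2 + (f1 + g2) * m4 - 2 * f * m4 * z) =
     partial 2 (partial 1 (partial 2 X)) p $ 2 - partial 1 (partial 2 (partial 2 X)) p $ 2"
    unfolding v4 w2 m by (rule R(4))
  then show "m3 * f2 - g1 * m2 + (f1 + g2) * m4 = 2 * f * m4 * z"
    unfolding com3 diff_self by (rule cancel)
qed

definition base_point :: "real^2" where "base_point = vector [1, 0]"

lemma base_point: "base_point \<in> half_plane" "base_point $ 1 = 1" "base_point $ 2 = 0"
  by (simp_all add: base_point_def half_plane_def)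

text \<open>A relation valid on the whole half-plane may be differentiated. At the base point
  \<open>x^1\<close> is 1 and the first component of \<open>X\<close> is 0, so on the right only the
  derivative of that component survives.\<close>

lemma diff_first_order_relation:
  assumes sm: "smooth_on half_plane X" and 0: "X base_point $ 1 = 0"
    and rel: "\<And>q. q \<in> half_plane \<Longrightarrow> b1 * partial 1 X q $ 1 + b2 * partial 2 X q $ 1
        + b3 * partial 1 X q $ 2 + b4 * partial 2 X q $ 2 = c * X q $ 1 * inverse (q $ 1)"
  defines "p \<equiv> base_point"
  shows "b1 * partial 1 (partial 1 X) p $ 1 + b2 * partial 1 (partial 2 X) p $ 1
        + b3 * partial 1 (partial 1 X) p $ 2 + b4 * partial 1 (partial 2 X) p $ 2 = c * partial 1 X p $ 1"
    and "b1 * partial 1 (partial 2 X) p $ 1 + b2 * partial 2 (partial 2 X) p $ 1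
        + b3 * partial 1 (partial 2 X) p $ 2 + b4 * partial 2 (partial 2 X) p $ 2 = c * partial 2 X p $ 1"
proof -
  note h1 = smooth_has_partials[OF sm] smooth_has_partials[OF smooth_on_partial[OF sm]]
  have com: "partial 2 (partial 1 X) q = partial 1 (partial 2 X) q" if "q \<in> half_plane" for q
    using that sm by (intro partial_commute[OF open_half_plane] smooth_onD smooth_on_partial)
  note l = has_partials_add[OF has_partials_add[OF has_partials_add[OF has_partials_cmult[OF h1(2)[of 1 1], of b1]
     has_partials_cmult[OF h1(2)[of 2 1], of b2]] has_partials_cmult[OF h1(2)[of 1 2], of b3]] has_partials_cmult[OF h1(2)[of 2 2], of b4]]
  note r = has_partials_mult[OF has_partials_cmult[OF h1(1)[of 1], of c] has_partials_inverse]
  have p: "p \<in> half_plane" "p $ 1 = 1" by (simp_all add: p_def base_point)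
  note u = has_partials_unique[OF l r _ p(1)]
  show "b1 * partial 1 (partial 1 X) p $ 1 + b2 * partial 1 (partial 2 X) p $ 1
        + b3 * partial 1 (partial 1 X) p $ 2 + b4 * partial 1 (partial 2 X) p $ 2 = c * partial 1 X p $ 1"
    using u(1) rel 0 p(2) by (simp add: half_plane_def p_def)
  show "b1 * partial 1 (partial 2 X) p $ 1 + b2 * partial 2 (partial 2 X) p $ 1
        + b3 * partial 1 (partial 2 X) p $ 2 + b4 * partial 2 (partial 2 X) p $ 2 = c * partial 2 X p $ 1"
    using u(2) rel 0 p com[OF p(1)] by (simp add: half_plane_def p_def)
qed

text \<open>Infinitesimally, an isotropic Killing field preserves the curvature; where that leaves two
  parameters, differentiating the invariance once more removes one of them.\<close>

lemma isotropy_line: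
  assumes M0: "curv C \<noteq> 0" and C0: "\<not> (C$3 = 0 \<and> C$5 = 0 \<and> C$6 = 0)"
  shows "\<exists>d1 d2 d3 d4. \<forall>X\<in>affine_killing C. X base_point $ 1 = 0 \<longrightarrow> (\<exists>l.
    partial 1 X base_point $ 1 = l * d1 \<and> partial 2 X base_point $ 1 = l * d2 \<and>
    partial 1 X base_point $ 2 = l * d3 \<and> partial 2 X base_point $ 2 = l * d4)"
proof -
  obtain m1 m2 m3 m4 where M: "curv C = (m1, m2, m3, m4)" by (metis surj_pair)
  have m: "m1 = C$3 * C$4 - C$2 * C$5 - C$3" "m2 = C$1 * C$5 + C$3 * C$6 - (C$3)\<^sup>2 - C$4 * C$5 - C$5"
     "m3 = C$2 * C$3 + (C$4)\<^sup>2 - C$1 * C$4 - C$2 * C$6 - C$4" "m4 = C$2 * C$5 - C$3 * C$4 - C$6"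
    using M by (auto simp: curv_def)
  have Mn: "\<not> (m1 = 0 \<and> m2 = 0 \<and> m3 = 0 \<and> m4 = 0)" using M0 M by (auto simp: zero_prod_def)
  have sm: "smooth_on half_plane X" if "X \<in> affine_killing C" for X
    using that by (simp add: affine_killing_iff)
  note K = affine_killing_curv[OF _ _ M]
  have K0: "m2 * partial 1 X base_point $ 2 - partial 2 X base_point $ 1 * m3 + (partial 1 X base_point $ 1 + partial 2 X base_point $ 2) * m1 = 0"
    "m1 * partial 2 X base_point $ 1 + m2 * partial 2 X base_point $ 2 - partial 1 X base_point $ 1 * m2 - partial 2 X base_point $ 1 * m4 + (partial 1 X base_point $ 1 + partial 2 X base_point $ 2) * m2 = 0"
    "m3 * partial 1 X base_point $ 1 + m4 * partial 1 X base_point $ 2 - partial 1 X base_point $ 2 * m1 - partial 2 X base_point $ 2 * m3 + (partial 1 X base_point $ 1 + partial 2 X base_point $ 2) * m3 = 0"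
    "m3 * partial 2 X base_point $ 1 - partial 1 X base_point $ 2 * m2 + (partial 1 X base_point $ 1 + partial 2 X base_point $ 2) * m4 = 0"
    if "X \<in> affine_killing C" "X base_point $ 1 = 0" for X
    using K[OF that(1) base_point(1)] that(2) by simp_all
  have pde: "partial 1 (partial 1 X) base_point $ 1 = partial 1 X base_point $ 1 * (- C$1) + partial 2 X base_point $ 1 * C$2 + partial 1 X base_point $ 2 * (- 2 * C$3)"
    "partial 1 (partial 2 X) base_point $ 1 = partial 2 X base_point $ 1 * (C$4 - C$1) + partial 1 X base_point $ 2 * (- C$5) + partial 2 X base_point $ 2 * (- C$3)"
    "partial 1 (partial 2 X) base_point $ 2 = partial 1 X base_point $ 1 * (- C$4) + partial 2 X base_point $ 1 * (- C$2) + partial 1 X base_point $ 2 * (C$3 - C$6)"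
    "partial 2 (partial 2 X) base_point $ 1 = partial 1 X base_point $ 1 * C$5 + partial 2 X base_point $ 1 * (C$6 - 2 * C$3) + partial 2 X base_point $ 2 * (- 2 * C$5)"
    "partial 2 (partial 2 X) base_point $ 2 = partial 2 X base_point $ 1 * (- 2 * C$4) + partial 1 X base_point $ 2 * C$5 + partial 2 X base_point $ 2 * (- C$6)"
    if "X \<in> affine_killing C" "X base_point $ 1 = 0" for X
    using that base_point(1) unfolding affine_killing_pde killing_pde_linear by (simp_all add: base_point)
  \<comment> \<open>The cases for the curvature matrix: nonscalar with nonzero trace or determinant,
    scalar, and nilpotent with vertical or with oblique kernel.\<close>
  consider (nonscalar) "m1 + m4 \<noteq> 0 \<or> m1 * m4 - m2 * m3 \<noteq> 0" "m1 \<noteq> m4 \<or> m2 \<noteq> 0 \<or> m3 \<noteq> 0"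
    | (scalar) "m1 = m4" "m2 = 0" "m3 = 0"
    | (vertical) "m4 = - m1" "m1 * m4 = m2 * m3" "m2 = 0"
    | (oblique) "m4 = - m1" "m1 * m4 = m2 * m3" "m2 \<noteq> 0"
    by argo
  then show ?thesis
  proof cases
    case nonscalar
    \<comment> \<open>The direction is twice the traceless part of the curvature matrix: a traceless
      matrix that commutes with a nonscalar 2 by 2 matrix is a multiple of this part.\<close>
    show ?thesis
    proof (rule exI[of _ "m1 - m4"], rule exI[of _ "2 * m2"], rule exI[of _ "2 * m3"], rule exI[of _ "m4 - m1"], intro ballI impI)
      fix X assume X: "X \<in> affine_killing C" "X base_point $ 1 = 0"
      define f1 f2 g1 g2 where "f1 = partial 1 X base_point $ 1" and "f2 = partial 2 X base_point $ 1"
        and "g1 = partial 1 X base_point $ 2" and "g2 = partial 2 X base_point $ 2"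
      note e = K0[OF X, folded f1_def f2_def g1_def g2_def]
      \<comment> \<open>Taking the trace of the curvature equation, directly or after multiplication
        by the curvature matrix, removes the commutator. What remains is the trace of the Jacobian
        times the trace of the curvature matrix or of its square, and one of these two factors is
        nonzero.\<close>
      have "(f1 + g2) * (m1 + m4) = 0" using e(1,4) by (simp add: algebra_simps)
      moreover have "(f1 + g2) * (m1 * m1 + 2 * (m2 * m3) + m4 * m4) = 0"
      proof -
        have "(f1 + g2) * (m1 * m1 + 2 * (m2 * m3) + m4 * m4) =
          m1 * (m2 * g1 - f2 * m3 + (f1 + g2) * m1) + m3 * (m1 * f2 + m2 * g2 - f1 * m2 - f2 * m4 + (f1 + g2) * m2)
          + m2 * (m3 * f1 + m4 * g1 - g1 * m1 - g2 * m3 + (f1 + g2) * m3) + m4 * (m3 * f2 - g1 * m2 + (f1 + g2) * m4)"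
          by (simp add: algebra_simps)
        then show ?thesis unfolding e by simp
      qed
      moreover have "m1 * m1 + 2 * (m2 * m3) + m4 * m4 = (m1 + m4)\<^sup>2 - 2 * (m1 * m4 - m2 * m3)"
        by (simp add: power2_eq_square algebra_simps)
      ultimately have tr: "g2 = - f1"
        using nonscalar(1) by (cases "m1 + m4 = 0") auto
      have e': "m2 * g1 = f2 * m3" "f2 * (m1 - m4) = 2 * f1 * m2" "g1 * (m1 - m4) = 2 * f1 * m3"
        using e(1-3) unfolding tr by (simp_all add: algebra_simps)
      have "\<exists>l. f1 = l * (m1 - m4) \<and> f2 = l * (2 * m2) \<and> g1 = l * (2 * m3) \<and> g2 = l * (m4 - m1)"
      proof (cases "m1 = m4")
        case False
        then show ?thesis using e' tr by (intro exI[of _ "f1 / (m1 - m4)"]) (simp add: field_simps)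
      next
        case True
        then have f1: "f1 = 0" using nonscalar(2) e'(2,3) by auto
        show ?thesis
        proof (cases "m2 = 0")
          case False
          then show ?thesis using e' tr f1 True by (intro exI[of _ "f2 / (2 * m2)"]) (simp add: field_simps)
        next
          case m2: True
          then have "m3 \<noteq> 0" using True nonscalar(2) by auto
          then show ?thesis using e' tr f1 True m2 by (intro exI[of _ "g1 / (2 * m3)"]) (simp add: field_simps)
        qed
      qed
      then show "\<exists>l. partial 1 X base_point $ 1 = l * (m1 - m4) \<and> partial 2 X base_point $ 1 = l * (2 * m2) \<and>
         partial 1 X base_point $ 2 = l * (2 * m3) \<and> partial 2 X base_point $ 2 = l * (m4 - m1)"
        unfolding f1_def f2_def g1_def g2_def .
    qed
  next
    case scalar
    have th: "C$3 + C$6 \<noteq> 0" and m1: "m1 \<noteq> 0" using scalar Mn m by auto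
    \<comment> \<open>A scalar curvature matrix only fixes the divergence of \<open>X\<close>, as
      \<open>2 * X^1 / x^1\<close> everywhere. Differentiating this identity and inserting the
      Killing equations makes the second row of the Jacobian \<open>k\<close> times the
      first.\<close>
    define k where "k = - (C$1 + C$4 + 2) / (C$3 + C$6)"
    show ?thesis
    proof (rule exI[of _ "- k"], rule exI[of _ "1"], rule exI[of _ "- (k * k)"], rule exI[of _ "k"], intro ballI impI)
      fix X assume X: "X \<in> affine_killing C" "X base_point $ 1 = 0"
      define f1 f2 g1 g2 where "f1 = partial 1 X base_point $ 1" and "f2 = partial 2 X base_point $ 1"
        and "g1 = partial 1 X base_point $ 2" and "g2 = partial 2 X base_point $ 2"
      have rel: "1 * partial 1 X q $ 1 + 0 * partial 2 X q $ 1 + 0 * partial 1 X q $ 2 + 1 * partial 2 X q $ 2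
        = 2 * X q $ 1 * inverse (q $ 1)" if "q \<in> half_plane" for q
      proof -
        have "m1 * (partial 1 X q $ 1 + partial 2 X q $ 2) = m1 * (2 * (X q $ 1 * inverse (q $ 1)))"
          using K(1)[OF X(1) that] unfolding scalar(2,3) by (simp add: algebra_simps)
        then show ?thesis using m1 by simp
      qed
      have tr: "g2 = - f1" using rel[OF base_point(1)] X(2) by (simp add: f1_def g2_def)
      note d = diff_first_order_relation[OF sm[OF X(1)] X(2) rel, simplified, unfolded pde[OF X], folded f1_def f2_def g1_def g2_def]
      have "(C$3 + C$6) * g1 = - (C$1 + C$4 + 2) * f1" "(C$3 + C$6) * g2 = - (C$1 + C$4 + 2) * f2"
        using d by (simp_all add: algebra_simps)
      then have g: "g1 = k * f1" "g2 = k * f2" using th by (simp_all add: k_def field_simps)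
      have f1: "f1 = - (k * f2)" using tr g(2) by simp
      have "f1 = f2 * (- k) \<and> f2 = f2 * 1 \<and> g1 = f2 * (- (k * k)) \<and> g2 = f2 * k"
        by (simp add: g f1 ac_simps)
      then show "\<exists>l. partial 1 X base_point $ 1 = l * (- k) \<and> partial 2 X base_point $ 1 = l * 1 \<and>
         partial 1 X base_point $ 2 = l * (- (k * k)) \<and> partial 2 X base_point $ 2 = l * k"
        unfolding f1_def f2_def g1_def g2_def by blast
    qed
  next
    case vertical
    have m': "m1 = 0" "m4 = 0" "m2 = 0" "m3 \<noteq> 0" using vertical Mn by auto
    have C6: "C$6 = - C$3" using m' m by simp
    have C35: "C$3 \<noteq> 0 \<or> C$5 \<noteq> 0" using C0 C6 by auto
    show ?thesis
    proof (rule exI[of _ "0"], rule exI[of _ "0"], rule exI[of _ "0"], rule exI[of _ "0"], intro ballI impI)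
      fix X assume X: "X \<in> affine_killing C" "X base_point $ 1 = 0"
      define f1 f2 g1 g2 where "f1 = partial 1 X base_point $ 1" and "f2 = partial 2 X base_point $ 1"
        and "g1 = partial 1 X base_point $ 2" and "g2 = partial 2 X base_point $ 2"
      \<comment> \<open>Here the curvature controls only the derivatives of the first component of
        \<open>X\<close>. Differentiating these relations and inserting the Killing equations forces
        the derivatives of the second component to vanish as well, so no isotropy remains.\<close>
      have rel1: "0 * partial 1 X q $ 1 + 1 * partial 2 X q $ 1 + 0 * partial 1 X q $ 2 + 0 * partial 2 X q $ 2
        = 0 * X q $ 1 * inverse (q $ 1)" if "q \<in> half_plane" for q
        using K(1)[OF X(1) that] m' by simp
      have rel2: "1 * partial 1 X q $ 1 + 0 * partial 2 X q $ 1 + 0 * partial 1 X q $ 2 + 0 * partial 2 X q $ 2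
        = 1 * X q $ 1 * inverse (q $ 1)" if "q \<in> half_plane" for q
      proof -
        have "m3 * (2 * partial 1 X q $ 1) = m3 * (2 * (X q $ 1 * inverse (q $ 1)))"
          using K(3)[OF X(1) that] m' by (simp add: algebra_simps)
        then show ?thesis using m'(4) by simp
      qed
      have f: "f1 = 0" "f2 = 0" using rel1[OF base_point(1)] rel2[OF base_point(1)] X(2) by (simp_all add: f1_def f2_def)
      note d = diff_first_order_relation[OF sm[OF X(1)] X(2) rel1, simplified, unfolded pde[OF X], folded f1_def f2_def g1_def g2_def]
       diff_first_order_relation(1)[OF sm[OF X(1)] X(2) rel2, simplified, unfolded pde[OF X], folded f1_def f2_def g1_def g2_def]
      have "C$3 * g1 = 0" "C$5 * g1 + C$3 * g2 = 0" "C$5 * g2 = 0"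
        using d f by (simp_all add: algebra_simps)
      then have "g1 = 0" "g2 = 0" using C35 by (auto; algebra)+
      then have "f1 = 0 * 0 \<and> f2 = 0 * 0 \<and> g1 = 0 * 0 \<and> g2 = 0 * (0::real)"
        using f by simp
      then show "\<exists>l. partial 1 X base_point $ 1 = l * 0 \<and> partial 2 X base_point $ 1 = l * 0 \<and>
         partial 1 X base_point $ 2 = l * 0 \<and> partial 2 X base_point $ 2 = l * 0"
        unfolding f1_def f2_def g1_def g2_def by blast
    qed
  next
    case oblique
    \<comment> \<open>The curvature matrix is nilpotent, and \<open>(1, w)\<close> spans both its
      kernel and its image.\<close>
    define w where "w = - m1 / m2"
    have m': "m1 = - (w * m2)" "m4 = w * m2" "m3 = - (w * w * m2)"
      using oblique by (auto simp: w_def field_simps)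
    show ?thesis
    proof (rule exI[of _ "- w"], rule exI[of _ "1"], rule exI[of _ "- w * w"], rule exI[of _ "w"], intro ballI impI)
      fix X assume X: "X \<in> affine_killing C" "X base_point $ 1 = 0"
      define f1 f2 g1 g2 where "f1 = partial 1 X base_point $ 1" and "f2 = partial 2 X base_point $ 1"
        and "g1 = partial 1 X base_point $ 2" and "g2 = partial 2 X base_point $ 2"
      have rel2: "0 * partial 1 X q $ 1 + (- w) * partial 2 X q $ 1 + 0 * partial 1 X q $ 2 + 1 * partial 2 X q $ 2
        = 1 * X q $ 1 * inverse (q $ 1)" if "q \<in> half_plane" for q
      proof -
        have "m2 * (2 * (partial 2 X q $ 2 - w * partial 2 X q $ 1)) = m2 * (2 * (X q $ 1 * inverse (q $ 1)))"
          using K(2)[OF X(1) that] unfolding m' by (simp add: algebra_simps)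
        then show ?thesis using oblique(3) by simp
      qed
      have rel1: "(- w) * partial 1 X q $ 1 + 0 * partial 2 X q $ 1 + 1 * partial 1 X q $ 2 + 0 * partial 2 X q $ 2
        = (- w) * X q $ 1 * inverse (q $ 1)" if "q \<in> half_plane" for q
      proof -
        have "m2 * (partial 1 X q $ 2 - w * partial 1 X q $ 1 - w * (partial 2 X q $ 2 - w * partial 2 X q $ 1))
            = m2 * (- 2 * w * (X q $ 1 * inverse (q $ 1)))"
          using K(1)[OF X(1) that] unfolding m' by (simp add: algebra_simps)
        then have "partial 1 X q $ 2 - w * partial 1 X q $ 1 - w * (partial 2 X q $ 2 - w * partial 2 X q $ 1)
            = - 2 * w * (X q $ 1 * inverse (q $ 1))" using oblique(3) by (metis mult_cancel_left)
        moreover have "partial 2 X q $ 2 - w * partial 2 X q $ 1 = X q $ 1 * inverse (q $ 1)"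
          using rel2[OF that] by simp
        ultimately show ?thesis by (simp add: algebra_simps)
      qed
      have f: "g1 = w * f1" "g2 = w * f2"
        using rel1[OF base_point(1)] rel2[OF base_point(1)] X(2) by (simp_all add: f1_def f2_def g1_def g2_def)
      \<comment> \<open>The two relations give both partial derivatives of
        \<open>X^2 - w * X^1\<close>; its mixed derivative, computed in both orders, yields the
        equation.\<close>
      have "f1 = - w * f2"
        using diff_first_order_relation(1)[OF sm[OF X(1)] X(2) rel2] diff_first_order_relation(2)[OF sm[OF X(1)] X(2) rel1]
        by (simp add: f1_def f2_def)
      then have "f1 = f2 * (- w) \<and> f2 = f2 * 1 \<and> g1 = f2 * (- w * w) \<and> g2 = f2 * w"
        by (simp add: f ac_simps)
      then show "\<exists>l. partial 1 X base_point $ 1 = l * (- w) \<and> partial 2 X base_point $ 1 = l * 1 \<and>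
         partial 1 X base_point $ 2 = l * (- w * w) \<and> partial 2 X base_point $ 2 = l * w"
        unfolding f1_def f2_def g1_def g2_def by blast
    qed
  qed
qed

section \<open>Killing fields are determined by their 1-jet at a point\<close>

lemma Gronwall_zero:
  fixes \<phi> :: "real \<Rightarrow> real"
  assumes d: "\<And>t. 0 \<le> t \<Longrightarrow> t \<le> 1 \<Longrightarrow> (\<phi> has_real_derivative \<phi>' t) (at t)"
    and le: "\<And>t. 0 \<le> t \<Longrightarrow> t \<le> 1 \<Longrightarrow> \<phi>' t \<le> K * \<phi> t" and 0: "\<phi> 0 = 0"
  shows "\<phi> 1 \<le> 0"
proof -
  have "\<phi> 1 * exp (- K * 1) \<le> \<phi> 0 * exp (- K * 0)"
  proof (rule DERIV_nonpos_imp_nonincreasing[of 0 1])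
    fix t :: real assume t: "0 \<le> t" "t \<le> 1"
    have "((\<lambda>t. \<phi> t * exp (- K * t)) has_real_derivative (\<phi>' t - K * \<phi> t) * exp (- K * t)) (at t)"
      by (rule derivative_eq_intros d[OF t] refl)+ (simp add: algebra_simps)
    then show "\<exists>y. ((\<lambda>t. \<phi> t * exp (- K * t)) has_real_derivative y) (at t) \<and> y \<le> 0"
      using le[OF t] by (intro exI conjI) (auto simp: mult_le_0_iff)
  qed simp
  then show ?thesis using 0 by (simp add: mult_le_0_iff)
qed

text \<open>The constant \<open>3 * N\<close> is large enough for coefficients such as
  \<open>C$1 - 2 * C$4\<close>, whose terms are bounded by \<open>N\<close>.\<close>

lemma first_order_bound:
  fixes z :: real
  assumes "\<bar>a\<bar> \<le> 3 * N" "\<bar>b1\<bar> \<le> 3 * N" "\<bar>b2\<bar> \<le> 3 * N" "\<bar>b3\<bar> \<le> 3 * N" "\<bar>b4\<bar> \<le> 3 * N" "\<bar>z\<bar> \<le> N" "1 \<le> N"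
  shows "\<bar>f * a * z\<^sup>2 + (f1 * b1 + f2 * b2 + g1 * b3 + g2 * b4) * z\<bar> \<le> 3 * N^3 * (\<bar>f\<bar> + \<bar>f1\<bar> + \<bar>f2\<bar> + \<bar>g1\<bar> + \<bar>g2\<bar>)"
proof -
  have 1: "\<bar>f * a * z\<^sup>2\<bar> \<le> \<bar>f\<bar> * (3 * N^3)"
  proof -
    have "\<bar>a\<bar> * \<bar>z\<bar>\<^sup>2 \<le> (3 * N) * N\<^sup>2" using assms by (intro mult_mono power_mono) auto
    then have "\<bar>f\<bar> * (\<bar>a\<bar> * \<bar>z\<bar>\<^sup>2) \<le> \<bar>f\<bar> * ((3 * N) * N\<^sup>2)" by (rule mult_left_mono) simp
    then show ?thesis by (simp only: abs_mult power2_eq_square power3_eq_cube mult.assoc)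
  qed
  have 2: "\<bar>u * b * z\<bar> \<le> \<bar>u\<bar> * (3 * N^3)" if "\<bar>b\<bar> \<le> 3 * N" for u b
  proof -
    have "\<bar>b\<bar> * \<bar>z\<bar> \<le> (3 * N) * N" using assms that by (intro mult_mono) auto
    also have "\<dots> * 1 \<le> (3 * N) * N * N" by (rule mult_left_mono) (use assms(7) in auto)
    finally have "\<bar>u\<bar> * (\<bar>b\<bar> * \<bar>z\<bar>) \<le> \<bar>u\<bar> * ((3 * N) * N * N)" by (intro mult_left_mono) simp_all
    then show ?thesis by (simp only: abs_mult power3_eq_cube mult.assoc)
  qed
  have "f * a * z\<^sup>2 + (f1 * b1 + f2 * b2 + g1 * b3 + g2 * b4) * z = f * a * z\<^sup>2 + f1 * b1 * z + f2 * b2 * z + g1 * b3 * z + g2 * b4 * z"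
    by (simp add: algebra_simps)
  moreover have "\<bar>f * a * z\<^sup>2 + f1 * b1 * z + f2 * b2 * z + g1 * b3 * z + g2 * b4 * z\<bar>
     \<le> \<bar>f\<bar> * (3 * N^3) + \<bar>f1\<bar> * (3 * N^3) + \<bar>f2\<bar> * (3 * N^3) + \<bar>g1\<bar> * (3 * N^3) + \<bar>g2\<bar> * (3 * N^3)"
    by (intro order_trans[OF abs_triangle_ineq add_mono] 1 2 assms)
  ultimately show ?thesis by (simp only: distrib_left distrib_right mult.commute mult.left_commute)
qed

text \<open>Cauchy-Schwarz against the vector of ones: the difference of the two sides is the sum of
  the squares of all pairwise differences.\<close>

lemma sum6_square_le:
  fixes a :: real
  shows "(a + b + c + d + e + f)\<^sup>2 \<le> 6 * (a\<^sup>2 + b\<^sup>2 + c\<^sup>2 + d\<^sup>2 + e\<^sup>2 + f\<^sup>2)"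
proof -
  have "6 * (a\<^sup>2 + b\<^sup>2 + c\<^sup>2 + d\<^sup>2 + e\<^sup>2 + f\<^sup>2) - (a + b + c + d + e + f)\<^sup>2
    = (a-b)\<^sup>2 + (a-c)\<^sup>2 + (a-d)\<^sup>2 + (a-e)\<^sup>2 + (a-f)\<^sup>2 + (b-c)\<^sup>2 + (b-d)\<^sup>2 + (b-e)\<^sup>2 + (b-f)\<^sup>2
      + (c-d)\<^sup>2 + (c-e)\<^sup>2 + (c-f)\<^sup>2 + (d-e)\<^sup>2 + (d-f)\<^sup>2 + (e-f)\<^sup>2"
    by (simp add: power2_eq_square algebra_simps)
  also have "\<dots> \<ge> 0" by (intro add_nonneg_nonneg) simp_all
  finally show ?thesis by simp
qed

text \<open>A Killing field solves a linear ODE for its 1-jet along every segment.\<close>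

lemma affine_killing_eq_0:
  assumes X: "X \<in> affine_killing C"
    and jet: "X base_point = 0" "partial 1 X base_point = 0" "partial 2 X base_point = 0"
  shows "X = (\<lambda>_. 0)"
proof
  fix p
  show "X p = 0"
  proof (cases "p \<in> half_plane")
    case False
    then show ?thesis using X by (simp add: affine_killing_def)
  next
    case True
    define d where "d = p - base_point"
    define q where "q t = base_point + t *\<^sub>R d" for t
    have sm: "smooth_on half_plane X" using X by (simp add: affine_killing_iff)
    note h1 = smooth_has_partials[OF sm] smooth_has_partials[OF smooth_on_partial[OF sm]]
    have com: "partial 2 (partial 1 X) q = partial 1 (partial 2 X) q" if "q \<in> half_plane" for q
      using that sm by (intro partial_commute[OF open_half_plane] smooth_onD smooth_on_partial)
    have P: "killing_pde C (p$1) (X p$1) (partial 1 X p$1) (partial 2 X p$1) (partial 1 X p$2) (partial 2 X p$2)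
      (partial 1 (partial 1 X) p$1) (partial 1 (partial 2 X) p$1) (partial 2 (partial 2 X) p$1)
      (partial 1 (partial 1 X) p$2) (partial 1 (partial 2 X) p$2) (partial 2 (partial 2 X) p$2)" if "p \<in> half_plane" for p
      using X that by (simp add: affine_killing_pde)
    \<comment> \<open>A lower bound for \<open>x^1\<close> along the segment from the base point to
      \<open>p\<close>, which bounds the factors \<open>1 / x^1\<close>.\<close>
    define m where "m = min 1 (p $ 1)"
    have m: "0 < m" using True by (simp add: m_def half_plane_def)
    have q1: "m \<le> q t $ 1" if "0 \<le> t" "t \<le> 1" for t
    proof -
      have "q t $ 1 = (1 - t) * 1 + t * p $ 1" by (simp add: q_def d_def base_point algebra_simps)
      moreover have "(1 - t) * m + t * m \<le> (1 - t) * 1 + t * p $ 1"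
        using that by (intro add_mono mult_left_mono) (auto simp: m_def)
      ultimately show ?thesis by (simp add: algebra_simps)
    qed
    have qH: "q t \<in> half_plane" if "0 \<le> t" "t \<le> 1" for t
      using q1[OF that] m by (simp add: half_plane_def)
    define N where "N = 1 + \<bar>d$1\<bar> + \<bar>d$2\<bar> + \<bar>C$1\<bar> + \<bar>C$2\<bar> + \<bar>C$3\<bar> + \<bar>C$4\<bar> + \<bar>C$5\<bar> + \<bar>C$6\<bar> + inverse m"
    have N: "1 \<le> N" "\<bar>d$1\<bar> \<le> N" "\<bar>d$2\<bar> \<le> N" "\<bar>C$1\<bar> \<le> N" "\<bar>C$2\<bar> \<le> N" "\<bar>C$3\<bar> \<le> N" "\<bar>C$4\<bar> \<le> N" "\<bar>C$5\<bar> \<le> N" "\<bar>C$6\<bar> \<le> N" "inverse m \<le> N"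
      using m by (auto simp: N_def)
    have zN: "\<bar>inverse (q t $ 1)\<bar> \<le> N" if "0 \<le> t" "t \<le> 1" for t
    proof -
      have "0 \<le> inverse (q t $ 1)" using q1[OF that] m by simp
      then show ?thesis using N(10) le_imp_inverse_le[OF q1[OF that] m] by linarith
    qed
    define f f1 f2 g g1 g2 where "f t = X (q t) $ 1" and "f1 t = partial 1 X (q t) $ 1" and "f2 t = partial 2 X (q t) $ 1"
      and "g t = X (q t) $ 2" and "g1 t = partial 1 X (q t) $ 2" and "g2 t = partial 2 X (q t) $ 2" for t
    define s where "s t = \<bar>f t\<bar> + \<bar>f1 t\<bar> + \<bar>f2 t\<bar> + \<bar>g t\<bar> + \<bar>g1 t\<bar> + \<bar>g2 t\<bar>" for t
    \<comment> \<open>Each derivative along the segment has two terms, a component of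
      \<open>d\<close> bounded by \<open>N\<close> times a partial derivative bounded by
      \<open>3 * N^3 * s t\<close>.\<close>
    define B where "B = 6 * N^4"
    have B1: "N * (2 * (3 * N^3)) = B" by (simp add: B_def power_numeral_reduce)
    have comb: "\<bar>d$1 * u + d$2 * v\<bar> \<le> B * r" if "\<bar>u\<bar> \<le> 3 * N^3 * r" "\<bar>v\<bar> \<le> 3 * N^3 * r" for u v r
    proof -
      have "\<bar>d$1 * u + d$2 * v\<bar> \<le> \<bar>d$1\<bar> * \<bar>u\<bar> + \<bar>d$2\<bar> * \<bar>v\<bar>" by (metis abs_mult abs_triangle_ineq)
      also have "\<dots> \<le> N * (3 * N^3 * r) + N * (3 * N^3 * r)" using that N(1-3) by (intro add_mono mult_mono) auto
      also have "\<dots> = N * (2 * (3 * N^3)) * r" by simp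
      finally show ?thesis unfolding B1 .
    qed
    have N3: "1 * 1 \<le> 3 * N^3" using one_le_power[OF N(1), of 3] by linarith
    have DX: "((\<lambda>t. X (q t) $ k) has_real_derivative (d$1 * partial 1 X (q t) $ k + d$2 * partial 2 X (q t) $ k)) (at t)"
      and D1: "((\<lambda>t. partial 1 X (q t) $ k) has_real_derivative (d$1 * partial 1 (partial 1 X) (q t) $ k + d$2 * partial 1 (partial 2 X) (q t) $ k)) (at t)"
      and D2: "((\<lambda>t. partial 2 X (q t) $ k) has_real_derivative (d$1 * partial 1 (partial 2 X) (q t) $ k + d$2 * partial 2 (partial 2 X) (q t) $ k)) (at t)"
      if "0 \<le> t" "t \<le> 1" for t k
      using has_partials_DERIV[OF h1(1) qH[OF that, unfolded q_def], of k]
        has_partials_DERIV[OF h1(2) qH[OF that, unfolded q_def], of 1 k]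
        has_partials_DERIV[OF h1(2) qH[OF that, unfolded q_def], of 2 k] com[OF qH[OF that]]
      unfolding q_def by simp_all
    have pos: "\<bar>c\<bar> \<le> 3 * N" and neg: "\<bar>- c\<bar> \<le> 3 * N" and neg2: "\<bar>- 2 * c\<bar> \<le> 3 * N" if "\<bar>c\<bar> \<le> N" for c
      using that by linarith+
    have dif: "\<bar>c - c'\<bar> \<le> 3 * N" and dif2: "\<bar>c - 2 * c'\<bar> \<le> 3 * N" if "\<bar>c\<bar> \<le> N" "\<bar>c'\<bar> \<le> N" for c c'
      using that by linarith+
    have z0: "\<bar>0\<bar> \<le> 3 * N" using N(1) by simp
    have sec: "\<bar>partial 1 (partial 1 X) (q t) $ 1\<bar> \<le> 3 * N^3 * s t" "\<bar>partial 1 (partial 1 X) (q t) $ 2\<bar> \<le> 3 * N^3 * s t"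
      "\<bar>partial 1 (partial 2 X) (q t) $ 1\<bar> \<le> 3 * N^3 * s t" "\<bar>partial 1 (partial 2 X) (q t) $ 2\<bar> \<le> 3 * N^3 * s t"
      "\<bar>partial 2 (partial 2 X) (q t) $ 1\<bar> \<le> 3 * N^3 * s t" "\<bar>partial 2 (partial 2 X) (q t) $ 2\<bar> \<le> 3 * N^3 * s t"
      if t: "0 \<le> t" "t \<le> 1" for t
    proof -
      note S = P[OF qH[OF t], unfolded killing_pde_linear]
      have le: "3 * N^3 * (\<bar>f t\<bar> + \<bar>f1 t\<bar> + \<bar>f2 t\<bar> + \<bar>g1 t\<bar> + \<bar>g2 t\<bar>) \<le> 3 * N^3 * s t"
        using N3 N(1) by (intro mult_left_mono) (auto simp: s_def)
      note b = order_trans[OF first_order_bound[OF _ _ _ _ _ zN[OF t] N(1)] le[unfolded f_def f1_def f2_def g1_def g2_def]]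
      show "\<bar>partial 1 (partial 1 X) (q t) $ 1\<bar> \<le> 3 * N^3 * s t"
        unfolding S[THEN conjunct1] by (rule b; rule z0 dif2 dif neg2 neg pos; (rule N)+)
      show "\<bar>partial 1 (partial 1 X) (q t) $ 2\<bar> \<le> 3 * N^3 * s t"
        unfolding S[THEN conjunct2, THEN conjunct1] by (rule b; rule z0 dif2 dif neg2 neg pos; (rule N)+)
      show "\<bar>partial 1 (partial 2 X) (q t) $ 1\<bar> \<le> 3 * N^3 * s t"
        unfolding S[THEN conjunct2, THEN conjunct2, THEN conjunct1] by (rule b; rule z0 dif2 dif neg2 neg pos; (rule N)+)
      show "\<bar>partial 1 (partial 2 X) (q t) $ 2\<bar> \<le> 3 * N^3 * s t"
        unfolding S[THEN conjunct2, THEN conjunct2, THEN conjunct2, THEN conjunct1] by (rule b; rule z0 dif2 dif neg2 neg pos; (rule N)+)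
      show "\<bar>partial 2 (partial 2 X) (q t) $ 1\<bar> \<le> 3 * N^3 * s t"
        unfolding S[THEN conjunct2, THEN conjunct2, THEN conjunct2, THEN conjunct2, THEN conjunct1] by (rule b; rule z0 dif2 dif neg2 neg pos; (rule N)+)
      show "\<bar>partial 2 (partial 2 X) (q t) $ 2\<bar> \<le> 3 * N^3 * s t"
        unfolding S[THEN conjunct2, THEN conjunct2, THEN conjunct2, THEN conjunct2, THEN conjunct2] by (rule b; rule z0 dif2 dif neg2 neg pos; (rule N)+)
    qed
    have fst: "\<bar>f1 t\<bar> \<le> 3 * N^3 * s t" "\<bar>f2 t\<bar> \<le> 3 * N^3 * s t" "\<bar>g1 t\<bar> \<le> 3 * N^3 * s t" "\<bar>g2 t\<bar> \<le> 3 * N^3 * s t" for t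
    proof -
      have "1 * s t \<le> 3 * N^3 * s t" using N3 by (intro mult_right_mono) (auto simp: s_def)
      then have le: "s t \<le> 3 * N^3 * s t" by simp
      show "\<bar>f1 t\<bar> \<le> 3 * N^3 * s t" "\<bar>f2 t\<bar> \<le> 3 * N^3 * s t" "\<bar>g1 t\<bar> \<le> 3 * N^3 * s t" "\<bar>g2 t\<bar> \<le> 3 * N^3 * s t"
        by (rule order_trans[OF _ le], simp add: s_def)+
    qed
    define \<phi> where "\<phi> t = (f t)\<^sup>2 + (f1 t)\<^sup>2 + (f2 t)\<^sup>2 + (g t)\<^sup>2 + (g1 t)\<^sup>2 + (g2 t)\<^sup>2" for t
    define \<phi>' where "\<phi>' t = 2 * f t * (d$1 * f1 t + d$2 * f2 t)
       + 2 * f1 t * (d$1 * partial 1 (partial 1 X) (q t) $ 1 + d$2 * partial 1 (partial 2 X) (q t) $ 1)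
       + 2 * f2 t * (d$1 * partial 1 (partial 2 X) (q t) $ 1 + d$2 * partial 2 (partial 2 X) (q t) $ 1)
       + 2 * g t * (d$1 * g1 t + d$2 * g2 t)
       + 2 * g1 t * (d$1 * partial 1 (partial 1 X) (q t) $ 2 + d$2 * partial 1 (partial 2 X) (q t) $ 2)
       + 2 * g2 t * (d$1 * partial 1 (partial 2 X) (q t) $ 2 + d$2 * partial 2 (partial 2 X) (q t) $ 2)" for t
    have "\<phi> 1 \<le> 0"
    proof (rule Gronwall_zero)
      fix t :: real assume t: "0 \<le> t" "t \<le> 1"
      show "(\<phi> has_real_derivative \<phi>' t) (at t)"
        unfolding \<phi>_def \<phi>'_def f_def f1_def f2_def g_def g1_def g2_def
        by (rule derivative_eq_intros DX[OF t] D1[OF t] D2[OF t] refl)+ (simp add: algebra_simps)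
      have tm: "2 * u * v \<le> \<bar>u\<bar> * (2 * B * s t)" if "\<bar>v\<bar> \<le> B * s t" for u v
      proof -
        have "2 * u * v \<le> 2 * (\<bar>u\<bar> * \<bar>v\<bar>)" by (metis abs_ge_self abs_mult mult.assoc mult_le_cancel_left_pos zero_less_numeral)
        also have "\<dots> \<le> 2 * (\<bar>u\<bar> * (B * s t))" using that by (intro mult_left_mono) auto
        finally show ?thesis by simp
      qed
      have "\<phi>' t \<le> \<bar>f t\<bar> * (2 * B * s t) + \<bar>f1 t\<bar> * (2 * B * s t) + \<bar>f2 t\<bar> * (2 * B * s t) + \<bar>g t\<bar> * (2 * B * s t)
         + \<bar>g1 t\<bar> * (2 * B * s t) + \<bar>g2 t\<bar> * (2 * B * s t)"
        unfolding \<phi>'_def by (intro add_mono tm comb fst sec[OF t])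
      also have "\<dots> = s t * (2 * B * s t)" by (simp only: s_def distrib_right)
      also have "\<dots> = 2 * B * (s t)\<^sup>2" by (simp add: power2_eq_square)
      also have "\<dots> \<le> 2 * B * (6 * \<phi> t)"
      proof (rule mult_left_mono)
        show "(s t)\<^sup>2 \<le> 6 * \<phi> t"
          unfolding s_def \<phi>_def using sum6_square_le[of "\<bar>f t\<bar>" "\<bar>f1 t\<bar>" "\<bar>f2 t\<bar>" "\<bar>g t\<bar>" "\<bar>g1 t\<bar>" "\<bar>g2 t\<bar>"] by simp
      qed (simp add: B_def)
      finally show "\<phi>' t \<le> (12 * B) * \<phi> t" by simp
    next
      show "\<phi> 0 = 0" using jet by (simp add: \<phi>_def f_def f1_def f2_def g_def g1_def g2_def q_def)
    qed
    moreover have "(X p $ 1)\<^sup>2 + (X p $ 2)\<^sup>2 \<le> \<phi> 1"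
      by (simp add: \<phi>_def f_def g_def q_def d_def)
    ultimately have "(X p $ 1)\<^sup>2 + (X p $ 2)\<^sup>2 = 0"
      using sum_power2_ge_zero[of "X p $ 1" "X p $ 2"] by linarith
    then show "X p = 0" by (simp add: vec_eq_iff forall_2 sum_power2_eq_zero_iff)
  qed
qed

section \<open>The space of Killing fields and its dimension\<close>

lemma partial_add_scaleR:
  assumes "f differentiable (at p)" "g differentiable (at p)"
  shows "partial i (\<lambda>p. f p + c *\<^sub>R g p) p = partial i f p + c *\<^sub>R partial i g p"
proof -
  have "((\<lambda>p. f p + c *\<^sub>R g p) has_derivative (\<lambda>v. frechet_derivative f (at p) v + c *\<^sub>R frechet_derivative g (at p) v)) (at p)"
    by (intro has_derivative_add has_derivative_scaleR_right differentiable_has_derivative assms)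
  then show ?thesis unfolding partial_def by (simp add: frechet_derivative_at[symmetric])
qed

lemma foldr_partial_add_scaleR:
  assumes "open U" "smooth_on U f" "smooth_on U g" "p \<in> U"
  shows "foldr partial is (\<lambda>p. f p + c *\<^sub>R g p) p = foldr partial is f p + c *\<^sub>R foldr partial is g p"
  using assms(4)
proof (induction "is" arbitrary: p)
  case (Cons i "is")
  have "foldr partial (i # is) (\<lambda>p. f p + c *\<^sub>R g p) p = partial i (\<lambda>p. foldr partial is f p + c *\<^sub>R foldr partial is g p) p"
    using partial_cong[OF assms(1) Cons.prems, of "foldr partial is (\<lambda>p. f p + c *\<^sub>R g p)" "\<lambda>p. foldr partial is f p + c *\<^sub>R foldr partial is g p"]
      Cons.IH by simp
  then show ?case
    using assms(2,3) Cons.prems by (simp add: partial_add_scaleR smooth_on_def)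
qed simp

lemma smooth_on_add_scaleR:
  fixes f :: "real^'n \<Rightarrow> 'b::real_normed_vector"
  assumes "open U" "smooth_on U f" "smooth_on U g"
  shows "smooth_on U (\<lambda>p. f p + c *\<^sub>R g p)"
  unfolding smooth_on_def
proof (intro allI ballI)
  fix "is" :: "'n list" and p assume p: "p \<in> U"
  have "(\<lambda>p. foldr partial is f p + c *\<^sub>R foldr partial is g p) differentiable (at p)"
    using assms p unfolding smooth_on_def by (intro differentiable_add differentiable_scaleR) auto
  then obtain D where "((\<lambda>p. foldr partial is f p + c *\<^sub>R foldr partial is g p) has_derivative D) (at p)"
    unfolding differentiable_def by blast
  then have "(foldr partial is (\<lambda>p. f p + c *\<^sub>R g p) has_derivative D) (at p)"
    by (rule has_derivative_transform_within_open[OF _ assms(1) p]) (simp add: foldr_partial_add_scaleR[OF assms])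
  then show "foldr partial is (\<lambda>p. f p + c *\<^sub>R g p) differentiable (at p)"
    unfolding differentiable_def by blast
qed

lemma first_order_add:
  fixes z :: real
  assumes "u = f * a * z\<^sup>2 + (f1 * b1 + f2 * b2 + g1 * b3 + g2 * b4) * z" "u' = f' * a * z\<^sup>2 + (f1' * b1 + f2' * b2 + g1' * b3 + g2' * b4) * z"
  shows "u + c * u' = (f + c * f') * a * z\<^sup>2 + ((f1 + c * f1') * b1 + (f2 + c * f2') * b2 + (g1 + c * g1') * b3 + (g2 + c * g2') * b4) * z"
  unfolding assms by (simp add: algebra_simps)

lemma killing_pde_add:
  assumes "killing_pde C x f f1 f2 g1 g2 f11 f12 f22 g11 g12 g22" "killing_pde C x f' f1' f2' g1' g2' f11' f12' f22' g11' g12' g22'"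
  shows "killing_pde C x (f + c * f') (f1 + c * f1') (f2 + c * f2') (g1 + c * g1') (g2 + c * g2') (f11 + c * f11') (f12 + c * f12') (f22 + c * f22')
     (g11 + c * g11') (g12 + c * g12') (g22 + c * g22')"
  using assms unfolding killing_pde_linear by - (elim conjE, intro conjI; rule first_order_add; assumption)

lemma affine_killing_add_scaleR:
  assumes X: "X \<in> affine_killing C" and Y: "Y \<in> affine_killing C"
  shows "(\<lambda>p. X p + c *\<^sub>R Y p) \<in> affine_killing C"
proof -
  have sm: "smooth_on half_plane X" "smooth_on half_plane Y" using X Y by (simp_all add: affine_killing_iff)
  have 1: "foldr partial is (\<lambda>p. X p + c *\<^sub>R Y p) p = foldr partial is X p + c *\<^sub>R foldr partial is Y p" if "p \<in> half_plane" for "is" p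
    using foldr_partial_add_scaleR[OF open_half_plane sm that] .
  show ?thesis
    unfolding affine_killing_pde
  proof (intro conjI ballI)
    show "smooth_on half_plane (\<lambda>p. X p + c *\<^sub>R Y p)" by (rule smooth_on_add_scaleR[OF open_half_plane sm])
    fix p :: "real^2" assume p: "p \<in> half_plane"
    note e = 1[OF p, of "[i]" for i, simplified] 1[OF p, of "[i,j]" for i j, simplified]
    show "killing_pde C (p $ 1) ((X p + c *\<^sub>R Y p) $ 1)
          (partial 1 (\<lambda>p. X p + c *\<^sub>R Y p) p $ 1) (partial 2 (\<lambda>p. X p + c *\<^sub>R Y p) p $ 1)
          (partial 1 (\<lambda>p. X p + c *\<^sub>R Y p) p $ 2) (partial 2 (\<lambda>p. X p + c *\<^sub>R Y p) p $ 2)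
          (partial 1 (partial 1 (\<lambda>p. X p + c *\<^sub>R Y p)) p $ 1) (partial 1 (partial 2 (\<lambda>p. X p + c *\<^sub>R Y p)) p $ 1)
          (partial 2 (partial 2 (\<lambda>p. X p + c *\<^sub>R Y p)) p $ 1) (partial 1 (partial 1 (\<lambda>p. X p + c *\<^sub>R Y p)) p $ 2)
          (partial 1 (partial 2 (\<lambda>p. X p + c *\<^sub>R Y p)) p $ 2) (partial 2 (partial 2 (\<lambda>p. X p + c *\<^sub>R Y p)) p $ 2)"
      unfolding e vector_add_component vector_scaleR_component real_scaleR_def
      using X Y p by (intro killing_pde_add) (auto simp: affine_killing_pde)
  qed (use X Y in \<open>auto simp: affine_killing_def\<close>)
qed

definition field2 :: "(real^2 \<Rightarrow> real) \<Rightarrow> (real^2 \<Rightarrow> real) \<Rightarrow> real^2 \<Rightarrow> real^2" where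
  "field2 f g = (\<lambda>p. if p \<in> half_plane then vector [f p, g p] else 0)"

lemmas field2_killingI = affine_killingI[folded field2_def]

lemma translation_killing: "field2 (\<lambda>_. 0) (\<lambda>_. 1) \<in> affine_killing C"
  by (rule field2_killingI; (rule elementary.intros has_partials_intros)?) (simp add: killing_pde_def)

lemma dilation_killing: "field2 (\<lambda>p. p $ 1) (\<lambda>p. p $ 2) \<in> affine_killing C"
  by (rule field2_killingI; (rule elementary.intros has_partials_intros)?) (simp add: killing_pde_def power2_eq_square field_simps)

global_interpretation vf: vector_space vf_scale
  by (rule vector_space_vf_scale)

lemma vf_combination_in_span3: "(\<lambda>p. a *\<^sub>R X p + b *\<^sub>R Y p + c *\<^sub>R Z p) \<in> vf.span {X, Y, Z}"
proof -
  have eq: "(\<lambda>p. a *\<^sub>R X p + b *\<^sub>R Y p + c *\<^sub>R Z p) = vf_scale a X + vf_scale b Y + vf_scale c Z"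
    by (simp add: fun_eq_iff vf_scale_def)
  show ?thesis unfolding eq by (intro vf.span_add vf.span_scale vf.span_base) auto
qed

lemma vf_independent2:
  assumes "\<And>a b. (\<forall>p. a *\<^sub>R X p + b *\<^sub>R Y p = 0) \<Longrightarrow> a = 0 \<and> b = 0"
  shows "vf.independent {X, Y}" "card {X, Y} = 2"
proof -
  have ne: "X \<noteq> Y" using assms[of 1 "-1"] by auto
  have Y: "Y \<noteq> 0" using assms[of 0 1] by auto
  have "X \<notin> vf.span {Y}"
  proof
    assume "X \<in> vf.span {Y}"
    then obtain k where "X = vf_scale k Y" by (auto simp: vf.span_singleton)
    then show False using assms[of 1 "-k"] by (auto simp: vf_scale_def)
  qed
  then show "vf.independent {X, Y}" using ne Y by (simp add: vf.independent_insert)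
  show "card {X, Y} = 2" using ne by simp
qed

text \<open>The spanning fields may repeat or be zero, as happens when there is no isotropy; only
  the bound 3 on their number enters.\<close>

lemma kappa_2_3:
  assumes "{X, Y} \<subseteq> affine_killing C" "\<And>a b. (\<forall>p. a *\<^sub>R X p + b *\<^sub>R Y p = 0) \<Longrightarrow> a = 0 \<and> b = 0"
    and "affine_killing C \<subseteq> vf.span {U, V, W}"
  shows "2 \<le> kappa C \<and> kappa C \<le> 3"
proof -
  obtain B where B: "B \<subseteq> affine_killing C" "vf.independent B" "affine_killing C \<subseteq> vf.span B" "card B = vf.dim (affine_killing C)"
    using vf.basis_exists by blast
  have fin: "finite B" and "card B \<le> card {U, V, W}"
    using vf.independent_span_bound[of "{U, V, W}" B] B assms(3) by auto
  moreover have "card {U, V, W} \<le> 3" by (simp add: card_insert_if)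
  moreover have "card {X, Y} \<le> card B"
    using vf.independent_span_bound[OF fin vf_independent2(1)[OF assms(2)]] B(3) assms(1) by blast
  ultimately show ?thesis using vf_independent2(2)[OF assms(2)] B(4) by (simp add: kappa_def)
qed

lemma kappa_not_2_3:
  assumes sub: "{X, Y, Z, W} \<subseteq> affine_killing C"
    and ind: "\<And>a b c d. (\<forall>p. a *\<^sub>R X p + b *\<^sub>R Y p + c *\<^sub>R Z p + d *\<^sub>R W p = 0) \<Longrightarrow> a = 0 \<and> b = 0 \<and> c = 0 \<and> d = 0"
  shows "\<not> (2 \<le> kappa C \<and> kappa C \<le> 3)"
proof
  assume k: "2 \<le> kappa C \<and> kappa C \<le> 3"
  obtain B where B: "B \<subseteq> affine_killing C" "vf.independent B" "affine_killing C \<subseteq> vf.span B" "card B = vf.dim (affine_killing C)"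
    using vf.basis_exists by blast
  have cB: "card B = kappa C" using B(4) by (simp add: kappa_def)
  \<comment> \<open>An infinite set has cardinality 0, so a dimension of at least 2 makes the basis
    finite.\<close>
  then have fin: "finite B" using k card.infinite by fastforce
  have i2: "vf.independent {X, Y}" by (rule vf_independent2) (use ind[of _ _ 0 0] in auto)
  have Z: "Z \<notin> vf.span {X, Y}"
  proof
    assume "Z \<in> vf.span {X, Y}"
    then obtain k l where "Z - vf_scale k X = vf_scale l Y"
      by (auto simp: vf.span_breakdown_eq vf.span_singleton)
    then have "Z = vf_scale k X + vf_scale l Y" by (simp add: algebra_simps)
    then show False using ind[of "-k" "-l" 1 0] by (auto simp: vf_scale_def)
  qed
  have W: "W \<notin> vf.span {Z, X, Y}"
  proof
    assume "W \<in> vf.span {Z, X, Y}"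
    then obtain m k l where "W - vf_scale m Z - vf_scale k X = vf_scale l Y"
      by (auto simp: vf.span_breakdown_eq vf.span_singleton)
    then have "W = vf_scale m Z + vf_scale k X + vf_scale l Y" by (simp add: algebra_simps)
    then show False using ind[of "-k" "-l" "-m" 1] by (auto simp: vf_scale_def)
  qed
  have nin: "Z \<notin> {X, Y}" "W \<notin> {Z, X, Y}" "X \<noteq> Y"
    using Z W vf.span_base ind[of 1 "-1" 0 0] by auto
  have "vf.independent {W, Z, X, Y}"
    using i2 Z W nin by (simp add: vf.independent_insert)
  from vf.independent_span_bound[OF fin this] have "card {W, Z, X, Y} \<le> card B"
    using sub B(3) by auto
  moreover have "card {W, Z, X, Y} = 4" using nin by simp
  ultimately show False using cB k by simp
qed

lemma field2_point: "0 < x \<Longrightarrow> field2 f g (vector [x, y]) = vector [f (vector [x, y]), g (vector [x, y])]"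
  by (simp add: field2_def half_plane_def)

lemma translation_dilation_independent:
  assumes "\<forall>p. a *\<^sub>R field2 (\<lambda>p. p $ 1) (\<lambda>p. p $ 2) p + b *\<^sub>R field2 (\<lambda>_. 0) (\<lambda>_. 1) p = 0"
  shows "a = 0 \<and> b = 0"
  using assms[rule_format, of "vector [1, 0]"] by (simp add: field2_point vec_eq_iff forall_2)

lemma kappa_generic:
  assumes M0: "curv C \<noteq> 0" and C0: "\<not> (C$3 = 0 \<and> C$5 = 0 \<and> C$6 = 0)"
  shows "2 \<le> kappa C \<and> kappa C \<le> 3"
proof -
  let ?T = "field2 (\<lambda>_. 0) (\<lambda>_. 1)" and ?E = "field2 (\<lambda>p. p $ 1) (\<lambda>p. p $ 2)"
  obtain d1 d2 d3 d4 where d: "\<And>X. X \<in> affine_killing C \<Longrightarrow> X base_point $ 1 = 0 \<Longrightarrow> \<exists>l.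
    partial 1 X base_point $ 1 = l * d1 \<and> partial 2 X base_point $ 1 = l * d2 \<and>
    partial 1 X base_point $ 2 = l * d3 \<and> partial 2 X base_point $ 2 = l * d4"
    using isotropy_line[OF assms] by blast
  have dv: "\<exists>l. partial 1 X base_point = l *\<^sub>R vector [d1, d3] \<and> partial 2 X base_point = l *\<^sub>R vector [d2, d4]"
    if "X \<in> affine_killing C" "X base_point = 0" for X
    using d[OF that(1)] that(2) by (simp add: vec_eq_iff forall_2) metis
  have bp: "?T base_point = vector [0, 1]" "?E base_point = vector [1, 0]"
    unfolding base_point_def by (simp_all add: field2_point)
  have sm: "X differentiable (at base_point)" if "X \<in> affine_killing C" for X
    using that base_point(1) smooth_onD by (auto simp: affine_killing_iff)
  \<comment> \<open>The dilation field is \<open>(1, 0)\<close> and the translation field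
    \<open>(0, 1)\<close> at the base point, so this combination vanishes there. It differs from
    \<open>X\<close> only by multiples of these two fields.\<close>
  define isotropic where "isotropic X = (\<lambda>p. X p + (- (X base_point $ 1)) *\<^sub>R ?E p + (- (X base_point $ 2)) *\<^sub>R ?T p)" for X
  have iso: "isotropic X \<in> affine_killing C" "isotropic X base_point = 0" if "X \<in> affine_killing C" for X
    unfolding isotropic_def
    by (intro affine_killing_add_scaleR that translation_killing dilation_killing)
      (simp add: bp vec_eq_iff forall_2)
  obtain Z where Z: "\<And>X. X \<in> affine_killing C \<Longrightarrow> X base_point = 0 \<Longrightarrow> \<exists>c. X = (\<lambda>p. c *\<^sub>R Z p)"
  proof (cases "\<exists>Z\<in>affine_killing C. Z base_point = 0 \<and> Z \<noteq> (\<lambda>_. 0)")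
    case False
    then show thesis by (intro that[of "\<lambda>_. 0"]) auto
  next
    case True
    then obtain Z where Z: "Z \<in> affine_killing C" "Z base_point = 0" "Z \<noteq> (\<lambda>_. 0)" by blast
    obtain m where m: "partial 1 Z base_point = m *\<^sub>R vector [d1, d3]" "partial 2 Z base_point = m *\<^sub>R vector [d2, d4]"
      using dv[OF Z(1,2)] by blast
    have m0: "m \<noteq> 0"
    proof
      assume "m = 0"
      then have "Z = (\<lambda>_. 0)" using affine_killing_eq_0[OF Z(1,2)] m by simp
      then show False using Z(3) by blast
    qed
    show thesis
    proof (rule that[of Z])
      fix X assume X: "X \<in> affine_killing C" "X base_point = 0"
      obtain l where l: "partial 1 X base_point = l *\<^sub>R vector [d1, d3]" "partial 2 X base_point = l *\<^sub>R vector [d2, d4]"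
        using dv[OF X] by blast
      have "(\<lambda>p. X p + (- (l / m)) *\<^sub>R Z p) = (\<lambda>_. 0)"
      proof (rule affine_killing_eq_0[OF affine_killing_add_scaleR[OF X(1) Z(1)]])
        show "partial 1 (\<lambda>p. X p + (- (l / m)) *\<^sub>R Z p) base_point = 0" "partial 2 (\<lambda>p. X p + (- (l / m)) *\<^sub>R Z p) base_point = 0"
          using m0 by (simp_all only: partial_add_scaleR[OF sm[OF X(1)] sm[OF Z(1)]] l m) simp_all
      qed (use X Z in simp)
      then show "\<exists>c. X = (\<lambda>p. c *\<^sub>R Z p)"
        by (intro exI[of _ "l / m"]) (simp add: fun_eq_iff add_eq_0_iff2)
    qed
  qed
  have sub: "affine_killing C \<subseteq> vf.span {?E, ?T, Z}"
  proof
    fix X assume X: "X \<in> affine_killing C"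
    have vec: "u = a *\<^sub>R e + b *\<^sub>R t + z" if "u + (- a) *\<^sub>R e + (- b) *\<^sub>R t = z" for u e t z :: "real^2" and a b
      unfolding that[symmetric] by (simp add: algebra_simps)
    obtain c where c: "isotropic X = (\<lambda>p. c *\<^sub>R Z p)" using Z[OF iso[OF X]] by blast
    have eq: "X = (\<lambda>p. (X base_point $ 1) *\<^sub>R ?E p + (X base_point $ 2) *\<^sub>R ?T p + c *\<^sub>R Z p)"
      by (rule ext, rule vec) (rule fun_cong[OF c[unfolded isotropic_def]])
    show "X \<in> vf.span {?E, ?T, Z}"
      by (rule back_subst[of "\<lambda>Y. Y \<in> vf.span {?E, ?T, Z}", OF vf_combination_in_span3 eq[symmetric]])
  qed
  show ?thesis
    by (rule kappa_2_3[OF _ translation_dilation_independent sub])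
      (simp_all add: translation_killing dilation_killing)
qed

section \<open>The excluded connections have at least four independent Killing fields\<close>

lemma kappa_degenerate:
  assumes "C$3 = 0" "C$5 = 0" "C$6 = 0"
  shows "\<not> (2 \<le> kappa C \<and> kappa C \<le> 3)"
proof -
  define a where "a = C$1 - 2 * C$4"
  \<comment> \<open>For vertical fields affine in \<open>x^2\<close> with constant slope
    \<open>m\<close>, the Killing equations reduce to an ordinary differential equation for
    \<open>k\<close> in \<open>x^1\<close>.\<close>
  have K: "field2 (\<lambda>_. 0) (\<lambda>p. m * p $ 2 + k p) \<in> affine_killing C"
    if k: "k \<in> elementary" "has_partials k k1 (\<lambda>_. 0)" "has_partials k1 k2 (\<lambda>_. 0)"
      "\<And>p. 0 < p $ 1 \<Longrightarrow> k2 p = (a * k1 p + m * C$2) / p $ 1" for m k k1 k2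
  proof (rule field2_killingI[where g = "\<lambda>p. m * p $ 2 + k p" and ?g1.0 = k1 and ?g2.0 = "\<lambda>_. m" and ?g11.0 = k2 and ?g21.0 = "\<lambda>_. 0" and ?g12.0 = "\<lambda>_. 0" and ?g22.0 = "\<lambda>_. 0"])
    show "has_partials (\<lambda>p. m * p $ 2 + k p) k1 (\<lambda>_. m)"
      by (rule has_partials_cong[OF has_partials_add[OF has_partials_cmult[OF has_partials_coord(2), of m] k(2)]]) auto
    show "(\<lambda>p. m * p $ 2 + k p) \<in> elementary" by (intro elementary.intros k)
  qed (rule elementary.intros k has_partials_const | use assms k(4) in \<open>simp add: killing_pde_def a_def field_simps\<close>)+
  \<comment> \<open>Solution for \<open>m = 0\<close>: an antiderivative of a power of
    \<open>x^1\<close>, which is a logarithm when \<open>a = -1\<close>.\<close>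
  obtain h where h: "h \<in> elementary" "has_partials h (\<lambda>p. p$1 powr a) (\<lambda>_. 0)" "h (vector [1, 0]) \<noteq> h (vector [2, 0])"
  proof (cases "a = -1")
    case True
    show thesis by (rule that[of "\<lambda>p. ln (p$1)"]) (use True has_partials_ln in \<open>auto intro: elementary.intros\<close>)
  next
    case False
    show thesis
    proof (rule that[of "\<lambda>p. (1 / (a + 1)) * p $ 1 powr (a + 1)"])
      show "has_partials (\<lambda>p. (1 / (a + 1)) * p $ 1 powr (a + 1)) (\<lambda>p. p$1 powr a) (\<lambda>_. 0)"
        by (rule has_partials_cong[OF has_partials_cmult[OF has_partials_powr[of "a + 1"], of "1 / (a + 1)"]]) (use False in auto)
      show "(\<lambda>p. (1 / (a + 1)) * p $ 1 powr (a + 1)) \<in> elementary" by (intro elementary.intros)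
    qed (use False in auto)
  qed
  \<comment> \<open>Particular solution for \<open>m = 1\<close>: linear in \<open>x^1\<close>, or
    with a logarithm in the resonant case \<open>a = 0\<close>.\<close>
  obtain k k1 k2 where k: "k \<in> elementary" "has_partials k k1 (\<lambda>_. 0)" "has_partials k1 k2 (\<lambda>_. 0)"
      "\<And>p. 0 < p $ 1 \<Longrightarrow> k2 p = (a * k1 p + 1 * C$2) / p $ 1" "\<And>x y y'. k (vector [x, y]) = k (vector [x, y'])"
  proof (cases "a = 0")
    case False
    show thesis
    proof (rule that[of "\<lambda>p. - C$2 / a * p $ 1" "\<lambda>_. - C$2 / a" "\<lambda>_. 0"])
      show "has_partials (\<lambda>p. - C$2 / a * p $ 1) (\<lambda>_. - C$2 / a) (\<lambda>_. 0)"
        by (rule has_partials_cong[OF has_partials_cmult[OF has_partials_coord(1), of "- C$2 / a"]]) auto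
      show "(\<lambda>p. - C$2 / a * p $ 1) \<in> elementary" by (intro elementary.intros)
      show "has_partials (\<lambda>_. - C$2 / a) (\<lambda>_. 0) (\<lambda>_. 0)" by (rule has_partials_const)
    qed (use False in auto)
  next
    case True
    show thesis
    proof (rule that[of "\<lambda>p. C$2 * (p$1 * ln (p$1) + (-1) * p $ 1)" "\<lambda>p. C$2 * ln (p$1)" "\<lambda>p. C$2 * p$1 powr (-1)"])
      show "has_partials (\<lambda>p. C$2 * (p$1 * ln (p$1) + (-1) * p $ 1)) (\<lambda>p. C$2 * ln (p$1)) (\<lambda>_. 0)"
        by (rule has_partials_cong[OF has_partials_cmult[OF has_partials_add[OF has_partials_mult[OF has_partials_coord(1) has_partials_ln]
             has_partials_cmult[OF has_partials_coord(1), of "-1"]], of "C$2"]]) (auto simp: powr_minus)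
      show "has_partials (\<lambda>p. C$2 * ln (p$1)) (\<lambda>p. C$2 * p$1 powr (-1)) (\<lambda>_. 0)"
        by (rule has_partials_cong[OF has_partials_cmult[OF has_partials_ln, of "C$2"]]) auto
      show "(\<lambda>p. C$2 * (p$1 * ln (p$1) + (-1) * p $ 1)) \<in> elementary" by (intro elementary.intros)
    qed (use True in \<open>auto simp: powr_minus divide_inverse\<close>)
  qed
  let ?T = "field2 (\<lambda>_. 0) (\<lambda>_. 1)" and ?E = "field2 (\<lambda>p. p $ 1) (\<lambda>p. p $ 2)"
  let ?H = "field2 (\<lambda>_. 0) (\<lambda>p. 0 * p $ 2 + h p)" and ?K = "field2 (\<lambda>_. 0) (\<lambda>p. 1 * p $ 2 + k p)"
  have mem1: "?H \<in> affine_killing C"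
  proof (rule K[OF h(1,2)])
    show "has_partials (\<lambda>p. p$1 powr a) (\<lambda>p. a * p $ 1 powr (a - 1)) (\<lambda>_. 0)" by (rule has_partials_powr)
  qed (simp add: powr_diff)
  have mem2: "?K \<in> affine_killing C" by (rule K[OF k(1-4)])
  have ind: "u = 0 \<and> b = 0 \<and> c = 0 \<and> d = 0"
    if "\<forall>p. u *\<^sub>R ?T p + b *\<^sub>R ?E p + c *\<^sub>R ?H p + d *\<^sub>R ?K p = 0" for u b c d
  proof -
    have e: "x * b = 0" "u + b * y + c * h (vector [x, y]) + d * (y + k (vector [x, y])) = 0" if "0 < x" for x y
      using \<open>\<forall>p. _ p = 0\<close>[rule_format, of "vector [x, y]"] that by (auto simp: field2_point vec_eq_iff forall_2)
    have b: "b = 0" using e(1)[of 1] by simp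
    have hh: "h (vector [x, y]) = h (vector [x, 0])" if "0 < x" for x y
    proof -
      have "((\<lambda>t. h (vector [x, 0] + t *\<^sub>R axis 2 1)) has_real_derivative 0) (at t)" for t
        using has_partials_DERIV[OF h(2), of "vector [x, 0]" t "axis 2 1"] that
        by (simp add: half_plane_def axis_def)
      then have "h (vector [x, 0] + y *\<^sub>R axis 2 1) = h (vector [x, 0] + 0 *\<^sub>R axis 2 1)"
        by (rule DERIV_isconst_all[rule_format])
      moreover have "vector [x, 0] + y *\<^sub>R axis 2 1 = (vector [x, y] :: real^2)"
        by (simp add: vec_eq_iff forall_2 axis_def)
      ultimately show ?thesis by simp
    qed
    have d: "d = 0" using e(2)[of 1 0] e(2)[of 1 1] hh[of 1 1] k(5)[of 1 1 0] b by (simp add: algebra_simps)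
    have "u + c * h (vector [1, 0]) = 0" "u + c * h (vector [2, 0]) = 0"
      using e(2)[of 1 0] e(2)[of 2 0] by (simp_all add: b d)
    then have "c * (h (vector [1, 0]) - h (vector [2, 0])) = 0" by (simp only: right_diff_distrib)
    then have c: "c = 0" using h(3) by simp
    show ?thesis using e(2)[of 1 0] b c d by simp
  qed
  show ?thesis
  proof -
    have mem: "{?T, ?E, ?H, ?K} \<subseteq> affine_killing C"
      using mem1 mem2 translation_killing dilation_killing by simp
    show ?thesis by (rule kappa_not_2_3[OF mem ind])
  qed
qed

text \<open>Such a connection arises from the coefficients \<open>(1, 0, 0, 0, q, 0)\<close> by a
  shear with parameter \<open>b\<close>. Up to constants its affine coordinates are \<open>v\<close>
  and \<open>q * v^2 + (x^1)^2\<close>. The fields used are the translation and the products of the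
  affine functions \<open>h\<close> with the coordinate field of the second coordinate, which is a
  multiple of \<open>(1, -b) / x^1\<close>.\<close>

lemma kappa_flat:
  assumes M0: "curv C = 0" and C0: "\<not> (C$3 = 0 \<and> C$5 = 0 \<and> C$6 = 0)"
  shows "\<not> (2 \<le> kappa C \<and> kappa C \<le> 3)"
proof -
  have m: "0 = C$3 * C$4 - C$2 * C$5 - C$3" "0 = C$1 * C$5 + C$3 * C$6 - (C$3)\<^sup>2 - C$4 * C$5 - C$5"
     "0 = C$2 * C$3 + (C$4)\<^sup>2 - C$1 * C$4 - C$2 * C$6 - C$4" "0 = C$2 * C$5 - C$3 * C$4 - C$6"
    using M0 by (auto simp: curv_def zero_prod_def)
  have C6: "C$6 = - C$3" using m(1,4) by simp
  have C5: "C$5 \<noteq> 0"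
  proof
    assume C5: "C$5 = 0"
    then have "(C$3)\<^sup>2 = 0" using m(2) C6 by (simp add: power2_eq_square)
    then show False using C5 C6 C0 by simp
  qed
  define b q where "b = C$3 / C$5" and "q = C$5"
  have q: "q \<noteq> 0" using C5 by (simp add: q_def)
  have C3: "C$3 = q * b" using C5 by (simp add: b_def q_def)
  have C6': "C$6 = - (q * b)" using C6 C3 by simp
  have "q * C$2 = q * (b * (C$4 - 1))" using m(1) C3 by (simp add: q_def[symmetric] algebra_simps)
  then have C2: "C$2 = b * (C$4 - 1)" using q by simp
  have "q * C$1 = q * (C$4 + 1 + 2 * q * b\<^sup>2)" using m(2) C3 C6' by (simp add: q_def[symmetric] algebra_simps power2_eq_square)
  then have C1: "C$1 = C$4 + 1 + 2 * q * b\<^sup>2" using q by simp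
  have C4: "C$4 = - q * b\<^sup>2" using m(3) unfolding C1 C2 C3 C6' by (simp add: algebra_simps power2_eq_square)
  note Cs = C1[unfolded C4] C2[unfolded C4] C3 C4 q_def[symmetric] C6'
  define v :: "real^2 \<Rightarrow> real" where "v = (\<lambda>p. p $ 2 + b * p $ 1)"
  let ?w = "\<lambda>p::real^2. p $ 1 powr (-1)"
  have v1: "has_partials v (\<lambda>_. b) (\<lambda>_. 1)"
    unfolding v_def
    by (rule has_partials_cong[OF has_partials_add[OF has_partials_coord(2) has_partials_cmult[OF has_partials_coord(1), of b]]]) auto
  have v2: "v \<in> elementary" unfolding v_def by (intro elementary.intros)
  note v = v1 v2
  have pw: "x powr (-2) = x powr (-1) * x powr (-1)" for x :: real
    using powr_add[of x "-1" "-1"] by (simp del: powr_neg_one)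
  have w: "has_partials ?w (\<lambda>p. - (?w p * ?w p)) (\<lambda>_. 0)"
    by (rule has_partials_cong[OF has_partials_powr[of "-1"]]) (simp_all add: pw del: powr_neg_one)
  have w1: "?w p = 1 / p $ 1" if "0 < p $ 1" for p :: "real^2" using that by (simp add: powr_minus divide_inverse)
  \<comment> \<open>The three conditions express that the Hessian of \<open>h\<close> with respect
    to the connection vanishes, in terms of \<open>x^2\<close> and the direction
    \<open>(1, -b)\<close> along which \<open>v\<close> is constant.\<close>
  have K: "field2 (\<lambda>p. h p * ?w p) (\<lambda>p. - b * (h p * ?w p)) \<in> affine_killing C"
    if h: "h \<in> elementary" "has_partials h h1 h2" "has_partials h1 h11 h12" "has_partials h2 h12 h22"
      and pde: "\<And>p. 0 < p $ 1 \<Longrightarrow> h1 p = b * h2 p + h11 p * p $ 1 - 2 * b * h12 p * p$1 + b\<^sup>2 * h22 p * p$1"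
       "\<And>p. 0 < p $ 1 \<Longrightarrow> h12 p = b * h22 p" "\<And>p. 0 < p $ 1 \<Longrightarrow> h22 p * p $ 1 = q * (h1 p - b * h2 p)" for h h1 h2 h11 h12 h22
  proof (rule field2_killingI)
    let ?f1 = "\<lambda>p. h1 p * ?w p + - (h p * (?w p * ?w p))"
    let ?f2 = "\<lambda>p. h2 p * ?w p"
    let ?f11 = "\<lambda>p. h11 p * ?w p - 2 * h1 p * (?w p * ?w p) + 2 * h p * (?w p * ?w p * ?w p)"
    let ?f12 = "\<lambda>p. h12 p * ?w p - h2 p * (?w p * ?w p)"
    let ?f22 = "\<lambda>p. h22 p * ?w p"
    show f: "has_partials (\<lambda>p. h p * ?w p) ?f1 ?f2"
      by (rule has_partials_cong[OF has_partials_mult[OF h(2) w]]) (auto simp: algebra_simps)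
    show "has_partials (\<lambda>p. - b * (h p * ?w p)) (\<lambda>p. - b * ?f1 p) (\<lambda>p. - b * ?f2 p)"
      by (rule has_partials_cmult[OF f])
    show f1: "has_partials ?f1 ?f11 ?f12"
      by (rule has_partials_cong[OF has_partials_add[OF has_partials_mult[OF h(3) w] has_partials_cmult[OF has_partials_mult[OF h(2) has_partials_mult[OF w w]], of "-1"]]])
        (auto simp: algebra_simps)
    show f2: "has_partials ?f2 ?f12 ?f22"
      by (rule has_partials_cong[OF has_partials_mult[OF h(4) w]]) (auto simp: algebra_simps)
    show "has_partials (\<lambda>p. - b * ?f1 p) (\<lambda>p. - b * ?f11 p) (\<lambda>p. - b * ?f12 p)" by (rule has_partials_cmult[OF f1])
    show "has_partials (\<lambda>p. - b * ?f2 p) (\<lambda>p. - b * ?f12 p) (\<lambda>p. - b * ?f22 p)" by (rule has_partials_cmult[OF f2])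
    show "(\<lambda>p. h p * ?w p) \<in> elementary" by (intro elementary.intros h)
    show "(\<lambda>p. - b * (h p * ?w p)) \<in> elementary" by (intro elementary.intros h)
    fix p :: "real^2" assume p: "0 < p $ 1"
    define z where "z = inverse (p $ 1)"
    have xz: "p $ 1 * z = 1" using p by (simp add: z_def)
    have h11: "h11 p = (h1 p - b * h2 p) * z + 2 * b * h12 p - b\<^sup>2 * h22 p"
    proof -
      have "(h1 p - b * h2 p) * z = (h11 p - 2 * b * h12 p + b\<^sup>2 * h22 p) * (p $ 1 * z)"
        unfolding pde(1)[OF p] by (simp add: algebra_simps)
      then show ?thesis unfolding xz by simp
    qed
    have h22: "h22 p = q * (h1 p - b * h2 p) * z"
    proof -
      have "h22 p * (p $ 1 * z) = q * (h1 p - b * h2 p) * z" unfolding mult.assoc[symmetric] pde(3)[OF p] ..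
      then show ?thesis unfolding xz by simp
    qed
    have wz: "?w p = z" using w1[OF p] by (simp add: z_def divide_inverse)
    show "killing_pde C (p $ 1) (h p * ?w p) (?f1 p) (?f2 p) (- b * ?f1 p) (- b * ?f2 p) (?f11 p) (?f12 p) (?f22 p) (- b * ?f11 p) (- b * ?f12 p) (- b * ?f22 p)"
      unfolding killing_pde_linear wz z_def[symmetric] Cs h11 pde(2)[OF p] h22
      by (intro conjI; simp add: algebra_simps power2_eq_square)
  qed
  let ?T = "field2 (\<lambda>_. 0) (\<lambda>_. 1)"
  let ?F = "\<lambda>h. field2 (\<lambda>p. h p * ?w p) (\<lambda>p. - b * (h p * ?w p))"
  let ?u = "\<lambda>p. q * (v p * v p) + p $ 1 * p $ 1"
  have mem1: "?F (\<lambda>_. 1) \<in> affine_killing C"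
    by (rule K[OF elementary.const has_partials_const has_partials_const has_partials_const]) simp_all
  have mem2: "?F v \<in> affine_killing C"
    by (rule K[OF v(2,1) has_partials_const has_partials_const]) simp_all
  have mem3: "?F ?u \<in> affine_killing C"
  proof (rule K)
    show "?u \<in> elementary" by (intro elementary.intros v)
    show "has_partials ?u (\<lambda>p. 2 * q * b * v p + 2 * p $ 1) (\<lambda>p. 2 * q * v p)"
      by (rule has_partials_cong[OF has_partials_add[OF has_partials_cmult[OF has_partials_mult[OF v(1) v(1)], of q] has_partials_mult[OF has_partials_coord(1) has_partials_coord(1)]]])
         auto
    show "has_partials (\<lambda>p. 2 * q * b * v p + 2 * p $ 1) (\<lambda>_. 2 * q * b * b + 2) (\<lambda>_. 2 * q * b)"
      by (rule has_partials_cong[OF has_partials_add[OF has_partials_cmult[OF v(1), of "2 * q * b"] has_partials_cmult[OF has_partials_coord(1), of 2]]]) auto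
    show "has_partials (\<lambda>p. 2 * q * v p) (\<lambda>_. 2 * q * b) (\<lambda>_. 2 * q)"
      by (rule has_partials_cong[OF has_partials_cmult[OF v(1), of "2 * q"]]) auto
  qed (simp_all add: algebra_simps power2_eq_square)
  have ind: "a = 0 \<and> c = 0 \<and> d = 0 \<and> e = 0"
    if "\<forall>p. a *\<^sub>R ?T p + c *\<^sub>R ?F (\<lambda>_. 1) p + d *\<^sub>R ?F v p + e *\<^sub>R ?F ?u p = 0" for a c d e
  proof -
    have f: "c + d * v (vector [x, y]) + e * (q * (v (vector [x, y]) * v (vector [x, y])) + x * x) = 0"
      and g: "a - b * ((c + d * v (vector [x, y]) + e * (q * (v (vector [x, y]) * v (vector [x, y])) + x * x)) * x powr (-1)) = 0" if "0 < x" for x y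
    proof -
      define W V U where "W = x powr (-1)" and "V = v (vector [x, y])" and "U = q * (V * V) + x * x"
      have r1: "c * W + d * (V * W) + e * (U * W) = 0"
        and r2: "a + c * (- b * W) + d * (- b * (V * W)) + e * (- b * (U * W)) = 0"
        using \<open>\<forall>p. _ p = 0\<close>[rule_format, of "vector [x, y]"] that
        unfolding W_def V_def U_def by (simp_all add: field2_point vec_eq_iff forall_2 del: powr_neg_one)
      have "(c + d * V + e * U) * W = c * W + d * (V * W) + e * (U * W)"
        "a - b * ((c + d * V + e * U) * W) = a + c * (- b * W) + d * (- b * (V * W)) + e * (- b * (U * W))"
        by (simp_all only: algebra_simps) simp
      then have 1: "(c + d * V + e * U) * W = 0" "a - b * ((c + d * V + e * U) * W) = 0" unfolding r1 r2 by blast+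
      moreover have "W \<noteq> 0" using that by (simp add: W_def)
      ultimately have 2: "c + d * V + e * U = 0" by simp
      show "c + d * v (vector [x, y]) + e * (q * (v (vector [x, y]) * v (vector [x, y])) + x * x) = 0"
        "a - b * ((c + d * v (vector [x, y]) + e * (q * (v (vector [x, y]) * v (vector [x, y])) + x * x)) * x powr (-1)) = 0"
        using 2 1(2) unfolding W_def V_def U_def .
    qed
    \<comment> \<open>Sample points with \<open>v\<close> equal to 0, 0, 1 and -1; the two with
      \<open>v = 0\<close> differ in \<open>x^1\<close> and isolate \<open>e\<close>.\<close>
    have "v (vector [1, -b]) = 0" "v (vector [2, -2*b]) = 0" "v (vector [1, 1 - b]) = 1" "v (vector [1, -1 - b]) = - 1" by (simp_all add: v_def)
    then have "c + e = 0" "c + 4 * e = 0" "c + d + e * (q + 1) = 0" "c - d + e * (q + 1) = 0"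
      using f[of 1 "-b"] f[of 2 "-2*b"] f[of 1 "1-b"] f[of 1 "-1-b"] by simp_all
    then have "e = 0" "c = 0" "d = 0" by (auto simp: algebra_simps)
    then show ?thesis using g[of 1 0] by simp
  qed
  have mem: "{?T, ?F (\<lambda>_. 1), ?F v, ?F ?u} \<subseteq> affine_killing C"
    using mem1 mem2 mem3 translation_killing by simp
  show ?thesis by (rule kappa_not_2_3[OF mem ind])
qed

theorem Z23B_eq: "Z23B = {C. curv C \<noteq> 0 \<and> \<not> (C$3 = 0 \<and> C$5 = 0 \<and> C$6 = 0)}"
  unfolding Z23B_def using kappa_generic kappa_degenerate kappa_flat by blast

subsection \<open>Charts on the quotient\<close>

lemma vector_4:
  fixes u v w x :: "'a::zero"
  shows "(vector [u, v, w, x] :: 'a^4) $ 1 = u" "(vector [u, v, w, x] :: 'a^4) $ 2 = v"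
    "(vector [u, v, w, x] :: 'a^4) $ 3 = w" "(vector [u, v, w, x] :: 'a^4) $ 4 = x"
  by (simp_all add: vector_def)

lemma exhaust_6: "i = 1 \<or> i = 2 \<or> i = 3 \<or> i = 4 \<or> i = 5 \<or> i = (6::6)"
proof (induct i)
  case (of_int z)
  then have "z = 0 \<or> z = 1 \<or> z = 2 \<or> z = 3 \<or> z = 4 \<or> z = 5" by auto
  then show ?case by auto
qed

lemma forall_6: "(\<forall>i::6. P i) \<longleftrightarrow> P 1 \<and> P 2 \<and> P 3 \<and> P 4 \<and> P 5 \<and> P 6"
  by (metis exhaust_6)

section \<open>The group action and the topology of its quotient\<close>

lemma pull_pull: "c \<noteq> 0 \<Longrightarrow> c' \<noteq> 0 \<Longrightarrow> pull b' c' (pull b c C) = pull (b + c * b') (c * c') C"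
  unfolding vec_eq_iff forall_6 pull_def vector_6
  by (intro conjI; simp add: field_simps power2_eq_square power3_eq_cube)

lemma pull_id: "pull 0 1 C = C"
  by (simp add: vec_eq_iff forall_6 pull_def vector_6)

lemma pull_inverse: "c \<noteq> 0 \<Longrightarrow> pull (- b / c) (1 / c) (pull b c C) = C"
  by (simp add: pull_pull pull_id)

text \<open>Flatness does not depend on the frame. The formula inside is the conjugate of the
  curvature matrix by the change of frame, times the determinant \<open>c\<close>.\<close>

lemma curv_pull_zero:
  assumes c: "c \<noteq> 0" and 0: "curv C = 0"
  shows "curv (pull b c C) = 0"
proof -
  obtain m1 m2 m3 m4 where M: "curv C = (m1, m2, m3, m4)" by (metis surj_pair)
  have m: "C$3 * C$4 - C$2 * C$5 - C$3 = m1" "C$1 * C$5 + C$3 * C$6 - (C$3)\<^sup>2 - C$4 * C$5 - C$5 = m2"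
     "C$2 * C$3 + (C$4)\<^sup>2 - C$1 * C$4 - C$2 * C$6 - C$4 = m3" "C$2 * C$5 - C$3 * C$4 - C$6 = m4"
    using M by (auto simp: curv_def)
  have "curv (pull b c C) = (c * (m1 + b * m2), c\<^sup>2 * m2, m3 + b * m4 - b * m1 - b\<^sup>2 * m2, c * (m4 - b * m2))"
    unfolding curv_def pull_def vector_6 m[symmetric] prod.inject using c
    by (intro conjI; simp add: field_simps power2_eq_square power3_eq_cube)
  then show ?thesis using 0 M by (simp add: zero_prod_def)
qed

lemma pull_in_Z23B:
  assumes c: "c \<noteq> 0" and C: "C \<in> Z23B"
  shows "pull b c C \<in> Z23B"
proof -
  have "curv (pull b c C) \<noteq> 0"
  proof
    assume "curv (pull b c C) = 0"
    then have "curv (pull (- b / c) (1 / c) (pull b c C)) = 0" using c by (intro curv_pull_zero[of "1 / c" "pull b c C"]) simp_all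
    then show False using C by (simp only: pull_inverse[OF c] Z23B_eq) simp
  qed
  moreover have "\<not> (pull b c C $ 3 = 0 \<and> pull b c C $ 5 = 0 \<and> pull b c C $ 6 = 0)"
    using c C by (auto simp: Z23B_eq pull_def vector_6)
  ultimately show ?thesis by (simp add: Z23B_eq)
qed

lemma continuous_on_vec_nthI:
  fixes f :: "'a::topological_space \<Rightarrow> real^'m"
  assumes "\<And>i. continuous_on S (\<lambda>x. f x $ i)"
  shows "continuous_on S f"
  using continuous_on_vec_lambda[of S "\<lambda>i x. f x $ i"] assms by simp

lemma continuous_on_pull: "continuous_on S (\<lambda>C. pull b c C)"
proof (rule continuous_on_vec_nthI)
  fix i
  show "continuous_on S (\<lambda>C. pull b c C $ i)"
    using exhaust_6[of i] by (elim disjE; simp add: pull_def vector_6 divide_inverse; intro continuous_intros)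
qed

lemma open_Z23B: "open Z23B"
proof -
  have eq: "Z23B = - {C. curv C = 0} \<inter> - {C. C$3 = 0 \<and> C$5 = 0 \<and> C$6 = 0}"
    by (auto simp: Z23B_eq)
  have 1: "closed {C. curv C = 0}"
    unfolding curv_def by (intro closed_Collect_eq continuous_intros)
  have 2: "closed {C::real^6. C$3 = 0 \<and> C$5 = 0 \<and> C$6 = 0}"
    by (intro closed_Collect_conj closed_Collect_eq continuous_intros)
  show ?thesis unfolding eq by (rule open_Int[OF open_Compl[OF 1] open_Compl[OF 2]])
qed

lemma moduli_rel_iff: "(C, D) \<in> moduli_rel \<longleftrightarrow> C \<in> Z23B \<and> (\<exists>b c. c \<noteq> 0 \<and> D = pull b c C)"
  unfolding moduli_rel_def using pull_in_Z23B by auto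

lemma equiv_moduli_rel: "equiv Z23B moduli_rel"
proof (rule equivI)
  show "moduli_rel \<subseteq> Z23B \<times> Z23B" by (auto simp: moduli_rel_def)
  show "refl_on Z23B moduli_rel"
  proof (rule refl_onI)
    fix C assume "C \<in> Z23B"
    moreover have "(1::real) \<noteq> 0 \<and> C = pull 0 1 C" by (simp add: pull_id)
    ultimately show "(C, C) \<in> moduli_rel" unfolding moduli_rel_iff by blast
  qed
  show "sym moduli_rel"
  proof (rule symI)
    fix C D assume CD: "(C, D) \<in> moduli_rel"
    then obtain b c where bc: "C \<in> Z23B" "c \<noteq> 0" "D = pull b c C" by (auto simp: moduli_rel_iff)
    then have "C = pull (- b / c) (1 / c) D" by (simp only: pull_inverse[OF bc(2)])
    moreover have "D \<in> Z23B" using bc pull_in_Z23B by simp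
    moreover have "1 / c \<noteq> 0" using bc by simp
    ultimately show "(D, C) \<in> moduli_rel" unfolding moduli_rel_iff by blast
  qed
  show "trans moduli_rel"
  proof (rule transI)
    fix C D E assume "(C, D) \<in> moduli_rel" "(D, E) \<in> moduli_rel"
    then obtain b c b' c' where bc: "C \<in> Z23B" "c \<noteq> 0" "D = pull b c C" "c' \<noteq> 0" "E = pull b' c' D"
      by (auto simp: moduli_rel_iff)
    then have "E = pull (b + c * b') (c * c') C" "c * c' \<noteq> 0" by (simp_all add: pull_pull)
    then show "(C, E) \<in> moduli_rel" using bc(1) unfolding moduli_rel_iff by blast
  qed
qed

lemma moduli_proj_eq_iff:
  "C \<in> Z23B \<Longrightarrow> D \<in> Z23B \<Longrightarrow> moduli_proj C = moduli_proj D \<longleftrightarrow> (\<exists>b c. c \<noteq> 0 \<and> D = pull b c C)"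
  unfolding moduli_proj_def using eq_equiv_class_iff[OF equiv_moduli_rel, of C D] by (simp add: moduli_rel_iff)

lemma moduli_proj_pull: "C \<in> Z23B \<Longrightarrow> c \<noteq> 0 \<Longrightarrow> moduli_proj (pull b c C) = moduli_proj C"
  using moduli_proj_eq_iff[of C "pull b c C"] pull_in_Z23B by auto

lemma topspace_moduli: "topspace moduli_space = moduli_proj ` Z23B"
  by (simp add: moduli_space_def topspace_quotient_topology)

lemma quotient_map_moduli: "quotient_map (top_of_set Z23B) moduli_space moduli_proj"
  unfolding moduli_space_def by (rule quotient_map_quotient_topology)

lemma openin_moduli:
  "openin moduli_space U \<longleftrightarrow> U \<subseteq> moduli_proj ` Z23B \<and> open {C \<in> Z23B. moduli_proj C \<in> U}"
  by (auto simp: moduli_space_def openin_quotient_topology openin_open_eq[OF open_Z23B])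

text \<open>The saturation of an open set is the union of its preimages under all maps
  \<open>pull b c\<close>, as for the orbit map of any group acting by homeomorphisms.\<close>

lemma open_moduli_proj:
  assumes W: "open W" "W \<subseteq> Z23B"
  shows "openin moduli_space (moduli_proj ` W)"
  unfolding openin_moduli
proof
  have "{C \<in> Z23B. moduli_proj C \<in> moduli_proj ` W} = (\<Union>b. \<Union>c\<in>-{0}. Z23B \<inter> (\<lambda>C. pull b c C) -` W)"
    (is "?l = ?r")
  proof
    show "?l \<subseteq> ?r" 
    proof
      fix C assume "C \<in> ?l"
      then obtain D where "C \<in> Z23B" "D \<in> W" "moduli_proj C = moduli_proj D" by auto
      then show "C \<in> ?r" using W(2) moduli_proj_eq_iff[of C D] by auto
    qed
    show "?r \<subseteq> ?l"
    proof
      fix C assume "C \<in> ?r"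
      then obtain b c where bc: "c \<noteq> 0" "C \<in> Z23B" "pull b c C \<in> W" by auto
      then have "moduli_proj C \<in> moduli_proj ` W" using moduli_proj_pull[OF bc(2,1), of b] by (metis imageI)
      then show "C \<in> ?l" using bc(2) by simp
    qed
  qed
  also have "open \<dots>"
  proof (intro open_UN ballI)
    fix b c :: real
    show "open (Z23B \<inter> (\<lambda>C. pull b c C) -` W)"
      by (rule open_Int[OF open_Z23B open_vimage[OF W(1) continuous_on_pull]])
  qed
  finally show "open {C \<in> Z23B. moduli_proj C \<in> moduli_proj ` W}" .
qed (use W in auto)

text \<open>A chart over an invariant open set \<open>Dom\<close>. The map \<open>G\<close> is a
  complete invariant on it, and \<open>sec\<close> parametrises a slice that meets every orbit,
  possibly more than once; \<open>s\<close>, the composite of \<open>sec\<close> and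
  \<open>G\<close>, identifies parameters on the same orbit. Where the action is free
  \<open>s\<close> is the identity, otherwise it is a branched open map.\<close>

locale quotient_chart =
  fixes Dom :: "(real^6) set" and G :: "real^6 \<Rightarrow> real^4" and Om Om' :: "(real^4) set"
    and sec :: "real^4 \<Rightarrow> real^6" and s :: "real^4 \<Rightarrow> real^4"
  assumes open_Dom: "open Dom" and Dom_sub: "Dom \<subseteq> Z23B"
    and inv: "\<And>C b c. C \<in> Dom \<Longrightarrow> c \<noteq> 0 \<Longrightarrow> pull b c C \<in> Dom \<and> G (pull b c C) = G C"
    and cont: "continuous_on Dom G"
    and cont_sec: "continuous_on Om' sec" and open_Om': "open Om'"
    and sec: "\<And>v. v \<in> Om' \<Longrightarrow> sec v \<in> Dom \<and> G (sec v) = s v"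
    and onto: "\<And>C. C \<in> Dom \<Longrightarrow> \<exists>v\<in>Om'. moduli_proj (sec v) = moduli_proj C"
    and inj: "\<And>v v'. v \<in> Om' \<Longrightarrow> v' \<in> Om' \<Longrightarrow> s v = s v' \<Longrightarrow> moduli_proj (sec v) = moduli_proj (sec v')"
    and s_open: "\<And>W. W \<subseteq> Om' \<Longrightarrow> open W \<Longrightarrow> open (s ` W)"
    and s_image: "s ` Om' = Om"
begin

definition U :: "(real^6) set set" where "U = moduli_proj ` Dom"

definition phi :: "(real^6) set \<Rightarrow> real^4" where "phi x = G (SOME C. C \<in> x)"

lemma phi_proj: assumes C: "C \<in> Dom" shows "phi (moduli_proj C) = G C"
proof -
  have CZ: "C \<in> Z23B" using C Dom_sub by blast
  then have "C \<in> moduli_proj C"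
    unfolding moduli_proj_def using equiv_moduli_rel by (rule equiv_class_self[rotated])
  then have "(SOME D. D \<in> moduli_proj C) \<in> moduli_proj C" by (rule someI)
  then obtain b c where "c \<noteq> 0" "(SOME D. D \<in> moduli_proj C) = pull b c C"
    unfolding moduli_proj_def Image_singleton_iff moduli_rel_iff by blast
  then show ?thesis unfolding phi_def using inv[OF C] by metis
qed

lemma proj_in_U_iff: assumes "C \<in> Z23B" shows "moduli_proj C \<in> U \<longleftrightarrow> C \<in> Dom"
proof
  assume "moduli_proj C \<in> U"
  then obtain D where D: "D \<in> Dom" "moduli_proj D = moduli_proj C" unfolding U_def by force
  then obtain b c where "c \<noteq> 0" "C = pull b c D"
    using moduli_proj_eq_iff[of D C] assms Dom_sub by blast
  then show "C \<in> Dom" using inv[OF D(1)] by blast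
qed (simp add: U_def)

lemma openin_U: "openin moduli_space U"
  unfolding U_def by (rule open_moduli_proj[OF open_Dom Dom_sub])

lemma U_subset: "U \<subseteq> topspace moduli_space"
  using openin_U by (rule openin_subset)

lemma U_cases: assumes "x \<in> U" obtains v where "v \<in> Om'" "x = moduli_proj (sec v)" "phi x = s v"
proof -
  obtain C where C: "C \<in> Dom" "x = moduli_proj C" using assms unfolding U_def by blast
  obtain v where v: "v \<in> Om'" "moduli_proj (sec v) = moduli_proj C" using onto[OF C(1)] by blast
  have "phi x = s v" using phi_proj[of "sec v"] sec[OF v(1)] v(2) C(2) by simp
  then show thesis using that[OF v(1)] v(2) C(2) by simp
qed

lemma phi_image: "phi ` U = Om"
proof
  show "phi ` U \<subseteq> Om" using s_image by (auto elim!: U_cases)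
  show "Om \<subseteq> phi ` U"
  proof
    fix w assume "w \<in> Om"
    then obtain v where v: "v \<in> Om'" "w = s v" using s_image by blast
    then have "moduli_proj (sec v) \<in> U" "phi (moduli_proj (sec v)) = w"
      using sec[OF v(1)] phi_proj[of "sec v"] by (auto simp: U_def)
    then show "w \<in> phi ` U" by force
  qed
qed

lemma inj_on_phi: "inj_on phi U"
proof (rule inj_onI)
  fix x y assume xy: "x \<in> U" "y \<in> U" "phi x = phi y"
  obtain v where v: "v \<in> Om'" "x = moduli_proj (sec v)" "phi x = s v" by (rule U_cases[OF xy(1)])
  obtain v' where v': "v' \<in> Om'" "y = moduli_proj (sec v')" "phi y = s v'" by (rule U_cases[OF xy(2)])
  show "x = y" using inj[OF v(1) v'(1)] v v' xy(3) by simp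
qed

text \<open>An open set of orbits is pulled back to parameters along the continuous
  \<open>sec\<close> and pushed forward by the open map \<open>s\<close>, which works at branch
  points too.\<close>

lemma open_map_phi: assumes W: "openin moduli_space W" "W \<subseteq> U" shows "open (phi ` W)"
proof -
  define V where "V = {v \<in> Om'. moduli_proj (sec v) \<in> W}"
  have "open {C \<in> Z23B. moduli_proj C \<in> W}" using W(1) unfolding openin_moduli by blast
  then have o: "open (Om' \<inter> sec -` {C \<in> Z23B. moduli_proj C \<in> W})"
    by (rule continuous_open_preimage[OF cont_sec open_Om'])
  have "V = Om' \<inter> sec -` {C \<in> Z23B. moduli_proj C \<in> W}"
    using sec Dom_sub by (auto simp: V_def)
  then have "open V" using o by simp
  moreover have "V \<subseteq> Om'" by (auto simp: V_def)
  ultimately have "open (s ` V)" using s_open by blast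
  also have "s ` V = phi ` W"
  proof
    show "phi ` W \<subseteq> s ` V"
    proof
      fix w assume "w \<in> phi ` W"
      then obtain x where x: "x \<in> W" "w = phi x" by blast
      have "x \<in> U" using x W(2) by blast
      then obtain v where "v \<in> Om'" "x = moduli_proj (sec v)" "phi x = s v" by (rule U_cases)
      then show "w \<in> s ` V" using x by (auto simp: V_def)
    qed
    show "s ` V \<subseteq> phi ` W"
    proof
      fix w assume "w \<in> s ` V"
      then obtain v where v: "v \<in> Om'" "moduli_proj (sec v) \<in> W" "w = s v" by (auto simp: V_def)
      then have "phi (moduli_proj (sec v)) = w" using phi_proj[of "sec v"] sec by simp
      then show "w \<in> phi ` W" using v(2) by force
    qed
  qed
  finally show ?thesis .
qed

lemma open_Om: "open Om"
  using open_map_phi[OF openin_U] phi_image by simp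

lemma homeomorphic_phi: "homeomorphic_map (subtopology moduli_space U) (top_of_set Om) phi"
proof (rule bijective_open_imp_homeomorphic_map)
  have ts: "topspace (subtopology moduli_space U) = U" using U_subset by auto
  show "phi ` topspace (subtopology moduli_space U) = topspace (top_of_set Om)"
    unfolding ts by (simp add: phi_image)
  show "inj_on phi (topspace (subtopology moduli_space U))" unfolding ts by (rule inj_on_phi)
  show "open_map (subtopology moduli_space U) (top_of_set Om) phi"
    unfolding open_map_def
  proof (intro allI impI)
    fix W assume "openin (subtopology moduli_space U) W"
    then have "openin moduli_space W" "W \<subseteq> U" by (simp_all add: openin_open_subtopology[OF openin_U])
    then show "openin (top_of_set Om) (phi ` W)"
      using open_map_phi[of W] phi_image by (simp add: openin_open_eq[OF open_Om]) blast
  qed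
  show "continuous_map (subtopology moduli_space U) (top_of_set Om) phi"
    unfolding continuous_map_def ts
  proof (intro conjI allI impI)
    fix T assume "openin (top_of_set Om) T"
    then have T: "open T" using openin_open_eq[OF open_Om] by blast
    have "open (Dom \<inter> G -` T)" by (rule continuous_open_preimage[OF cont open_Dom T])
    then have "openin moduli_space (moduli_proj ` (Dom \<inter> G -` T))"
      by (rule open_moduli_proj) (use Dom_sub in auto)
    moreover have "moduli_proj ` (Dom \<inter> G -` T) = {x \<in> U. phi x \<in> T}"
      using phi_proj by (auto simp: U_def)
    ultimately show "openin (subtopology moduli_space U) {x \<in> U. phi x \<in> T}"
      by (simp add: openin_open_subtopology[OF openin_U])
  qed (use phi_image in auto)
qed

lemma is_chart: "is_chart moduli_space (U, phi)"
  using openin_U homeomorphic_phi open_Om by (simp add: is_chart_def phi_image)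

lemma homeomorphic_phi_subset:
  assumes "W \<subseteq> U" shows "homeomorphic_map (subtopology moduli_space W) (top_of_set (phi ` W)) phi"
proof -
  have "homeomorphic_map (subtopology (subtopology moduli_space U) W) (subtopology (top_of_set Om) (phi ` W)) phi"
    using homeomorphic_phi by (rule homeomorphic_map_subtopologies) (use assms U_subset phi_image in auto)
  moreover have "U \<inter> W = W" "Om \<inter> phi ` W = phi ` W" using assms phi_image by auto
  ultimately show ?thesis by (simp add: subtopology_subtopology)
qed

end

section \<open>Analyticity of the transition maps\<close>

definition coords_analytic_at :: "(real^'n \<Rightarrow> real^'m) \<Rightarrow> real^'n \<Rightarrow> bool" where
  "coords_analytic_at F x \<longleftrightarrow> (\<forall>j. \<exists>g. analytic_at g x \<and> (\<forall>\<^sub>F y in nhds x. F y $ j = g y))"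

lemma coords_analytic_atI:
  assumes "\<And>j. analytic_at (\<lambda>y. F y $ j) x" shows "coords_analytic_at F x"
  unfolding coords_analytic_at_def
proof
  fix j
  show "\<exists>g. analytic_at g x \<and> (\<forall>\<^sub>F y in nhds x. F y $ j = g y)"
    by (intro exI[of _ "\<lambda>y. F y $ j"] conjI assms) simp
qed

lemma coords_analytic_imp_isCont:
  fixes F :: "real^'n \<Rightarrow> real^'m"
  assumes "coords_analytic_at F x" shows "isCont F x"
proof -
  have "isCont (\<lambda>y. F y $ j) x" for j
  proof -
    obtain g where g: "analytic_at g x" "\<forall>\<^sub>F y in nhds x. F y $ j = g y"
      using assms unfolding coords_analytic_at_def by blast
    show ?thesis using isCont_cong[OF g(2)] analytic_at_imp_isCont[OF g(1)] by blast
  qed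
  then show ?thesis unfolding isCont_def by (intro vec_tendstoI) auto
qed

text \<open>Near \<open>w\<close> the inverse of the first chart is the projection of a local
  analytic lift \<open>L\<close>, so the transition map is given there by \<open>G2\<close>
  evaluated on \<open>L\<close>.\<close>

lemma transition_analytic:
  assumes c1: "quotient_chart Dom1 G1 Om1 Om1' sec1 s1" and c2: "quotient_chart Dom2 G2 Om2 Om2' sec2 s2"
    and lift: "\<And>w. w \<in> quotient_chart.phi G1 ` (quotient_chart.U Dom1 \<inter> quotient_chart.U Dom2) \<Longrightarrow>
        \<exists>L. (\<forall>i. analytic_at (\<lambda>y. L y $ i) w) \<and> (\<forall>\<^sub>F y in nhds w. L y \<in> Dom1 \<and> G1 (L y) = y)"
    and G2: "\<And>(L :: real^4 \<Rightarrow> real^6) w. (\<And>i. analytic_at (\<lambda>y. L y $ i) w) \<Longrightarrow> L w \<in> Dom2 \<Longrightarrow> coords_analytic_at (\<lambda>y. G2 (L y)) w"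
  shows "real_analytic_on (quotient_chart.phi G1 ` (quotient_chart.U Dom1 \<inter> quotient_chart.U Dom2))
      (quotient_chart.phi G2 \<circ> inv_into (quotient_chart.U Dom1) (quotient_chart.phi G1))"
proof (rule real_analytic_onI)
  interpret c1: quotient_chart Dom1 G1 Om1 Om1' sec1 s1 by fact
  interpret c2: quotient_chart Dom2 G2 Om2 Om2' sec2 s2 by fact
  show "open (c1.phi ` (c1.U \<inter> c2.U))"
    by (rule c1.open_map_phi) (use c1.openin_U c2.openin_U in auto)
  fix w j assume w: "w \<in> c1.phi ` (c1.U \<inter> c2.U)"
  obtain L where L: "\<And>i. analytic_at (\<lambda>y. L y $ i) w" "\<forall>\<^sub>F y in nhds w. L y \<in> Dom1 \<and> G1 (L y) = y"
    using lift[OF w] by blast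
  have inv: "inv_into c1.U c1.phi y = moduli_proj (L y)" if "L y \<in> Dom1 \<and> G1 (L y) = y" for y
    by (rule inv_into_f_eq[OF c1.inj_on_phi]) (use that c1.phi_proj in \<open>auto simp: c1.U_def\<close>)
  have Lw: "L w \<in> Dom1 \<and> G1 (L w) = w" using L(2) by (rule eventually_nhds_x_imp_x)
  have "moduli_proj (L w) \<in> c2.U"
    using w inv[OF Lw] c1.inj_on_phi by (auto simp: inv_into_f_f)
  then have Lw2: "L w \<in> Dom2" using c2.proj_in_U_iff[of "L w"] Lw c1.Dom_sub by blast
  have "isCont L w" using L(1) by (intro coords_analytic_imp_isCont coords_analytic_atI)
  then have ev: "\<forall>\<^sub>F y in nhds w. L y \<in> Dom2"
  proof -
    have "\<forall>\<^sub>F y in at w. L y \<in> Dom2"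
      using topological_tendstoD[OF \<open>isCont L w\<close>[unfolded isCont_def] c2.open_Dom Lw2] .
    then have "\<forall>\<^sub>F y in nhds w. y \<noteq> w \<longrightarrow> y \<in> UNIV \<longrightarrow> L y \<in> Dom2" unfolding eventually_at_filter .
    then show ?thesis by (rule eventually_mono) (use Lw2 in auto)
  qed
  obtain g where g: "analytic_at g w" "\<forall>\<^sub>F y in nhds w. G2 (L y) $ j = g y"
    using G2[OF L(1) Lw2] unfolding coords_analytic_at_def by blast
  have "\<forall>\<^sub>F y in nhds w. (c2.phi \<circ> inv_into c1.U c1.phi) y $ j = g y"
    using L(2) ev g(2) by eventually_elim (simp add: inv c2.phi_proj)
  then show "\<exists>g. analytic_at g w \<and> (\<forall>\<^sub>F y in nhds w. (c2.phi \<circ> inv_into c1.U c1.phi) y $ j = g y)"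
    using g(1) by blast
qed

text \<open>The map is the identity. Treating it separately covers the branch points of a chart,
  where the argument with analytic lifts breaks down.\<close>

lemma transition_self_analytic:
  assumes "quotient_chart Dom G Om Om' sec s"
  shows "real_analytic_on (quotient_chart.phi G ` (quotient_chart.U Dom \<inter> quotient_chart.U Dom))
      (quotient_chart.phi G \<circ> inv_into (quotient_chart.U Dom) (quotient_chart.phi G))"
proof (rule real_analytic_onI)
  interpret quotient_chart Dom G Om Om' sec s by fact
  show "open (phi ` (U \<inter> U))" using open_Om phi_image by simp
  fix w j assume w: "w \<in> phi ` (U \<inter> U)"
  have "\<forall>\<^sub>F y in nhds w. y \<in> phi ` U"
    using open_Om phi_image w by (simp add: eventually_nhds_in_open)
  then have "\<forall>\<^sub>F y in nhds w. (phi \<circ> inv_into U phi) y $ j = y $ j"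
    by eventually_elim (simp add: f_inv_into_f)
  then show "\<exists>g. analytic_at g w \<and> (\<forall>\<^sub>F y in nhds w. (phi \<circ> inv_into U phi) y $ j = g y)"
    using analytic_at_coord by blast
qed

lemma continuous_on_coords_analytic:
  fixes F :: "real^'n \<Rightarrow> real^'m"
  assumes "\<And>x. x \<in> S \<Longrightarrow> coords_analytic_at F x" shows "continuous_on S F"
  using assms coords_analytic_imp_isCont by (intro continuous_at_imp_continuous_on) auto

section \<open>Relative invariants of the action\<close>

abbreviation qform_disc :: "real^6 \<Rightarrow> real" where "qform_disc C \<equiv> C$1 * C$5 - (C$3)\<^sup>2"
text \<open>After the shear that makes \<open>C_12^1\<close> vanish, the coefficient
  \<open>C_11^2\<close> is \<open>cubic_res C\<close> divided by the square of \<open>C$5\<close>,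
  and \<open>C_11^1\<close> is the determinant \<open>qform_disc C\<close> divided by
  \<open>C$5\<close>.\<close>

abbreviation cubic_res :: "real^6 \<Rightarrow> real" where
  "cubic_res C \<equiv> (C$5)\<^sup>2 * C$2 - C$3 * C$5 * (2 * C$4 - C$1) + (C$3)\<^sup>2 * (C$6 - C$3)"
abbreviation trace2 :: "real^6 \<Rightarrow> real" where "trace2 C \<equiv> C$3 + C$6"
text \<open>The second term has the same weight 3 in \<open>c\<close> and cancels \<open>C$6\<close>
  when \<open>C$5 = 0\<close>: there the value is \<open>-2 * (C$3)^3\<close>, whose sign is
  opposite to that of \<open>C$3\<close>.\<close>

definition ncov :: "real^6 \<Rightarrow> real" where "ncov C = cubic_res C + qform_disc C * trace2 C"

lemma pull_covariants:
  assumes c: "c \<noteq> 0"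
  shows "pull b c C $ 5 = c\<^sup>2 * C$5" "trace2 (pull b c C) = c * trace2 C" "qform_disc (pull b c C) = c\<^sup>2 * qform_disc C"
    "pull b c C $ 4 * pull b c C $ 5 - pull b c C $ 3 * pull b c C $ 6 = c\<^sup>2 * (C$4 * C$5 - C$3 * C$6)"
    "cubic_res (pull b c C) = c^3 * cubic_res C"
proof -
  \<comment> \<open>With the inverse of \<open>c\<close> as a separate variable the identities
    become polynomial.\<close>
  define d where "d = 1 / c"
  have cd: "c * d = 1" using c by (simp add: d_def)
  define g where "g = C$2 + b * (2 * C$4 - C$1) + b\<^sup>2 * (C$6 - 2 * C$3) - b^3 * C$5"
  have p: "pull b c C = vector [C$1 + 2 * b * C$3 + b^2 * C$5, d * g, c * (C$3 + b * C$5), C$4 + b * C$6 - b * (C$3 + b * C$5), c\<^sup>2 * C$5, c * (C$6 - b * C$5)]"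
  proof -
    have "pull b c C = vector [C$1 + 2 * b * C$3 + b^2 * C$5, g / c, c * C$3 + b * c * C$5, C$4 + b * C$6 - b * (C$3 + b * C$5), c\<^sup>2 * C$5, c * C$6 - b * c * C$5]"
      by (simp add: pull_def g_def)
    then show ?thesis by (simp add: vec_eq_iff forall_6 vector_6 d_def algebra_simps)
  qed
  show "pull b c C $ 5 = c\<^sup>2 * C$5" unfolding p vector_6 ..
  show "trace2 (pull b c C) = c * trace2 C" unfolding p vector_6 by (simp add: algebra_simps)
  show "qform_disc (pull b c C) = c\<^sup>2 * qform_disc C" unfolding p vector_6 by (simp add: algebra_simps power2_eq_square)
  show "pull b c C $ 4 * pull b c C $ 5 - pull b c C $ 3 * pull b c C $ 6 = c\<^sup>2 * (C$4 * C$5 - C$3 * C$6)"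
    unfolding p vector_6 by (simp add: algebra_simps power2_eq_square)
  have "(c\<^sup>2 * C$5)\<^sup>2 * (d * g) = c^3 * (c * d) * ((C$5)\<^sup>2 * g)" by (simp add: power2_eq_square power3_eq_cube)
  then have "cubic_res (pull b c C) = c^3 * ((C$5)\<^sup>2 * g) - c * (C$3 + b * C$5) * (c\<^sup>2 * C$5) * (2 * (C$4 + b * C$6 - b * (C$3 + b * C$5)) - (C$1 + 2 * b * C$3 + b^2 * C$5))
      + (c * (C$3 + b * C$5))\<^sup>2 * (c * (C$6 - b * C$5) - c * (C$3 + b * C$5))" unfolding p vector_6 cd by simp
  also have "\<dots> = c^3 * cubic_res C"
    unfolding g_def by (simp add: algebra_simps power2_eq_square power3_eq_cube)
  finally show "cubic_res (pull b c C) = c^3 * cubic_res C" .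
qed

lemma ncov_pull: "c \<noteq> 0 \<Longrightarrow> ncov (pull b c C) = c^3 * ncov C"
  unfolding ncov_def pull_covariants(2,3,5) by (simp add: algebra_simps power2_eq_square power3_eq_cube)

lemma analytic_at_pull:
  assumes "analytic_at b w" "analytic_at c w" "\<And>i. analytic_at (\<lambda>y. C y $ i) w" "c w \<noteq> 0"
  shows "analytic_at (\<lambda>y. pull (b y) (c y) (C y) $ i) w"
  using exhaust_6[of i] by (elim disjE; simp add: pull_def vector_6; intro analytic_intros assms)

subsection \<open>The atlas\<close>

text \<open>The complex square in the last two coordinates, taken as real and imaginary
  part.\<close>

definition square34 :: "real^4 \<Rightarrow> real^4" where
  "square34 v = vector [v$1, v$2, (v$3)\<^sup>2 - (v$4)\<^sup>2, 2 * v$3 * v$4]"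

lemma vec4_eq_iff: "(v::'a^4) = w \<longleftrightarrow> v$1 = w$1 \<and> v$2 = w$2 \<and> v$3 = w$3 \<and> v$4 = w$4"
  by (simp add: vec_eq_iff forall_4)

lemma square34_eq_iff:
  "square34 v = square34 w \<longleftrightarrow> v = w \<or> v = vector [w$1, w$2, - (w$3), - (w$4)]"
proof
  assume "square34 v = square34 w"
  then have e: "v$1 = w$1" "v$2 = w$2" "(v$3)\<^sup>2 - (v$4)\<^sup>2 = (w$3)\<^sup>2 - (w$4)\<^sup>2" "v$3 * v$4 = w$3 * w$4"
    by (simp_all add: square34_def vec4_eq_iff vector_4)
  then have "(Complex (v$3) (v$4))\<^sup>2 = (Complex (w$3) (w$4))\<^sup>2"
    by (simp add: complex_eq_iff power2_eq_square mult.commute)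
  then have "Complex (v$3) (v$4) = Complex (w$3) (w$4) \<or> Complex (v$3) (v$4) = - Complex (w$3) (w$4)"
    by (simp add: power2_eq_iff)
  then show "v = w \<or> v = vector [w$1, w$2, - (w$3), - (w$4)]"
    using e(1,2) by (auto simp: vec4_eq_iff vector_4 complex_eq_iff)
qed (auto simp: square34_def vec4_eq_iff vector_4)

lemma square34_surj: "\<exists>v. square34 v = w"
proof -
  obtain z where z: "z\<^sup>2 = Complex (w$3) (w$4)" using power2_csqrt by blast
  then have "(Re z)\<^sup>2 - (Im z)\<^sup>2 = w$3" "2 * Re z * Im z = w$4"
    by (simp_all add: complex_eq_iff power2_eq_square mult.commute mult.left_commute)
  then have "square34 (vector [w$1, w$2, Re z, Im z]) = w"
    by (simp add: square34_def vec4_eq_iff vector_4)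
  then show ?thesis by blast
qed

text \<open>Openness comes from the open mapping theorem for the holomorphic square, which also
  covers the branch point; the first two coordinates are carried along unchanged.\<close>

lemma open_square34:
  assumes W: "open W" shows "open (square34 ` W)"
proof (subst open_subopen, intro ballI)
  fix y assume "y \<in> square34 ` W"
  then obtain v where v: "v \<in> W" "y = square34 v" by blast
  obtain e where e: "e > 0" "ball v e \<subseteq> W" using W v(1) open_contains_ball by blast
  define z0 where "z0 = Complex (v$3) (v$4)"
  \<comment> \<open>Each of the four coordinates may move by less than \<open>e/4\<close>, which
    keeps the sum of the absolute changes below \<open>e\<close>.\<close>
  define B where "B = (\<lambda>z. z\<^sup>2) ` ball z0 (e/4)"
  have "open B" unfolding B_def
  proof (rule open_mapping_thm[of _ UNIV])
    show "\<not> (\<lambda>z::complex. z\<^sup>2) constant_on UNIV"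
    proof
      assume "(\<lambda>z::complex. z\<^sup>2) constant_on UNIV"
      then obtain c where "\<And>z::complex. z\<^sup>2 = c" by (auto simp: constant_on_def)
      from this[of 0] this[of 1] show False by simp
    qed
  qed (auto intro!: holomorphic_intros)
  define f where "f w = Complex (w$3) (w$4)" for w :: "real^4"
  have f: "continuous_on UNIV f" unfolding f_def by (intro continuous_intros)
  define T where "T = {w. \<bar>w$1 - v$1\<bar> < e/4} \<inter> ({w. \<bar>w$2 - v$2\<bar> < e/4} \<inter> f -` B)"
  have "open T" unfolding T_def
    by (intro open_Int open_Collect_less continuous_intros open_vimage \<open>open B\<close> f)
  moreover have "y \<in> T"
  proof -
    have "f y = z0\<^sup>2" by (simp add: f_def v(2) square34_def vector_4 z0_def complex_eq_iff power2_eq_square)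
    then show ?thesis using e(1) by (auto simp: T_def B_def v(2) square34_def vector_4)
  qed
  moreover have "T \<subseteq> square34 ` W"
  proof
    fix w assume w: "w \<in> T"
    then obtain z where z: "z \<in> ball z0 (e/4)" "f w = z\<^sup>2" by (auto simp: T_def B_def)
    define v' :: "real^4" where "v' = vector [w$1, w$2, Re z, Im z]"
    have "\<bar>Re z - v$3\<bar> < e/4" "\<bar>Im z - v$4\<bar> < e/4"
      using z(1) abs_Re_le_cmod[of "z - z0"] abs_Im_le_cmod[of "z - z0"]
      by (auto simp: z0_def dist_norm norm_minus_commute)
    moreover have "norm (v' - v) \<le> (\<Sum>i\<in>UNIV. \<bar>(v' - v) $ i\<bar>)" by (rule norm_le_l1_cart)
    ultimately have "norm (v' - v) < e" using w by (simp add: sum_4 v'_def vector_4 T_def)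
    then have "v' \<in> W" using e(2) by (auto simp: dist_norm norm_minus_commute)
    moreover have "square34 v' = w"
      using z(2) by (simp add: square34_def v'_def vec4_eq_iff vector_4 f_def complex_eq_iff power2_eq_square)
    ultimately show "w \<in> square34 ` W" by blast
  qed
  ultimately show "\<exists>T. open T \<and> y \<in> T \<and> T \<subseteq> square34 ` W" by blast
qed

lemma continuous_on_vec6:
  assumes "continuous_on S a" "continuous_on S b" "continuous_on S c" "continuous_on S d" "continuous_on S e" "continuous_on S f"
  shows "continuous_on S (\<lambda>x. vector [a x, b x, c x, d x, e x, f x] :: real^6)"
proof (rule continuous_on_vec_nthI)
  fix i show "continuous_on S (\<lambda>x. (vector [a x, b x, c x, d x, e x, f x] :: real^6) $ i)"
    using exhaust_6[of i] assms by (elim disjE) (simp_all add: vector_6)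
qed

subsubsection \<open>The charts where the coefficient of index 5 is nonzero\<close>

text \<open>The only flat connection on the slices \<open>secQ\<close>, fixed by the reflection. The
  entries are, in this order, \<open>C_11^1\<close>, \<open>C_12^2\<close>, \<open>C_22^2\<close>
  and \<open>C_11^2\<close>.\<close>

definition flat_point :: "real^4" where "flat_point = vector [1, 0, 0, 0]"

definition DomQ :: "real \<Rightarrow> (real^6) set" where "DomQ \<epsilon> = {C \<in> Z23B. 0 < \<epsilon> * C$5}"
text \<open>After normalising \<open>C_12^1\<close> to 0 and \<open>C_22^1\<close> to \<epsilon>,
  the coefficients \<open>C_11^1\<close>, \<open>C_12^2\<close>, \<open>C_22^2\<close> and
  \<open>C_11^2\<close> remain. The first two are the first two entries. The other two are
  determined only up to a common sign, and the last entries are the real and imaginary parts of the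
  square of the complex number that they form.\<close>

definition GQ :: "real \<Rightarrow> real^6 \<Rightarrow> real^4" where
  "GQ \<epsilon> C = vector [qform_disc C / C$5, (C$4 * C$5 - C$3 * C$6) / C$5,
     \<epsilon> * ((trace2 C)\<^sup>2 / C$5 - (cubic_res C)\<^sup>2 / (C$5)^3), 2 * trace2 C * cubic_res C / (C$5)\<^sup>2]"
definition secQ :: "real \<Rightarrow> real^4 \<Rightarrow> real^6" where
  "secQ \<epsilon> v = vector [v$1, v$4, 0, v$2, \<epsilon>, v$3]"

lemma square34_flat_point: "square34 v = flat_point \<longleftrightarrow> v = flat_point"
proof -
  have "square34 flat_point = flat_point" "vector [flat_point$1, flat_point$2, - (flat_point$3), - (flat_point$4)] = flat_point"
    by (simp_all add: square34_def flat_point_def vec4_eq_iff vector_4)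
  then show ?thesis using square34_eq_iff[of v flat_point] by metis
qed

lemma secQ_in_Z23B:
  assumes "\<epsilon> = 1 \<or> \<epsilon> = -1" shows "secQ \<epsilon> v \<in> Z23B \<longleftrightarrow> v \<noteq> flat_point"
proof -
  have "curv (secQ \<epsilon> v) = 0 \<longleftrightarrow> v = flat_point"
  proof
    assume 0: "curv (secQ \<epsilon> v) = 0"
    then have 1: "v$4 = 0" "v$3 = 0" using assms by (auto simp: curv_def secQ_def vector_6 zero_prod_def)
    then have 2: "v$1 = 1 + v$2" using 0 assms by (auto simp: curv_def secQ_def vector_6 zero_prod_def)
    then have "v$2 = 0" using 0 1 by (auto simp: curv_def secQ_def vector_6 zero_prod_def power2_eq_square algebra_simps)
    then show "v = flat_point" using 1 2 by (simp add: flat_point_def vec4_eq_iff vector_4)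
  qed (simp add: curv_def secQ_def vector_6 zero_prod_def flat_point_def vector_4)
  moreover have "secQ \<epsilon> v $ 5 \<noteq> 0" using assms by (auto simp: secQ_def vector_6)
  ultimately show ?thesis by (auto simp: Z23B_eq)
qed

lemma coords_analytic_GQ:
  assumes L: "\<And>i. analytic_at (\<lambda>y. L y $ i) w" and w: "L w \<in> DomQ \<epsilon>"
  shows "coords_analytic_at (\<lambda>y. GQ \<epsilon> (L y)) w"
proof (rule coords_analytic_atI)
  fix j
  have q: "L w $ 5 \<noteq> 0" "L w $ 5 ^ k \<noteq> 0" for k using w by (auto simp: DomQ_def)
  show "analytic_at (\<lambda>y. GQ \<epsilon> (L y) $ j) w"
    using exhaust_4[of j] by (elim disjE; simp add: GQ_def vector_4; intro analytic_intros L q)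
qed

lemma GQ_secQ:
  assumes "\<epsilon> = 1 \<or> \<epsilon> = -1" shows "GQ \<epsilon> (secQ \<epsilon> v) = square34 v"
  using assms by (auto simp: GQ_def secQ_def square34_def vec4_eq_iff vector_4 vector_6 power2_eq_square power3_eq_cube)

lemma secQ_reflect: "pull 0 (-1) (secQ \<epsilon> w) = secQ \<epsilon> (vector [w$1, w$2, - (w$3), - (w$4)])"
  by (simp add: secQ_def pull_def vector_6 vector_4)

lemma GQ_scaling:
  fixes c q :: real
  assumes "c \<noteq> 0" "q \<noteq> 0"
  shows "c\<^sup>2 * d / (c\<^sup>2 * q) = d / q" "(c * u)\<^sup>2 / (c\<^sup>2 * q) - (c^3 * r)\<^sup>2 / (c\<^sup>2 * q)^3 = u\<^sup>2 / q - r\<^sup>2 / q^3"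
    "2 * (c * u) * (c^3 * r) / (c\<^sup>2 * q)\<^sup>2 = 2 * u * r / q\<^sup>2"
  using assms by (simp_all add: power2_eq_square power3_eq_cube)

lemma quotient_chart_Q:
  assumes \<epsilon>: "\<epsilon> = 1 \<or> \<epsilon> = -1"
  shows "quotient_chart (DomQ \<epsilon>) (GQ \<epsilon>) (- {flat_point}) (- {flat_point}) (secQ \<epsilon>) square34"
proof
  have \<epsilon>2: "\<epsilon> * \<epsilon> = 1" using \<epsilon> by auto
  show "open (DomQ \<epsilon>)"
  proof -
    have "DomQ \<epsilon> = Z23B \<inter> {C. 0 < \<epsilon> * C$5}" by (auto simp: DomQ_def)
    then show ?thesis using open_Int[OF open_Z23B open_Collect_less[of "\<lambda>_. 0" "\<lambda>C::real^6. \<epsilon> * C$5"]]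
      by (simp add: continuous_intros)
  qed
  show "DomQ \<epsilon> \<subseteq> Z23B" by (auto simp: DomQ_def)
  show "pull b c C \<in> DomQ \<epsilon> \<and> GQ \<epsilon> (pull b c C) = GQ \<epsilon> C" if C: "C \<in> DomQ \<epsilon>" and c: "c \<noteq> 0" for C b c
  proof
    have "0 < c\<^sup>2 * (\<epsilon> * C$5)" using c C by (simp add: DomQ_def)
    then show "pull b c C \<in> DomQ \<epsilon>"
      using c C pull_in_Z23B by (simp add: DomQ_def pull_covariants(1) mult.left_commute)
    have q: "C$5 \<noteq> 0" using C by (auto simp: DomQ_def)
    show "GQ \<epsilon> (pull b c C) = GQ \<epsilon> C"
      unfolding GQ_def
      unfolding pull_covariants(5)[OF c]
      unfolding pull_covariants(4)[OF c]
      unfolding pull_covariants(2,3)[OF c]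
      unfolding pull_covariants(1)[OF c] GQ_scaling[OF c q] ..
  qed
  show "continuous_on (DomQ \<epsilon>) (GQ \<epsilon>)"
    by (rule continuous_on_coords_analytic) (rule coords_analytic_GQ[OF analytic_at_coord])
  show "continuous_on (- {flat_point}) (secQ \<epsilon>)"
    unfolding secQ_def by (intro continuous_on_vec6 continuous_intros)
  show "open (- {flat_point})" by auto
  show "secQ \<epsilon> v \<in> DomQ \<epsilon> \<and> GQ \<epsilon> (secQ \<epsilon> v) = square34 v" if "v \<in> - {flat_point}" for v
    using that secQ_in_Z23B[OF \<epsilon>] GQ_secQ[OF \<epsilon>] \<epsilon>2 by (simp add: DomQ_def) (simp add: secQ_def vector_6)
  show "\<exists>v\<in>- {flat_point}. moduli_proj (secQ \<epsilon> v) = moduli_proj C" if C: "C \<in> DomQ \<epsilon>" for C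
  proof -
    have q: "0 < \<epsilon> * C$5" and CZ: "C \<in> Z23B" using C by (auto simp: DomQ_def)
    define r where "r = sqrt (\<epsilon> * C$5)"
    have r: "r > 0" "r\<^sup>2 = \<epsilon> * C$5" using q by (auto simp: r_def)
    \<comment> \<open>The shear makes \<open>C_12^1\<close> vanish, and the scaling turns
      \<open>C_22^1\<close> into \<epsilon>.\<close>
    define D where "D = pull (- (C$3) / C$5) (1 / r) C"
    have DZ: "D \<in> Z23B" unfolding D_def by (rule pull_in_Z23B) (use r CZ in auto)
    have q0: "C$5 \<noteq> 0" using q by auto
    have D3: "D$3 = 0" using q0 by (simp add: D_def pull_def vector_6 field_simps)
    have "D$5 = C$5 / r\<^sup>2" by (simp add: D_def pull_def vector_6 power_divide)
    also have "\<dots> = \<epsilon>" using \<epsilon> q0 r(2) by auto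
    finally have D5: "D$5 = \<epsilon>" .
    define v :: "real^4" where "v = vector [D$1, D$4, D$6, D$2]"
    have Dv: "D = secQ \<epsilon> v" using D3 D5 by (simp add: secQ_def v_def vec_eq_iff forall_6 vector_6 vector_4)
    then have "v \<noteq> flat_point" using DZ secQ_in_Z23B[OF \<epsilon>] by simp
    moreover have "moduli_proj (secQ \<epsilon> v) = moduli_proj C"
      unfolding Dv[symmetric] D_def by (rule moduli_proj_pull) (use r CZ in auto)
    ultimately show ?thesis by auto
  qed
  show "moduli_proj (secQ \<epsilon> v) = moduli_proj (secQ \<epsilon> v')"
    if vv: "v \<in> - {flat_point}" "v' \<in> - {flat_point}" "square34 v = square34 v'" for v v'
  proof -
    consider "v = v'" | "v = vector [v'$1, v'$2, - (v'$3), - (v'$4)]" using vv(3) square34_eq_iff[of v v'] by blast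
    then show ?thesis
    proof cases
      case 2
      have "secQ \<epsilon> v' \<in> Z23B" using secQ_in_Z23B[OF \<epsilon>, of v'] vv(2) by simp
      then show ?thesis unfolding 2 secQ_reflect[symmetric] by (rule moduli_proj_pull) simp
    qed simp
  qed
  show "open (square34 ` W)" if "W \<subseteq> - {flat_point}" "open W" for W using open_square34[OF that(2)] .
  show "square34 ` (- {flat_point}) = - {flat_point}"
  proof
    show "square34 ` (- {flat_point}) \<subseteq> - {flat_point}" 
    proof
      fix w assume "w \<in> square34 ` (- {flat_point})"
      then obtain v where "v \<noteq> flat_point" "w = square34 v" by blast
      then have "w \<noteq> flat_point" using square34_flat_point[of v] by metis
      then show "w \<in> - {flat_point}" by simp
    qed
    show "- {flat_point} \<subseteq> square34 ` (- {flat_point})"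
    proof
      fix w assume w: "w \<in> - {flat_point}"
      obtain v where v: "square34 v = w" using square34_surj by blast
      then have "v \<noteq> flat_point" using w square34_flat_point[of v] by (metis Compl_iff singletonI)
      then show "w \<in> square34 ` (- {flat_point})" using v by blast
    qed
  qed
qed

lemma eventually_pos_isCont:
  fixes f :: "'a::t2_space \<Rightarrow> real"
  assumes "isCont f x" "0 < f x" shows "\<forall>\<^sub>F y in nhds x. 0 < f y"
proof -
  have "\<forall>\<^sub>F y in at x. 0 < f y"
    using order_tendstoD(1)[OF assms(1)[unfolded isCont_def] assms(2)] .
  then have "\<forall>\<^sub>F y in nhds x. y \<noteq> x \<longrightarrow> y \<in> UNIV \<longrightarrow> 0 < f y" unfolding eventually_at_filter .
  then show ?thesis by (rule eventually_mono) (use assms(2) in auto)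
qed

text \<open>Away from the branch locus the complex square root is locally analytic. With
  \<open>n\<close> the modulus, \<open>n + w$3\<close> and \<open>n - w$3\<close> are nonnegative
  and not both 0; the root is computed from its real part when the former is positive, and from its
  imaginary part otherwise.\<close>

lemma lift_Q:
  assumes \<epsilon>: "\<epsilon> = 1 \<or> \<epsilon> = -1" and w: "w$3 \<noteq> 0 \<or> w$4 \<noteq> 0"
  shows "\<exists>L. (\<forall>i. analytic_at (\<lambda>y. L y $ i) w) \<and> (\<forall>\<^sub>F y in nhds w. L y \<in> DomQ \<epsilon> \<and> GQ \<epsilon> (L y) = y)"
proof -
  interpret quotient_chart "DomQ \<epsilon>" "GQ \<epsilon>" "- {flat_point}" "- {flat_point}" "secQ \<epsilon>" square34
    by (rule quotient_chart_Q[OF \<epsilon>])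
  define n where "n y = sqrt ((y$3)\<^sup>2 + (y$4)\<^sup>2)" for y :: "real^4"
  have n0: "(w$3)\<^sup>2 + (w$4)\<^sup>2 > 0" using w by (simp add: sum_power2_gt_zero_iff)
  have na: "analytic_at n w" unfolding n_def by (intro analytic_intros n0)
  have n2: "(n y)\<^sup>2 = (y$3)\<^sup>2 + (y$4)\<^sup>2" for y by (simp add: n_def)
  have "\<exists>a b. analytic_at a w \<and> analytic_at b w \<and> (\<forall>\<^sub>F y in nhds w. (a y)\<^sup>2 - (b y)\<^sup>2 = y$3 \<and> 2 * a y * b y = y$4)"
  proof (cases "n w + w$3 > 0")
    case True
    define a where "a y = sqrt ((n y + y$3) / 2)" for y :: "real^4"
    define b where "b y = y$4 / (2 * a y)" for y :: "real^4"
    have p: "0 < (n w + w$3) / 2" using True by simp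
    have aa: "analytic_at a w" unfolding a_def by (intro analytic_intros na p) simp
    have "analytic_at b w" unfolding b_def by (intro analytic_intros aa) (use p in \<open>simp add: a_def\<close>)
    moreover have "isCont (\<lambda>y. n y + y$3) w" by (intro analytic_at_imp_isCont analytic_intros na)
    then have "\<forall>\<^sub>F y in nhds w. n y + y$3 > 0"
      using True by (rule eventually_pos_isCont)
    then have "\<forall>\<^sub>F y in nhds w. (a y)\<^sup>2 - (b y)\<^sup>2 = y$3 \<and> 2 * a y * b y = y$4"
    proof eventually_elim
      case (elim y)
      have a2: "(a y)\<^sup>2 = (n y + y$3) / 2" using elim by (simp add: a_def)
      have a0: "a y \<noteq> 0" using elim by (simp add: a_def)
      have b2: "(b y)\<^sup>2 = (n y - y$3) / 2"
      proof -
        have "(b y)\<^sup>2 = (y$4)\<^sup>2 / (4 * (a y)\<^sup>2)" by (simp add: b_def power_divide power_mult_distrib)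
        also have "\<dots> = (n y - y$3) / 2"
          using elim n2[of y] unfolding a2 by (simp add: field_simps power2_eq_square)
        finally show ?thesis .
      qed
      show ?case using a0 unfolding a2 b2 by (simp add: b_def field_simps)
    qed
    ultimately show ?thesis using aa by blast
  next
    case False
    have lt: "n w - w$3 > 0"
    proof (rule ccontr)
      assume "\<not> n w - w$3 > 0"
      moreover have "0 \<le> n w" by (simp add: n_def)
      ultimately have "w$3 = 0" "n w = 0" using False by linarith+
      then show False using n2[of w] n0 by simp
    qed
    define b where "b y = sqrt ((n y - y$3) / 2)" for y :: "real^4"
    define a where "a y = y$4 / (2 * b y)" for y :: "real^4"
    have p: "0 < (n w - w$3) / 2" using lt by simp
    have bb: "analytic_at b w" unfolding b_def by (intro analytic_intros na p) simp
    have "analytic_at a w" unfolding a_def by (intro analytic_intros bb) (use p in \<open>simp add: b_def\<close>)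
    moreover have "isCont (\<lambda>y. n y - y$3) w" by (intro analytic_at_imp_isCont analytic_intros na)
    then have "\<forall>\<^sub>F y in nhds w. n y - y$3 > 0"
      using lt by (rule eventually_pos_isCont)
    then have "\<forall>\<^sub>F y in nhds w. (a y)\<^sup>2 - (b y)\<^sup>2 = y$3 \<and> 2 * a y * b y = y$4"
    proof eventually_elim
      case (elim y)
      have b2: "(b y)\<^sup>2 = (n y - y$3) / 2" using elim by (simp add: b_def)
      have b0: "b y \<noteq> 0" using elim by (simp add: b_def)
      have a2: "(a y)\<^sup>2 = (n y + y$3) / 2"
      proof -
        have "(a y)\<^sup>2 = (y$4)\<^sup>2 / (4 * (b y)\<^sup>2)" by (simp add: a_def power_divide power_mult_distrib)
        also have "\<dots> = (n y + y$3) / 2"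
          using elim n2[of y] unfolding b2 by (simp add: field_simps power2_eq_square)
        finally show ?thesis .
      qed
      show ?case using b0 unfolding a2 b2 by (simp add: a_def field_simps)
    qed
    ultimately show ?thesis using bb by blast
  qed
  then obtain a b where ab: "analytic_at a w" "analytic_at b w"
    "\<forall>\<^sub>F y in nhds w. (a y)\<^sup>2 - (b y)\<^sup>2 = y$3 \<and> 2 * a y * b y = y$4" by blast
  define v :: "real^4 \<Rightarrow> real^4" where "v y = vector [y$1, y$2, a y, b y]" for y
  have an: "analytic_at (\<lambda>y. secQ \<epsilon> (v y) $ i) w" for i
    using exhaust_6[of i] by (elim disjE; simp add: secQ_def v_def vector_6 vector_4; intro analytic_intros ab)
  have "w \<noteq> flat_point" using w by (auto simp: flat_point_def vector_4)
  then have "\<forall>\<^sub>F y in nhds w. y \<noteq> flat_point" by (rule t1_space_nhds)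
  with ab(3) have "\<forall>\<^sub>F y in nhds w. secQ \<epsilon> (v y) \<in> DomQ \<epsilon> \<and> GQ \<epsilon> (secQ \<epsilon> (v y)) = y"
  proof eventually_elim
    case (elim y)
    then have "square34 (v y) = y" by (simp add: square34_def v_def vec4_eq_iff vector_4)
    then show ?case using sec[of "v y"] elim square34_flat_point[of "v y"] by (metis Compl_iff singletonD)
  qed
  then show ?thesis by (intro exI[of _ "\<lambda>y. secQ \<epsilon> (v y)"] conjI allI an)
qed

subsubsection \<open>The chart where the trace is nonzero\<close>

definition DomB :: "(real^6) set" where "DomB = {C \<in> Z23B. trace2 C \<noteq> 0}"
text \<open>Contraction of the Christoffel symbols gives a covector with components
  \<open>C$1 + C$4\<close> and \<open>C$3 + C$6\<close>, up to the factor \<open>1 / x^1\<close>;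
  the new frame turns these into 0 and 1.\<close>

definition normB :: "real^6 \<Rightarrow> real^6" where "normB C = pull (- (C$1 + C$4) / trace2 C) (1 / trace2 C) C"
definition GB :: "real^6 \<Rightarrow> real^4" where "GB C = vector [normB C $ 1, normB C $ 2, normB C $ 3, normB C $ 5]"
definition secB :: "real^4 \<Rightarrow> real^6" where "secB w = vector [w$1, w$2, w$3, - (w$1), w$4, 1 - w$3]"

lemma coords_analytic_GB:
  assumes L: "\<And>i. analytic_at (\<lambda>y. L y $ i) w" and w: "L w \<in> DomB"
  shows "coords_analytic_at (\<lambda>y. GB (L y)) w"
proof (rule coords_analytic_atI)
  fix j
  have u: "trace2 (L w) \<noteq> 0" using w by (auto simp: DomB_def)
  have "analytic_at (\<lambda>y. normB (L y) $ i) w" for i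
    unfolding normB_def by (intro analytic_at_pull analytic_intros L) (use u in auto)
  then show "analytic_at (\<lambda>y. GB (L y) $ j) w"
    using exhaust_4[of j] by (elim disjE) (simp_all add: GB_def vector_4)
qed

text \<open>The trace of the curvature matrix is \<open>- trace2\<close>, so the normalisation
  \<open>trace2 = 1\<close> excludes flatness.\<close>

lemma secB_in_DomB: "secB w \<in> DomB"
  by (simp add: DomB_def Z23B_eq curv_def secB_def vector_6 zero_prod_def)

lemma pull_trace1: "pull b c C $ 1 + pull b c C $ 4 = C$1 + C$4 + b * trace2 C"
  by (simp add: pull_def vector_6 algebra_simps power2_eq_square)

lemma quotient_chart_B: "quotient_chart DomB GB UNIV UNIV secB (\<lambda>w. w)"
proof
  show "open DomB"
  proof -
    have eq: "DomB = Z23B \<inter> - {C. trace2 C = 0}" by (auto simp: DomB_def)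
    have "closed {C::real^6. trace2 C = 0}" by (intro closed_Collect_eq continuous_intros)
    then show ?thesis unfolding eq by (rule open_Int[OF open_Z23B open_Compl])
  qed
  show "DomB \<subseteq> Z23B" by (auto simp: DomB_def)
  show "pull b c C \<in> DomB \<and> GB (pull b c C) = GB C" if C: "C \<in> DomB" and c: "c \<noteq> 0" for C b c
  proof
    show "pull b c C \<in> DomB" using c C pull_in_Z23B by (simp add: DomB_def pull_covariants(2)[OF c])
    have u: "trace2 C \<noteq> 0" using C by (simp add: DomB_def)
    note t = pull_trace1[of b c C]
    have shift: "b + c * (- (a + b * v) / (c * v)) = - a / v" if "v \<noteq> 0" for a v
      using c that by (simp add: field_simps)
    have "normB (pull b c C) = pull (b + c * (- (C$1 + C$4 + b * trace2 C) / (c * trace2 C))) (c * (1 / (c * trace2 C))) C"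
      unfolding normB_def pull_covariants(2)[OF c] t using c u by (simp add: pull_pull)
    also have "b + c * (- (C$1 + C$4 + b * trace2 C) / (c * trace2 C)) = - (C$1 + C$4) / trace2 C"
      using shift[OF u] .
    also have "c * (1 / (c * trace2 C)) = 1 / trace2 C" using c by simp
    finally have "normB (pull b c C) = normB C" by (simp add: normB_def)
    then show "GB (pull b c C) = GB C" by (simp add: GB_def)
  qed
  show "continuous_on DomB GB"
    by (rule continuous_on_coords_analytic) (rule coords_analytic_GB[OF analytic_at_coord])
  show "continuous_on UNIV secB" unfolding secB_def by (intro continuous_on_vec6 continuous_intros)
  have nsec: "normB (secB v) = secB v" for v
    by (simp add: normB_def secB_def vector_6 pull_id)
  show "secB v \<in> DomB \<and> GB (secB v) = v" if "v \<in> UNIV" for v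
    using secB_in_DomB by (simp add: GB_def nsec) (simp add: secB_def vec4_eq_iff vector_6 vector_4)
  show "\<exists>v\<in>UNIV. moduli_proj (secB v) = moduli_proj C" if C: "C \<in> DomB" for C
  proof -
    have u: "trace2 C \<noteq> 0" and CZ: "C \<in> Z23B" using C by (auto simp: DomB_def)
    have n: "normB C $ 1 + normB C $ 4 = 0" "normB C $ 3 + normB C $ 6 = 1"
    proof -
      show "normB C $ 1 + normB C $ 4 = 0" unfolding normB_def pull_trace1 using u by simp
      show "normB C $ 3 + normB C $ 6 = 1" unfolding normB_def using pull_covariants(2)[of "1 / trace2 C"] u by simp
    qed
    then have "secB (GB C) = normB C" by (simp add: secB_def GB_def vec_eq_iff forall_6 vector_6 vector_4)
    moreover have "moduli_proj (normB C) = moduli_proj C"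
      unfolding normB_def by (rule moduli_proj_pull) (use u CZ in auto)
    ultimately show ?thesis by (intro bexI[of _ "GB C"]) auto
  qed
qed auto

lemma lift_B: "\<exists>L. (\<forall>i. analytic_at (\<lambda>y. L y $ i) w) \<and> (\<forall>\<^sub>F y in nhds w. L y \<in> DomB \<and> GB (L y) = y)"
proof (intro exI[of _ secB] conjI allI)
  interpret quotient_chart DomB GB UNIV UNIV secB "\<lambda>w. w" by (rule quotient_chart_B)
  show "analytic_at (\<lambda>y. secB y $ i) w" for i
    using exhaust_6[of i] by (elim disjE; simp add: secB_def vector_6; intro analytic_intros)
  show "\<forall>\<^sub>F y in nhds w. secB y \<in> DomB \<and> GB (secB y) = y" using sec by simp
qed

text \<open>Away from the charts above, the quadratic form with coefficients \<open>C\<^sub>i\<^sub>j\<^sup>1\<close> is indefinite.  The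
  sign of \<open>ncov\<close> singles out one of its two real roots, analytically even where the form degenerates
  to a linear one.\<close>

definition eta :: "real^6 \<Rightarrow> real" where "eta C = - sgn (ncov C) * sqrt (- qform_disc C)"
text \<open>Both branches agree with \<open>- C$1 / (C$3 + eta C)\<close> where that denominator is
  nonzero, and this expression continues across \<open>C$5 = 0\<close> because
  \<open>eta C = C$3\<close> there.\<close>

definition root :: "real^6 \<Rightarrow> real" where
  "root C = (if C$5 = 0 then - C$1 / (2 * C$3) else (eta C - C$3) / C$5)"
definition DomN :: "(real^6) set" where "DomN = {C \<in> Z23B. qform_disc C < 0 \<and> ncov C \<noteq> 0}"
definition normN :: "real^6 \<Rightarrow> real^6" where "normN C = pull (root C) (1 / eta C) C"
definition GN :: "real^6 \<Rightarrow> real^4" where "GN C = vector [normN C $ 2, normN C $ 4, normN C $ 5, trace2 (normN C)]"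
definition secN :: "real^4 \<Rightarrow> real^6" where "secN w = vector [0, w$1, 1, w$2, w$3, w$4 - 1]"
text \<open>The condition \<open>ncov (secN w) < 0\<close>. With this sign the distinguished root of
  the quadratic form of \<open>secN w\<close> is 0, so that \<open>secN w\<close> is already
  normalised.\<close>

definition OmN :: "(real^4) set" where "OmN = {w. (w$3)\<^sup>2 * w$1 - 2 * w$2 * w$3 < 2}"

text \<open>The shear by \<open>root C\<close> turns \<open>C_12^1\<close> into
  \<open>eta C\<close>, which explains the scaling by its inverse in \<open>normN\<close>. At
  \<open>C$5 = 0\<close> the square root is the absolute value of \<open>C$3\<close>, and the sign
  of \<open>ncov\<close> restores its sign.\<close>

lemma eta_facts:
  assumes "qform_disc C < 0" "ncov C \<noteq> 0"
  shows "eta C \<noteq> 0" "(eta C)\<^sup>2 = (C$3)\<^sup>2 - C$1 * C$5" "C$5 = 0 \<Longrightarrow> eta C = C$3" "C$3 + eta C \<noteq> 0 \<Longrightarrow> root C = - C$1 / (C$3 + eta C)"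
    "C$3 + root C * C$5 = eta C"
proof -
  have s: "(sgn (ncov C))\<^sup>2 = 1" using assms(2) by (auto simp: sgn_real_def)
  show e0: "eta C \<noteq> 0" using assms by (auto simp: eta_def sgn_zero_iff)
  show e2: "(eta C)\<^sup>2 = (C$3)\<^sup>2 - C$1 * C$5" using assms(1) s by (simp add: eta_def power_mult_distrib)
  show e5: "eta C = C$3" if "C$5 = 0"
  proof -
    have n: "ncov C = - 2 * C$3 ^ 3" using that by (simp add: ncov_def power2_eq_square power3_eq_cube algebra_simps)
    have "sqrt (- qform_disc C) = \<bar>C$3\<bar>" using that by simp
    moreover have "sgn (ncov C) = - sgn (C$3)" unfolding n by (auto simp: sgn_real_def zero_less_power_eq power_less_zero_eq mult_less_0_iff)
    ultimately show ?thesis by (simp add: eta_def sgn_mult_abs)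
  qed
  show "root C = - C$1 / (C$3 + eta C)" if "C$3 + eta C \<noteq> 0"
  proof (cases "C$5 = 0")
    case False
    have "(eta C - C$3) * (C$3 + eta C) = - C$1 * C$5" using e2 by (simp add: algebra_simps power2_eq_square)
    then show ?thesis using False that by (simp add: root_def field_simps)
  qed (use e5 in \<open>simp add: root_def\<close>)
  show "C$3 + root C * C$5 = eta C" using e5 by (cases "C$5 = 0") (auto simp: root_def)
qed

text \<open>The odd weight of \<open>ncov\<close> supplies the sign of \<open>c\<close> that is lost
  in the square root of \<open>c^2\<close>.\<close>

lemma eta_pull: assumes c: "c \<noteq> 0" shows "eta (pull b c C) = c * eta C"
proof -
  have s: "sqrt (- (c\<^sup>2 * q)) = \<bar>c\<bar> * sqrt (- q)" for q :: real
    using real_sqrt_mult[of "c\<^sup>2" "- q"] by simp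
  have "sgn (c^3 * ncov C) * \<bar>c\<bar> = c * sgn (ncov C)"
    by (simp add: sgn_mult power3_eq_cube) (auto simp: sgn_real_def)
  then have "- sgn (c^3 * ncov C) * (\<bar>c\<bar> * x) = c * (- sgn (ncov C) * x)" for x
    by (simp only: mult_minus_left mult_minus_right mult.assoc[symmetric])
  then show ?thesis
    unfolding eta_def ncov_pull[OF c] pull_covariants(3)[OF c] s .
qed

text \<open>Since \<open>eta\<close> is multiplied by exactly \<open>c\<close>, sign included, the
  distinguished root goes to the distinguished root and is not exchanged with the other one.\<close>

lemma root_pull:
  assumes C: "qform_disc C < 0" "ncov C \<noteq> 0" and c: "c \<noteq> 0"
  shows "b + c * root (pull b c C) = root C"
proof (cases "C$5 = 0")
  case True
  have "C$3 \<noteq> 0" using C(1) True by auto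
  then show ?thesis using True c by (simp add: root_def pull_def vector_6 field_simps)
next
  case False
  have p: "pull b c C $ 5 = c\<^sup>2 * C$5" "pull b c C $ 3 = c * (C$3 + b * C$5)"
    by (simp_all add: pull_def vector_6 algebra_simps)
  have "root (pull b c C) = (c * eta C - c * (C$3 + b * C$5)) / (c\<^sup>2 * C$5)"
    unfolding root_def p eta_pull[OF c] using False c by simp
  also have "c * \<dots> = (eta C - C$3) / C$5 - b" using False c by (simp add: field_simps power2_eq_square)
  finally show ?thesis using False by (simp add: root_def)
qed

lemma eventually_ne_isCont:
  fixes f :: "'a::t2_space \<Rightarrow> real"
  assumes "isCont f x" "f x \<noteq> 0" shows "\<forall>\<^sub>F y in nhds x. f y \<noteq> 0"
proof -
  have "isCont (\<lambda>y. f y * f y) x" using assms(1) by (intro continuous_intros)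
  moreover have "0 < f x * f x" using assms(2) by (auto simp: zero_less_mult_iff linorder_neq_iff)
  ultimately have "\<forall>\<^sub>F y in nhds x. 0 < f y * f y" by (rule eventually_pos_isCont)
  then show ?thesis by (rule eventually_mono) auto
qed

text \<open>Near \<open>w\<close> the sign of \<open>ncov\<close> is constant, so \<open>eta\<close>
  coincides with the analytic function \<open>h\<close>. When \<open>L w $ 5 = 0\<close>, the root
  is taken in the form with denominator \<open>C$3 + eta C\<close>, which stays away from 0.\<close>

lemma coords_analytic_GN:
  assumes L: "\<And>i. analytic_at (\<lambda>y. L y $ i) w" and w: "L w \<in> DomN"
  shows "coords_analytic_at (\<lambda>y. GN (L y)) w"
proof -
  have d: "qform_disc (L w) < 0" and n: "ncov (L w) \<noteq> 0" using w by (auto simp: DomN_def)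
  note e = eta_facts[OF d n]
  define k where "k = - sgn (ncov (L w))"
  define h where "h y = k * sqrt (- qform_disc (L y))" for y
  have na: "analytic_at (\<lambda>y. ncov (L y)) w" unfolding ncov_def by (intro analytic_intros L)
  have da: "analytic_at (\<lambda>y. - qform_disc (L y)) w" by (intro analytic_intros L)
  have ha: "analytic_at h w" unfolding h_def by (intro analytic_at_mult analytic_at_const analytic_at_sqrt da) (use d in simp)
  have hw: "h w = eta (L w)" by (simp add: h_def k_def eta_def)
  have ev_d: "\<forall>\<^sub>F y in nhds w. 0 < - qform_disc (L y)"
    by (rule eventually_pos_isCont[OF analytic_at_imp_isCont[OF da]]) (use d in simp)
  have "\<forall>\<^sub>F y in nhds w. 0 < ncov (L w) * ncov (L y)"
    by (rule eventually_pos_isCont[OF analytic_at_imp_isCont[OF analytic_at_mult[OF analytic_at_const na]]])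
      (use n in \<open>auto simp: zero_less_mult_iff linorder_neq_iff\<close>)
  then have ev_n: "\<forall>\<^sub>F y in nhds w. ncov (L y) \<noteq> 0 \<and> eta (L y) = h y"
  proof (rule eventually_mono)
    fix y assume "0 < ncov (L w) * ncov (L y)"
    then have "sgn (ncov (L y)) = sgn (ncov (L w))" "ncov (L y) \<noteq> 0" by (auto simp: sgn_real_def zero_less_mult_iff)
    then show "ncov (L y) \<noteq> 0 \<and> eta (L y) = h y" by (simp add: eta_def h_def k_def)
  qed
  obtain b where b: "analytic_at b w" "\<forall>\<^sub>F y in nhds w. root (L y) = b y"
  proof (cases "L w $ 5 = 0")
    case False
    have "analytic_at (\<lambda>y. (h y - L y $ 3) / L y $ 5) w" by (intro analytic_intros ha L False)
    moreover have "\<forall>\<^sub>F y in nhds w. L y $ 5 \<noteq> 0" by (rule eventually_ne_isCont[OF analytic_at_imp_isCont[OF L] False])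
    with ev_n have "\<forall>\<^sub>F y in nhds w. root (L y) = (h y - L y $ 3) / L y $ 5"
      by eventually_elim (simp add: root_def)
    ultimately show thesis by (rule that)
  next
    case True
    have "L w $ 3 \<noteq> 0" using d True by auto
    then have ne: "L w $ 3 + h w \<noteq> 0" using e(3)[OF True] hw by simp
    have sa: "analytic_at (\<lambda>y. L y $ 3 + h y) w" by (intro analytic_intros ha L)
    have "analytic_at (\<lambda>y. - L y $ 1 / (L y $ 3 + h y)) w" by (intro analytic_at_divide analytic_at_minus sa L ne)
    moreover have "\<forall>\<^sub>F y in nhds w. L y $ 3 + h y \<noteq> 0" by (rule eventually_ne_isCont[OF analytic_at_imp_isCont[OF sa] ne])
    with ev_n ev_d have "\<forall>\<^sub>F y in nhds w. root (L y) = - L y $ 1 / (L y $ 3 + h y)"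
    proof eventually_elim
      case (elim y)
      then show ?case using eta_facts(4)[of "L y"] by auto
    qed
    ultimately show thesis by (rule that)
  qed
  define P where "P y = pull (b y) (1 / h y) (L y)" for y
  have hne: "h w \<noteq> 0" using hw e(1) by simp
  have Pa: "analytic_at (\<lambda>y. P y $ i) w" for i
    unfolding P_def by (intro analytic_at_pull b(1) analytic_at_divide analytic_at_const ha hne L) (use hne in simp)
  have "\<forall>\<^sub>F y in nhds w. normN (L y) = P y"
    using ev_n b(2) by eventually_elim (simp add: normN_def P_def)
  then have ev: "\<forall>\<^sub>F y in nhds w. GN (L y) $ j = (vector [P y $ 2, P y $ 4, P y $ 5, P y $ 3 + P y $ 6] :: real^4) $ j" for j
    by eventually_elim (simp add: GN_def)
  have "analytic_at (\<lambda>y. (vector [P y $ 2, P y $ 4, P y $ 5, P y $ 3 + P y $ 6] :: real^4) $ j) w" for j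
    using exhaust_4[of j] by (elim disjE; simp add: vector_4; intro analytic_intros Pa)
  then show ?thesis unfolding coords_analytic_at_def using ev by blast
qed

lemma secN_facts:
  "qform_disc (secN w) = -1" "trace2 (secN w) = w$4" "ncov (secN w) = (w$3)\<^sup>2 * w$1 - 2 * w$2 * w$3 - 2"
  by (simp_all add: secN_def vector_6 ncov_def algebra_simps power2_eq_square)

text \<open>Flatness would give \<open>ncov (secN w) = 0\<close>, which the strict inequality in
  \<open>OmN\<close> excludes.\<close>

lemma secN_in_DomN: assumes w: "w \<in> OmN" shows "secN w \<in> DomN"
proof -
  have "curv (secN w) \<noteq> 0"
  proof
    assume "curv (secN w) = 0"
    then have m: "w$2 - w$1 * w$3 - 1 = 0" "w$4 - 2 - w$2 * w$3 - w$3 = 0" "w$1 * w$3 - w$2 - (w$4 - 1) = 0"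
      by (simp_all add: curv_def secN_def vector_6 zero_prod_def)
    then have "w$4 = 0" by linarith
    then have "w$3 * (w$2 + 1) = -2" using m(2) by (simp add: algebra_simps)
    moreover have "(w$3)\<^sup>2 * w$1 - 2 * w$2 * w$3 = w$3 * (w$1 * w$3 - w$2 + 1) - w$3 * (w$2 + 1)"
      by (simp add: algebra_simps power2_eq_square)
    moreover have "w$1 * w$3 - w$2 + 1 = 0" using m(1) by linarith
    ultimately show False using w by (simp add: OmN_def)
  qed
  moreover have "secN w $ 3 \<noteq> 0" by (simp add: secN_def vector_6)
  ultimately have "secN w \<in> Z23B" by (auto simp: Z23B_eq)
  then show ?thesis unfolding DomN_def mem_Collect_eq secN_facts using w by (simp add: OmN_def)
qed

lemma quotient_chart_N: "quotient_chart DomN GN OmN OmN secN (\<lambda>w. w)"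
proof
  have cn: "continuous_on UNIV ncov" unfolding ncov_def by (intro continuous_intros)
  show "open DomN"
  proof -
    have eq: "DomN = Z23B \<inter> ({C. qform_disc C < 0} \<inter> - {C. ncov C = 0})" by (auto simp: DomN_def)
    have "closed {C. ncov C = 0}" by (intro closed_Collect_eq cn continuous_intros)
    moreover have "open {C::real^6. qform_disc C < 0}" by (intro open_Collect_less continuous_intros)
    ultimately show ?thesis unfolding eq by (intro open_Int open_Z23B open_Compl)
  qed
  show "DomN \<subseteq> Z23B" by (auto simp: DomN_def)
  show "pull b c C \<in> DomN \<and> GN (pull b c C) = GN C" if C: "C \<in> DomN" and c: "c \<noteq> 0" for C b c
  proof
    have d: "qform_disc C < 0" "ncov C \<noteq> 0" using C by (auto simp: DomN_def)
    have "c\<^sup>2 * qform_disc C < 0" using d(1) c by (simp add: mult_pos_neg)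
    then show "pull b c C \<in> DomN"
      using C c d(2) pull_in_Z23B[OF c] unfolding DomN_def mem_Collect_eq pull_covariants(3)[OF c] ncov_pull[OF c] by simp
    have e: "eta C \<noteq> 0" by (rule eta_facts(1)[OF d])
    have "normN (pull b c C) = pull (b + c * root (pull b c C)) (c * (1 / (c * eta C))) C"
      unfolding normN_def eta_pull[OF c] using c e by (intro pull_pull) simp_all
    also have "\<dots> = normN C" unfolding root_pull[OF d c] normN_def using c by simp
    finally show "GN (pull b c C) = GN C" by (simp add: GN_def)
  qed
  show "continuous_on DomN GN"
    by (rule continuous_on_coords_analytic) (rule coords_analytic_GN[OF analytic_at_coord])
  show "continuous_on OmN secN" unfolding secN_def by (intro continuous_on_vec6 continuous_intros)
  show "open OmN" unfolding OmN_def by (intro open_Collect_less continuous_intros)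
  show "secN w \<in> DomN \<and> GN (secN w) = w" if w: "w \<in> OmN" for w
  proof
    have "sgn (ncov (secN w)) = -1" using w by (simp add: secN_facts(3) OmN_def sgn_real_def)
    then have "eta (secN w) = 1" by (simp add: eta_def secN_facts(1))
    moreover from this have "root (secN w) = 0" by (simp add: root_def secN_def vector_6)
    ultimately have "normN (secN w) = secN w" by (simp add: normN_def pull_id)
    then show "GN (secN w) = w" by (simp add: GN_def) (simp add: secN_def vector_6 vec4_eq_iff vector_4)
  qed (rule secN_in_DomN[OF w])
  show "\<exists>v\<in>OmN. moduli_proj (secN v) = moduli_proj C" if C: "C \<in> DomN" for C
  proof -
    have d: "qform_disc C < 0" "ncov C \<noteq> 0" and CZ: "C \<in> Z23B" using C by (auto simp: DomN_def)
    note e = eta_facts[OF d]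
    have c: "1 / eta C \<noteq> 0" using e(1) by simp
    have n3: "normN C $ 3 = 1"
    proof -
      have "normN C $ 3 = (C$3 + root C * C$5) / eta C" by (simp add: normN_def pull_def vector_6 add_divide_distrib)
      then show ?thesis unfolding e(5) using e(1) by simp
    qed
    have "qform_disc (normN C) = (1 / eta C)\<^sup>2 * qform_disc C" unfolding normN_def by (rule pull_covariants(3)[OF c])
    also have "\<dots> = -1" using e(1,2) by (simp add: power_divide field_simps)
    finally have dn: "qform_disc (normN C) = -1" .
    have n1: "normN C $ 1 = 0"
    proof (cases "C$5 = 0")
      case True
      have "C$3 \<noteq> 0" using d(1) True by auto
      then show ?thesis using True by (simp add: normN_def pull_def vector_6 root_def)
    next
      case False
      then have "normN C $ 5 \<noteq> 0" using e(1) by (simp add: normN_def pull_def vector_6)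
      then show ?thesis using dn n3 by simp
    qed
    define v :: "real^4" where "v = GN C"
    have vN: "secN v = normN C"
      using n1 n3 by (simp add: v_def GN_def secN_def vec_eq_iff forall_6 vector_6 vector_4)
    \<comment> \<open>By definition \<open>eta\<close> has the sign opposite to \<open>ncov\<close>,
      so dividing by its cube always leaves a negative number.\<close>
    have "ncov (normN C) = (1 / eta C)^3 * ncov C" unfolding normN_def by (rule ncov_pull[OF c])
    also have "\<dots> < 0"
    proof -
      have "sgn ((1 / eta C)^3 * ncov C) = - 1"
      proof -
        have "sgn (eta C) = - sgn (ncov C)" using d by (simp add: eta_def sgn_mult)
        then show ?thesis using d(2) by (simp add: sgn_mult power3_eq_cube sgn_divide) (auto simp: sgn_real_def)
      qed
      then show ?thesis by (simp only: sgn_1_neg)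
    qed
    finally have "v \<in> OmN" unfolding vN[symmetric] secN_facts(3) OmN_def by simp
    moreover have "moduli_proj (secN v) = moduli_proj C"
      unfolding vN normN_def by (rule moduli_proj_pull[OF CZ c])
    ultimately show ?thesis by blast
  qed
qed auto

lemma lift_N: assumes "w \<in> OmN"
  shows "\<exists>L. (\<forall>i. analytic_at (\<lambda>y. L y $ i) w) \<and> (\<forall>\<^sub>F y in nhds w. L y \<in> DomN \<and> GN (L y) = y)"
proof (intro exI[of _ secN] conjI allI)
  interpret quotient_chart DomN GN OmN OmN secN "\<lambda>w. w" by (rule quotient_chart_N)
  show "analytic_at (\<lambda>y. secN y $ i) w" for i
    using exhaust_6[of i] by (elim disjE; simp add: secN_def vector_6; intro analytic_intros)
  show "\<forall>\<^sub>F y in nhds w. secN y \<in> DomN \<and> GN (secN y) = y"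
    using eventually_nhds_in_open[OF open_Om assms] by (rule eventually_mono) (rule sec)
qed

section \<open>Covering by the four charts and their compatibility\<close>

global_interpretation Qp: quotient_chart "DomQ 1" "GQ 1" "- {flat_point}" "- {flat_point}" "secQ 1" square34
  by (rule quotient_chart_Q) simp
global_interpretation Qm: quotient_chart "DomQ (-1)" "GQ (-1)" "- {flat_point}" "- {flat_point}" "secQ (-1)" square34
  by (rule quotient_chart_Q) simp
global_interpretation B: quotient_chart DomB GB UNIV UNIV secB "\<lambda>w. w"
  by (rule quotient_chart_B)
global_interpretation N: quotient_chart DomN GN OmN OmN secN "\<lambda>w. w"
  by (rule quotient_chart_N)

text \<open>These conditions and membership in \<open>Z23B\<close> force
  \<open>C$3 \<noteq> 0\<close>; the determinant of the form is then \<open>- (C$3)^2\<close> and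
  \<open>ncov C\<close> is \<open>-2 * (C$3)^3\<close>.\<close>

lemma degenerate_in_DomN: assumes "C \<in> Z23B" "C$5 = 0" "trace2 C = 0" shows "C \<in> DomN"
proof -
  have "C$3 \<noteq> 0" using assms by (auto simp: Z23B_eq)
  moreover have "C$6 = - C$3" using assms(3) by simp
  ultimately show ?thesis using assms(1,2) by (simp add: DomN_def ncov_def)
qed

lemma Z23B_charts: "Z23B = DomQ 1 \<union> DomQ (-1) \<union> DomB \<union> DomN"
  using degenerate_in_DomN by (auto simp: DomQ_def DomB_def DomN_def)

definition moduli_atlas :: "((real^6) set set \<times> ((real^6) set \<Rightarrow> real^4)) set" where
  "moduli_atlas = {(Qp.U, Qp.phi), (Qm.U, Qm.phi), (B.U, B.phi), (N.U, N.phi)}"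

lemma moduli_atlas_cover: "(\<Union>\<kappa>\<in>moduli_atlas. fst \<kappa>) = topspace moduli_space"
  by (simp add: moduli_atlas_def topspace_moduli Z23B_charts Qp.U_def Qm.U_def B.U_def N.U_def image_Un Un_assoc)

text \<open>On the slice \<open>secQ \<epsilon>\<close> the trace is \<open>v$3\<close>, and
  \<open>ncov\<close> is \<open>v$4 + \<epsilon> * v$1 * v$3\<close>. Hence \<open>sub\<close> keeps
  the overlap away from the branch locus where \<open>v$3\<close> and \<open>v$4\<close> vanish, and
  local lifts exist.\<close>

lemma transition_from_Q:
  assumes \<epsilon>: "\<epsilon> = 1 \<or> \<epsilon> = -1" and c2: "quotient_chart Dom2 G2 Om2 Om2' sec2 s2"
    and sub: "\<And>C. C \<in> Dom2 \<Longrightarrow> trace2 C \<noteq> 0 \<or> ncov C \<noteq> 0"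
    and G2: "\<And>(L :: real^4 \<Rightarrow> real^6) w. (\<And>i. analytic_at (\<lambda>y. L y $ i) w) \<Longrightarrow> L w \<in> Dom2 \<Longrightarrow> coords_analytic_at (\<lambda>y. G2 (L y)) w"
  shows "real_analytic_on (quotient_chart.phi (GQ \<epsilon>) ` (quotient_chart.U (DomQ \<epsilon>) \<inter> quotient_chart.U Dom2))
      (quotient_chart.phi G2 \<circ> inv_into (quotient_chart.U (DomQ \<epsilon>)) (quotient_chart.phi (GQ \<epsilon>)))"
proof (rule transition_analytic[OF quotient_chart_Q[OF \<epsilon>] c2 _ G2])
  interpret c1: quotient_chart "DomQ \<epsilon>" "GQ \<epsilon>" "- {flat_point}" "- {flat_point}" "secQ \<epsilon>" square34
    by (rule quotient_chart_Q[OF \<epsilon>])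
  interpret c2: quotient_chart Dom2 G2 Om2 Om2' sec2 s2 by (rule c2)
  fix w assume "w \<in> c1.phi ` (c1.U \<inter> c2.U)"
  then obtain x where x: "x \<in> c1.U" "x \<in> c2.U" "w = c1.phi x" by blast
  then obtain v where v: "v \<in> - {flat_point}" "x = moduli_proj (secQ \<epsilon> v)" "w = square34 v"
    using c1.U_cases by metis
  have "secQ \<epsilon> v \<in> Dom2" using x(2) v c1.sec c1.Dom_sub c2.proj_in_U_iff by blast
  from sub[OF this] have "v$3 \<noteq> 0 \<or> v$4 \<noteq> 0"
    using \<epsilon> by (auto simp: secQ_def vector_6 ncov_def)
  then have "w$3 \<noteq> 0 \<or> w$4 \<noteq> 0"
    unfolding v(3) square34_def vector_4 by (auto simp: power2_eq_square)
  then show "\<exists>L. (\<forall>i. analytic_at (\<lambda>y. L y $ i) w) \<and> (\<forall>\<^sub>F y in nhds w. L y \<in> DomQ \<epsilon> \<and> GQ \<epsilon> (L y) = y)"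
    by (rule lift_Q[OF \<epsilon>])
qed

lemma Qp_Qm_disjoint: "Qp.U \<inter> Qm.U = {}"
proof -
  have "False" if x: "x \<in> Qp.U" "x \<in> Qm.U" for x
  proof -
    obtain C where C: "C \<in> DomQ 1" "x = moduli_proj C" using x(1) unfolding Qp.U_def by blast
    then have "C \<in> DomQ (-1)" using x(2) Qm.proj_in_U_iff Qp.Dom_sub by blast
    then show False using C(1) by (simp add: DomQ_def)
  qed
  then show ?thesis by blast
qed

lemma analytic_atlas_moduli: "analytic_atlas moduli_space moduli_atlas"
proof -
  have B: "trace2 C \<noteq> 0 \<or> ncov C \<noteq> 0" if "C \<in> DomB" for C using that by (simp add: DomB_def)
  have N: "trace2 C \<noteq> 0 \<or> ncov C \<noteq> 0" if "C \<in> DomN" for C using that by (simp add: DomN_def)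
  have liftN: "\<exists>L. (\<forall>i. analytic_at (\<lambda>y. L y $ i) w) \<and> (\<forall>\<^sub>F y in nhds w. L y \<in> DomN \<and> GN (L y) = y)"
    if "w \<in> N.phi ` (N.U \<inter> V)" for w V
    by (rule lift_N) (use that N.phi_image in auto)
  have one: "(1::real) = 1 \<or> (1::real) = -1" "(-1::real) = 1 \<or> (-1::real) = -1" by simp_all
  note fromQ = transition_from_Q[OF one(1) quotient_chart_B B coords_analytic_GB] transition_from_Q[OF one(2) quotient_chart_B B coords_analytic_GB]
     transition_from_Q[OF one(1) quotient_chart_N N coords_analytic_GN] transition_from_Q[OF one(2) quotient_chart_N N coords_analytic_GN]
  note fromB = transition_analytic[OF quotient_chart_B quotient_chart_Q[OF one(1)] lift_B coords_analytic_GQ]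
     transition_analytic[OF quotient_chart_B quotient_chart_Q[OF one(2)] lift_B coords_analytic_GQ]
     transition_analytic[OF quotient_chart_B quotient_chart_N lift_B coords_analytic_GN]
  note fromN = transition_analytic[OF quotient_chart_N quotient_chart_Q[OF one(1)] liftN coords_analytic_GQ]
     transition_analytic[OF quotient_chart_N quotient_chart_Q[OF one(2)] liftN coords_analytic_GQ]
     transition_analytic[OF quotient_chart_N quotient_chart_B liftN coords_analytic_GB]
  note self = transition_self_analytic[OF quotient_chart_B] transition_self_analytic[OF quotient_chart_N]
     transition_self_analytic[OF quotient_chart_Q[OF one(1)]] transition_self_analytic[OF quotient_chart_Q[OF one(2)]]
  have emp: "real_analytic_on {} f" for f :: "real^4 \<Rightarrow> real^4" by (simp add: real_analytic_on_def)
  have QQ: "Qp.U \<inter> Qm.U = {}" "Qm.U \<inter> Qp.U = {}" using Qp_Qm_disjoint by auto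
  have "\<forall>(U, \<phi>)\<in>moduli_atlas. \<forall>(V, \<psi>)\<in>moduli_atlas. real_analytic_on (\<phi> ` (U \<inter> V)) (\<psi> \<circ> inv_into U \<phi>)"
    unfolding moduli_atlas_def ball_simps split QQ image_empty by (intro conjI TrueI fromQ fromB fromN self emp)
  moreover have "\<forall>\<kappa>\<in>moduli_atlas. is_chart moduli_space \<kappa>"
    unfolding moduli_atlas_def using Qp.is_chart Qm.is_chart B.is_chart N.is_chart by blast
  ultimately show ?thesis unfolding analytic_atlas_def using moduli_atlas_cover by blast
qed

lemma (in quotient_chart) analytic_proj:
  assumes "\<And>(L :: real^6 \<Rightarrow> real^6) w. (\<And>i. analytic_at (\<lambda>y. L y $ i) w) \<Longrightarrow> L w \<in> Dom \<Longrightarrow> coords_analytic_at (\<lambda>y. G (L y)) w"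
  shows "real_analytic_on {x \<in> Z23B. moduli_proj x \<in> U} (phi \<circ> moduli_proj)"
proof -
  have eq: "{x \<in> Z23B. moduli_proj x \<in> U} = Dom" using proj_in_U_iff Dom_sub by blast
  show ?thesis
    unfolding eq
  proof (rule real_analytic_onI[OF open_Dom])
    fix C j assume C: "C \<in> Dom"
    obtain g where g: "analytic_at g C" "\<forall>\<^sub>F y in nhds C. G y $ j = g y"
      using assms[OF analytic_at_coord C] unfolding coords_analytic_at_def by blast
    have "\<forall>\<^sub>F y in nhds C. (phi \<circ> moduli_proj) y $ j = g y"
      using g(2) eventually_nhds_in_open[OF open_Dom C] by eventually_elim (simp add: phi_proj)
    then show "\<exists>g. analytic_at g C \<and> (\<forall>\<^sub>F y in nhds C. (phi \<circ> moduli_proj) y $ j = g y)" using g(1) by blast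
  qed
qed

lemma analytic_into_moduli: "analytic_into Z23B moduli_space moduli_atlas moduli_proj"
proof -
  have "continuous_map (top_of_set Z23B) moduli_space moduli_proj"
    using quotient_map_moduli by (rule quotient_imp_continuous_map)
  moreover note Qp.analytic_proj[OF coords_analytic_GQ] Qm.analytic_proj[OF coords_analytic_GQ]
     B.analytic_proj[OF coords_analytic_GB] N.analytic_proj[OF coords_analytic_GN]
  ultimately show ?thesis
    unfolding analytic_into_def moduli_atlas_def using open_Z23B by simp
qed

section \<open>Countability and separation\<close>

lemma second_countable_moduli: "second_countable moduli_space"
proof (rule second_countable_open_map_image)
  show "continuous_map (top_of_set Z23B) moduli_space moduli_proj"
    using quotient_map_moduli by (rule quotient_imp_continuous_map)
  show "open_map (top_of_set Z23B) moduli_space moduli_proj"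
    unfolding open_map_def openin_open_eq[OF open_Z23B] using open_moduli_proj by simp
  show "moduli_proj ` topspace (top_of_set Z23B) = topspace moduli_space" by (simp add: topspace_moduli)
  obtain \<B> :: "(real^6) set set" where \<B>: "countable \<B>" "\<And>C. C \<in> \<B> \<Longrightarrow> open C" "\<And>S. open S \<Longrightarrow> \<exists>U. U \<subseteq> \<B> \<and> S = \<Union>U"
    using univ_second_countable by blast
  have "second_countable (euclidean :: (real^6) topology)"
    unfolding second_countable_def open_openin[symmetric]
  proof (intro exI[of _ \<B>] conjI ballI allI impI)
    fix S :: "(real^6) set" and x assume "open S \<and> x \<in> S"
    then obtain K where "K \<subseteq> \<B>" "S = \<Union>K" "x \<in> S" using \<B>(3)[of S] by auto
    then show "\<exists>V\<in>\<B>. x \<in> V \<and> V \<subseteq> S" by fast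
  qed (use \<B>(1,2) in simp_all)
  then show "second_countable (top_of_set Z23B)" by (rule second_countable_subtopology)
qed

text \<open>Disjoint neighbourhoods of two different values of an invariant function have disjoint
  invariant preimages, and the projection is open.\<close>

lemma moduli_separation:
  fixes f :: "real^6 \<Rightarrow> real"
  assumes f: "continuous_on Z23B f" "\<And>C b c. C \<in> Z23B \<Longrightarrow> c \<noteq> 0 \<Longrightarrow> f (pull b c C) = f C"
    and CD: "C \<in> Z23B" "D \<in> Z23B" "f C \<noteq> f D"
  shows "\<exists>V W. openin moduli_space V \<and> openin moduli_space W \<and> moduli_proj C \<in> V \<and> moduli_proj D \<in> W \<and> disjnt V W"
proof -
  obtain S T where ST: "open S" "open T" "f C \<in> S" "f D \<in> T" "S \<inter> T = {}" using hausdorff[OF CD(3)] by blast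
  have o: "openin moduli_space (moduli_proj ` (Z23B \<inter> f -` S))" "openin moduli_space (moduli_proj ` (Z23B \<inter> f -` T))"
    by (rule open_moduli_proj[OF continuous_open_preimage[OF f(1) open_Z23B]]; use ST in blast)+
  have "disjnt (moduli_proj ` (Z23B \<inter> f -` S)) (moduli_proj ` (Z23B \<inter> f -` T))"
  proof -
    have "False" if x: "x \<in> Z23B" "f x \<in> S" "y \<in> Z23B" "f y \<in> T" "moduli_proj x = moduli_proj y" for x y
    proof -
      obtain b c where "c \<noteq> 0" "y = pull b c x" using moduli_proj_eq_iff[OF x(1,3)] x(5) by blast
      then have "f y = f x" using f(2)[OF x(1)] by simp
      then show False using x ST(5) by auto
    qed
    then show ?thesis unfolding disjnt_def by blast
  qed
  moreover have "moduli_proj C \<in> moduli_proj ` (Z23B \<inter> f -` S)" "moduli_proj D \<in> moduli_proj ` (Z23B \<inter> f -` T)"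
    using CD ST by (auto intro!: imageI)
  ultimately show ?thesis using o by (intro exI conjI)
qed

lemma (in quotient_chart) separation:
  assumes xy: "x \<in> U" "y \<in> U" "x \<noteq> y"
  shows "\<exists>V W. openin moduli_space V \<and> openin moduli_space W \<and> x \<in> V \<and> y \<in> W \<and> disjnt V W"
proof -
  have "phi x \<noteq> phi y" using inj_on_phi xy by (auto dest: inj_onD)
  then obtain S T where ST: "open S" "open T" "phi x \<in> S" "phi y \<in> T" "S \<inter> T = {}" using hausdorff[of "phi x" "phi y"] by auto
  have d: "disjnt {z \<in> U. phi z \<in> S} {z \<in> U. phi z \<in> T}" using ST(5) unfolding disjnt_def by blast
  have o: "openin moduli_space {z \<in> U. phi z \<in> R}" if "open R" for R
  proof -
    have "openin (subtopology moduli_space U) {z \<in> topspace (subtopology moduli_space U). phi z \<in> Om \<inter> R}"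
      using that by (intro openin_continuous_map_preimage[OF homeomorphic_imp_continuous_map[OF homeomorphic_phi]]) auto
    moreover have "{z \<in> topspace (subtopology moduli_space U). phi z \<in> Om \<inter> R} = {z \<in> U. phi z \<in> R}"
      using U_subset phi_image by auto
    ultimately show ?thesis using openin_trans_full[OF _ openin_U] by simp
  qed
  show ?thesis
    by (intro exI[of _ "{z \<in> U. phi z \<in> S}"] exI[of _ "{z \<in> U. phi z \<in> T}"] conjI o d)
      (use ST(1-4) xy(1,2) in simp_all)
qed

text \<open>Within one chart separation is inherited from Euclidean space, so only pairs without a
  common chart are critical. If the invariants \<open>f\<close> and \<open>g\<close> do not separate
  two orbits, the sign of \<open>C$5\<close> and the vanishing of the trace agree for both, and some
  chart contains both.\<close>

lemma Hausdorff_moduli: "Hausdorff_space moduli_space"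
  unfolding Hausdorff_space_def
proof (intro allI impI)
  fix x y assume "x \<in> topspace moduli_space \<and> y \<in> topspace moduli_space \<and> x \<noteq> y"
  then obtain C D where CD: "C \<in> Z23B" "D \<in> Z23B" "x = moduli_proj C" "y = moduli_proj D" "x \<noteq> y"
    unfolding topspace_moduli by blast
  \<comment> \<open>All summands have weight 2 in \<open>c\<close>, which makes \<open>f\<close> and
    \<open>g\<close> invariant. They vanish together only if the coefficients of index 3, 5 and 6
    do, which \<open>Z23B\<close> excludes.\<close>
  define n where "n C = \<bar>C$5\<bar> + (trace2 C)\<^sup>2 + \<bar>qform_disc C\<bar>" for C :: "real^6"
  define f where "f C = C$5 / n C" for C
  define g where "g C = (trace2 C)\<^sup>2 / n C" for C
  have n0: "n C > 0" if "C \<in> Z23B" for C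
  proof (rule ccontr)
    assume "\<not> n C > 0"
    then have h: "\<bar>C$5\<bar> = 0 \<and> (trace2 C)\<^sup>2 = 0 \<and> \<bar>qform_disc C\<bar> = 0"
      unfolding n_def
      using abs_ge_zero[of "C$5"] zero_le_power2[of "trace2 C"] abs_ge_zero[of "qform_disc C"] by linarith
    then have z: "C$5 = 0" "trace2 C = 0" by simp_all
    have q: "qform_disc C = 0" using h[THEN conjunct2, THEN conjunct2] unfolding abs_eq_0 .
    from q have "(C$3)\<^sup>2 = C$1 * C$5" by linarith
    then have "C$3 = 0" using z(1) by simp
    with z have "C$3 = 0 \<and> C$5 = 0 \<and> C$6 = 0" by simp
    then show False using that by (simp add: Z23B_eq)
  qed
  have cn: "continuous_on Z23B n" unfolding n_def by (intro continuous_intros)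
  have cf: "continuous_on Z23B f" "continuous_on Z23B g"
    unfolding f_def g_def using n0[THEN less_imp_neq, symmetric] by (intro continuous_on_divide cn continuous_intros ballI; simp)+
  have np: "n (pull b c C) = c\<^sup>2 * n C" if "c \<noteq> 0" for b c C
    unfolding n_def unfolding pull_covariants(3)[OF that] unfolding pull_covariants(1-2)[OF that]
    by (simp only: abs_mult power_mult_distrib distrib_left[of "c\<^sup>2"] abs_power2)
  have fp: "f (pull b c C) = f C" "g (pull b c C) = g C" if "c \<noteq> 0" for b c C
    unfolding f_def g_def np[OF that] pull_covariants(1-2)[OF that] using that by (simp_all add: power_mult_distrib)
  show "\<exists>V W. openin moduli_space V \<and> openin moduli_space W \<and> x \<in> V \<and> y \<in> W \<and> disjnt V W"
  proof (cases "f C = f D \<and> g C = g D")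
    case False
    then consider "f C \<noteq> f D" | "g C \<noteq> g D" by blast
    then show ?thesis
      unfolding CD(3,4)
    proof cases
      case 1
      show "\<exists>V W. openin moduli_space V \<and> openin moduli_space W \<and> moduli_proj C \<in> V \<and> moduli_proj D \<in> W \<and> disjnt V W"
        by (rule moduli_separation[OF cf(1) _ CD(1,2) 1]) (rule fp(1))
    next
      case 2
      show "\<exists>V W. openin moduli_space V \<and> openin moduli_space W \<and> moduli_proj C \<in> V \<and> moduli_proj D \<in> W \<and> disjnt V W"
        by (rule moduli_separation[OF cf(2) _ CD(1,2) 2]) (rule fp(2))
    qed
  next
    case True
    have nn: "n C > 0" "n D > 0" using n0 CD(1,2) by auto
    \<comment> \<open>Equal values of \<open>f\<close> and \<open>g\<close> mean that
      \<open>C$5\<close> and the squared trace are proportional with this positive factor.\<close>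
    define k where "k = n C / n D"
    have k0: "k > 0" using nn by (simp add: k_def)
    have k5: "C$5 = k * D$5" and kt: "(trace2 C)\<^sup>2 = k * (trace2 D)\<^sup>2"
      using True nn unfolding f_def g_def k_def by (simp_all add: frac_eq_eq less_imp_neq[symmetric] field_simps)
    consider "D$5 > 0" | "D$5 < 0" | "D$5 = 0" "trace2 D \<noteq> 0" | "D$5 = 0" "trace2 D = 0" by linarith
    then show ?thesis
    proof cases
      case 1
      then have "C \<in> DomQ 1" "D \<in> DomQ 1" using CD(1,2) k0 k5 by (simp_all add: DomQ_def)
      then have "x \<in> Qp.U" "y \<in> Qp.U" by (simp_all only: CD(3,4) Qp.U_def imageI)
      then show ?thesis by (rule Qp.separation[OF _ _ CD(5)])
    next
      case 2
      then have "C \<in> DomQ (-1)" "D \<in> DomQ (-1)" using CD(1,2) k0 k5 by (simp_all add: DomQ_def mult_pos_neg)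
      then have "x \<in> Qm.U" "y \<in> Qm.U" by (simp_all only: CD(3,4) Qm.U_def imageI)
      then show ?thesis by (rule Qm.separation[OF _ _ CD(5)])
    next
      case 3
      then have "(trace2 C)\<^sup>2 \<noteq> 0" unfolding kt using k0 by simp
      then have "C \<in> DomB" "D \<in> DomB" using CD(1,2) 3 by (simp_all add: DomB_def)
      then have "x \<in> B.U" "y \<in> B.U" by (simp_all only: CD(3,4) B.U_def imageI)
      then show ?thesis by (rule B.separation[OF _ _ CD(5)])
    next
      case 4
      have "C$5 = 0" "trace2 C = 0" using k5 kt 4 by simp_all
      then have "C \<in> DomN" by (rule degenerate_in_DomN[OF CD(1)])
      moreover have "D \<in> DomN" by (rule degenerate_in_DomN[OF CD(2) 4])
      ultimately have "x \<in> N.U" "y \<in> N.U" by (simp_all only: CD(3,4) N.U_def imageI)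
      then show ?thesis by (rule N.separation[OF _ _ CD(5)])
    qed
  qed
qed

theorem moduli_manifold: "real_analytic_manifold moduli_space moduli_atlas"
  unfolding real_analytic_manifold_def
  using Hausdorff_moduli second_countable_moduli analytic_atlas_moduli by blast

subsection \<open>Topology of the moduli space\<close>

lemma paths_homotopic_space_Un_open:
  assumes S: "openin X S" and T: "openin X T"
    and Sp: "paths_homotopic_space (subtopology X S)" and Tp: "paths_homotopic_space (subtopology X T)"
    and conn: "path_connected_space (subtopology X (S \<inter> T))" and ne: "S \<inter> T \<noteq> {}"
  shows "paths_homotopic_space (subtopology X (S \<union> T))"
proof -
  have eq: "(S \<union> T) \<inter> S = S" "(S \<union> T) \<inter> T = T" "(S \<union> T) \<inter> (S \<inter> T) = S \<inter> T" by blast+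
  have o: "openin (subtopology X (S \<union> T)) S" "openin (subtopology X (S \<union> T)) T"
    using S T by (simp_all add: openin_open_subtopology openin_Un)
  have "S \<union> T = topspace (subtopology X (S \<union> T))"
    using openin_subset[OF S] openin_subset[OF T] by auto
  then show ?thesis
    by (rule paths_homotopic_space_Un[OF o, unfolded subtopology_subtopology eq, OF _ Sp Tp conn ne])
qed

lemma trivial_reduced_homology_Un_open:
  assumes S: "openin X S" and T: "openin X T" and ne: "S \<inter> T \<noteq> {}"
    and c: "contractible_space (subtopology X (S \<inter> T))"
    and tS: "trivial_group (reduced_homology_group p (subtopology X S))"
    and tT: "trivial_group (reduced_homology_group p (subtopology X T))"
  shows "trivial_group (reduced_homology_group p (subtopology X (S \<union> T)))"
proof -
  have eq: "(S \<union> T) \<inter> S = S" "(S \<union> T) \<inter> T = T" "(S \<union> T) \<inter> (S \<inter> T) = S \<inter> T" by blast+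
  have o: "openin (subtopology X (S \<union> T)) S" "openin (subtopology X (S \<union> T)) T"
    using S T by (simp_all add: openin_open_subtopology openin_Un)
  have "S \<union> T = topspace (subtopology X (S \<union> T))"
    using openin_subset[OF S] openin_subset[OF T] by auto
  then show ?thesis
    by (rule trivial_reduced_homology_Un[OF o, unfolded subtopology_subtopology eq, OF _ ne c tS tT])
qed

context quotient_chart
begin

lemma phi_image_Int:
  assumes "\<And>v. v \<in> Om' \<Longrightarrow> moduli_proj (sec v) \<in> V \<longleftrightarrow> P v"
  shows "phi ` (U \<inter> V) = s ` {v \<in> Om'. P v}"
proof (intro subset_antisym image_subsetI)
  fix x assume "x \<in> U \<inter> V"
  then have x: "x \<in> U" "x \<in> V" by simp_all
  obtain v where v: "v \<in> Om'" "x = moduli_proj (sec v)" "phi x = s v" by (rule U_cases[OF x(1)])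
  then show "phi x \<in> s ` {v \<in> Om'. P v}" using assms x(2) by simp
next
  fix v assume "v \<in> {v \<in> Om'. P v}"
  then have v: "v \<in> Om'" "P v" by simp_all
  have D: "sec v \<in> Dom" "G (sec v) = s v" using sec[OF v(1)] by simp_all
  have "moduli_proj (sec v) \<in> U \<inter> V" using assms[OF v(1)] v(2) D(1) by (simp add: U_def)
  moreover have "s v = phi (moduli_proj (sec v))" using phi_proj[OF D(1)] D(2) by simp
  ultimately show "s v \<in> phi ` (U \<inter> V)" by (rule rev_image_eqI)
qed

lemma homeomorphic_space_phi:
  "W \<subseteq> U \<Longrightarrow> subtopology moduli_space W homeomorphic_space top_of_set (phi ` W)"
  by (rule homeomorphic_map_imp_homeomorphic_space[OF homeomorphic_phi_subset])

lemma paths_homotopic_U: "simply_connected Om \<Longrightarrow> paths_homotopic_space (subtopology moduli_space U)"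
  by (rule paths_homotopic_space_homeomorphic[OF homeomorphic_phi paths_homotopic_space_euclidean])

lemma sec_in_Z23B: "v \<in> Om' \<Longrightarrow> sec v \<in> Z23B"
  using sec Dom_sub by blast

end

section \<open>Shapes of the overlaps\<close>

definition slit :: "(real^4) set" where "slit = {w. \<not> (w$4 = 0 \<and> w$3 \<le> 0)}"
definition annulus :: "(real^4) set" where "annulus = {w \<in> OmN. w$3 \<noteq> 0 \<or> w$4 \<noteq> 0}"

lemma slit_nonempty: "slit \<noteq> {}"
proof -
  have "vector [0, 0, 1, 0] \<in> slit" by (simp add: slit_def vector_4)
  then show ?thesis by blast
qed

lemma annulus_nonempty: "annulus \<noteq> {}"
proof -
  have "vector [0, 0, 1, 0] \<in> annulus" by (simp add: annulus_def OmN_def vector_4)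
  then show ?thesis by blast
qed

text \<open>A plane without its closed negative half-line is star-shaped about 1, and the first two
  coordinates contribute a linear factor.\<close>

lemma contractible_slit: "contractible slit"
proof (rule starlike_imp_contractible)
  define a :: "real^4" where "a = vector [0, 0, 1, 0]"
  have a: "a \<in> slit" by (simp add: a_def slit_def vector_4)
  have "y \<in> slit" if x: "x \<in> slit" "y \<in> closed_segment a x" for x y
  proof -
    obtain t where t: "0 \<le> t" "t \<le> 1" "y = (1 - t) *\<^sub>R a + t *\<^sub>R x" using x(2) unfolding in_segment by blast
    have y: "y$3 = (1 - t) + t * x$3" "y$4 = t * x$4" by (simp_all add: t(3) a_def vector_4)
    have "False" if "y$4 = 0" "y$3 \<le> 0"
    proof (cases "t = 0")
      case False
      then have "x$4 = 0" using that y by simp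
      then have "0 < t * x$3" using x(1) t False by (auto simp: slit_def)
      then show False using that y t by linarith
    qed (use that y in simp)
    then show ?thesis by (auto simp: slit_def)
  qed
  then show "starlike slit" unfolding starlike_def using a by blast
qed

text \<open>A complex number has nonpositive real square exactly when its real part
  vanishes.\<close>

lemma square34_slit: "square34 ` {v \<in> - {flat_point}. v$3 \<noteq> 0} = slit"
proof (intro subset_antisym image_subsetI subsetI)
  fix v assume "v \<in> {v \<in> - {flat_point}. v$3 \<noteq> 0}"
  then have "v$3 \<noteq> 0" by simp
  then have "0 < (v$3)\<^sup>2" by simp
  then show "square34 v \<in> slit" using \<open>v$3 \<noteq> 0\<close> by (auto simp: slit_def square34_def vector_4)
next
  fix w assume w: "w \<in> slit"
  obtain v where v: "square34 v = w" using square34_surj by blast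
  have "v$3 \<noteq> 0"
  proof
    assume "v$3 = 0"
    then have "w$4 = 0" "w$3 \<le> 0" unfolding v[symmetric] by (simp_all add: square34_def vector_4)
    then show False using w by (simp add: slit_def)
  qed
  moreover from this have "v \<noteq> flat_point" by (auto simp: flat_point_def vector_4)
  ultimately have "v \<in> {v \<in> - {flat_point}. v$3 \<noteq> 0}" by simp
  then show "w \<in> square34 ` {v \<in> - {flat_point}. v$3 \<noteq> 0}" unfolding v[symmetric] by (rule imageI)
qed

lemma Q_B_image: "Qp.phi ` (Qp.U \<inter> B.U) = slit" "Qm.phi ` (Qm.U \<inter> B.U) = slit"
proof -
  have t: "trace2 (secQ \<epsilon> v) = v$3" for \<epsilon> v by (simp add: secQ_def vector_6)
  have p: "moduli_proj (secQ 1 v) \<in> B.U \<longleftrightarrow> v$3 \<noteq> 0" if "v \<in> - {flat_point}" for v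
    using B.proj_in_U_iff[OF Qp.sec_in_Z23B[OF that]] Qp.sec_in_Z23B[OF that] t[of 1 v] by (simp add: DomB_def)
  have m: "moduli_proj (secQ (-1) v) \<in> B.U \<longleftrightarrow> v$3 \<noteq> 0" if "v \<in> - {flat_point}" for v
    using B.proj_in_U_iff[OF Qm.sec_in_Z23B[OF that]] Qm.sec_in_Z23B[OF that] t[of "-1" v] by (simp add: DomB_def)
  show "Qp.phi ` (Qp.U \<inter> B.U) = slit" by (rule Qp.phi_image_Int[OF p, unfolded square34_slit])
  show "Qm.phi ` (Qm.U \<inter> B.U) = slit" by (rule Qm.phi_image_Int[OF m, unfolded square34_slit])
qed

text \<open>In the parameters of \<open>secN\<close> the coordinates \<open>w$3\<close> and
  \<open>w$4\<close> are \<open>C_22^1\<close> and the trace; a point of the last chart lies in no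
  other chart exactly when both vanish.\<close>

lemma N_image: "N.phi ` (N.U \<inter> (Qp.U \<union> B.U \<union> Qm.U)) = annulus"
proof -
  have "moduli_proj (secN w) \<in> Qp.U \<union> B.U \<union> Qm.U \<longleftrightarrow> w$3 \<noteq> 0 \<or> w$4 \<noteq> 0" if "w \<in> OmN" for w
  proof -
    have Z: "secN w \<in> Z23B" by (rule N.sec_in_Z23B[OF that])
    have "trace2 (secN w) = w$4" "secN w $ 5 = w$3" by (simp_all add: secN_def vector_6)
    then show ?thesis
      unfolding Un_iff Qp.proj_in_U_iff[OF Z] B.proj_in_U_iff[OF Z] Qm.proj_in_U_iff[OF Z]
      using Z by (auto simp: DomQ_def DomB_def)
  qed
  from N.phi_image_Int[OF this] show ?thesis by (simp add: annulus_def)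
qed

text \<open>For fixed \<open>w$3\<close> the defining inequality is linear in the first two
  coordinates and holds at 0.\<close>

lemma shrink_OmN:
  fixes w :: "real^4"
  assumes w: "w \<in> OmN" and t: "0 \<le> t" "t \<le> 1" and y: "y$1 = t * w$1" "y$2 = t * w$2" "y$3 = w$3"
  shows "y \<in> OmN"
proof -
  define q where "q = (w$3)\<^sup>2 * w$1 - 2 * w$2 * w$3"
  have "(y$3)\<^sup>2 * y$1 - 2 * y$2 * y$3 = t * q" unfolding y q_def by (simp add: algebra_simps)
  moreover have "q < 2" using w by (simp add: OmN_def q_def)
  then have "t * q < 2"
  proof (cases "q \<le> 0")
    case True
    then have "t * q \<le> 0" using t by (simp add: mult_nonneg_nonpos)
    then show ?thesis by simp
  next
    case False
    then have "t * q \<le> 1 * q" using t by (intro mult_right_mono) auto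
    then show ?thesis using \<open>q < 2\<close> by simp
  qed
  ultimately show ?thesis by (simp add: OmN_def)
qed

definition proj34 :: "real^4 \<Rightarrow> real^4" where "proj34 w = vector [0, 0, w$3, w$4]"

lemma continuous_on_vec4:
  fixes f g h k :: "'a::topological_space \<Rightarrow> real"
  assumes "continuous_on S f" "continuous_on S g" "continuous_on S h" "continuous_on S k"
  shows "continuous_on S (\<lambda>x. vector [f x, g x, h x, k x] :: real^4)"
proof -
  have "continuous_on S (\<lambda>x. (vector [f x, g x, h x, k x] :: real^4) $ i)" for i
    using exhaust_4[of i] assms by (elim disjE) (simp_all add: vector_4)
  then have "continuous_on S (\<lambda>x. \<chi> i. (vector [f x, g x, h x, k x] :: real^4) $ i)"
    by (rule continuous_on_vec_lambda)
  then show ?thesis by simp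
qed

lemma segment_proj34:
  assumes "y \<in> closed_segment (proj34 w) w"
  obtains t where "0 \<le> t" "t \<le> 1" "y$1 = t * w$1" "y$2 = t * w$2" "y$3 = w$3" "y$4 = w$4"
proof -
  obtain t where t: "0 \<le> t" "t \<le> 1" "y = (1 - t) *\<^sub>R proj34 w + t *\<^sub>R w" using assms unfolding in_segment by blast
  show thesis by (rule that[OF t(1,2)]) (simp_all add: t(3) proj34_def vector_4 algebra_simps)
qed

lemma continuous_on_proj34: "continuous_on S proj34"
  unfolding proj34_def by (intro continuous_on_vec4 continuous_intros)

text \<open>Two straight-line homotopies: the first two coordinates shrink to 0, and the plane that
  is left, which lies in \<open>OmN\<close>, shrinks to the origin.\<close>

lemma contractible_OmN: "contractible OmN"
proof -
  have 1: "homotopic_with_canon (\<lambda>x. True) OmN OmN proj34 id"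
  proof (rule homotopic_with_linear[OF continuous_on_proj34 continuous_on_id'[unfolded id_def[symmetric]]])
    show "closed_segment (proj34 w) (id w) \<subseteq> OmN" if w: "w \<in> OmN" for w
      using shrink_OmN[OF w] by (auto elim!: segment_proj34)
  qed
  have 2: "homotopic_with_canon (\<lambda>x. True) OmN OmN (\<lambda>_. 0) proj34"
  proof (rule homotopic_with_linear[OF continuous_on_const continuous_on_proj34])
    show "closed_segment 0 (proj34 w) \<subseteq> OmN" if w: "w \<in> OmN" for w
      by (auto simp: in_segment OmN_def proj34_def vector_4)
  qed
  have "homotopic_with_canon (\<lambda>x. True) OmN OmN id (\<lambda>_. 0)"
    using homotopic_with_trans[OF 2 1] by (rule homotopic_with_symD)
  then show ?thesis unfolding contractible_def by blast
qed

lemma segment_annulus: assumes w: "w \<in> annulus" shows "closed_segment (proj34 w) w \<subseteq> annulus"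
  using w shrink_OmN[of w] by (auto simp: annulus_def elim!: segment_proj34)

definition emb34 :: "complex \<Rightarrow> real^4" where "emb34 z = vector [0, 0, Re z, Im z]"

lemma emb34:
  "continuous_on S emb34" "emb34 \<in> - {0} \<rightarrow> annulus" "emb34 (Complex (w$3) (w$4)) = proj34 w"
proof -
  show "continuous_on S emb34" unfolding emb34_def by (intro continuous_on_vec4 continuous_intros)
  show "emb34 \<in> - {0} \<rightarrow> annulus" by (auto simp: emb34_def annulus_def OmN_def vector_4 complex_eq_iff)
  show "emb34 (Complex (w$3) (w$4)) = proj34 w" by (simp add: emb34_def proj34_def)
qed

lemma path_connected_annulus: "path_connected annulus"
  unfolding path_connected_component
proof (intro ballI)
  fix x y assume xy: "x \<in> annulus" "y \<in> annulus"
  have seg: "path_component annulus (proj34 w) w" if "w \<in> annulus" for w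
    using segment_annulus[OF that] by (rule path_component_linepath)
  have "path_connected (emb34 ` (- {0}))"
    by (intro path_connected_continuous_image emb34 path_connected_punctured_universe) simp
  moreover have "proj34 w \<in> emb34 ` (- {0})" if "w \<in> annulus" for w
    using that emb34(3)[of w] by (intro image_eqI[of _ _ "Complex (w$3) (w$4)"]) (auto simp: annulus_def complex_eq_iff)
  ultimately have "path_component (emb34 ` (- {0})) (proj34 x) (proj34 y)"
    unfolding path_connected_component using xy by blast
  then have "path_component annulus (proj34 x) (proj34 y)"
    by (rule path_component_of_subset[rotated]) (use emb34(2) in auto)
  from path_component_trans[OF path_component_sym[OF seg[OF xy(1)]] path_component_trans[OF this seg[OF xy(2)]]]
  show "path_component annulus x y" .
qed

text \<open>The segments from \<open>w\<close> to \<open>proj34 w\<close> keep the last two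
  coordinates, so they stay in \<open>annulus\<close> and deform it onto a punctured plane.\<close>

lemma annulus_homotopy_eqv: "annulus homotopy_eqv (- {0::complex})"
proof -
  define f where "f w = Complex (w$3) (w$4)" for w :: "real^4"
  have cf: "continuous_on annulus f"
    unfolding f_def Complex_eq by (intro continuous_intros)
  have mf: "f \<in> annulus \<rightarrow> - {0}" by (auto simp: f_def annulus_def complex_eq_iff)
  have gf: "emb34 \<circ> f = proj34" by (simp add: fun_eq_iff f_def emb34)
  have fg: "f \<circ> emb34 = id" by (simp add: fun_eq_iff f_def emb34_def vector_4)
  have "homotopic_with_canon (\<lambda>x. True) annulus annulus proj34 id"
    by (rule homotopic_with_linear[OF continuous_on_proj34 continuous_on_id'[unfolded id_def[symmetric]]])
      (simp add: segment_annulus)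
  then show ?thesis
    unfolding homotopy_equivalent_space_def
    by (intro exI[of _ f] exI[of _ emb34]) (use cf mf emb34(1,2) in \<open>auto simp: gf fg\<close>)
qed

text \<open>A punctured 4-space is a 3-sphere up to homotopy, with reduced homology in degree 3
  only.\<close>

lemma trivial_reduced_homology_Q:
  assumes "p \<noteq> 3"
  shows "trivial_group (reduced_homology_group p (subtopology moduli_space Qp.U))"
    "trivial_group (reduced_homology_group p (subtopology moduli_space Qm.U))"
proof -
  have t: "trivial_group (reduced_homology_group p (nsphere (DIM(real^4) - 1)))"
    by (rule reduced_homology_group_nsphere(2)) (use assms in simp)
  have t': "trivial_group (reduced_homology_group p (top_of_set (- {flat_point})))"
    using isomorphic_group_triviality[OF reduced_homology_punctured group_reduced_homology_group group_reduced_homology_group] t by blast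
  show "trivial_group (reduced_homology_group p (subtopology moduli_space Qp.U))"
    using isomorphic_group_triviality[OF homeomorphic_space_imp_isomorphic_reduced_homology_groups[OF Qp.homeomorphic_space_phi[OF order_refl]]
        group_reduced_homology_group group_reduced_homology_group] t' unfolding Qp.phi_image by blast
  show "trivial_group (reduced_homology_group p (subtopology moduli_space Qm.U))"
    using isomorphic_group_triviality[OF homeomorphic_space_imp_isomorphic_reduced_homology_groups[OF Qm.homeomorphic_space_phi[OF order_refl]]
        group_reduced_homology_group group_reduced_homology_group] t' unfolding Qm.phi_image by blast
qed

lemma contractible_pieces:
  "contractible_space (subtopology moduli_space B.U)" "contractible_space (subtopology moduli_space N.U)"
  "contractible_space (subtopology moduli_space (Qp.U \<inter> B.U))" "contractible_space (subtopology moduli_space (Qm.U \<inter> B.U))"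
proof -
  have "contractible_space (euclidean :: (real^4) topology)"
    using contractible_space_top_of_set[of "UNIV :: (real^4) set"] by simp
  then show "contractible_space (subtopology moduli_space B.U)" "contractible_space (subtopology moduli_space N.U)"
    "contractible_space (subtopology moduli_space (Qp.U \<inter> B.U))" "contractible_space (subtopology moduli_space (Qm.U \<inter> B.U))"
  using homeomorphic_space_contractibility[OF B.homeomorphic_space_phi[OF order_refl]]
    homeomorphic_space_contractibility[OF N.homeomorphic_space_phi[OF order_refl]]
    homeomorphic_space_contractibility[OF Qp.homeomorphic_space_phi[OF Int_lower1, of B.U]]
    homeomorphic_space_contractibility[OF Qm.homeomorphic_space_phi[OF Int_lower1, of B.U]]
    contractible_OmN contractible_slit
  unfolding B.phi_image N.phi_image Q_B_image by simp_all
qed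

section \<open>Simple connectivity and the second homology group\<close>

abbreviation YU :: "(real^6) set set" where "YU \<equiv> Qp.U \<union> B.U \<union> Qm.U"

lemma moduli_cover:
  "openin moduli_space (Qp.U \<union> B.U)" "openin moduli_space YU" "YU \<union> N.U = topspace moduli_space"
  "(Qp.U \<union> B.U) \<inter> Qm.U = Qm.U \<inter> B.U" "YU \<inter> N.U = N.U \<inter> YU"
  "Qp.U \<inter> B.U \<noteq> {}" "Qm.U \<inter> B.U \<noteq> {}" "N.U \<inter> YU \<noteq> {}"
proof -
  show "openin moduli_space (Qp.U \<union> B.U)" "openin moduli_space YU"
    by (intro openin_Un Qp.openin_U B.openin_U Qm.openin_U)+
  have "YU \<union> N.U = moduli_proj ` Z23B"
    unfolding Qp.U_def B.U_def Qm.U_def N.U_def image_Un[symmetric] Z23B_charts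
    by (rule arg_cong[where f = "image moduli_proj"]) (simp only: Un_ac)
  then show "YU \<union> N.U = topspace moduli_space" by (simp add: topspace_moduli)
  show "(Qp.U \<union> B.U) \<inter> Qm.U = Qm.U \<inter> B.U"
    unfolding Int_Un_distrib2 Qp_Qm_disjoint Un_empty_left by (rule Int_commute)
  show "YU \<inter> N.U = N.U \<inter> YU" by (rule Int_commute)
  show "Qp.U \<inter> B.U \<noteq> {}" "Qm.U \<inter> B.U \<noteq> {}" "N.U \<inter> YU \<noteq> {}"
    using Q_B_image N_image slit_nonempty annulus_nonempty image_empty by metis+
qed

lemma simply_connected_moduli: "simply_connected_space moduli_space"
proof -
  have sp: "simply_connected (- {flat_point})" by (simp add: simply_connected_punctured_universe_eq)
  have Q: "paths_homotopic_space (subtopology moduli_space Qp.U)" "paths_homotopic_space (subtopology moduli_space Qm.U)"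
    by (rule Qp.paths_homotopic_U[OF sp] Qm.paths_homotopic_U[OF sp])+
  have B: "paths_homotopic_space (subtopology moduli_space B.U)"
    by (rule B.paths_homotopic_U[OF convex_imp_simply_connected[OF convex_UNIV]])
  have N: "paths_homotopic_space (subtopology moduli_space N.U)"
    by (rule N.paths_homotopic_U[OF contractible_imp_simply_connected[OF contractible_OmN]])
  have "path_connected_space (top_of_set annulus)"
    using path_connected_annulus path_connectedin_euclidean[of annulus]
    by (simp add: path_connectedin_def del: path_connectedin_euclidean)
  then have a: "path_connected_space (subtopology moduli_space (N.U \<inter> YU))"
    using homeomorphic_path_connected_space[OF N.homeomorphic_space_phi[OF Int_lower1, of YU]] unfolding N_image by blast
  note c = contractible_imp_path_connected_space[OF contractible_pieces(3)] contractible_imp_path_connected_space[OF contractible_pieces(4)]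
  have "paths_homotopic_space (subtopology moduli_space (Qp.U \<union> B.U))"
    by (rule paths_homotopic_space_Un_open[OF Qp.openin_U B.openin_U Q(1) B c(1) moduli_cover(6)])
  from paths_homotopic_space_Un_open[OF moduli_cover(1) Qm.openin_U this Q(2), unfolded moduli_cover(4), OF c(2) moduli_cover(7)]
  have "paths_homotopic_space (subtopology moduli_space YU)" .
  from paths_homotopic_space_Un[OF moduli_cover(2) N.openin_U moduli_cover(3) this N, unfolded moduli_cover(5), OF a moduli_cover(8)]
  show ?thesis by (rule paths_homotopic_space_imp_simply_connected)
qed

lemma homology_moduli: "homology_group 2 moduli_space \<cong> integer_group"
proof -
  have t: "trivial_group (reduced_homology_group p (subtopology moduli_space YU))" if p: "p \<noteq> 3" for p :: int
  proof -
    have "trivial_group (reduced_homology_group p (subtopology moduli_space (Qp.U \<union> B.U)))"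
      by (rule trivial_reduced_homology_Un_open[OF Qp.openin_U B.openin_U moduli_cover(6) contractible_pieces(3)
            trivial_reduced_homology_Q(1)[OF p] trivial_reduced_homology_group_contractible_space[OF contractible_pieces(1)]])
    from trivial_reduced_homology_Un_open[OF moduli_cover(1) Qm.openin_U, unfolded moduli_cover(4),
        OF moduli_cover(7) contractible_pieces(4) this trivial_reduced_homology_Q(2)[OF p]]
    show ?thesis .
  qed
  have t2: "trivial_group (reduced_homology_group 2 (subtopology moduli_space YU))"
    "trivial_group (reduced_homology_group (2 - 1) (subtopology moduli_space YU))" by (rule t; simp)+
  from reduced_homology_Un_contractible[OF moduli_cover(2) N.openin_U moduli_cover(3), unfolded moduli_cover(5),
      OF moduli_cover(8) contractible_pieces(2) t2]
  have "reduced_homology_group 2 moduli_space \<cong> reduced_homology_group (2 - 1) (subtopology moduli_space (N.U \<inter> YU))" .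
  also have "\<dots> \<cong> reduced_homology_group (2 - 1) (top_of_set annulus)"
    using homeomorphic_space_imp_isomorphic_reduced_homology_groups[OF N.homeomorphic_space_phi[OF Int_lower1, of YU]]
    unfolding N_image .
  also have "\<dots> \<cong> reduced_homology_group (2 - 1) (top_of_set (- {0::complex}))"
    by (rule homotopy_equivalent_space_imp_isomorphic_reduced_homology_groups[OF annulus_homotopy_eqv])
  also have "\<dots> \<cong> reduced_homology_group (2 - 1) (nsphere (DIM(complex) - 1))"
    by (rule reduced_homology_punctured)
  also have "\<dots> \<cong> integer_group"
    using reduced_homology_group_nsphere(1)[of 1] by simp
  \<comment> \<open>Reduced and ordinary homology coincide in nonzero degrees.\<close>
  finally show ?thesis by (simp add: un_reduced_homology_group)
qed

lemma betti_number_moduli: "betti_number 2 moduli_space = 1"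
  unfolding betti_number_def
  using abelian_rank_integer[OF abelian_homology_group homology_moduli] by simp

theorem theorem1p8:
  shows "(\<exists>A :: ((real^6) set set \<times> ((real^6) set \<Rightarrow> real^4)) set.
            real_analytic_manifold moduli_space A \<and>
            analytic_into Z23B moduli_space A moduli_proj) \<and>
         simply_connected_space moduli_space \<and>
         betti_number 2 moduli_space = 1"
  using moduli_manifold analytic_into_moduli simply_connected_moduli betti_number_moduli by blast

end
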